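(* Let $\beta>0$ and $x>\beta$ be fixed and let $p=p_n\ge n$, $n\to\infty$. Let $P$ be the law of the ordered eigenvalues $(\lambda_{(1)},\dots,\lambda_{(n)})$ of the $\beta$-Laguerre ensemble with parameters $(n,p,\beta)$, let $P^*_{px}(\cdot)=P(\cdot\mid\lambda_{(1)}>px)$, and let the sampling measure $Q$ and the importance sampling estimator $L_p$ be as defined in the context. (i) If $p/n^{5/3}\to\infty$, then $$\lim_{n\to\infty}\sup_{A\in\mathcal F}|Q(A)-P^*_{px}(A)|=0,$$ where $\mathcal F=\mathcal B([0,\infty)^n)$ is the Borel $\sigma$-field. In addition, $E^Q[L_p^2]\sim P(\lambda_{(1)}>px)^2$. (ii) If $n^{5/3}/p=O(1)$, then $E^Q[L_p^2]=O(1)\,P(\lambda_{(1)}>px)^2$, i.e. the estimator based on $Q$ is strongly efficient. (iii) More generally, if $p/n\to\infty$, then $$\frac{\log E^Q[L_p^2]}{2\log P(\lambda_{(1)}>px)}\to1,$$ i.e. the estimator is asymptotically efficient.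
   Context: The $\beta$-Laguerre ensemble with parameters $(n,p,\beta)$, $p\ge n$, $\beta>0$: random $(\lambda_1,\dots,\lambda_n)\in(0,\infty)^n$ with density $$f_{n,p,\beta}(\lambda_1,\dots,\lambda_n)=c_{n,p,\beta}\prod_{1\le i<j\le n}|\lambda_i-\lambda_j|^{\beta}\prod_{i=1}^n\lambda_i^{\frac{\beta(p-n+1)}{2}-1}e^{-\frac12\sum_{i=1}^n\lambda_i},\qquad c_{n,p,\beta}=2^{-\frac{\beta np}{2}}\prod_{j=1}^n\frac{\Gamma(1+\frac\beta2)}{\Gamma(1+\frac\beta2 j)\,\Gamma(\frac\beta2(p-n+j))}.$$ The order statistics $\lambda_{(1)}>\cdots>\lambda_{(n)}$ have joint density $g_{n,p,\beta}(\lambda_1,\dots,\lambda_n)=n!\,f_{n,p,\beta}(\lambda_1,\dots,\lambda_n)\,I_{(\lambda_1>\cdots>\lambda_n)}$. Put $A_n=c_{n,p,\beta}/c_{n-1,p-1,\beta}$. Measure $Q$: first sample $\lambda_{(2)}>\cdots>\lambda_{(n)}$ with density $g_{n-1,p-1,\beta}$; then, given these, sample $\lambda_{(1)}$ with density $\frac{x-\beta}{2x}e^{-\frac{x-\beta}{2x}(\lambda_{(1)}-px\vee\lambda_{(2)})}I_{(\lambda_{(1)}>px\vee\lambda_{(2)})}$, where $a\vee b=\max(a,b)$. So under $Q$ the vector $(\lambda_{(1)},\dots,\lambda_{(n)})$ has density $$g_{n-1,p-1,\beta}(\lambda_2,\dots,\lambda_n)\cdot\frac{x-\beta}{2x}e^{-\frac{x-\beta}{2x}(\lambda_1-px\vee\lambda_2)}I_{(\lambda_1>px\vee\lambda_2)}.$$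 Estimator: $$L_p=\frac{dP}{dQ}1_{(\lambda_{(1)}>px)}=\frac{nA_n\prod_{i=2}^n(\lambda_{(1)}-\lambda_{(i)})^\beta\,\lambda_{(1)}^{\frac{\beta(p-n+1)}{2}-1}e^{-\frac12\lambda_{(1)}}}{\frac{x-\beta}{2x}e^{-\frac{x-\beta}{2x}(\lambda_{(1)}-px\vee\lambda_{(2)})}},$$ which is well defined $Q$-almost surely since $\lambda_{(1)}>px\vee\lambda_{(2)}$ under $Q$. $E^Q$ is expectation under $Q$. An unbiased estimator $L_p$ of $P(\lambda_{(1)}>px)$ is strongly efficient if $\limsup E^Q[L_p^2]/P(\lambda_{(1)}>px)^2<\infty$, and asymptotically efficient if $\log E^Q[L_p^2]/(2\log P(\lambda_{(1)}>px))\to1$. Here $a_n\sim b_n$ means $a_n/b_n\to1$, and $O(1)$ denotes a bounded sequence, as $n\to\infty$. *)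

theory Defs
  imports "HOL-Probability.Probability" "HOL-Library.Landau_Symbols"
begin

text \<open>
  Points of \<open>\<real>\<^sup>n\<close> are functions \<open>l :: nat \<Rightarrow> real\<close> read at the indices \<open>1, \<dots>, n\<close>; laws on
  \<open>\<real>\<^sup>n\<close> live on the product space over \<open>{1..n}\<close>. The parameter \<open>p\<close> of the ensemble is real.
\<close>

definition laguerre_const :: "nat \<Rightarrow> real \<Rightarrow> real \<Rightarrow> real" where
  "laguerre_const n p \<beta> =
     2 powr (- (\<beta> * real n * p / 2)) *
     (\<Prod>j=1..n. Gamma (1 + \<beta> / 2) /
        (Gamma (1 + \<beta> / 2 * real j) * Gamma (\<beta> / 2 * (p - real n + real j))))"

definition laguerre_density :: "nat \<Rightarrow> real \<Rightarrow> real \<Rightarrow> (nat \<Rightarrow> real) \<Rightarrow> real" where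
  "laguerre_density n p \<beta> l =
     (if \<forall>i\<in>{1..n}. 0 < l i
      then laguerre_const n p \<beta> *
        (\<Prod>j=1..n. \<Prod>i\<in>{1..<j}. \<bar>l i - l j\<bar> powr \<beta>) *
        (\<Prod>i=1..n. l i powr (\<beta> * (p - real n + 1) / 2 - 1)) *
        exp (- (1 / 2) * (\<Sum>i=1..n. l i))
      else 0)"

definition ordered_laguerre_density :: "nat \<Rightarrow> real \<Rightarrow> real \<Rightarrow> (nat \<Rightarrow> real) \<Rightarrow> real" where
  "ordered_laguerre_density n p \<beta> l =
     (if \<forall>i\<in>{1..<n}. l (i + 1) < l i then fact n * laguerre_density n p \<beta> l else 0)"

definition ordered_laguerre_law :: "nat \<Rightarrow> real \<Rightarrow> real \<Rightarrow> (nat \<Rightarrow> real) measure" where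
  "ordered_laguerre_law n p \<beta> =
     density (\<Pi>\<^sub>M i\<in>{1..n}. lborel) (\<lambda>l. ennreal (ordered_laguerre_density n p \<beta> l))"

definition tail_prob :: "nat \<Rightarrow> real \<Rightarrow> real \<Rightarrow> real \<Rightarrow> real" where
  "tail_prob n p \<beta> x = \<P>(l in ordered_laguerre_law n p \<beta>. l 1 > p * x)"

text \<open>The law of the largest eigenvalue, given the second largest one, under the sampling measure.\<close>

definition top_density :: "real \<Rightarrow> real \<Rightarrow> real \<Rightarrow> real \<Rightarrow> real \<Rightarrow> real" where
  "top_density p \<beta> x l2 l1 =
     (if l1 > max (p * x) l2
      then (x - \<beta>) / (2 * x) * exp (- ((x - \<beta>) / (2 * x)) * (l1 - max (p * x) l2))
      else 0)"

text \<open>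
  The shift \<open>\<lambda>i. l (i + 1)\<close> feeds \<open>l 2, \<dots>, l n\<close> to the density with \<open>n - 1\<close> arguments.
  The sampling law and the estimator are meaningful for \<open>n \<ge> 2\<close> only.
\<close>

definition sampling_law :: "nat \<Rightarrow> real \<Rightarrow> real \<Rightarrow> real \<Rightarrow> (nat \<Rightarrow> real) measure" where
  "sampling_law n p \<beta> x =
     density (\<Pi>\<^sub>M i\<in>{1..n}. lborel)
       (\<lambda>l. ennreal (ordered_laguerre_density (n - 1) (p - 1) \<beta> (\<lambda>i. l (i + 1)) *
                     top_density p \<beta> x (l 2) (l 1)))"

definition is_estimator :: "nat \<Rightarrow> real \<Rightarrow> real \<Rightarrow> real \<Rightarrow> (nat \<Rightarrow> real) \<Rightarrow> real" where
  "is_estimator n p \<beta> x l =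
     (real n * (laguerre_const n p \<beta> / laguerre_const (n - 1) (p - 1) \<beta>) *
      (\<Prod>i=2..n. (l 1 - l i) powr \<beta>) *
      l 1 powr (\<beta> * (p - real n + 1) / 2 - 1) * exp (- (1 / 2) * l 1)) /
     ((x - \<beta>) / (2 * x) * exp (- ((x - \<beta>) / (2 * x)) * (l 1 - max (p * x) (l 2))))"

definition orthant_borel :: "nat \<Rightarrow> (nat \<Rightarrow> real) set set" where
  "orthant_borel n =
     sets (restrict_space (\<Pi>\<^sub>M i\<in>{1..n}. borel) (\<Pi>\<^sub>E i\<in>{1..n}. {0..}))"

definition unbiased_estimator :: "'a measure \<Rightarrow> ('a \<Rightarrow> real) \<Rightarrow> real \<Rightarrow> bool" where
  "unbiased_estimator Q L \<theta> \<longleftrightarrow> integrable Q L \<and> integral\<^sup>L Q L = \<theta>"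

text \<open>
  The second moment is a nonnegative integral here, so that an infinite second moment is not
  mistaken for zero.
\<close>

definition strongly_efficient ::
    "(nat \<Rightarrow> 'a measure) \<Rightarrow> (nat \<Rightarrow> 'a \<Rightarrow> real) \<Rightarrow> (nat \<Rightarrow> real) \<Rightarrow> bool" where
  "strongly_efficient Q L \<theta> \<longleftrightarrow>
     (\<forall>\<^sub>F n in sequentially. unbiased_estimator (Q n) (L n) (\<theta> n)) \<and>
     limsup (\<lambda>n. (\<integral>\<^sup>+ l. ennreal ((L n l)\<^sup>2) \<partial>Q n) / ennreal ((\<theta> n)\<^sup>2)) < \<infinity>"

definition asymptotically_efficient ::
    "(nat \<Rightarrow> 'a measure) \<Rightarrow> (nat \<Rightarrow> 'a \<Rightarrow> real) \<Rightarrow> (nat \<Rightarrow> real) \<Rightarrow> bool" where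
  "asymptotically_efficient Q L \<theta> \<longleftrightarrow>
     (\<forall>\<^sub>F n in sequentially. unbiased_estimator (Q n) (L n) (\<theta> n)) \<and>
     (\<lambda>n. ln (\<integral>l. (L n l)\<^sup>2 \<partial>Q n) / (2 * ln (\<theta> n))) \<longlonglongrightarrow> 1"

end

theory Submission
  imports Defs "HOL-Real_Asymp.Real_Asymp"
begin

text \<open>
  Everything follows from the fact that the relative second moment of the estimator tends to \<open>1\<close>
  as soon as \<open>p / n\<close> tends to infinity. Indeed the estimator is unbiased, so by the Cauchy-Schwarz
  inequality the distance in total variation is at most the square root of the relative variance.
  Given \<open>\<lambda>\<^sub>2, \<dots>, \<lambda>\<^sub>n\<close>, the moments of the estimator are one-dimensional Laplace integrals, and up to a
  factor tending to \<open>1\<close> what remains is to compare the mean of \<open>X\<^sup>2\<close> with the squared mean of \<open>X\<close>, where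
  \<open>X = (px - \<lambda>\<^sub>2)\<^sup>\<beta> \<cdots> (px - \<lambda>\<^sub>n)\<^sup>\<beta>\<close>. As long as \<open>\<lambda>\<^sub>2 < px'\<close> with \<open>\<beta> < x' < x\<close>, the density is log-concave
  with curvature of order \<open>1 / p\<close> in each coordinate, and the Prekopa-Leindler inequality bounds the
  quotient by \<open>exp O(n / p)\<close>. The event \<open>\<lambda>\<^sub>2 \<ge> px'\<close> costs \<open>exp O(n)\<close> but has probability \<open>exp (-c p)\<close>, by
  Chernoff's inequality and the explicit normalising constant. The latter comes from the Selberg-Laguerre
  integral: Aomoto's recursion gives the shift \<open>a + 1\<close> of the exponent, log-convexity determines the
  integral up to a constant, and the limit \<open>a \<rightarrow> 0\<close> removes one variable and fixes the constant.
\<close>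

subsection \<open>The Prekopa-Leindler inequality\<close>

text \<open>The rate \<rho> is the limit of 1 / 2 - \<alpha> / (p x), the exponential rate at which
  the weight of the top eigenvalue decays just above p x. Hence the second moment and the squared
  first moment of this factor both produce 1 / \<rho>^2. The obstacle is the fluctuation of X: on
  the bulk it is only known up to factors exp O(n), so pointwise bounds cannot give a quotient
  tending to 1. Prekopa-Leindler at midpoints, applied to the triple X^2 w, w, X w with w the
  density of the lower eigenvalues, acts as a reverse Jensen inequality. Ordered coordinates make
  this possible: their chamber is convex, and the Vandermonde factor is log-concave on it. Replacing
  u by the midpoint costs a term linear in |u - v| / p in the logarithm of each factor of X, while
  the power \<alpha> of the weight gains a quadratic term with a coefficient of order p; completing
  the square leaves O(1 / p) per coordinate. The Selberg-Laguerre integral is needed exactly,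
  because it turns w and the law P into probability densities; the Chernoff bound uses the quotient
  of two consecutive constants.\<close>

interpretation lebesgue_product: product_sigma_finite "\<lambda>_. lborel :: real measure"
  by standard

text \<open>Brunn-Minkowski on the line. With k = max K and l = min L, the half-size copies (l + K)
  / 2 and (k + L) / 2 both lie in C, and they meet only in (k + l) / 2, so their measures add
  up.\<close>

lemma emeasure_midpoint_compact:
  fixes K L C :: "real set"
  assumes "compact K" "K \<noteq> {}" "compact L" "L \<noteq> {}" "C \<in> sets borel"
    and mid: "\<And>u v. u \<in> K \<Longrightarrow> v \<in> L \<Longrightarrow> (u + v) / 2 \<in> C"
  shows "emeasure lborel K + emeasure lborel L \<le> 2 * emeasure lborel C"
proof -
  obtain k where k: "k \<in> K" "\<And>u. u \<in> K \<Longrightarrow> u \<le> k"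
    using compact_attains_sup[OF assms(1,2)] by auto
  obtain l where l: "l \<in> L" "\<And>v. v \<in> L \<Longrightarrow> l \<le> v"
    using compact_attains_inf[OF assms(3,4)] by auto
  let ?K = "(\<lambda>u. l / 2 + u * (1/2)) ` K" and ?L = "(\<lambda>v. k / 2 + v * (1/2)) ` L"
  have borel: "K \<in> sets borel" "L \<in> sets borel"
    using assms(1,3) by (auto intro: borel_compact)
  have cK: "compact ?K" "compact ?L"
    using assms(1,3) by (auto intro!: compact_continuous_image continuous_intros)
  then have bK: "?K \<in> sets lborel" "?L \<in> sets lborel"
    by (auto intro: borel_compact)
  have scale: "emeasure lborel A = 2 * emeasure lborel ((\<lambda>u. c / 2 + u * (1/2)) ` A)" 
    if [measurable]: "A \<in> sets borel" "(\<lambda>u. c / 2 + u * (1/2)) ` A \<in> sets borel"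
        for A :: "real set" and c :: real
  proof -
    let ?B = "(\<lambda>u. c / 2 + u * (1/2)) ` A"
    have indB: "(\<lambda>u. indicator ?B (c / 2 + (1/2) * u) :: ennreal) \<in> borel_measurable lborel"
      by (rule measurable_compose[OF _ borel_measurable_indicator[OF that(2)]]) measurable
    have "emeasure lborel A = (\<integral>\<^sup>+u. indicator A u \<partial>lborel)"
      by simp
    also have "\<dots> = (\<integral>\<^sup>+u. indicator ?B (c / 2 + (1/2) * u) \<partial>lborel)"
      by (intro nn_integral_cong) (auto simp: indicator_def image_iff)
    also have "\<dots> = (\<integral>\<^sup>+u. 2 * (ennreal \<bar>1/2\<bar> * indicator ?B (c / 2 + (1/2) * u)) \<partial>lborel)"
    proof (intro nn_integral_cong)
      have *: "2 * ennreal (1/2) = 1"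
        using ennreal_mult[of 2 "1/2"] by simp
      show "indicator ?B (c / 2 + (1/2) * u) = 2 * (ennreal \<bar>1/2\<bar> * indicator ?B (c / 2 + (1/2) * u))" for u
        using * by (simp add: mult.assoc[symmetric])
    qed
    also have "\<dots> = 2 * (ennreal \<bar>1/2\<bar> * (\<integral>\<^sup>+u. indicator ?B (c / 2 + (1/2) * u) \<partial>lborel))"
    proof -
      note [measurable] = indB
      show ?thesis by (subst nn_integral_cmult, measurable, subst nn_integral_cmult, measurable)
    qed
    also have "\<dots> = 2 * (\<integral>\<^sup>+u. indicator ?B u \<partial>lborel)"
      by (subst nn_integral_real_affine[OF borel_measurable_indicator[OF that(2)], of "1/2" "c/2"]) auto
    also have "\<dots> = 2 * emeasure lborel ?B"
      using that(2) by (subst nn_integral_indicator) (simp_all only: sets_lborel)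
    finally show ?thesis .
  qed
  have "?K \<inter> ?L \<subseteq> {(k + l) / 2}"
    using k l by (force simp: field_simps)
  then have "emeasure lborel (?K \<inter> ?L) \<le> emeasure lborel {(k + l) / 2}"
    by (intro emeasure_mono) auto
  then have "?K \<inter> ?L \<in> null_sets lborel"
    using bK by (auto simp: null_sets_def)
  then have "emeasure lborel (?K \<union> ?L) = emeasure lborel ?K + emeasure lborel ?L"
    using bK emeasure_Un'[of ?K lborel ?L] by (auto simp: null_sets_def)
  then have "emeasure lborel K + emeasure lborel L = 2 * emeasure lborel (?K \<union> ?L)"
    using borel bK by (simp add: scale[of K l] scale[of L k] distrib_left)
  moreover have "emeasure lborel (?K \<union> ?L) \<le> emeasure lborel C"
  proof (rule emeasure_mono)
    show "?K \<union> ?L \<subseteq> C"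
    proof -
      have *: "l / 2 + u * (1 / 2) = (u + l) / 2" "k / 2 + u * (1 / 2) = (k + u) / 2" for u
        by (simp_all add: field_simps)
      then show ?thesis using mid[OF _ l(1)] mid[OF k(1)] unfolding * by blast
    qed
    show "C \<in> sets lborel" using assms by simp
  qed
  ultimately show ?thesis
    by (simp add: mult_left_mono)
qed

text \<open>Inner regularity reduces this to compact sets; boundedness makes the closed inner
  approximations compact.\<close>

lemma emeasure_midpoint:
  fixes A B C :: "real set"
  assumes A: "A \<in> sets borel" "A \<noteq> {}" "bounded A" and B: "B \<in> sets borel" "B \<noteq> {}" "bounded B"
    and C: "C \<in> sets borel" and mid: "\<And>u v. u \<in> A \<Longrightarrow> v \<in> B \<Longrightarrow> (u + v) / 2 \<in> C"
  shows "emeasure lborel A + emeasure lborel B \<le> 2 * emeasure lborel C"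
proof (rule ennreal_le_epsilon)
  fix e :: real assume e: "0 < e"
  have *: "\<exists>K. compact K \<and> K \<noteq> {} \<and> K \<subseteq> A \<and> emeasure lborel A \<le> emeasure lborel K + ennreal (e / 2)"
    if A: "A \<in> sets borel" "A \<noteq> {}" "bounded A" for A :: "real set"
  proof -
    have "A \<in> sets lebesgue" using A by simp
    then obtain T where T: "closed T" "T \<subseteq> A" "A - T \<in> lmeasurable" "emeasure lebesgue (A - T)
        < ennreal (e/2)"
      using sets_lebesgue_inner_closed[of A "e / 2"] e by auto
    obtain z where z: "z \<in> A" using A by auto
    \<comment> \<open>The inner approximation T may be empty, whereas the compact case needs a point
      in each set; adding z keeps the set inside A.\<close>
    let ?K = "insert z T"
    have K: "compact ?K" 
      using T A by (auto simp: compact_eq_bounded_closed intro: bounded_subset)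
    then have bK: "?K \<in> sets borel" by (rule borel_compact)
    have "emeasure lborel (A - ?K) \<le> emeasure lebesgue (A - T)"
    proof -
      have "emeasure lborel (A - ?K) = emeasure lebesgue (A - ?K)"
        using A bK by simp
      also have "\<dots> \<le> emeasure lebesgue (A - T)"
        using T by (intro emeasure_mono) (auto dest: fmeasurableD)
      finally show ?thesis .
    qed
    then have "emeasure lborel (A - ?K) \<le> ennreal (e/2)" using T by simp
    moreover have "emeasure lborel A = emeasure lborel ?K + emeasure lborel (A - ?K)"
      using A bK T z by (subst plus_emeasure) (auto intro!: arg_cong[where f = "emeasure lborel"])
    ultimately show ?thesis using K T z by (intro exI[of _ ?K]) (auto intro: add_left_mono)
  qed
  obtain K where K: "compact K" "K \<noteq> {}" "K \<subseteq> A" "emeasure lborel A \<le> emeasure lborel K + ennreal (e / 2)"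
    using *[OF A] by blast
  obtain L where L: "compact L" "L \<noteq> {}" "L \<subseteq> B" "emeasure lborel B \<le> emeasure lborel L + ennreal (e / 2)"
    using *[OF B] by blast
  have "emeasure lborel A + emeasure lborel B
      \<le> (emeasure lborel K + ennreal (e / 2)) + (emeasure lborel L + ennreal (e / 2))"
    by (rule add_mono[OF K(4) L(4)])
  also have "\<dots> = (emeasure lborel K + emeasure lborel L) + (ennreal (e / 2) + ennreal (e / 2))"
    by (simp add: ac_simps)
  also have "ennreal (e / 2) + ennreal (e / 2) = ennreal e"
    using e by (subst ennreal_plus[symmetric]) auto
  also have "emeasure lborel K + emeasure lborel L \<le> 2 * emeasure lborel C"
    using K L mid by (intro emeasure_midpoint_compact C) auto
  finally show "emeasure lborel A + emeasure lborel B \<le> 2 * emeasure lborel C + ennreal e"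
    by (simp add: add_right_mono)
qed

text \<open>Each value f x is the length of the set of all t > 0 with t < f x, the value infinity
  included; Tonelli's theorem exchanges the integrals.\<close>

lemma nn_integral_layer_cake:
  fixes f :: "'a \<Rightarrow> ennreal"
  assumes [measurable]: "f \<in> borel_measurable M" and "sigma_finite_measure M"
  shows "(\<integral>\<^sup>+x. f x \<partial>M) = (\<integral>\<^sup>+t. emeasure M {x\<in>space M. ennreal t < f x} * indicator {0<..} t \<partial>lborel)"
proof -
  interpret sigma_finite_measure M by fact
  interpret pair_sigma_finite lborel M by standard
  have [measurable]: "Measurable.pred (lborel \<Otimes>\<^sub>M M) (\<lambda>(t, x). ennreal t < f x)" by measurable
  have "f x = (\<integral>\<^sup>+t. indicator {t. ennreal t < f x} t * indicator {0<..} t \<partial>lborel)" for x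
  proof (cases "f x")
    case (real r)
    have "(\<integral>\<^sup>+t. indicator {t. ennreal t < f x} t * indicator {0<..} t \<partial>lborel)
        = (\<integral>\<^sup>+t. indicator {0<..<r} t \<partial>lborel)"
      using real by (intro nn_integral_cong) (auto simp: indicator_def ennreal_less_iff)
    then show ?thesis using real by simp
  next
    case top
    have "(\<integral>\<^sup>+t. indicator {t. ennreal t < f x} t * indicator {0<..} t \<partial>lborel)
        = (\<integral>\<^sup>+t. indicator {0::real<..} t \<partial>lborel)"
      using top by (intro nn_integral_cong) (auto simp: indicator_def)
    also have "\<dots> = \<infinity>"
    proof (rule ccontr)
      assume "(\<integral>\<^sup>+t. indicator {0::real<..} t \<partial>lborel) \<noteq> \<infinity>"
      then obtain k :: nat where "emeasure lborel {0::real<..} < of_nat k"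
        using ennreal_Ex_less_of_nat[of "emeasure lborel {0::real<..}"] by (auto simp: less_top)
      moreover have "emeasure lborel {0::real<..<k} \<le> emeasure lborel {0::real<..}"
        by (intro emeasure_mono) auto
      ultimately show False
        by (simp add: ennreal_of_nat_eq_real_of_nat)
    qed
    finally show ?thesis using top by simp
  qed
  then have "(\<integral>\<^sup>+x. f x \<partial>M) = (\<integral>\<^sup>+x. (\<integral>\<^sup>+t. indicator {t. ennreal t
      < f x} t * indicator {0<..} t \<partial>lborel) \<partial>M)"
    by simp
  also have "\<dots> = (\<integral>\<^sup>+t. (\<integral>\<^sup>+x. indicator {t. ennreal t < f x} t * indicator {0<..} t \<partial>M) \<partial>lborel)"
    by (rule Fubini') (simp add: indicator_def)
  also have "\<dots> = (\<integral>\<^sup>+t. emeasure M {x\<in>space M. ennreal t < f x} * indicator {0<..} t \<partial>lborel)"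
  proof (intro nn_integral_cong)
    fix t :: real
    have "(\<integral>\<^sup>+x. indicator {t. ennreal t < f x} t * indicator {0<..} t \<partial>M) 
       = (\<integral>\<^sup>+x. indicator {x\<in>space M. ennreal t < f x} x * indicator {0<..} t \<partial>M)"
      by (intro nn_integral_cong) (auto simp: indicator_def)
    then show "(\<integral>\<^sup>+x. indicator {t. ennreal t < f x} t * indicator {0<..} t \<partial>M) 
       = emeasure M {x\<in>space M. ennreal t < f x} * indicator {0<..} t"
      by (simp add: nn_integral_multc)
  qed
  finally show ?thesis .
qed


text \<open>When both suprema equal 1, the superlevel sets of f and g are nonempty at every height t
  < 1, and the midpoints of their points lie in the superlevel set of h, because h^2 >= f g > t^2.
  Brunn-Minkowski at each height and integration over t give the arithmetic mean on the left, which
  is stronger than the geometric mean.\<close>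

lemma prekopa_leindler_real_normalized:
  fixes f g h :: "real \<Rightarrow> ennreal" and r :: real
  assumes [measurable]: "f \<in> borel_measurable borel" "g \<in> borel_measurable borel" "h \<in> borel_measurable borel"
    and fsup: "\<And>u. f u \<le> 1" "\<And>t. t < 1 \<Longrightarrow> \<exists>u. t < f u"
    and gsup: "\<And>u. g u \<le> 1" "\<And>t. t < 1 \<Longrightarrow> \<exists>u. t < g u"
    and supp: "\<And>u. f u \<noteq> 0 \<Longrightarrow> \<bar>u\<bar> \<le> r" "\<And>u. g u \<noteq> 0 \<Longrightarrow> \<bar>u\<bar> \<le> r"
    and mid: "\<And>u v. f u * g v \<le> (h ((u + v) / 2))\<^sup>2"
  shows "(\<integral>\<^sup>+u. f u \<partial>lborel) + (\<integral>\<^sup>+u. g u \<partial>lborel) \<le> 2 * (\<integral>\<^sup>+u. h u \<partial>lborel)"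
proof -
  have meas: "{u. ennreal t < k u} \<in> sets borel" if "k \<in> borel_measurable borel"
      for k :: "real \<Rightarrow> ennreal" and t
    using that by measurable
  have bdd: "bounded {u. ennreal t < k u}" if "\<And>u. k u \<noteq> 0 \<Longrightarrow> \<bar>u\<bar> \<le> r" for k :: "real \<Rightarrow> ennreal" and t
    using that by (intro boundedI[of _ r]) (force simp: less_top)
  have level: "emeasure lborel {u. ennreal t < f u} + emeasure lborel {u. ennreal t < g u}
      \<le> 2 * emeasure lborel {u. ennreal t < h u}" if t: "0 < t" for t
  proof (cases "t < 1")
    case True
    then have t1: "ennreal t < 1" using t by (simp flip: ennreal_1 add: ennreal_less_iff)
    show ?thesis
    proof (rule emeasure_midpoint)
      show "{u. ennreal t < f u} \<noteq> {}" "{u. ennreal t < g u} \<noteq> {}"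
        using fsup(2)[OF t1] gsup(2)[OF t1] by auto
      fix u v assume uv: "u \<in> {u. ennreal t < f u}" "v \<in> {u. ennreal t < g u}"
      show "(u + v) / 2 \<in> {u. ennreal t < h u}"
      proof (rule ccontr)
        assume "(u + v) / 2 \<notin> {u. ennreal t < h u}"
        then have "(h ((u + v) / 2))\<^sup>2 \<le> ennreal t * ennreal t"
          unfolding power2_eq_square by (intro mult_mono) auto
        then have le: "f u * g v \<le> ennreal t * ennreal t"
          using mid[of u v] by simp
        obtain a where a: "f u = ennreal a" "0 \<le> a" using fsup(1)[of u]
            by (cases "f u") (auto simp: top_unique)
        obtain b where b: "g v = ennreal b" "0 \<le> b" using gsup(1)[of v]
            by (cases "g v") (auto simp: top_unique)
        have "t < a" "t < b" using uv a b t by (auto simp: ennreal_less_iff)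
        then have "t * t < a * b" using t by (intro mult_strict_mono) auto
        moreover have "a * b \<le> t * t" using le a b t by (simp flip: ennreal_mult)
        ultimately show False by simp
      qed
    qed (use supp in \<open>auto intro: meas bdd\<close>)
  next
    case False
    then have "1 \<le> ennreal t" by simp
    then have "{u. ennreal t < f u} = {}" "{u. ennreal t < g u} = {}"
      using fsup(1) gsup(1) by (auto simp: not_less simp del: ennreal_ge_1 intro: order_trans)
    then show ?thesis by simp
  qed
  have "(\<integral>\<^sup>+u. f u \<partial>lborel) + (\<integral>\<^sup>+u. g u \<partial>lborel) =
     (\<integral>\<^sup>+t. emeasure lborel {u. ennreal t < f u} * indicator {0<..} t
         + emeasure lborel {u. ennreal t < g u} * indicator {0<..} t \<partial>lborel)"
    using nn_integral_layer_cake[of f lborel] nn_integral_layer_cake[of g lborel]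
    by (subst nn_integral_add) (auto simp: lborel.sigma_finite_measure_axioms)
  also have "\<dots> \<le> (\<integral>\<^sup>+t. 2 * (emeasure lborel {u. ennreal t < h u} * indicator {0<..} t) \<partial>lborel)"
    using level by (intro nn_integral_mono) (auto simp: indicator_def)
  also have "\<dots> = 2 * (\<integral>\<^sup>+u. h u \<partial>lborel)"
    using nn_integral_layer_cake[of h lborel]
    by (subst nn_integral_cmult) (auto simp: lborel.sigma_finite_measure_axioms)
  finally show ?thesis .
qed

lemma ennreal_amgm: "4 * (a * b) \<le> ((a + b)\<^sup>2 :: ennreal)"
proof (cases a; cases b)
  fix r s assume "a = ennreal r" "0 \<le> r" "b = ennreal s" "0 \<le> s"
  moreover have "4 * (r * s) \<le> (r + s)\<^sup>2" 
    using sum_squares_bound[of r s] by (simp add: power2_eq_square algebra_simps)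
  ultimately show ?thesis
    by (simp flip: ennreal_numeral ennreal_mult ennreal_plus add: ennreal_power)
qed (auto simp: power2_eq_square ennreal_top_mult ennreal_mult_top)

text \<open>Dividing f and g by their suprema M and N, and h by sqrt (M * N), keeps the midpoint
  hypothesis and reduces to the normalised case. \<open>ennreal_amgm\<close> then turns the sum into
  the product, in which M and N cancel.\<close>

lemma prekopa_leindler_real_bounded:
  fixes f g h :: "real \<Rightarrow> ennreal" and r c :: real
  assumes [measurable]: "f \<in> borel_measurable borel" "g \<in> borel_measurable borel" "h \<in> borel_measurable borel"
    and bdd: "\<And>u. f u \<le> ennreal c" "\<And>u. g u \<le> ennreal c"
    and supp: "\<And>u. f u \<noteq> 0 \<Longrightarrow> \<bar>u\<bar> \<le> r" "\<And>u. g u \<noteq> 0 \<Longrightarrow> \<bar>u\<bar> \<le> r"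
    and mid: "\<And>u v. f u * g v \<le> (h ((u + v) / 2))\<^sup>2"
  shows "(\<integral>\<^sup>+u. f u \<partial>lborel) * (\<integral>\<^sup>+u. g u \<partial>lborel) \<le> (\<integral>\<^sup>+u. h u \<partial>lborel)\<^sup>2"
proof (cases "(\<forall>u. f u = 0) \<or> (\<forall>u. g u = 0)")
  case True
  then show ?thesis by auto
next
  case False
  have sup: "\<exists>M>0. (\<forall>u. ennreal (1 / M) * k u \<le> 1) \<and> (\<forall>t<1. \<exists>u. t < ennreal (1 / M) * k u)"
    if k: "\<And>u. k u \<le> ennreal c" "k u0 \<noteq> 0" for k :: "real \<Rightarrow> ennreal" and u0
  proof -
    have "(SUP u. k u) \<le> ennreal c" using k by (auto intro: SUP_least)
    then obtain M where M: "(SUP u. k u) = ennreal M" "0 \<le> M"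
      by (cases "SUP u. k u") (auto simp: top_unique)
    have le: "k u \<le> ennreal M" for u using M by (metis SUP_upper UNIV_I)
    have "M \<noteq> 0" using le[of u0] k(2) by auto
    then have pos: "0 < M" using M by simp
    have inv: "ennreal (1 / M) * ennreal M = 1" using pos by (simp flip: ennreal_mult)
    have "ennreal (1 / M) * k u \<le> 1" for u
      using mult_left_mono[OF le[of u], of "ennreal (1 / M)"] inv by simp
    moreover have "\<exists>u. t < ennreal (1 / M) * k u" if "t < 1" for t
    proof -
      have "ennreal M * t < ennreal M * 1" 
        using that pos by (intro ennreal_mult_strict_left_mono) auto
      then obtain u where u: "ennreal M * t < k u" using M(1) less_SUP_iff[of "ennreal M * t" k UNIV] by auto
      have "t = ennreal (1 / M) * (ennreal M * t)" using inv by (simp add: mult.assoc[symmetric])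
      also have "\<dots> < ennreal (1 / M) * k u"
        using u pos by (intro ennreal_mult_strict_left_mono) auto
      finally show ?thesis by blast
    qed
    ultimately show ?thesis using pos by blast
  qed
  obtain M where M: "0 < M" "\<And>u. ennreal (1 / M) * f u \<le> 1" "\<And>t. t < 1 \<Longrightarrow> \<exists>u. t < ennreal (1 / M) * f u"
    using sup[of f] bdd False by metis
  obtain N where N: "0 < N" "\<And>u. ennreal (1 / N) * g u \<le> 1" "\<And>t. t < 1 \<Longrightarrow> \<exists>u. t < ennreal (1 / N) * g u"
    using sup[of g] bdd False by metis
  let ?H = "ennreal (1 / sqrt (M * N))"
  have HH: "?H * ?H = ennreal (1 / M) * ennreal (1 / N)"
    using M N by (simp flip: ennreal_mult add: real_sqrt_mult[symmetric])
  have "(\<integral>\<^sup>+u. ennreal (1 / M) * f u \<partial>lborel) + (\<integral>\<^sup>+u. ennreal (1 / N) * g u \<partial>lborel)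
      \<le> 2 * (\<integral>\<^sup>+u. ?H * h u \<partial>lborel)"
  proof (rule prekopa_leindler_real_normalized[of _ _ _ r])
    fix u v :: real
    have "ennreal (1 / M) * f u * (ennreal (1 / N) * g v) = ?H * ?H * (f u * g v)"
      unfolding HH by (simp add: ac_simps)
    also have "\<dots> \<le> ?H * ?H * (h ((u + v) / 2))\<^sup>2" by (intro mult_left_mono mid) auto
    finally show "ennreal (1 / M) * f u * (ennreal (1 / N) * g v) \<le> (?H * h ((u + v) / 2))\<^sup>2"
      by (simp add: power2_eq_square ac_simps)
  qed (use M N supp in auto)
  then have le: "ennreal (1 / M) * (\<integral>\<^sup>+u. f u \<partial>lborel) + ennreal (1 / N) * (\<integral>\<^sup>+u. g u \<partial>lborel)
      \<le> 2 * (?H * (\<integral>\<^sup>+u. h u \<partial>lborel))"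
    by (simp add: nn_integral_cmult)
  have "4 * (?H * ?H * ((\<integral>\<^sup>+u. f u \<partial>lborel) * (\<integral>\<^sup>+u. g u \<partial>lborel)))
     = 4 * (ennreal (1 / M) * (\<integral>\<^sup>+u. f u \<partial>lborel) * (ennreal (1 / N) * (\<integral>\<^sup>+u. g u \<partial>lborel)))"
    unfolding HH by (simp add: ac_simps)
  also have "\<dots> \<le> (ennreal (1 / M) * (\<integral>\<^sup>+u. f u \<partial>lborel) + ennreal (1 / N) * (\<integral>\<^sup>+u. g u \<partial>lborel))\<^sup>2"
    by (rule ennreal_amgm)
  also have "\<dots> \<le> (2 * (?H * (\<integral>\<^sup>+u. h u \<partial>lborel)))\<^sup>2"
    using le by (rule power_mono) simp
  also have "\<dots> = 4 * (?H * ?H * (\<integral>\<^sup>+u. h u \<partial>lborel)\<^sup>2)"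
    by (simp add: power2_eq_square ac_simps)
  finally have "(4 * (?H * ?H)) * ((\<integral>\<^sup>+u. f u \<partial>lborel) * (\<integral>\<^sup>+u. g u \<partial>lborel))
     \<le> (4 * (?H * ?H)) * (\<integral>\<^sup>+u. h u \<partial>lborel)\<^sup>2"
    by (simp add: ac_simps)
  moreover have "4 * (?H * ?H) \<noteq> 0" "4 * (?H * ?H) < top"
    using M N by (auto simp: ennreal_mult_less_top)
  ultimately show ?thesis
    by (meson ennreal_mult_strict_left_mono less_le_not_le not_le zero_less_iff_neq_zero)
qed

text \<open>Monotone truncation in height and support. The functions f and g get separate truncation
  indices, since the product of their integrals is a double supremum; h stays as it is.\<close>

lemma prekopa_leindler_real:
  fixes f g h :: "real \<Rightarrow> ennreal"
  assumes [measurable]: "f \<in> borel_measurable borel" "g \<in> borel_measurable borel" "h \<in> borel_measurable borel"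
    and mid: "\<And>u v. f u * g v \<le> (h ((u + v) / 2))\<^sup>2"
  shows "(\<integral>\<^sup>+u. f u \<partial>lborel) * (\<integral>\<^sup>+u. g u \<partial>lborel) \<le> (\<integral>\<^sup>+u. h u \<partial>lborel)\<^sup>2"
proof -
  define T where "T k F u = min (F u) (ennreal (real k)) * indicator {- real k..real k} u"
      for k :: nat and F :: "real \<Rightarrow> ennreal" and u
  have [measurable]: "T k F \<in> borel_measurable borel" if "F \<in> borel_measurable borel" for F k
    using that unfolding T_def by measurable
  have T_le: "T k F u \<le> F u" for k F u
    by (auto simp: T_def indicator_def)
  have inc: "incseq (\<lambda>k. T k F)" for F
    unfolding T_def incseq_def le_fun_def
    by (auto simp: indicator_def intro: min.coboundedI2 le_ennreal_iff)
  have lim: "(SUP k. T k F u) = F u" for F u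
  proof (rule antisym)
    show "(SUP k. T k F u) \<le> F u" by (intro SUP_least T_le)
    show "F u \<le> (SUP k. T k F u)"
    proof (rule ccontr)
      assume "\<not> F u \<le> (SUP k. T k F u)"
      then have less: "(SUP k. T k F u) < F u" by simp
      then have "(SUP k. T k F u) < top" using less_top_ennreal order.strict_trans2 top_greatest by blast
      then obtain k1 where k1: "(SUP k. T k F u) < ennreal (real k1)"
        using ennreal_Ex_less_of_nat[of "SUP k. T k F u"]
            by (auto simp: less_top ennreal_of_nat_eq_real_of_nat)
      obtain k2 where k2: "\<bar>u\<bar> \<le> real k2" using real_arch_simple by blast
      let ?k = "max k1 k2"
      have "T ?k F u = min (F u) (ennreal (real ?k))" using k2 by (auto simp: T_def indicator_def)
      moreover have "(SUP k. T k F u) < ennreal (real ?k)" 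
        using k1 by (rule order.strict_trans2) (auto intro!: ennreal_leI)
      ultimately have "(SUP k. T k F u) < T ?k F u" using less by (simp add: min_def)
      then show False by (meson SUP_upper UNIV_I leD)
    qed
  qed
  have int: "(\<integral>\<^sup>+u. F u \<partial>lborel) = (SUP k. \<integral>\<^sup>+u. T k F u \<partial>lborel)"
      if [measurable]: "F \<in> borel_measurable borel" for F
    using nn_integral_monotone_convergence_SUP[OF inc[of F], of lborel] by (simp add: lim)
  have "(\<integral>\<^sup>+u. T k f u \<partial>lborel) * (\<integral>\<^sup>+u. T l g u \<partial>lborel) \<le> (\<integral>\<^sup>+u. h u \<partial>lborel)\<^sup>2" for k l
  proof (rule prekopa_leindler_real_bounded[of _ _ _ "real (max k l)" "real (max k l)"])
    show "T k f u * T l g v \<le> (h ((u + v) / 2))\<^sup>2" for u v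
      using mid[of u v] by (rule order_trans[rotated]) (intro mult_mono T_le; simp)
    show "T k f u \<le> ennreal (real (max k l))" "T l g u \<le> ennreal (real (max k l))" for u
      by (auto simp: T_def indicator_def intro!: min.coboundedI2 ennreal_leI)
    show "\<bar>u\<bar> \<le> real (max k l)" if "T k f u \<noteq> 0" for u
      using that by (auto simp: T_def indicator_def split: if_splits)
    show "\<bar>u\<bar> \<le> real (max k l)" if "T l g u \<noteq> 0" for u
      using that by (auto simp: T_def indicator_def split: if_splits)
  qed auto
  then show ?thesis
    by (subst (1 2) int) (auto simp: SUP_mult_left_ennreal SUP_mult_right_ennreal intro!: SUP_least)
qed

text \<open>Tensorisation: for fixed values s and t of the new coordinate, the induction hypothesis
  applies to the sections, which is the midpoint hypothesis of the one-dimensional inequality for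
  the marginals.\<close>

theorem prekopa_leindler:
  fixes f g h :: "('i \<Rightarrow> real) \<Rightarrow> ennreal"
  assumes "finite I"
    and "f \<in> borel_measurable (PiM I (\<lambda>_. lborel))" "g \<in> borel_measurable (PiM I (\<lambda>_. lborel))"
      "h \<in> borel_measurable (PiM I (\<lambda>_. lborel))"
    and "\<And>u v. u \<in> extensional I \<Longrightarrow> v \<in> extensional I \<Longrightarrow> f u * g v \<le> (h (\<lambda>i\<in>I. (u i + v i) / 2))\<^sup>2"
  shows "(\<integral>\<^sup>+u. f u \<partial>PiM I (\<lambda>_. lborel)) * (\<integral>\<^sup>+u. g u \<partial>PiM I (\<lambda>_. lborel))
     \<le> (\<integral>\<^sup>+u. h u \<partial>PiM I (\<lambda>_. lborel))\<^sup>2"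
  using assms
proof (induction I arbitrary: f g h rule: finite_induct)
  case empty
  have *: "(\<lambda>i\<in>{}. (undefined + undefined) / 2) = (\<lambda>_. undefined)" by auto
  show ?case using empty.prems(4)[of "\<lambda>_. undefined" "\<lambda>_. undefined"] 
    by (simp add: lebesgue_product.nn_integral_empty)
next
  case (insert i I)
  note [measurable] = insert.prems(1-3)
  note fin = insert.hyps
  have ins: "(\<integral>\<^sup>+u. k u \<partial>PiM (insert i I) (\<lambda>_. lborel))
      = (\<integral>\<^sup>+t. (\<integral>\<^sup>+u. k (u(i := t)) \<partial>PiM I (\<lambda>_. lborel)) \<partial>lborel)"
    if "k \<in> borel_measurable (PiM (insert i I) (\<lambda>_. lborel))" for k :: "('i \<Rightarrow> real) \<Rightarrow> ennreal"
    using lebesgue_product.product_nn_integral_insert_rev[OF fin that] .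
  interpret I: finite_product_sigma_finite "\<lambda>_. lborel :: real measure" I by standard fact
  have [measurable]: "(\<lambda>t. \<integral>\<^sup>+u. k (u(i := t)) \<partial>PiM I (\<lambda>_. lborel)) \<in> borel_measurable borel"
    if [measurable]: "k \<in> borel_measurable (PiM (insert i I) (\<lambda>_. lborel))" for k :: "('i \<Rightarrow> real) \<Rightarrow> ennreal"
    by measurable
  have upd: "(\<lambda>u. k (u(i := t))) \<in> borel_measurable (PiM I (\<lambda>_. lborel))"
    if [measurable]: "k \<in> borel_measurable (PiM (insert i I) (\<lambda>_. lborel))"
        for k :: "('i \<Rightarrow> real) \<Rightarrow> ennreal" and t
    by measurable
  show ?case
  proof (subst (1 2 3) ins; (intro insert.prems)?)
    show "(\<integral>\<^sup>+t. (\<integral>\<^sup>+u. f (u(i := t)) \<partial>PiM I (\<lambda>_. lborel)) \<partial>lborel) *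
        (\<integral>\<^sup>+t. (\<integral>\<^sup>+u. g (u(i := t)) \<partial>PiM I (\<lambda>_. lborel)) \<partial>lborel)
       \<le> (\<integral>\<^sup>+t. (\<integral>\<^sup>+u. h (u(i := t)) \<partial>PiM I (\<lambda>_. lborel)) \<partial>lborel)\<^sup>2"
    proof (rule prekopa_leindler_real)
      fix s t :: real
      show "(\<integral>\<^sup>+u. f (u(i := s)) \<partial>PiM I (\<lambda>_. lborel)) * (\<integral>\<^sup>+u. g (u(i := t)) \<partial>PiM I (\<lambda>_. lborel))
        \<le> (\<integral>\<^sup>+u. h (u(i := (s + t) / 2)) \<partial>PiM I (\<lambda>_. lborel))\<^sup>2"
      proof (rule insert.IH)
        fix u v :: "'i \<Rightarrow> real" assume "u \<in> extensional I" "v \<in> extensional I"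
        then have "u(i := s) \<in> extensional (insert i I)" "v(i := t) \<in> extensional (insert i I)"
          by (auto simp: extensional_def)
        from insert.prems(4)[OF this]
        show "f (u(i := s)) * g (v(i := t)) \<le> (h ((\<lambda>i\<in>I. (u i + v i) / 2)(i := (s + t) / 2)))\<^sup>2"
          using fin(2) by (elim order_trans) (auto intro!: eq_refl arg_cong[where f = "\<lambda>x. (h x)\<^sup>2"]
              simp: fun_eq_iff restrict_def)
      qed (intro upd insert.prems)+
    qed measurable
  qed
qed

subsection \<open>Ordering the coordinates of exchangeable functions\<close>

lemma distr_PiM_lborel_reindex:
  assumes fin: "finite I" and bij: "bij_betw \<pi> I J"
  shows "distr (PiM J (\<lambda>_. lborel :: real measure)) (PiM I (\<lambda>_. lborel)) (\<lambda>x. \<lambda>i\<in>I. x (\<pi> i))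
    = PiM I (\<lambda>_. lborel)"
proof (rule lebesgue_product.PiM_eqI[OF fin])
  have finJ: "finite J" using bij_betw_finite[OF bij] fin by simp
  have meas: "(\<lambda>x. \<lambda>i\<in>I. x (\<pi> i)) \<in> measurable (PiM J (\<lambda>_. lborel :: real measure)) (PiM I (\<lambda>_. lborel))"
    using bij by (intro measurable_restrict measurable_component_singleton) (auto simp: bij_betw_def)
  fix A :: "_ \<Rightarrow> real set" assume A: "\<And>i. i \<in> I \<Longrightarrow> A i \<in> sets lborel"
  let ?\<sigma> = "inv_into I \<pi>"
  have \<sigma>: "\<And>j. j \<in> J \<Longrightarrow> ?\<sigma> j \<in> I" "\<And>j. j \<in> J \<Longrightarrow> \<pi> (?\<sigma> j) = j" "\<And>i. i \<in> I \<Longrightarrow> ?\<sigma> (\<pi> i) = i"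
    using bij by (auto simp: bij_betw_def inv_into_into f_inv_into_f inv_into_f_f)
  have \<pi>: "\<And>i. i \<in> I \<Longrightarrow> \<pi> i \<in> J" using bij by (auto simp: bij_betw_def)
  have "(\<lambda>x. \<lambda>i\<in>I. x (\<pi> i)) -` Pi\<^sub>E I A \<inter> space (PiM J (\<lambda>_. lborel)) = Pi\<^sub>E J (A \<circ> ?\<sigma>)"
  proof (intro set_eqI iffI)
    fix x assume "x \<in> (\<lambda>x. \<lambda>i\<in>I. x (\<pi> i)) -` Pi\<^sub>E I A \<inter> space (PiM J (\<lambda>_. lborel))"
    then have x: "\<And>i. i \<in> I \<Longrightarrow> x (\<pi> i) \<in> A i" "x \<in> extensional J"
      by (auto simp: space_PiM PiE_iff restrict_def)
    then show "x \<in> Pi\<^sub>E J (A \<circ> ?\<sigma>)" 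
      using \<sigma> by (auto simp: PiE_iff) (metis \<sigma>)
  next
    fix x assume "x \<in> Pi\<^sub>E J (A \<circ> ?\<sigma>)"
    then show "x \<in> (\<lambda>x. \<lambda>i\<in>I. x (\<pi> i)) -` Pi\<^sub>E I A \<inter> space (PiM J (\<lambda>_. lborel))"
      using \<pi> \<sigma> by (auto simp: space_PiM PiE_iff) (metis \<sigma>(3) \<pi>)
  qed
  then have "emeasure (distr (PiM J (\<lambda>_. lborel)) (PiM I (\<lambda>_. lborel)) (\<lambda>x. \<lambda>i\<in>I. x (\<pi> i))) (Pi\<^sub>E I A)
      = emeasure (PiM J (\<lambda>_. lborel)) (Pi\<^sub>E J (A \<circ> ?\<sigma>))"
    using A fin by (subst emeasure_distr[OF meas]) (auto intro!: sets_PiM_I_finite)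
  also have "\<dots> = (\<Prod>j\<in>J. emeasure lborel ((A \<circ> ?\<sigma>) j))"
    using A finJ \<sigma> by (intro lebesgue_product.emeasure_PiM) auto
  also have "\<dots> = (\<Prod>i\<in>I. emeasure lborel (A i))"
    using \<sigma> by (subst prod.reindex_bij_betw[OF bij, symmetric]) (auto intro!: prod.cong)
  finally show "emeasure (distr (PiM J (\<lambda>_. lborel)) (PiM I (\<lambda>_. lborel)) (\<lambda>x. \<lambda>i\<in>I. x (\<pi> i))) (Pi\<^sub>E I A)
      = (\<Prod>i\<in>I. emeasure lborel (A i))" .
qed simp

lemma measurable_PiM_lborel_reindex:
  assumes "\<pi> ` I \<subseteq> J"
  shows "(\<lambda>x. \<lambda>i\<in>I. x (\<pi> i)) \<in> measurable (PiM J (\<lambda>_. lborel :: real measure)) (PiM I (\<lambda>_. lborel))"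
  using assms by (intro measurable_restrict measurable_component_singleton) auto

lemma nn_integral_PiM_lborel_reindex:
  assumes "finite I" "bij_betw \<pi> I J" "F \<in> borel_measurable (PiM I (\<lambda>_. lborel :: real measure))"
  shows "(\<integral>\<^sup>+x. F (\<lambda>i\<in>I. x (\<pi> i)) \<partial>PiM J (\<lambda>_. lborel)) = (\<integral>\<^sup>+x. F x \<partial>PiM I (\<lambda>_. lborel))"
  using assms nn_integral_distr[OF measurable_PiM_lborel_reindex[of \<pi> I J], of F]
  unfolding distr_PiM_lborel_reindex[OF assms(1,2)] by (auto simp: bij_betw_def)

abbreviation transposition :: "'i \<Rightarrow> 'i \<Rightarrow> 'i \<Rightarrow> 'i" where
  "transposition i j \<equiv> id(i := j, j := i)"

lemma bij_betw_transposition: "i \<in> I \<Longrightarrow> j \<in> I \<Longrightarrow> bij_betw (transposition i j) I I"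
  by (rule bij_betw_byWitness[where f' = "transposition i j"]) auto

text \<open>Invariance is asked only at extensional points, the points of the product space, and
  only for transpositions, which bring any index to any place.\<close>

definition exchangeable_on :: "'i set \<Rightarrow> (('i \<Rightarrow> real) \<Rightarrow> 'a) \<Rightarrow> bool" where
  "exchangeable_on I F \<longleftrightarrow>
     (\<forall>i\<in>I. \<forall>j\<in>I. \<forall>x\<in>extensional I. F (\<lambda>k\<in>I. x (transposition i j k)) = F x)"

text \<open>Ties form a null set; letting the integrand vanish there makes the decomposition by the
  position of the extreme coordinate exact at every point.\<close>

definition vanishes_on_ties :: "'i set \<Rightarrow> (('i \<Rightarrow> real) \<Rightarrow> 'a::zero) \<Rightarrow> bool" where
  "vanishes_on_ties I F \<longleftrightarrow> (\<forall>x\<in>extensional I. \<not> inj_on x I \<longrightarrow> F x = 0)"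

text \<open>Off ties exactly one index carries the strict extreme, and by exchangeability all
  indices contribute equally. The relation r covers the maximum, needed to order the coordinates,
  and the minimum, needed for the limit of small exponents.\<close>

lemma nn_integral_strict_extreme:
  fixes F :: "('i \<Rightarrow> real) \<Rightarrow> ennreal" and r :: "real \<Rightarrow> real \<Rightarrow> bool"
  assumes I: "finite I" "k \<in> I" and F [measurable]: "F \<in> borel_measurable (PiM I (\<lambda>_. lborel))"
    and sym: "exchangeable_on I F" and ties: "vanishes_on_ties I F"
    and r: "r = (<) \<or> r = (>)"
  shows "(\<integral>\<^sup>+x. F x \<partial>PiM I (\<lambda>_. lborel)) =
     of_nat (card I) * (\<integral>\<^sup>+x. F x * of_bool (\<forall>j\<in>I - {k}. r (x j) (x k)) \<partial>PiM I (\<lambda>_. lborel))"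
proof -
  let ?E = "\<lambda>i x. of_bool (\<forall>j\<in>I - {i}. r (x j) (x i)) :: ennreal"
  have [measurable]: "?E i \<in> borel_measurable (PiM I (\<lambda>_. lborel))" if "i \<in> I" for i
  proof -
    have "Measurable.pred (PiM I (\<lambda>_. lborel)) (\<lambda>x. \<forall>j\<in>I - {i}. r (x j) (x i))"
      using r I that by (intro pred_intros_finite) (auto intro!: borel_measurable_pred_less
          measurable_component_singleton)
    then show ?thesis by measurable
  qed
  have split: "F x = (\<Sum>i\<in>I. F x * ?E i x)" if x: "x \<in> extensional I" for x
  proof (cases "inj_on x I")
    case False
    then show ?thesis using ties x by (auto simp: vanishes_on_ties_def)
  next
    case True
    have "\<exists>i\<in>I. \<forall>j\<in>I. j \<noteq> i \<longrightarrow> r (x j) (x i)"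
    proof -
      from r consider "r = (<)" | "r = (>)" by blast
      then show ?thesis
      proof cases
        case 1
        obtain i where "i \<in> I" "x i = Max (x ` I)"
          using Max_in[of "x ` I"] I by (metis empty_iff finite_imageI imageE image_is_empty)
        then show ?thesis 
          using I True 1 by (intro bexI[of _ i]) (auto simp: less_le inj_on_def intro!: Max_ge)
      next
        case 2
        obtain i where "i \<in> I" "x i = Min (x ` I)"
          using Min_in[of "x ` I"] I by (metis empty_iff finite_imageI imageE image_is_empty)
        then show ?thesis 
          using I True 2 by (intro bexI[of _ i]) (auto simp: less_le inj_on_def intro!: Min_le)
      qed
    qed
    then obtain i where i: "i \<in> I" "\<forall>j\<in>I. j \<noteq> i \<longrightarrow> r (x j) (x i)" by auto
    have "(\<Sum>l\<in>I. F x * ?E l x) = (\<Sum>l\<in>I. if l = i then F x else 0)"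
    proof (intro sum.cong refl)
      fix l assume l: "l \<in> I"
      show "F x * ?E l x = (if l = i then F x else 0)"
      proof (cases "l = i")
        case True
        then show ?thesis using i by auto
      next
        case False
        then have "r (x l) (x i)" using i l by auto
        then have "\<not> r (x i) (x l)" using r by auto
        then show ?thesis using False i by auto
      qed
    qed
    then show ?thesis using I i by simp
  qed
  have same: "(\<integral>\<^sup>+x. F x * ?E i x \<partial>PiM I (\<lambda>_. lborel)) = (\<integral>\<^sup>+x. F x * ?E k x \<partial>PiM I (\<lambda>_. lborel))" 
    if i: "i \<in> I" for i
  proof -
    have "(\<integral>\<^sup>+x. F x * ?E i x \<partial>PiM I (\<lambda>_. lborel)) = 
       (\<integral>\<^sup>+x. F (\<lambda>l\<in>I. x (transposition i k l)) * ?E i (\<lambda>l\<in>I. x (transposition i k l)) \<partial>PiM I (\<lambda>_. lborel))"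
      using I i by (subst nn_integral_PiM_lborel_reindex[OF I(1) bij_betw_transposition, where F
          = "\<lambda>x. F x * ?E i x"]) auto
    also have "\<dots> = (\<integral>\<^sup>+x. F x * ?E k x \<partial>PiM I (\<lambda>_. lborel))"
    proof (intro nn_integral_cong)
      fix x assume "x \<in> space (PiM I (\<lambda>_. lborel :: real measure))"
      then have x: "x \<in> extensional I" by (auto simp: space_PiM PiE_iff)
      have "(\<forall>j\<in>I - {i}. r ((\<lambda>l\<in>I. x (transposition i k l)) j) ((\<lambda>l\<in>I. x (transposition i k l)) i))
        \<longleftrightarrow> (\<forall>j\<in>I - {k}. r (x j) (x k))"
        using I i by auto
      then show "F (\<lambda>l\<in>I. x (transposition i k l)) * ?E i (\<lambda>l\<in>I. x (transposition i k l)) = F x * ?E k x"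
        using sym I i x by (auto simp: exchangeable_on_def)
    qed
    finally show ?thesis .
  qed
  have "(\<integral>\<^sup>+x. F x \<partial>PiM I (\<lambda>_. lborel)) = (\<integral>\<^sup>+x. (\<Sum>i\<in>I. F x * ?E i x) \<partial>PiM I (\<lambda>_. lborel))"
    by (intro nn_integral_cong split) (auto simp: space_PiM PiE_iff)
  also have "\<dots> = (\<Sum>i\<in>I. \<integral>\<^sup>+x. F x * ?E i x \<partial>PiM I (\<lambda>_. lborel))"
    by (intro nn_integral_sum) measurable
  also have "\<dots> = (\<Sum>i\<in>I. \<integral>\<^sup>+x. F x * ?E k x \<partial>PiM I (\<lambda>_. lborel))"
    by (intro sum.cong same) auto
  finally show ?thesis by simp
qed

text \<open>Induction by a new smallest index b, whose coordinate must become the maximum. This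
  costs a factor equal to the cardinality, and for a fixed value t the section restricted to
  coordinates below t is again exchangeable and vanishes on ties, so the induction hypothesis
  applies to it.\<close>

lemma nn_integral_decreasing:
  fixes F :: "(nat \<Rightarrow> real) \<Rightarrow> ennreal"
  assumes "finite I" "F \<in> borel_measurable (PiM I (\<lambda>_. lborel))" "exchangeable_on I F" "vanishes_on_ties I F"
  shows "(\<integral>\<^sup>+x. F x \<partial>PiM I (\<lambda>_. lborel)) =
     fact (card I) * (\<integral>\<^sup>+x. F x * of_bool (\<forall>i\<in>I. \<forall>j\<in>I. i < j \<longrightarrow> x j < x i) \<partial>PiM I (\<lambda>_. lborel))"
  using assms
proof (induction I arbitrary: F rule: finite_linorder_min_induct)
  case empty
  then show ?case by simp
next
  case (insert b A)
  note [measurable] = insert.prems(1)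
  have b: "b \<notin> A" using insert.hyps by auto
  interpret A: finite_product_sigma_finite "\<lambda>_. lborel :: real measure" A by standard fact
  have pm: "Measurable.pred (PiM B (\<lambda>_. lborel)) (\<lambda>x :: nat \<Rightarrow> real. \<forall>i\<in>B. \<forall>j\<in>B. i < j \<longrightarrow> x j < x i)"
      if "finite B" for B
    using that by (intro pred_intros_finite pred_intros_imp')
        (auto intro!: borel_measurable_pred_less measurable_component_singleton)
  have [measurable]: "Measurable.pred (PiM (insert b A) (\<lambda>_. lborel)) (\<lambda>x :: nat \<Rightarrow> real. \<forall>j\<in>A. x j < x b)"
    "Measurable.pred (PiM A (\<lambda>_. lborel)) (\<lambda>x :: nat \<Rightarrow> real. \<forall>j\<in>A. x j < t)" for t
    using insert.hyps(1) by (auto intro!: pred_intros_finite borel_measurable_pred_less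
        measurable_component_singleton)
  have [measurable]: "Measurable.pred (PiM (insert b A) (\<lambda>_. lborel))
      (\<lambda>x :: nat \<Rightarrow> real. \<forall>i\<in>A. \<forall>j\<in>A. i < j \<longrightarrow> x j < x i)"
    using insert.hyps(1) by (intro pred_intros_finite pred_intros_imp')
        (auto intro!: borel_measurable_pred_less measurable_component_singleton)
  note [measurable] = pm[OF insert.hyps(1)]
  let ?O = "\<lambda>x. of_bool (\<forall>i\<in>A. \<forall>j\<in>A. i < j \<longrightarrow> x j < x i) :: ennreal"
  let ?G = "\<lambda>t x. F (x(b := t)) * of_bool (\<forall>j\<in>A. x j < t)"
  have IH: "(\<integral>\<^sup>+x. ?G t x \<partial>PiM A (\<lambda>_. lborel)) = fact (card A)
      * (\<integral>\<^sup>+x. ?G t x * ?O x \<partial>PiM A (\<lambda>_. lborel))" for t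
  proof (rule insert.IH)
    show "?G t \<in> borel_measurable (PiM A (\<lambda>_. lborel))" by measurable
    show "exchangeable_on A (?G t)"
      unfolding exchangeable_on_def
    proof (intro ballI)
      fix i j and x :: "nat \<Rightarrow> real" assume ij: "i \<in> A" "j \<in> A" and x: "x \<in> extensional A"
      have "(\<lambda>k\<in>A. x (transposition i j k))(b := t) = (\<lambda>k\<in>insert b A. (x(b := t)) (transposition i j k))"
        using ij b by (auto simp: fun_eq_iff)
      moreover have "F \<dots> = F (x(b := t))"
      proof -
        have "x(b := t) \<in> extensional (insert b A)" using x by (auto simp: extensional_def)
        then show ?thesis using insert.prems(2) ij unfolding exchangeable_on_def by blast
      qed
      moreover have "(\<forall>l\<in>A. (\<lambda>k\<in>A. x (transposition i j k)) l < t) \<longleftrightarrow> (\<forall>j\<in>A. x j < t)"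
        using ij by auto
      ultimately show "?G t (\<lambda>k\<in>A. x (transposition i j k)) = ?G t x" by simp
    qed
    show "vanishes_on_ties A (?G t)"
      unfolding vanishes_on_ties_def
    proof (intro ballI impI)
      fix x :: "nat \<Rightarrow> real" assume x: "x \<in> extensional A" "\<not> inj_on x A"
      then have "\<not> inj_on (x(b := t)) (insert b A)"
        using b by (auto simp: inj_on_def)
      then show "?G t x = 0"
        using insert.prems(3) x by (auto simp: vanishes_on_ties_def extensional_def)
    qed
  qed
  have Ot: "?O (x(b := t)) = ?O x" for x t
    using b by (auto intro!: arg_cong[where f = of_bool])
  have bt: "(\<forall>j\<in>A. (x(b := t)) j < t) \<longleftrightarrow> (\<forall>j\<in>A. x j < t)" for x :: "nat \<Rightarrow> real" and t
    using b by auto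
  have "(\<integral>\<^sup>+x. F x \<partial>PiM (insert b A) (\<lambda>_. lborel)) = of_nat (card (insert b A)) * 
      (\<integral>\<^sup>+x. F x * of_bool (\<forall>j\<in>A. x j < x b) \<partial>PiM (insert b A) (\<lambda>_. lborel))"
    using insert.prems insert.hyps(1) b
    by (subst nn_integral_strict_extreme[where k = b and r = "(<)"]) auto
  also have "(\<integral>\<^sup>+x. F x * of_bool (\<forall>j\<in>A. x j < x b) \<partial>PiM (insert b A) (\<lambda>_. lborel)) 
      = (\<integral>\<^sup>+t. (\<integral>\<^sup>+x. ?G t x \<partial>PiM A (\<lambda>_. lborel)) \<partial>lborel)"
    using insert.hyps(1) b bt
    by (subst lebesgue_product.product_nn_integral_insert_rev) auto
  also have "\<dots> = (\<integral>\<^sup>+t. fact (card A) * (\<integral>\<^sup>+x. ?G t x * ?O x \<partial>PiM A (\<lambda>_. lborel)) \<partial>lborel)"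
    by (simp only: IH)
  also have "\<dots> = fact (card A) * (\<integral>\<^sup>+t. (\<integral>\<^sup>+x. ?G t x * ?O x \<partial>PiM A (\<lambda>_. lborel)) \<partial>lborel)"
    by (intro nn_integral_cmult) measurable
  also have "(\<integral>\<^sup>+t. (\<integral>\<^sup>+x. ?G t x * ?O x \<partial>PiM A (\<lambda>_. lborel)) \<partial>lborel)
     = (\<integral>\<^sup>+x. F x * of_bool (\<forall>j\<in>A. x j < x b) * ?O x \<partial>PiM (insert b A) (\<lambda>_. lborel))"
  proof -
    have m: "(\<lambda>x. F x * of_bool (\<forall>j\<in>A. x j < x b) * ?O x) \<in> borel_measurable (PiM (insert b A) (\<lambda>_. lborel))"
      by measurable
    show ?thesis
      unfolding lebesgue_product.product_nn_integral_insert_rev[OF insert.hyps(1) b m] fun_upd_same bt Ot ..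
  qed
  also have "(\<lambda>x. F x * of_bool (\<forall>j\<in>A. x j < x b) * ?O x) 
     = (\<lambda>x. F x * of_bool (\<forall>i\<in>insert b A. \<forall>j\<in>insert b A. i < j \<longrightarrow> x j < x i))"
    using insert.hyps(2) by (intro ext) (auto simp: less_asym; fastforce)
  finally show ?case
    using insert.hyps(1) b by (simp add: mult.assoc)
qed

subsection \<open>The Laguerre weight\<close>

text \<open>The unnormalised density of a Gamma law of shape a and scale 2. The ensemble has a =
  \<beta> (p - n + 1) / 2.\<close>

definition laguerre_weight :: "real \<Rightarrow> real \<Rightarrow> real" where
  "laguerre_weight a t = (if 0 < t then t powr (a - 1) * exp (- t / 2) else 0)"

text \<open>Each unordered pair occurs twice, so this is the absolute Vandermonde determinant to the
  power 2 * g, and the ensemble has g = \<beta> / 2. Ordered pairs keep the product symmetric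
  without an order on the index type.\<close>

definition vandermonde_power :: "'i set \<Rightarrow> real \<Rightarrow> ('i \<Rightarrow> real) \<Rightarrow> real" where
  "vandermonde_power I g x = (\<Prod>i\<in>I. \<Prod>j\<in>I - {i}. \<bar>x i - x j\<bar> powr g)"

definition laguerre_fun :: "'i set \<Rightarrow> real \<Rightarrow> real \<Rightarrow> ('i \<Rightarrow> real) \<Rightarrow> real" where
  "laguerre_fun I g a x = (\<Prod>i\<in>I. laguerre_weight a (x i)) * vandermonde_power I g x"

lemma laguerre_weight_nonneg [simp]: "0 \<le> laguerre_weight a t"
  by (simp add: laguerre_weight_def)

lemma vandermonde_power_nonneg [simp]: "0 \<le> vandermonde_power I g x"
  unfolding vandermonde_power_def by (intro prod_nonneg) auto

lemma laguerre_fun_nonneg [simp]: "0 \<le> laguerre_fun I g a x"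
  unfolding laguerre_fun_def by (intro mult_nonneg_nonneg prod_nonneg) auto

lemma borel_measurable_laguerre_weight [measurable]: "laguerre_weight a \<in> borel_measurable borel"
  unfolding laguerre_weight_def by measurable

lemma borel_measurable_laguerre_fun [measurable]:
  assumes "I \<subseteq> J"
  shows "laguerre_fun I g a \<in> borel_measurable (PiM J (\<lambda>_. lborel))"
proof -
  have [measurable]: "(\<lambda>x. x i) \<in> borel_measurable (PiM J (\<lambda>_. lborel :: real measure))" if "i \<in> I" for i
    using measurable_component_singleton[of i J "\<lambda>_. lborel"] that assms by auto
  show ?thesis
    unfolding laguerre_fun_def vandermonde_power_def
    by (intro borel_measurable_times borel_measurable_prod) measurable
qed

lemma vandermonde_power_insert:
  assumes "finite I" "k \<notin> I"
  shows "vandermonde_power (insert k I) g x = vandermonde_power I g x * (\<Prod>i\<in>I. \<bar>x k - x i\<bar> powr (2 * g))"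
proof -
  have "(\<Prod>j\<in>insert k I - {i}. \<bar>x i - x j\<bar> powr g) = \<bar>x i - x k\<bar> powr g
      * (\<Prod>j\<in>I - {i}. \<bar>x i - x j\<bar> powr g)" if "i \<in> I" for i
  proof -
    have "insert k I - {i} = insert k (I - {i})" using that assms by auto
    then show ?thesis using assms by simp
  qed
  moreover have "insert k I - {k} = I" using assms by auto
  ultimately have "vandermonde_power (insert k I) g x = (\<Prod>j\<in>I. \<bar>x k - x j\<bar> powr g) *
      (\<Prod>i\<in>I. \<bar>x i - x k\<bar> powr g * (\<Prod>j\<in>I - {i}. \<bar>x i - x j\<bar> powr g))"
    using assms by (simp add: vandermonde_power_def)
  also have "\<dots> = vandermonde_power I g x * ((\<Prod>j\<in>I. \<bar>x k - x j\<bar> powr g) * (\<Prod>i\<in>I. \<bar>x i - x k\<bar> powr g))"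
    by (simp add: vandermonde_power_def prod.distrib)
  also have "(\<Prod>j\<in>I. \<bar>x k - x j\<bar> powr g) * (\<Prod>i\<in>I. \<bar>x i - x k\<bar> powr g) = (\<Prod>i\<in>I. \<bar>x k - x i\<bar> powr (2 * g))"
    unfolding prod.distrib[symmetric] mult_2 powr_add by (simp add: abs_minus_commute)
  finally show ?thesis .
qed

lemma vandermonde_power_cong: "(\<And>i. i \<in> I \<Longrightarrow> x i = y i) \<Longrightarrow> vandermonde_power I g x = vandermonde_power I g y"
  by (auto simp: vandermonde_power_def intro!: prod.cong)

lemma laguerre_fun_cong: "(\<And>i. i \<in> I \<Longrightarrow> x i = y i) \<Longrightarrow> laguerre_fun I g a x = laguerre_fun I g a y"
  unfolding laguerre_fun_def by (auto intro!: arg_cong2[where f = "(*)"] prod.cong vandermonde_power_cong)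

lemma laguerre_fun_insert:
  assumes "finite I" "k \<notin> I"
  shows "laguerre_fun (insert k I) g a x =
    laguerre_weight a (x k) * (\<Prod>i\<in>I. \<bar>x k - x i\<bar> powr (2 * g)) * laguerre_fun I g a x"
  using assms by (simp add: laguerre_fun_def vandermonde_power_insert)

lemma laguerre_fun_eq_0:
  assumes "finite I" "(\<exists>i\<in>I. x i \<le> 0) \<or> \<not> inj_on x I"
  shows "laguerre_fun I g a x = 0"
  using assms(2)
proof
  assume "\<exists>i\<in>I. x i \<le> 0"
  then have "(\<Prod>i\<in>I. laguerre_weight a (x i)) = 0"
    using assms(1) by (intro prod_zero) (auto simp: laguerre_weight_def intro!: bexI)
  then show ?thesis by (simp add: laguerre_fun_def)
next
  assume "\<not> inj_on x I"
  then obtain i j where "i \<in> I" "j \<in> I - {i}" "x i = x j" by (auto simp: inj_on_def)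
  then have "(\<Prod>j\<in>I - {i}. \<bar>x i - x j\<bar> powr g) = 0"
    using assms(1) by (intro prod_zero) (auto intro!: bexI[of _ j])
  then have "vandermonde_power I g x = 0"
    unfolding vandermonde_power_def using assms(1) \<open>i \<in> I\<close> by (intro prod_zero) auto
  then show ?thesis by (simp add: laguerre_fun_def)
qed

lemma laguerre_fun_pos:
  assumes "finite I" "\<And>i. i \<in> I \<Longrightarrow> 0 < x i" "inj_on x I"
  shows "0 < laguerre_fun I g a x"
proof -
  have "0 < laguerre_weight a (x i)" if "i \<in> I" for i
    using assms(2)[OF that] by (simp add: laguerre_weight_def zero_less_mult_iff)
  then show ?thesis
    using assms unfolding laguerre_fun_def vandermonde_power_def
    by (intro mult_pos_pos prod_pos) (auto simp: inj_on_def)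
qed

lemma laguerre_fun_reindex:
  assumes "bij_betw \<pi> I J"
  shows "laguerre_fun I g a (\<lambda>k. x (\<pi> k)) = laguerre_fun J g a x"
proof -
  have "vandermonde_power I g (\<lambda>k. x (\<pi> k)) = (\<Prod>i\<in>I. \<Prod>j\<in>J - {\<pi> i}. \<bar>x (\<pi> i) - x j\<bar> powr g)"
    unfolding vandermonde_power_def
  proof (rule prod.cong[OF refl])
    fix i assume i: "i \<in> I"
    have "bij_betw \<pi> (I - {i}) (J - {\<pi> i})"
      using bij_betw_DiffI[OF assms, of "{i}" "{\<pi> i}"] i assms by (auto simp: bij_betw_def)
    from prod.reindex_bij_betw[OF this]
    show "(\<Prod>j\<in>I - {i}. \<bar>x (\<pi> i) - x (\<pi> j)\<bar> powr g) = (\<Prod>j\<in>J - {\<pi> i}. \<bar>x (\<pi> i) - x j\<bar> powr g)" .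
  qed
  also have "\<dots> = vandermonde_power J g x"
    unfolding vandermonde_power_def
    by (rule prod.reindex_bij_betw[OF assms, of "\<lambda>i. \<Prod>j\<in>J - {i}. \<bar>x i - x j\<bar> powr g"])
  finally show ?thesis
    unfolding laguerre_fun_def using prod.reindex_bij_betw[OF assms, of "\<lambda>i. laguerre_weight a (x i)"] by simp
qed

lemma exchangeable_on_laguerre_fun: "exchangeable_on I (laguerre_fun I g a)"
  unfolding exchangeable_on_def
proof (intro ballI)
  fix i j and x :: "'a \<Rightarrow> real" assume ij: "i \<in> I" "j \<in> I"
  have "laguerre_fun I g a (\<lambda>k\<in>I. x (transposition i j k)) = laguerre_fun I g a (\<lambda>k. x (transposition i j k))"
    by (rule laguerre_fun_cong) auto
  then show "laguerre_fun I g a (\<lambda>k\<in>I. x (transposition i j k)) = laguerre_fun I g a x"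
    using laguerre_fun_reindex[OF bij_betw_transposition[OF ij]] by simp
qed

section \<open>Integrability of the Laguerre weight, also with one singular quotient\<close>

lemma one_plus_powr_le_exp:
  fixes M c :: real
  assumes c: "0 < c"
  shows "\<exists>C>0. \<forall>t\<ge>0. (1 + t) powr M \<le> C * exp (c * t)"
proof (cases "0 < M")
  case False
  have "(1 + t) powr M \<le> 1 * exp (c * t)" if "0 \<le> t" for t
  proof -
    have "(1 + t) powr M \<le> (1 + t) powr 0" using False that by (intro powr_mono) auto
    also have "\<dots> \<le> exp (c * t)" using that c by simp
    finally show ?thesis by simp
  qed
  then show ?thesis by (intro exI[of _ 1]) auto
next
  case True
  \<comment> \<open>The tangent to ln at M / c has slope c / M, which makes M * ln (1 + t) grow like
    c * t.\<close>
  let ?k = "M / c"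
  have k: "0 < ?k" using c True by simp
  have "(1 + t) powr M \<le> exp (c + M * (ln ?k - 1)) * exp (c * t)" if t: "0 \<le> t" for t
  proof -
    have "ln ((1 + t) / ?k) \<le> (1 + t) / ?k - 1"
      using True c t by (intro ln_le_minus_one divide_pos_pos) auto
    then have "ln (1 + t) \<le> (1 + t) / ?k - 1 + ln ?k"
      using True c t by (subst (asm) ln_div) auto
    then have "M * ln (1 + t) \<le> M * ((1 + t) / ?k - 1 + ln ?k)"
      using True by (intro mult_left_mono) auto
    also have "\<dots> = c + M * (ln ?k - 1) + c * t"
      using True c by (simp add: field_simps)
    finally show ?thesis using t by (simp add: powr_def flip: exp_add)
  qed
  then show ?thesis by (intro exI[of _ "exp (c + M * (ln ?k - 1))"]) auto
qed

lemma nn_integral_powr_exp: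
  assumes "0 < a" "0 < c"
  shows "(\<integral>\<^sup>+t. ennreal (if 0 < t then t powr (a - 1) * exp (- (c * t)) else 0) \<partial>lborel)
      = ennreal (Gamma a / c powr a)"
proof -
  have "ennreal (Gamma a) = (\<integral>\<^sup>+t. ennreal (indicator {0..} t * t powr (a - 1) / exp t) \<partial>lborel)"
    using Gamma_conv_nn_integral_real[OF assms(1)] .
  also have "\<dots> = ennreal \<bar>c\<bar> * (\<integral>\<^sup>+t. ennreal (indicator {0..} (0 + c * t)
      * (0 + c * t) powr (a - 1) / exp (0 + c * t)) \<partial>lborel)"
    using assms by (intro nn_integral_real_affine) auto
  also have "\<dots> = ennreal c * (\<integral>\<^sup>+t. ennreal (c powr (a - 1)) * ennreal (if 0
      < t then t powr (a - 1) * exp (- (c * t)) else 0) \<partial>lborel)"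
    using assms by (auto intro!: arg_cong2[where f = "(*)"] nn_integral_cong 
      simp: indicator_def zero_le_mult_iff powr_mult exp_minus field_simps ennreal_mult[symmetric])
  also have "\<dots> = ennreal c * (ennreal (c powr (a - 1)) * (\<integral>\<^sup>+t. ennreal (if 0
      < t then t powr (a - 1) * exp (- (c * t)) else 0) \<partial>lborel))"
    by (subst nn_integral_cmult) auto
  also have "\<dots> = ennreal (c powr a) * (\<integral>\<^sup>+t. ennreal (if 0
      < t then t powr (a - 1) * exp (- (c * t)) else 0) \<partial>lborel)"
    using assms by (simp add: mult.assoc[symmetric] ennreal_mult[symmetric] powr_diff)
  finally have "ennreal (c powr a) * (\<integral>\<^sup>+t. ennreal (if 0
      < t then t powr (a - 1) * exp (- (c * t)) else 0) \<partial>lborel) = ennreal (Gamma a)" by simp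
  then have "ennreal (1 / c powr a) * ennreal (c powr a) * (\<integral>\<^sup>+t. ennreal (if 0
      < t then t powr (a - 1) * exp (- (c * t)) else 0) \<partial>lborel)
     = ennreal (1 / c powr a) * ennreal (Gamma a)" by (simp add: mult.assoc)
  then show ?thesis using assms Gamma_real_pos[of a]
    by (simp add: ennreal_mult[symmetric])
qed

lemma nn_integral_laguerre_weight:
  assumes "0 < a"
  shows "(\<integral>\<^sup>+t. ennreal (laguerre_weight a t) \<partial>lborel) = ennreal (2 powr a * Gamma a)"
proof -
  have "exp (- t / 2) = exp (- (1 / 2 * t))" for t :: real by simp
  then show ?thesis
    using nn_integral_powr_exp[of a "1/2"] assms
    by (simp only: laguerre_weight_def) (simp add: powr_divide mult.commute)
qed

lemma nn_integral_laguerre_weight_powr: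
  assumes "0 < a"
  shows "(\<integral>\<^sup>+t. ennreal (laguerre_weight a t * (1 + t) powr M) \<partial>lborel) < \<infinity>"
proof -
  obtain C where C: "0 < C" "\<And>t. 0 \<le> t \<Longrightarrow> (1 + t) powr M \<le> C * exp (1/4 * t)"
    using one_plus_powr_le_exp[of "1/4" M] by auto
  have "(\<integral>\<^sup>+t. ennreal (laguerre_weight a t * (1 + t) powr M) \<partial>lborel)
      \<le> (\<integral>\<^sup>+t. ennreal C * ennreal (if 0 < t then t powr (a - 1) * exp (- (1/4 * t)) else 0) \<partial>lborel)"
  proof (intro nn_integral_mono)
    fix t :: real
    have "laguerre_weight a t * (1 + t) powr M \<le> C * (t powr (a - 1) * exp (- (1/4 * t)))" if "0 < t"
    proof -
      have "laguerre_weight a t * (1 + t) powr M \<le> laguerre_weight a t * (C * exp (1/4 * t))"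
        using C(2)[of t] that by (intro mult_left_mono) auto
      also have "\<dots> = C * (t powr (a - 1) * (exp (- t / 2) * exp (1/4 * t)))"
        using that by (simp add: laguerre_weight_def)
      also have "exp (- t / 2) * exp (1/4 * t) = exp (- (1/4 * t))"
        by (simp flip: exp_add)
      finally show ?thesis .
    qed
    then show "ennreal (laguerre_weight a t * (1 + t) powr M)
       \<le> ennreal C * ennreal (if 0 < t then t powr (a - 1) * exp (- (1/4 * t)) else 0)"
      using C(1) by (auto simp: ennreal_mult[symmetric] laguerre_weight_def intro!: ennreal_leI)
  qed
  also have "\<dots> = ennreal C * ennreal (Gamma a / (1/4) powr a)"
    using nn_integral_powr_exp[OF assms, of "1/4"] by (subst nn_integral_cmult) auto
  also have "\<dots> < \<infinity>" by (simp add: ennreal_mult_less_top)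
  finally show ?thesis .
qed

lemma nn_integral_abs_powr_unit:
  assumes "-1 < b"
  shows "(\<integral>\<^sup>+t. ennreal (\<bar>t - y\<bar> powr b * of_bool (\<bar>t - y\<bar> \<le> 1)) \<partial>lborel) \<le> ennreal (2 / (b + 1))"
proof -
  have half: "(\<integral>\<^sup>+t. ennreal (t powr b * of_bool (0 \<le> t \<and> t \<le> 1)) \<partial>lborel) = ennreal (1 / (b + 1))"
  proof (rule nn_integral_has_integral_lborel)
    have "((\<lambda>t. if t \<in> {0..1} then t powr b else 0) has_integral 1 / (b + 1)) UNIV"
      using has_integral_powr_from_0[of b 1] assms by (subst has_integral_restrict_UNIV) simp
    then show "((\<lambda>t. t powr b * of_bool (0 \<le> t \<and> t \<le> 1)) has_integral 1 / (b + 1)) UNIV"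
      by (rule has_integral_eq[rotated]) auto
  qed auto
  have "(\<integral>\<^sup>+t. ennreal (\<bar>t - y\<bar> powr b * of_bool (\<bar>t - y\<bar> \<le> 1)) \<partial>lborel) 
     = (\<integral>\<^sup>+t. ennreal (\<bar>t\<bar> powr b * of_bool (\<bar>t\<bar> \<le> 1)) \<partial>lborel)"
    by (subst nn_integral_real_affine[where c = 1 and t = y]) auto
  also have "\<dots> \<le> (\<integral>\<^sup>+t. ennreal (t powr b * of_bool (0 \<le> t \<and> t \<le> 1)) + ennreal ((- t) powr b
      * of_bool (0 \<le> -t \<and> -t \<le> 1)) \<partial>lborel)"
    by (intro nn_integral_mono) (auto simp: abs_if)
  also have "\<dots> = (\<integral>\<^sup>+t. ennreal (t powr b * of_bool (0 \<le> t \<and> t \<le> 1)) \<partial>lborel)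
     + (\<integral>\<^sup>+t. ennreal ((- t) powr b * of_bool (0 \<le> -t \<and> -t \<le> 1)) \<partial>lborel)"
    by (intro nn_integral_add) auto
  also have "(\<integral>\<^sup>+t. ennreal ((- t) powr b * of_bool (0 \<le> -t \<and> -t \<le> 1)) \<partial>lborel)
      = (\<integral>\<^sup>+t. ennreal (t powr b * of_bool (0 \<le> t \<and> t \<le> 1)) \<partial>lborel)"
    by (subst nn_integral_real_affine[where c = "-1" and t = 0]) auto
  finally show ?thesis
    using assms unfolding half by (simp flip: ennreal_plus)
qed

text \<open>For decoupling: it bounds the Vandermonde factor by a product of functions of single
  coordinates, so that integrability becomes a question in one dimension.\<close>

lemma abs_diff_le_one_plus:
  fixes s t :: real
  assumes "0 < s" "0 < t"
  shows "\<bar>s - t\<bar> \<le> (1 + s) * (1 + t)"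
  using assms by (auto simp: abs_if algebra_simps)

lemma abs_diff_powr_le_one_plus:
  fixes s t :: real
  assumes "0 < s" "0 < t" "0 \<le> g"
  shows "\<bar>s - t\<bar> powr g \<le> (1 + s) powr g * (1 + t) powr g"
proof -
  have "\<bar>s - t\<bar> powr g \<le> ((1 + s) * (1 + t)) powr g"
    using assms abs_diff_le_one_plus by (intro powr_mono2) auto
  also have "\<dots> = (1 + s) powr g * (1 + t) powr g"
    using assms by (intro powr_mult)
  finally show ?thesis .
qed

lemma prod_powr_const: "0 < s \<Longrightarrow> finite I \<Longrightarrow> (\<Prod>i\<in>I. s powr g) = s powr (g * card I)" for s :: real
  by (simp add: powr_realpow[symmetric] powr_powr mult.commute powr_power)

lemma vandermonde_power_le:
  assumes "finite I" "\<And>i. i \<in> I \<Longrightarrow> 0 < x i" "0 \<le> g"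
  shows "vandermonde_power I g x \<le> (\<Prod>i\<in>I. (1 + x i) powr (2 * g * card I))"
proof -
  have "vandermonde_power I g x \<le> (\<Prod>i\<in>I. \<Prod>j\<in>I. (1 + x i) powr g * (1 + x j) powr g)"
    unfolding vandermonde_power_def
  proof (intro prod_mono conjI prod_nonneg)
    fix i assume i: "i \<in> I"
    have "(\<Prod>j\<in>I - {i}. \<bar>x i - x j\<bar> powr g) \<le> (\<Prod>j\<in>I - {i}. (1 + x i) powr g * (1 + x j) powr g)"
      using assms i by (intro prod_mono conjI abs_diff_powr_le_one_plus) auto
    also have "\<dots> \<le> (\<Prod>j\<in>I - {i}. (1 + x i) powr g * (1 + x j) powr g) * ((1 + x i) powr g * (1 + x i) powr g)"
    proof -
      have "1 \<le> (1 + x i) powr g"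
        using assms i by (intro ge_one_powr_ge_zero) (auto simp: less_imp_le)
      then have "1 * 1 \<le> (1 + x i) powr g * (1 + x i) powr g" by (intro mult_mono) auto
      moreover have "0 \<le> (\<Prod>j\<in>I - {i}. (1 + x i) powr g * (1 + x j) powr g)"
        by (intro prod_nonneg) auto
      ultimately have "(\<Prod>j\<in>I - {i}. (1 + x i) powr g * (1 + x j) powr g) * 1 \<le>
          (\<Prod>j\<in>I - {i}. (1 + x i) powr g * (1 + x j) powr g) * ((1 + x i) powr g * (1 + x i) powr g)"
        by (intro mult_left_mono) (simp_all only: mult_1_right)
      then show ?thesis by (simp only: mult_1_right)
    qed
    also have "\<dots> = (\<Prod>j\<in>I. (1 + x i) powr g * (1 + x j) powr g)"
      using assms i by (subst prod.remove[of I i]) (auto simp: mult.commute)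
    finally show "(\<Prod>j\<in>I - {i}. \<bar>x i - x j\<bar> powr g) \<le> (\<Prod>j\<in>I. (1 + x i) powr g * (1 + x j) powr g)" .
  qed auto
  also have "\<dots> = (\<Prod>i\<in>I. (1 + x i) powr (g * card I)) * (\<Prod>j\<in>I. (1 + x j) powr (g * card I))"
  proof -
    have "(\<Prod>i\<in>I. \<Prod>j\<in>I. (1 + x j) powr g) = (\<Prod>j\<in>I. (1 + x j) powr (g * card I))"
      using assms by (subst prod.swap) (intro prod.cong refl prod_powr_const; auto simp: add_pos_pos)
    moreover have "(\<Prod>i\<in>I. \<Prod>j\<in>I. (1 + x i) powr g) = (\<Prod>i\<in>I. (1 + x i) powr (g * card I))"
      using assms by (intro prod.cong refl prod_powr_const; auto simp: add_pos_pos)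
    ultimately show ?thesis by (simp only: prod.distrib)
  qed
  also have "\<dots> = (\<Prod>i\<in>I. (1 + x i) powr (2 * g * card I))"
    by (simp add: prod.distrib[symmetric] powr_add[symmetric] mult.assoc)
  finally show ?thesis .
qed

lemma laguerre_fun_le:
  assumes "finite I" "0 \<le> g"
  shows "laguerre_fun I g a x \<le> (\<Prod>i\<in>I. laguerre_weight a (x i) * (1 + x i) powr (2 * g * card I))"
proof (cases "\<forall>i\<in>I. 0 < x i")
  case True
  then show ?thesis
    unfolding laguerre_fun_def prod.distrib using assms
    by (intro mult_left_mono vandermonde_power_le prod_nonneg) auto
next
  case False
  then have "laguerre_fun I g a x = 0" using assms by (intro laguerre_fun_eq_0) (auto simp: not_less)
  then show ?thesis by (auto intro!: prod_nonneg)
qed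

lemma nn_integral_laguerre_fun_powr_finite:
  assumes "finite I" "0 \<le> g" "0 < a"
  shows "(\<integral>\<^sup>+x. ennreal (laguerre_fun I g a x * (\<Prod>i\<in>I. (1 + x i) powr M)) \<partial>PiM I (\<lambda>_. lborel)) < \<infinity>"
proof -
  let ?M = "M + 2 * g * card I"
  have "(\<integral>\<^sup>+x. ennreal (laguerre_fun I g a x * (\<Prod>i\<in>I. (1 + x i) powr M)) \<partial>PiM I (\<lambda>_. lborel))
     \<le> (\<integral>\<^sup>+x. (\<Prod>i\<in>I. ennreal (laguerre_weight a (x i) * (1 + x i) powr ?M)) \<partial>PiM I (\<lambda>_. lborel))"
  proof (intro nn_integral_mono)
    fix x :: "'a \<Rightarrow> real"
    have "laguerre_fun I g a x * (\<Prod>i\<in>I. (1 + x i) powr M) \<le>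
        (\<Prod>i\<in>I. laguerre_weight a (x i) * (1 + x i) powr (2 * g * card I)) * (\<Prod>i\<in>I. (1 + x i) powr M)"
      by (intro mult_right_mono laguerre_fun_le assms prod_nonneg) auto
    also have "\<dots> = (\<Prod>i\<in>I. laguerre_weight a (x i) * (1 + x i) powr ?M)"
      by (simp add: prod.distrib powr_add mult.commute)
    finally show "ennreal (laguerre_fun I g a x * (\<Prod>i\<in>I. (1 + x i) powr M)) \<le>
        (\<Prod>i\<in>I. ennreal (laguerre_weight a (x i) * (1 + x i) powr ?M))"
      by (subst prod_ennreal) (auto intro!: ennreal_leI)
  qed
  also have "\<dots> = (\<Prod>i\<in>I. \<integral>\<^sup>+t. ennreal (laguerre_weight a t * (1 + t) powr ?M) \<partial>lborel)"
    using assms by (intro lebesgue_product.product_nn_integral_prod) auto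
  also have "\<dots> < \<infinity>"
    using nn_integral_laguerre_weight_powr[OF assms(3), of ?M]
    by (simp add: less_top[symmetric] power_eq_top_ennreal)
  finally show ?thesis .
qed

text \<open>Near y the singularity has exponent 2 * g - 1 > -1, and the extra factor t raises the
  exponent of the weight to a > 0, so that the rest of the integrand is bounded by B. At distance
  more than 1 from y, the exponent may be raised to 2 * g and the difference decoupled. The
  dependence on y is a mere power, which the weights of the other coordinates absorb.\<close>

lemma laguerre_weight_singular_integral:
  assumes "0 < a" "0 < g"
  shows "\<exists>C. \<forall>y>0. (\<integral>\<^sup>+t. ennreal (t * \<bar>t - y\<bar> powr (2 * g - 1) * laguerre_weight a t
      * (1 + t) powr M) \<partial>lborel)
     \<le> ennreal C * ennreal ((1 + y) powr (2 * g))"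
proof -
  obtain B where B: "0 < B" "\<And>t. 0 \<le> t \<Longrightarrow> (1 + t) powr (a + \<bar>M\<bar>) \<le> B * exp (1/2 * t)"
    using one_plus_powr_le_exp[of "1/2" "a + \<bar>M\<bar>"] by auto
  define D where "D = enn2real (\<integral>\<^sup>+t. ennreal (laguerre_weight (a + 1) t * (1 + t) powr (M + 2 * g)) \<partial>lborel)"
  have D: "(\<integral>\<^sup>+t. ennreal (laguerre_weight (a + 1) t * (1 + t) powr (M + 2 * g)) \<partial>lborel) = ennreal D" "0 \<le> D"
    unfolding D_def using nn_integral_laguerre_weight_powr[of "a + 1" "M + 2 * g"] assms by auto
  have bound: "t * laguerre_weight a t * (1 + t) powr M \<le> B" for t
  proof (cases "0 < t")
    case True
    have "t * laguerre_weight a t * (1 + t) powr M = t powr a * (1 + t) powr M * exp (- t / 2)"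
      using True by (simp add: laguerre_weight_def powr_diff)
    also have "\<dots> \<le> (1 + t) powr a * (1 + t) powr \<bar>M\<bar> * exp (- t / 2)"
      using True assms by (intro mult_right_mono mult_mono powr_mono2 powr_mono) auto
    also have "\<dots> = (1 + t) powr (a + \<bar>M\<bar>) * exp (- t / 2)"
      by (simp add: powr_add)
    also have "\<dots> \<le> B * exp (1/2 * t) * exp (- t / 2)"
      using B(2)[of t] True by (intro mult_right_mono) auto
    also have "\<dots> = B" by (simp add: mult.assoc flip: exp_add)
    finally show ?thesis .
  qed (use B in \<open>auto simp: laguerre_weight_def\<close>)
  have "(\<integral>\<^sup>+t. ennreal (t * \<bar>t - y\<bar> powr (2 * g - 1) * laguerre_weight a t * (1 + t) powr M) \<partial>lborel)
     \<le> ennreal (B / g + D) * ennreal ((1 + y) powr (2 * g))" if y: "0 < y" for y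
  proof -
    have "(\<integral>\<^sup>+t. ennreal (t * \<bar>t - y\<bar> powr (2 * g - 1) * laguerre_weight a t * (1 + t) powr M) \<partial>lborel) \<le>
      (\<integral>\<^sup>+t. ennreal B * ennreal (\<bar>t - y\<bar> powr (2 * g - 1) * of_bool (\<bar>t - y\<bar> \<le> 1)) +
        ennreal ((1 + y) powr (2 * g)) * ennreal (laguerre_weight (a + 1) t
            * (1 + t) powr (M + 2 * g)) \<partial>lborel)"
    proof (intro nn_integral_mono)
      fix t :: real
      let ?h = "t * laguerre_weight a t * (1 + t) powr M"
      have h0: "0 \<le> ?h" by (auto simp: laguerre_weight_def)
      have "?h * \<bar>t - y\<bar> powr (2 * g - 1) \<le> B * (\<bar>t - y\<bar> powr (2 * g - 1) * of_bool (\<bar>t - y\<bar> \<le> 1)) +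
         (1 + y) powr (2 * g) * (laguerre_weight (a + 1) t * (1 + t) powr (M + 2 * g))"
      proof (cases "0 < t")
        case False
        then show ?thesis using B by (auto simp: laguerre_weight_def)
      next
        case t: True
        have hw: "?h = laguerre_weight (a + 1) t * (1 + t) powr M"
          using t by (simp add: laguerre_weight_def powr_diff)
        show ?thesis
        proof (cases "\<bar>t - y\<bar> \<le> 1")
          case True
          have "?h * \<bar>t - y\<bar> powr (2 * g - 1) \<le> B * \<bar>t - y\<bar> powr (2 * g - 1)"
            by (intro mult_right_mono bound) auto
          moreover have "0 \<le> (1 + y) powr (2 * g) * (laguerre_weight (a + 1) t * (1 + t) powr (M + 2 * g))"
            by simp
          ultimately show ?thesis using True by (simp only: of_bool_eq mult_1_right simp_thms)
        next
          case False
          have "\<bar>t - y\<bar> powr (2 * g - 1) \<le> \<bar>t - y\<bar> powr (2 * g)"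
            using False by (intro powr_mono) auto
          also have "\<dots> \<le> (1 + t) powr (2 * g) * (1 + y) powr (2 * g)"
            using t y assms by (intro abs_diff_powr_le_one_plus) auto
          finally have "?h * \<bar>t - y\<bar> powr (2 * g - 1) \<le> ?h * ((1 + t) powr (2 * g) * (1 + y) powr (2 * g))"
            using h0 by (intro mult_left_mono)
          also have "\<dots> = (1 + y) powr (2 * g) * (laguerre_weight (a + 1) t * (1 + t) powr (M + 2 * g))"
            unfolding hw by (simp add: powr_add)
          finally show ?thesis using False B by simp
        qed
      qed
      then have "ennreal (t * \<bar>t - y\<bar> powr (2 * g - 1) * laguerre_weight a t * (1 + t) powr M) \<le>
        ennreal (B * (\<bar>t - y\<bar> powr (2 * g - 1) * of_bool (\<bar>t - y\<bar> \<le> 1)) +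
         (1 + y) powr (2 * g) * (laguerre_weight (a + 1) t * (1 + t) powr (M + 2 * g)))"
        by (intro ennreal_leI) (simp add: ac_simps)
      also have "\<dots> = ennreal B * ennreal (\<bar>t - y\<bar> powr (2 * g - 1) * of_bool (\<bar>t - y\<bar> \<le> 1)) +
        ennreal ((1 + y) powr (2 * g)) * ennreal (laguerre_weight (a + 1) t * (1 + t) powr (M + 2 * g))"
        using B by (subst ennreal_plus) (auto simp: ennreal_mult)
      finally show "ennreal (t * \<bar>t - y\<bar> powr (2 * g - 1) * laguerre_weight a t * (1 + t) powr M) \<le> \<dots>" .
    qed
    also have "\<dots> = ennreal B * (\<integral>\<^sup>+t. ennreal (\<bar>t - y\<bar> powr (2 * g - 1) * of_bool (\<bar>t - y\<bar> \<le> 1)) \<partial>lborel) +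
        ennreal ((1 + y) powr (2 * g)) * ennreal D"
      unfolding D(1)[symmetric] by (simp add: nn_integral_add nn_integral_cmult)
    also have "\<dots> \<le> ennreal B * ennreal (2 / (2 * g - 1 + 1)) * ennreal ((1 + y) powr (2 * g))
        + ennreal ((1 + y) powr (2 * g)) * ennreal D"
    proof (intro add_mono order_refl)
      have "1 \<le> ennreal ((1 + y) powr (2 * g))"
        using y assms by (simp add: ge_one_powr_ge_zero)
      then have "ennreal B * (\<integral>\<^sup>+t. ennreal (\<bar>t - y\<bar> powr (2 * g - 1) * of_bool (\<bar>t - y\<bar> \<le> 1)) \<partial>lborel) * 1
        \<le> ennreal B * ennreal (2 / (2 * g - 1 + 1)) * ennreal ((1 + y) powr (2 * g))"
        using assms by (intro mult_mono mult_left_mono nn_integral_abs_powr_unit) auto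
      then show "ennreal B * (\<integral>\<^sup>+t. ennreal (\<bar>t - y\<bar> powr (2 * g - 1) * of_bool (\<bar>t - y\<bar> \<le> 1)) \<partial>lborel)
        \<le> ennreal B * ennreal (2 / (2 * g - 1 + 1)) * ennreal ((1 + y) powr (2 * g))" by simp
    qed
    also have "\<dots> = ennreal (B / g + D) * ennreal ((1 + y) powr (2 * g))"
      using B D assms by (simp add: ennreal_mult[symmetric] ennreal_plus[symmetric]
          algebra_simps del: ennreal_plus)
    finally show ?thesis .
  qed
  then show ?thesis by blast
qed

text \<open>Aomoto's identity is split into one integral for each j, and each of them must exist by
  itself. The quotient is absorbed by the factor |x k - x j| powr (2 * g) of the Vandermonde
  product, which leaves an integrable singularity; all other factors are decoupled.\<close>

lemma integrable_laguerre_fun_singular: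
  fixes J :: "'i set"
  assumes J: "finite J" "k \<notin> J" "j \<in> J" and K: "K \<subseteq> J" and a: "0 < a" and g: "0 < g"
  shows "integrable (PiM (insert k J) (\<lambda>_. lborel))
    (\<lambda>x. (\<Prod>i\<in>K. x i) * (x k / (x k - x j)) * laguerre_fun (insert k J) g a x)"
proof -
  let ?P = "PiM (insert k J) (\<lambda>_. lborel :: real measure)"
  let ?N = "real (card J)"
  let ?F = "\<lambda>x. (\<Prod>i\<in>K. x i) * (x k / (x k - x j)) * laguerre_fun (insert k J) g a x"
  have fK: "finite K" using J K finite_subset by auto
  have [measurable]: "(\<lambda>x. x i) \<in> borel_measurable ?P" if "i \<in> insert k J" for i
    using measurable_component_singleton[of i "insert k J" "\<lambda>_. lborel"] that by auto
  have F_meas [measurable]: "?F \<in> borel_measurable ?P"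
    using J K by (intro borel_measurable_times borel_measurable_prod borel_measurable_divide
        borel_measurable_diff) auto
  let ?S = "\<lambda>t y. t * \<bar>t - y\<bar> powr (2 * g - 1) * laguerre_weight a t * (1 + t) powr (2 * g * ?N)"
  let ?R = "\<lambda>x. laguerre_fun J g a x * (\<Prod>i\<in>J. (1 + x i) powr (2 * g + 1))"
  have bound: "\<bar>?F (x(k := t))\<bar> \<le> ?S t (x j) * ?R x" for x t
  proof (cases "0 < t \<and> (\<forall>i\<in>J. 0 < x i) \<and> t \<noteq> x j")
    case False
    have "?F (x(k := t)) = 0"
    proof (cases "t = x j")
      case True
      then show ?thesis using J by auto
    next
      case ne: False
      then have "laguerre_fun (insert k J) g a (x(k := t)) = 0"
      proof (intro laguerre_fun_eq_0 disjI1)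
        have "\<not> 0 < t \<or> (\<exists>i\<in>J. \<not> 0 < x i)" using False ne by auto
        then show "\<exists>i\<in>insert k J. (x(k := t)) i \<le> 0" 
        proof
          assume "\<exists>i\<in>J. \<not> 0 < x i"
          then obtain i where "i \<in> J" "x i \<le> 0" by (auto simp: not_less)
          then show ?thesis using J by (intro bexI[of _ i]) auto
        qed (auto simp: not_less)
      qed (use J in auto)
      then show ?thesis by simp
    qed
    moreover have "0 \<le> ?S t (x j) * ?R x"
      by (rule mult_nonneg_nonneg) (auto simp: laguerre_weight_def intro!: mult_nonneg_nonneg prod_nonneg)
    ultimately show ?thesis by (simp only: abs_zero)
  next
    case True
    then have t: "0 < t" and x: "\<And>i. i \<in> J \<Longrightarrow> 0 < x i" and ne: "t \<noteq> x j" by auto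
    have x1: "(\<Prod>i\<in>K. (x(k := t)) i) \<le> (\<Prod>i\<in>J. 1 + x i)"
    proof -
      have "(\<Prod>i\<in>K. (x(k := t)) i) = (\<Prod>i\<in>K. x i)" using K J by (intro prod.cong) auto
      also have "\<dots> \<le> (\<Prod>i\<in>K. 1 + x i)" using x K by (intro prod_mono) (auto simp: less_imp_le subset_eq)
      also have "\<dots> \<le> (\<Prod>i\<in>J. 1 + x i)"
        using x K J by (intro prod_mono2) (auto simp: less_imp_le subset_eq)
      finally show ?thesis .
    qed
    have "(\<Prod>i\<in>J. \<bar>t - x i\<bar> powr (2 * g)) = \<bar>t - x j\<bar> powr (2 * g) * (\<Prod>i\<in>J - {j}. \<bar>t - x i\<bar> powr (2 * g))"
      using J by (simp add: prod.remove)
    also have "\<dots> \<le> \<bar>t - x j\<bar> powr (2 * g) * (\<Prod>i\<in>J. (1 + t) powr (2 * g) * (1 + x i) powr (2 * g))"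
    proof (intro mult_left_mono)
      have "(\<Prod>i\<in>J - {j}. \<bar>t - x i\<bar> powr (2 * g)) \<le> (\<Prod>i\<in>J - {j}. (1 + t) powr (2 * g)
          * (1 + x i) powr (2 * g))"
        using t x g by (intro prod_mono conjI abs_diff_powr_le_one_plus) auto
      also have "\<dots> \<le> (\<Prod>i\<in>J. (1 + t) powr (2 * g) * (1 + x i) powr (2 * g))"
      proof (intro prod_mono2)
        fix i assume "i \<in> J - (J - {j})"
        then have "0 < x i" using x by auto
        then have "1 * 1 \<le> (1 + t) powr (2 * g) * (1 + x i) powr (2 * g)"
          using t g by (intro mult_mono ge_one_powr_ge_zero) auto
        then show "1 \<le> (1 + t) powr (2 * g) * (1 + x i) powr (2 * g)" by simp
      qed (use J in auto)
      finally show "(\<Prod>i\<in>J - {j}. \<bar>t - x i\<bar> powr (2 * g))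
          \<le> (\<Prod>i\<in>J. (1 + t) powr (2 * g) * (1 + x i) powr (2 * g))" .
    qed auto
    also have "(\<Prod>i\<in>J. (1 + t) powr (2 * g) * (1 + x i) powr (2 * g)) = 
        (1 + t) powr (2 * g * ?N) * (\<Prod>i\<in>J. (1 + x i) powr (2 * g))"
      unfolding prod.distrib using t J by (subst prod_powr_const) auto
    finally have x2: "(\<Prod>i\<in>J. \<bar>t - x i\<bar> powr (2 * g)) \<le> 
       \<bar>t - x j\<bar> powr (2 * g) * ((1 + t) powr (2 * g * ?N) * (\<Prod>i\<in>J. (1 + x i) powr (2 * g)))" .
    have "(\<Prod>i\<in>J. \<bar>(x(k := t)) k - (x(k := t)) i\<bar> powr (2 * g)) = (\<Prod>i\<in>J. \<bar>t - x i\<bar> powr (2 * g))"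
      using J by (intro prod.cong) auto
    moreover have "laguerre_fun J g a (x(k := t)) = laguerre_fun J g a x"
      using J by (intro laguerre_fun_cong) auto
    ultimately have F: "laguerre_fun (insert k J) g a (x(k := t)) =
        laguerre_weight a t * (\<Prod>i\<in>J. \<bar>t - x i\<bar> powr (2 * g)) * laguerre_fun J g a x"
      using J by (simp add: laguerre_fun_insert)
    have p0: "0 \<le> (\<Prod>i\<in>K. (x(k := t)) i)" using x K t by (intro prod_nonneg) (auto simp: less_imp_le subset_eq)
    have kj: "(x(k := t)) j = x j" using J by auto
    have "\<bar>?F (x(k := t))\<bar> = (\<Prod>i\<in>K. (x(k := t)) i) * (t / \<bar>t - x j\<bar>) *
       (laguerre_weight a t * (\<Prod>i\<in>J. \<bar>t - x i\<bar> powr (2 * g)) * laguerre_fun J g a x)"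
      unfolding F kj using p0 t prod_nonneg[of J "\<lambda>i. \<bar>t - x i\<bar> powr (2 * g)"] by (simp add: abs_mult)
    also have "\<dots> \<le> (\<Prod>i\<in>J. 1 + x i) * (t / \<bar>t - x j\<bar>) *
       (laguerre_weight a t * (\<bar>t - x j\<bar> powr (2 * g) * ((1 + t) powr (2 * g * ?N)
           * (\<Prod>i\<in>J. (1 + x i) powr (2 * g)))) * laguerre_fun J g a x)"
      using t x x1 x2 by (intro mult_mono mult_nonneg_nonneg prod_nonneg) (auto simp: less_imp_le
          add_nonneg_nonneg)
    also have "\<dots> = ?S t (x j) * ?R x"
    proof -
      have "(\<Prod>i\<in>J. (1 + x i) powr (2 * g + 1)) = (\<Prod>i\<in>J. (1 + x i) powr (2 * g)) * (\<Prod>i\<in>J. 1 + x i)"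
        unfolding prod.distrib[symmetric] using x by (intro prod.cong refl)
            (auto simp: powr_add add_pos_pos less_imp_le add_nonneg_nonneg)
      moreover have "\<bar>t - x j\<bar> powr (2 * g - 1) = \<bar>t - x j\<bar> powr (2 * g) / \<bar>t - x j\<bar>"
        using ne by (simp add: powr_diff)
      ultimately show ?thesis by simp
    qed
    finally show ?thesis .
  qed
  obtain C where C: "\<And>y. 0 < y \<Longrightarrow> (\<integral>\<^sup>+t. ennreal (?S t y) \<partial>lborel)
      \<le> ennreal C * ennreal ((1 + y) powr (2 * g))"
    using laguerre_weight_singular_integral[OF a g, of "2 * g * ?N"] by blast
  have R0: "0 \<le> ?R x" for x by (intro mult_nonneg_nonneg prod_nonneg) auto
  have S0: "0 \<le> ?S t y" for t y by (auto simp: laguerre_weight_def)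
  have "(\<integral>\<^sup>+x. ennreal \<bar>?F x\<bar> \<partial>?P) = (\<integral>\<^sup>+x. (\<integral>\<^sup>+t. ennreal \<bar>?F (x(k := t))\<bar> \<partial>lborel) \<partial>PiM J (\<lambda>_. lborel))"
  proof -
    have "(\<lambda>x. ennreal \<bar>?F x\<bar>) \<in> borel_measurable ?P" by measurable
    then show ?thesis by (rule lebesgue_product.product_nn_integral_insert[OF J(1,2)])
  qed
  also have "\<dots> \<le> (\<integral>\<^sup>+x. ennreal C * ennreal (laguerre_fun J g a x
      * (\<Prod>i\<in>J. (1 + x i) powr (4 * g + 1))) \<partial>PiM J (\<lambda>_. lborel))"
  proof (intro nn_integral_mono)
    fix x :: "'i \<Rightarrow> real"
    have "(\<integral>\<^sup>+t. ennreal \<bar>?F (x(k := t))\<bar> \<partial>lborel) \<le> (\<integral>\<^sup>+t. ennreal (?S t (x j)) * ennreal (?R x) \<partial>lborel)"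
      using bound S0 R0 by (intro nn_integral_mono) (auto simp: ennreal_mult[symmetric] intro!: ennreal_leI)
    also have "\<dots> = (\<integral>\<^sup>+t. ennreal (?S t (x j)) \<partial>lborel) * ennreal (?R x)"
      by (intro nn_integral_multc) auto
    also have "\<dots> \<le> ennreal C * ennreal (laguerre_fun J g a x * (\<Prod>i\<in>J. (1 + x i) powr (4 * g + 1)))"
    proof (cases "\<forall>i\<in>J. 0 < x i")
      case False
      then have "laguerre_fun J g a x = 0" using J by (intro laguerre_fun_eq_0) (auto simp: not_less)
      then show ?thesis by simp
    next
      case True
      have "(\<integral>\<^sup>+t. ennreal (?S t (x j)) \<partial>lborel) * ennreal (?R x)
          \<le> (ennreal C * ennreal ((1 + x j) powr (2 * g))) * ennreal (?R x)"
        using True J by (intro mult_right_mono C) auto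
      also have "\<dots> = ennreal C * ennreal ((1 + x j) powr (2 * g) * ?R x)"
        using R0 by (simp add: ennreal_mult mult.assoc)
      also have "\<dots> \<le> ennreal C * ennreal (laguerre_fun J g a x * (\<Prod>i\<in>J. (1 + x i) powr (4 * g + 1)))"
      proof (intro mult_left_mono ennreal_leI)
        have "(1 + x j) powr (2 * g) \<le> (\<Prod>i\<in>J. (1 + x i) powr (2 * g))"
        proof -
          have "(\<Prod>i\<in>{j}. (1 + x i) powr (2 * g)) \<le> (\<Prod>i\<in>J. (1 + x i) powr (2 * g))"
            using J True g by (intro prod_mono2) (auto intro!: ge_one_powr_ge_zero simp: less_imp_le)
          then show ?thesis by simp
        qed
        then have "(1 + x j) powr (2 * g) * ?R x \<le> (\<Prod>i\<in>J. (1 + x i) powr (2 * g)) * ?R x"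
          using R0 by (intro mult_right_mono)
        also have "\<dots> = laguerre_fun J g a x * (\<Prod>i\<in>J. (1 + x i) powr (4 * g + 1))"
          by (simp add: mult.left_commute prod.distrib[symmetric] powr_add[symmetric] add.assoc[symmetric])
        finally show "(1 + x j) powr (2 * g) * ?R x \<le> \<dots>" .
      qed auto
      finally show ?thesis .
    qed
    finally show "(\<integral>\<^sup>+t. ennreal \<bar>?F (x(k := t))\<bar> \<partial>lborel) \<le> \<dots>" .
  qed
  also have "\<dots> < \<infinity>"
  proof -
    have [measurable]: "(\<lambda>x. x i) \<in> borel_measurable (PiM J (\<lambda>_. lborel :: real measure))" if "i \<in> J" for i
      using measurable_component_singleton[of i J "\<lambda>_. lborel"] that by auto
    have [measurable]: "(\<lambda>x. \<Prod>i\<in>J. (1 + x i) powr (4 * g + 1)) \<in> borel_measurable (PiM J (\<lambda>_. lborel))"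
      by (intro borel_measurable_prod) measurable
    show ?thesis
      using nn_integral_laguerre_fun_powr_finite[OF J(1), of g a "4 * g + 1"] a g
      by (subst nn_integral_cmult) (auto simp: ennreal_mult_less_top)
  qed
  finally show ?thesis by (intro integrableI_bounded F_meas) simp
qed

subsection \<open>Aomoto's recursion\<close>

text \<open>The derivative is written as a multiple of the function itself, so that products
  differentiate logarithmically and produce the quotients t / (t - y) of Aomoto's identity.\<close>

lemma has_real_derivative_abs_powr:
  fixes c y :: real
  assumes "t \<noteq> y"
  shows "((\<lambda>t. \<bar>t - y\<bar> powr c) has_real_derivative (c * \<bar>t - y\<bar> powr c / (t - y))) (at t)"
proof -
  have "((\<lambda>t. \<bar>t - y\<bar>) has_real_derivative sgn (t - y)) (at t)"
  proof -
    have d: "((\<lambda>u. sgn (t - y) * (u - y)) has_real_derivative sgn (t - y)) (at t)"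
      by (auto intro!: derivative_eq_intros)
    have "eventually (\<lambda>u. u \<noteq> y \<and> sgn (u - y) = sgn (t - y)) (nhds t)"
    proof (cases "y < t")
      case True
      then have "eventually (\<lambda>u. u \<in> {y<..}) (nhds t)" by (intro eventually_nhds_in_open) auto
      then show ?thesis by eventually_elim (use True in auto)
    next
      case False
      then have "t < y" using assms by simp
      then have "eventually (\<lambda>u. u \<in> {..<y}) (nhds t)" by (intro eventually_nhds_in_open) auto
      then show ?thesis by eventually_elim (use \<open>t < y\<close> in auto)
    qed
    then have ev: "eventually (\<lambda>u. \<bar>u - y\<bar> = sgn (t - y) * (u - y)) (nhds t)"
      by eventually_elim (auto simp: sgn_if abs_if split: if_splits)
    show ?thesis by (rule iffD2[OF DERIV_cong_ev[OF refl ev refl] d])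
  qed
  from DERIV_fun_powr[OF this, of c]
  have "((\<lambda>t. \<bar>t - y\<bar> powr c) has_real_derivative c * \<bar>t - y\<bar> powr (c - of_nat 1) * sgn (t - y)) (at t)"
    using assms by simp
  moreover have "c * \<bar>t - y\<bar> powr (c - of_nat 1) * sgn (t - y) = c * \<bar>t - y\<bar> powr c / (t - y)"
  proof -
    have *: "X / \<bar>d\<bar> * sgn d = X / d" if "d \<noteq> 0" for X d :: real
      using that by (cases "0 < d") (auto simp: sgn_if)
    show ?thesis using assms *[of "t - y" "c * \<bar>t - y\<bar> powr c"] by (simp add: powr_diff)
  qed
  ultimately show ?thesis by simp
qed

text \<open>The integrand is the derivative of \<open>?q\<close>, which vanishes at 0 because a > 0
  and tends to 0 at infinity because of the exponential. At the points y j only continuity of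
  \<open>?q\<close> is available, so these form the finite exceptional set in the fundamental
  theorem of calculus.\<close>

lemma laguerre_integral_by_parts:
  fixes y :: "'i \<Rightarrow> real"
  assumes J: "finite J" and a: "0 < a" and g: "0 < g"
    and int: "integrable lborel (\<lambda>t. (if 0 < t then (a - t / 2 + 2 * g * (\<Sum>j\<in>J. t / (t - y j))) else 0) *
       (laguerre_weight a t * (\<Prod>j\<in>J. \<bar>t - y j\<bar> powr (2 * g))))"
  shows "(\<integral>t. (if 0 < t then (a - t / 2 + 2 * g * (\<Sum>j\<in>J. t / (t - y j))) else 0) *
       (laguerre_weight a t * (\<Prod>j\<in>J. \<bar>t - y j\<bar> powr (2 * g))) \<partial>lborel) = 0"
proof -
  let ?f = "\<lambda>t. (if 0 < t then (a - t / 2 + 2 * g * (\<Sum>j\<in>J. t / (t - y j))) else 0) *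
       (laguerre_weight a t * (\<Prod>j\<in>J. \<bar>t - y j\<bar> powr (2 * g)))"
  let ?q = "\<lambda>t. t powr a * (exp (- t / 2) * (\<Prod>j\<in>J. \<bar>t - y j\<bar> powr (2 * g)))"
  have deriv: "(?q has_real_derivative ?f t) (at t)" if t: "0 < t" "t \<notin> y ` J" for t
  proof -
    have p: "((\<lambda>t. \<Prod>j\<in>J. \<bar>t - y j\<bar> powr (2 * g)) has_real_derivative
        (\<Prod>j\<in>J. \<bar>t - y j\<bar> powr (2 * g)) * (\<Sum>j\<in>J. (2 * g * \<bar>t - y j\<bar> powr (2 * g) / (t - y j)) / \<bar>t
            - y j\<bar> powr (2 * g))) (at t)"
      using t by (intro has_field_derivative_prod' has_real_derivative_abs_powr) auto
    have "(\<Sum>j\<in>J. (2 * g * \<bar>t - y j\<bar> powr (2 * g) / (t - y j)) / \<bar>t - y j\<bar> powr (2 * g))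
        = (\<Sum>j\<in>J. 2 * g / (t - y j))"
      using t by (intro sum.cong) auto
    also have "\<dots> = 2 * g * (\<Sum>j\<in>J. 1 / (t - y j))"
      by (simp add: sum_distrib_left)
    finally have p: "((\<lambda>t. \<Prod>j\<in>J. \<bar>t - y j\<bar> powr (2 * g)) has_real_derivative
        (\<Prod>j\<in>J. \<bar>t - y j\<bar> powr (2 * g)) * (2 * g * (\<Sum>j\<in>J. 1 / (t - y j)))) (at t)"
      using p by simp
    have q: "((\<lambda>t. t powr a) has_real_derivative a * t powr (a - 1)) (at t)"
      using t by (intro has_real_derivative_powr)
    have e: "((\<lambda>t. exp (- t / 2)) has_real_derivative - (exp (- t / 2) / 2)) (at t)"
      by (auto intro!: derivative_eq_intros)
    have "(?q has_real_derivative a * t powr (a - 1) * (exp (- t / 2) * (\<Prod>j\<in>J. \<bar>t - y j\<bar> powr (2 * g))) +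
       ((- (exp (- t / 2) / 2)) * (\<Prod>j\<in>J. \<bar>t - y j\<bar> powr (2 * g)) + (\<Prod>j\<in>J. \<bar>t - y j\<bar> powr (2 * g))
           * (2 * g * (\<Sum>j\<in>J. 1 / (t - y j))) * exp (- t / 2)) * t powr a) (at t)"
      by (rule DERIV_mult[OF q DERIV_mult[OF e p]])
    moreover have "a * t powr (a - 1) * (exp (- t / 2) * (\<Prod>j\<in>J. \<bar>t - y j\<bar> powr (2 * g))) +
       ((- (exp (- t / 2) / 2)) * (\<Prod>j\<in>J. \<bar>t - y j\<bar> powr (2 * g)) + (\<Prod>j\<in>J. \<bar>t - y j\<bar> powr (2 * g))
           * (2 * g * (\<Sum>j\<in>J. 1 / (t - y j))) * exp (- t / 2)) * t powr a = ?f t"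
    proof -
      have "t powr a = t * t powr (a - 1)" using t by (simp add: powr_diff)
      moreover have "(\<Sum>j\<in>J. t / (t - y j)) = t * (\<Sum>j\<in>J. 1 / (t - y j))"
        by (simp add: sum_distrib_left)
      ultimately show ?thesis
        using t by (simp add: laguerre_weight_def algebra_simps)
    qed
    ultimately show ?thesis by simp
  qed
  have cont: "continuous_on {0..T} ?q" for T
    using a g by (auto intro!: continuous_intros continuous_on_powr')
  have set_int: "set_integrable lborel A ?f" if "A \<in> sets lborel" for A
    using that int by (rule integrable_mult_indicator[where 'b = real, folded set_integrable_def]) 
  have "(LINT t:{0..T}|lborel. ?f t) = ?q T" if T: "0 \<le> T" for T
  proof -
    have "(?f has_integral (?q T - ?q 0)) {0..T}"
    proof (rule fundamental_theorem_of_calculus_interior_strong[of "y ` J"])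
      show "(?q has_vector_derivative ?f t) (at t)" if "t \<in> {0<..<T} - y ` J" for t
        using deriv[of t] that by (simp add: has_real_derivative_iff_has_vector_derivative)
    qed (use J T cont in auto)
    then have "integral {0..T} ?f = ?q T"
      using a by (simp add: integral_unique)
    then show ?thesis
      using set_borel_integral_eq_integral(2)[OF set_int[of "{0..T}"]] by simp
  qed
  moreover have "((\<lambda>T. LINT t:{0..T}|lborel. ?f t) \<longlongrightarrow> (LINT t:{0..}|lborel. ?f t)) at_top"
    by (intro tendsto_set_lebesgue_integral_at_top set_int) auto
  ultimately have lim: "(?q \<longlongrightarrow> (LINT t:{0..}|lborel. ?f t)) at_top"
    by (rule_tac Lim_transform_eventually) (auto intro: eventually_mono[OF eventually_ge_at_top[of 0]])
  define Y where "Y = (\<Prod>j\<in>J. (1 + \<bar>y j\<bar>) powr (2 * g))"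
  obtain C where C: "0 < C" "\<And>t. 0 \<le> t \<Longrightarrow> (1 + t) powr (a + 2 * g * card J) \<le> C * exp (1/4 * t)"
    using one_plus_powr_le_exp[of "1/4" "a + 2 * g * card J"] by auto
  have Y0: "0 \<le> Y" unfolding Y_def by (intro prod_nonneg) auto
  have "(?q \<longlongrightarrow> 0) at_top"
  proof (rule tendsto_sandwich[of "\<lambda>_. 0" ?q at_top "\<lambda>t. C * Y * exp (- t / 4)"])
    show "eventually (\<lambda>t. ?q t \<le> C * Y * exp (- t / 4)) at_top"
    proof (rule eventually_mono[OF eventually_gt_at_top[of 0]])
      fix t :: real assume t: "0 < t"
      have "(\<Prod>j\<in>J. \<bar>t - y j\<bar> powr (2 * g)) \<le> (\<Prod>j\<in>J. (1 + t) powr (2 * g) * (1 + \<bar>y j\<bar>) powr (2 * g))"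
      proof (intro prod_mono conjI)
        fix j
        have "\<bar>t - y j\<bar> \<le> t + \<bar>y j\<bar>" using t by linarith
        also have "\<dots> \<le> (1 + t) * (1 + \<bar>y j\<bar>)" using t by (simp add: algebra_simps)
        finally have "\<bar>t - y j\<bar> powr (2 * g) \<le> ((1 + t) * (1 + \<bar>y j\<bar>)) powr (2 * g)"
          using g by (intro powr_mono2) auto
        then show "\<bar>t - y j\<bar> powr (2 * g) \<le> (1 + t) powr (2 * g) * (1 + \<bar>y j\<bar>) powr (2 * g)"
          by (simp add: powr_mult)
      qed auto
      also have "\<dots> = (1 + t) powr (2 * g * card J) * Y"
        unfolding prod.distrib Y_def using t J by (subst prod_powr_const) auto
      finally have "?q t \<le> t powr a * (exp (- t / 2) * ((1 + t) powr (2 * g * card J) * Y))"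
        by (intro mult_left_mono) auto
      also have "\<dots> \<le> (1 + t) powr a * (exp (- t / 2) * ((1 + t) powr (2 * g * card J) * Y))"
        using t a Y0 by (intro mult_right_mono powr_mono2) auto
      also have "\<dots> = (1 + t) powr (a + 2 * g * card J) * exp (- t / 2) * Y"
        by (simp add: powr_add)
      also have "\<dots> \<le> C * exp (1/4 * t) * exp (- t / 2) * Y"
        using C(2)[of t] t Y0 by (intro mult_right_mono) auto
      also have "\<dots> = C * Y * exp (- t / 4)"
        by (simp add: exp_add[symmetric] mult.assoc mult.left_commute[of Y])
      finally show "?q t \<le> C * Y * exp (- t / 4)" .
    qed
    show "((\<lambda>t. C * Y * exp (- t / 4)) \<longlongrightarrow> 0) at_top"
      by real_asymp
  qed (auto intro!: always_eventually mult_nonneg_nonneg prod_nonneg simp del: mult_eq_0_iff)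
  with lim have "(LINT t:{0..}|lborel. ?f t) = 0"
    by (intro tendsto_unique[OF _ lim]) auto
  moreover have "(LINT t:{0..}|lborel. ?f t) = (\<integral>t. ?f t \<partial>lborel)"
    unfolding set_lebesgue_integral_def by (intro Bochner_Integration.integral_cong)
        (auto simp: indicator_def)
  ultimately show ?thesis by simp
qed

lemma integral_PiM_lborel_reindex:
  fixes F :: "('i \<Rightarrow> real) \<Rightarrow> real"
  assumes "finite I" "bij_betw \<pi> I J" "F \<in> borel_measurable (PiM I (\<lambda>_. lborel :: real measure))"
  shows "(\<integral>x. F (\<lambda>i\<in>I. x (\<pi> i)) \<partial>PiM J (\<lambda>_. lborel)) = (\<integral>x. F x \<partial>PiM I (\<lambda>_. lborel))"
  using assms integral_distr[OF measurable_PiM_lborel_reindex[of \<pi> I J], of F]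
  unfolding distr_PiM_lborel_reindex[OF assms(1,2)] by (auto simp: bij_betw_def)

lemma integrable_prod_laguerre_fun:
  fixes I :: "'i set"
  assumes I: "finite I" "K \<subseteq> I" and a: "0 < a" and g: "0 \<le> g"
  shows "integrable (PiM I (\<lambda>_. lborel)) (\<lambda>x. (\<Prod>i\<in>K. x i) * laguerre_fun I g a x)"
proof (rule integrableI_bounded)
  have [measurable]: "(\<lambda>x. x i) \<in> borel_measurable (PiM I (\<lambda>_. lborel :: real measure))" if "i \<in> I" for i
    using measurable_component_singleton[of i I "\<lambda>_. lborel"] that by auto
  show "(\<lambda>x. (\<Prod>i\<in>K. x i) * laguerre_fun I g a x) \<in> borel_measurable (PiM I (\<lambda>_. lborel))"
    using I by (intro borel_measurable_times borel_measurable_prod) auto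
  have "(\<integral>\<^sup>+x. ennreal (norm ((\<Prod>i\<in>K. x i) * laguerre_fun I g a x)) \<partial>PiM I (\<lambda>_. lborel)) \<le>
      (\<integral>\<^sup>+x. ennreal (laguerre_fun I g a x * (\<Prod>i\<in>I. (1 + x i) powr 1)) \<partial>PiM I (\<lambda>_. lborel))"
  proof (intro nn_integral_mono ennreal_leI)
    fix x :: "'i \<Rightarrow> real"
    show "norm ((\<Prod>i\<in>K. x i) * laguerre_fun I g a x) \<le> laguerre_fun I g a x * (\<Prod>i\<in>I. (1 + x i) powr 1)"
    proof (cases "\<forall>i\<in>I. 0 < x i")
      case False
      then have "laguerre_fun I g a x = 0" using I by (intro laguerre_fun_eq_0) (auto simp: not_less)
      then show ?thesis by simp
    next
      case True
      then have pos: "\<And>i. i \<in> I \<Longrightarrow> 0 \<le> x i" by (auto simp: less_imp_le)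
      have "\<bar>\<Prod>i\<in>K. x i\<bar> \<le> (\<Prod>i\<in>K. 1 + x i)" 
        unfolding abs_prod using pos I by (intro prod_mono) auto
      also have "\<dots> \<le> (\<Prod>i\<in>I. 1 + x i)"
        using pos I by (intro prod_mono2) auto
      also have "\<dots> = (\<Prod>i\<in>I. (1 + x i) powr 1)"
        using pos by (intro prod.cong) (auto simp: add_nonneg_nonneg)
      finally have "\<bar>\<Prod>i\<in>K. x i\<bar> * laguerre_fun I g a x \<le> (\<Prod>i\<in>I. (1 + x i) powr 1) * laguerre_fun I g a x"
        by (rule mult_right_mono) simp
      then show ?thesis by (simp only: real_norm_def abs_mult abs_of_nonneg[OF laguerre_fun_nonneg]
          mult.commute)
    qed
  qed
  also have "\<dots> < \<infinity>" using nn_integral_laguerre_fun_powr_finite[OF I(1) g a] .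
  finally show "(\<integral>\<^sup>+x. ennreal (norm ((\<Prod>i\<in>K. x i) * laguerre_fun I g a x)) \<partial>PiM I (\<lambda>_. lborel)) < \<infinity>" .
qed


text \<open>The derivative in x k of x k times the product over K - {k} times the weight integrates
  to 0. Its interaction terms with x k / (x k - x j) are found by exchanging k and j. For j in K -
  {k} the integrand is antisymmetric and contributes nothing. For j outside K the identity x k / (x
  k - x j) + x j / (x j - x k) = 1 gives one half of the integral without the quotient, and there
  are card I - card K such j.\<close>

theorem aomoto_recursion:
  fixes I :: "'i set"
  assumes I: "finite I" "k \<in> K" "K \<subseteq> I" and a: "0 < a" and g: "0 < g"
  shows "(\<integral>x. (\<Prod>i\<in>K. x i) * laguerre_fun I g a x \<partial>PiM I (\<lambda>_. lborel)) =
     2 * (a + g * (real (card I) - real (card K))) *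
       (\<integral>x. (\<Prod>i\<in>K - {k}. x i) * laguerre_fun I g a x \<partial>PiM I (\<lambda>_. lborel))"
proof -
  define J where "J = I - {k}"
  define L where "L = K - {k}"
  have J: "finite J" "k \<notin> J" "I = insert k J" using I by (auto simp: J_def)
  have L: "L \<subseteq> J" "k \<notin> L" "K = insert k L" "finite L"
    using I(2,3) finite_subset[OF I(3,1)] unfolding L_def J_def by auto
  let ?P = "PiM I (\<lambda>_. lborel :: real measure)"
  let ?\<Phi> = "laguerre_fun I g a"
  let ?A = "\<lambda>x. (\<Prod>i\<in>L. x i) * ?\<Phi> x"
  let ?B = "\<lambda>x. (\<Prod>i\<in>K. x i) * ?\<Phi> x"
  let ?T = "\<lambda>j x. (\<Prod>i\<in>L. x i) * (x k / (x k - x j)) * ?\<Phi> x"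
  have iA: "integrable ?P ?A" using integrable_prod_laguerre_fun[of I L a g] I L J a g by auto
  have iB: "integrable ?P ?B" using integrable_prod_laguerre_fun[of I K a g] I a g by auto
  have iT: "integrable ?P (?T j)" if "j \<in> J" for j
    using integrable_laguerre_fun_singular[of J k j L a g] that J L a g by simp
  let ?\<Psi> = "\<lambda>x. a * ?A x - (1/2) * ?B x + 2 * g * (\<Sum>j\<in>J. ?T j x)"
  have i\<Psi>: "integrable ?P ?\<Psi>" using iA iB iT by auto
  have zero: "(\<integral>t. ?\<Psi> (x(k := t)) \<partial>lborel) = 0" for x
  proof -
    let ?c = "(\<Prod>i\<in>L. x i) * laguerre_fun J g a x"
    let ?f = "\<lambda>t. (if 0 < t then (a - t / 2 + 2 * g * (\<Sum>j\<in>J. t / (t - x j))) else 0) *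
       (laguerre_weight a t * (\<Prod>j\<in>J. \<bar>t - x j\<bar> powr (2 * g)))"
    have eq: "?\<Psi> (x(k := t)) = ?c * ?f t" for t
    proof -
      have pL: "(\<Prod>i\<in>L. (x(k := t)) i) = (\<Prod>i\<in>L. x i)" using L by (intro prod.cong) auto
      have pK: "(\<Prod>i\<in>K. (x(k := t)) i) = t * (\<Prod>i\<in>L. x i)" using L pL by simp
      have "(\<Prod>i\<in>J. \<bar>(x(k := t)) k - (x(k := t)) i\<bar> powr (2 * g)) = (\<Prod>i\<in>J. \<bar>t - x i\<bar> powr (2 * g))"
        using J by (intro prod.cong) auto
      moreover have "laguerre_fun J g a (x(k := t)) = laguerre_fun J g a x"
        using J by (intro laguerre_fun_cong) auto
      ultimately have F: "?\<Phi> (x(k := t)) =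
          laguerre_weight a t * (\<Prod>i\<in>J. \<bar>t - x i\<bar> powr (2 * g)) * laguerre_fun J g a x"
        using J by (simp add: laguerre_fun_insert)
      have "(\<Sum>j\<in>J. ?T j (x(k := t))) = (\<Sum>j\<in>J. (\<Prod>i\<in>L. x i) * (t / (t - x j)) * ?\<Phi> (x(k := t)))"
        using J pL by (intro sum.cong refl) auto
      also have "\<dots> = (\<Prod>i\<in>L. x i) * (\<Sum>j\<in>J. t / (t - x j)) * ?\<Phi> (x(k := t))"
        by (simp add: sum_distrib_left sum_distrib_right)
      finally have S: "(\<Sum>j\<in>J. ?T j (x(k := t))) = (\<Prod>i\<in>L. x i) * (\<Sum>j\<in>J. t / (t - x j)) * ?\<Phi> (x(k := t))" .
      show ?thesis
      proof (cases "0 < t")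
        case True
        then show ?thesis unfolding S unfolding pL pK F by (simp add: algebra_simps)
      next
        case False
        then show ?thesis unfolding S unfolding pL pK F by (simp add: laguerre_weight_def)
      qed
    qed
    have "(\<integral>t. ?\<Psi> (x(k := t)) \<partial>lborel) = ?c * (\<integral>t. ?f t \<partial>lborel)"
      unfolding eq by simp
    \<comment> \<open>Integrability of the section is not checked: where it fails, the integral has
      the default value 0, so the equation holds for every x.\<close>
    also have "(\<integral>t. ?f t \<partial>lborel) = 0"
    proof (cases "integrable lborel ?f")
      case True
      then show ?thesis by (rule laguerre_integral_by_parts[OF J(1) a g])
    qed (rule not_integrable_integral_eq)
    also have "?c * 0 = 0" by simp
    finally show ?thesis .
  qed
  have "(\<integral>x. ?\<Psi> x \<partial>?P) = (\<integral>x. (\<integral>t. ?\<Psi> (x(k := t)) \<partial>lborel) \<partial>PiM J (\<lambda>_. lborel))"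
    using i\<Psi> unfolding J(3) by (intro lebesgue_product.product_integral_insert[OF J(1,2)]) auto
  also have "\<dots> = 0" unfolding zero by simp
  finally have tot0: "(\<integral>x. ?\<Psi> x \<partial>?P) = 0" .
  have tot: "a * integral\<^sup>L ?P ?A - (1/2) * integral\<^sup>L ?P ?B + 2 * g * (\<Sum>j\<in>J. integral\<^sup>L ?P (?T j)) = 0"
    using tot0 iA iB iT by (simp add: integral_sum')
  have swap: "integral\<^sup>L ?P (\<lambda>x. ?T j (\<lambda>l\<in>I. x (transposition k j l))) = integral\<^sup>L ?P (?T j)"
      if j: "j \<in> J" for j
    using integral_PiM_lborel_reindex[OF I(1) bij_betw_transposition[of k I j], of "?T j"] iT[OF j]
        J j by auto
  have \<Phi>swap: "?\<Phi> (\<lambda>l\<in>I. x (transposition k j l)) = ?\<Phi> x" if "j \<in> J" "x \<in> space ?P" for j x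
    using exchangeable_on_laguerre_fun[of I g a] that J unfolding exchangeable_on_def
        by (auto simp: space_PiM PiE_iff)
  have T_in: "integral\<^sup>L ?P (?T j) = 0" if j: "j \<in> L" for j
  proof -
    have jJ: "j \<in> J" using j L by auto
    have "integral\<^sup>L ?P (?T j) = integral\<^sup>L ?P (\<lambda>x. ?T j (\<lambda>l\<in>I. x (transposition k j l)))"
        using swap[OF jJ] by simp
    also have "\<dots> = integral\<^sup>L ?P (\<lambda>x. - ?T j x)"
    proof (rule Bochner_Integration.integral_cong[OF refl])
      fix x assume x: "x \<in> space ?P"
      have "(\<Prod>i\<in>L. (\<lambda>l\<in>I. x (transposition k j l)) i) = x k * (\<Prod>i\<in>L - {j}. x i)"
      proof -
        have "(\<Prod>i\<in>L. (\<lambda>l\<in>I. x (transposition k j l)) i)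
            = (\<lambda>l\<in>I. x (transposition k j l)) j * (\<Prod>i\<in>L - {j}. (\<lambda>l\<in>I. x (transposition k j l)) i)"
          using j L by (simp add: prod.remove)
        also have "(\<Prod>i\<in>L - {j}. (\<lambda>l\<in>I. x (transposition k j l)) i) = (\<Prod>i\<in>L - {j}. x i)"
          using L J by (intro prod.cong) auto
        also have "(\<lambda>l\<in>I. x (transposition k j l)) j = x k"
          using jJ J by auto
        finally show ?thesis .
      qed
      moreover have "(\<Prod>i\<in>L. x i) = x j * (\<Prod>i\<in>L - {j}. x i)" using j L by (simp add: prod.remove)
      moreover have "x j / (x j - x k) = - (x j / (x k - x j))" by (metis minus_divide_right minus_diff_eq)
      moreover have "(\<lambda>l\<in>I. x (transposition k j l)) k = x j" "(\<lambda>l\<in>I. x (transposition k j l)) j = x k"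
        using jJ J(2,3) by auto
      moreover note \<Phi>swap[OF jJ x]
      ultimately show "?T j (\<lambda>l\<in>I. x (transposition k j l)) = - ?T j x"
        by (simp only:) (simp add: ac_simps)
    qed
    also have "\<dots> = - integral\<^sup>L ?P (?T j)" by simp
    finally show ?thesis by simp
  qed
  have T_out: "integral\<^sup>L ?P (?T j) = integral\<^sup>L ?P ?A / 2" if j: "j \<in> J - L" for j
  proof -
    have jJ: "j \<in> J" using j by auto
    have "integrable ?P (\<lambda>x. ?T j (\<lambda>l\<in>I. x (transposition k j l)))"
    proof -
      have bij: "bij_betw (transposition k j) I I"
        using jJ J(3) by (intro bij_betw_transposition) auto
      then have m: "(\<lambda>x. \<lambda>l\<in>I. x (transposition k j l)) \<in> measurable ?P ?P"
        by (intro measurable_PiM_lborel_reindex) (simp only: bij_betw_imp_surj_on subset_refl)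
      have "integrable (distr ?P ?P (\<lambda>x. \<lambda>l\<in>I. x (transposition k j l))) (?T j)"
        unfolding distr_PiM_lborel_reindex[OF I(1) bij] by (rule iT[OF jJ])
      from integrable_distr[OF m this] show ?thesis .
    qed
    then have "integral\<^sup>L ?P (?T j) + integral\<^sup>L ?P (?T j)
        = integral\<^sup>L ?P (\<lambda>x. ?T j x + ?T j (\<lambda>l\<in>I. x (transposition k j l)))"
      using swap[OF jJ] iT[OF jJ] by (subst Bochner_Integration.integral_add) auto
    also have "\<dots> = integral\<^sup>L ?P ?A"
    proof (rule Bochner_Integration.integral_cong[OF refl])
      fix x assume x: "x \<in> space ?P"
      have pL: "(\<Prod>i\<in>L. (\<lambda>l\<in>I. x (transposition k j l)) i) = (\<Prod>i\<in>L. x i)"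
        using L J j by (intro prod.cong) auto
      have "?T j (\<lambda>l\<in>I. x (transposition k j l)) = (\<Prod>i\<in>L. x i) * (x j / (x j - x k)) * ?\<Phi> x"
      proof -
        have "(\<lambda>l\<in>I. x (transposition k j l)) k = x j" "(\<lambda>l\<in>I. x (transposition k j l)) j = x k"
          using jJ J(2,3) by auto
        then show ?thesis using \<Phi>swap[OF jJ x] pL by (simp only:)
      qed
      moreover have "x k / (x k - x j) + x j / (x j - x k) = 1" if "x j \<noteq> x k"
      proof -
        have "x j / (x j - x k) = - (x j / (x k - x j))" by (metis minus_divide_right minus_diff_eq)
        then show ?thesis using that by (simp add: diff_divide_distrib[symmetric])
      qed
      moreover have "?\<Phi> x = 0" if "x j = x k"
        using that jJ J by (intro laguerre_fun_eq_0) (auto simp: inj_on_def)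
      ultimately show "?T j x + ?T j (\<lambda>l\<in>I. x (transposition k j l)) = ?A x"
        by (metis (no_types, lifting) distrib_left distrib_right mult_1_right mult_zero_right add_0)
    qed
    finally show ?thesis by simp
  qed
  have "(\<Sum>j\<in>J. integral\<^sup>L ?P (?T j)) = (\<Sum>j\<in>J - L. integral\<^sup>L ?P (?T j)) + (\<Sum>j\<in>L. integral\<^sup>L ?P (?T j))"
    using sum.subset_diff[OF L(1) J(1)] by simp
  also have "\<dots> = real (card (J - L)) * (integral\<^sup>L ?P ?A / 2)"
  proof -
    have "(\<Sum>j\<in>J - L. integral\<^sup>L ?P (?T j)) = (\<Sum>j\<in>J - L. integral\<^sup>L ?P ?A / 2)"
      by (rule sum.cong[OF refl T_out])
    moreover have "(\<Sum>j\<in>L. integral\<^sup>L ?P (?T j)) = (\<Sum>j\<in>L. 0)"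
      by (rule sum.cong[OF refl T_in])
    ultimately show ?thesis by (simp only: sum_constant sum.neutral_const add_0_right)
  qed
  also have "real (card (J - L)) = real (card I) - real (card K)"
    using J L by (simp add: card_Diff_subset card_mono of_nat_diff)
  finally have S: "(\<Sum>j\<in>J. integral\<^sup>L ?P (?T j)) = (real (card I) - real (card K)) * (integral\<^sup>L ?P ?A / 2)" .
  have "a * integral\<^sup>L ?P ?A - (1/2) * integral\<^sup>L ?P ?B + 2 * g * ((real (card I) - real (card K))
      * (integral\<^sup>L ?P ?A / 2)) = 0"
    using tot unfolding S .
  moreover have "B = 2 * (a + g * d) * A" if "a * A - (1/2) * B + 2 * g * (d * (A / 2)) = 0" for A B d :: real
    using that by (simp add: algebra_simps)
  ultimately show ?thesis unfolding L_def by blast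
qed

subsection \<open>Normalisation up to a constant\<close>

definition laguerre_integral :: "'i set \<Rightarrow> real \<Rightarrow> real \<Rightarrow> real" where
  "laguerre_integral I g a = (\<integral>x. laguerre_fun I g a x \<partial>PiM I (\<lambda>_. lborel))"

lemma integrable_laguerre_fun:
  "finite I \<Longrightarrow> 0 < a \<Longrightarrow> 0 \<le> g \<Longrightarrow> integrable (PiM I (\<lambda>_. lborel)) (laguerre_fun I g a)"
  using integrable_prod_laguerre_fun[of I "{}" a g] by simp

lemma nn_integral_laguerre_fun:
  "finite I \<Longrightarrow> 0 < a \<Longrightarrow> 0 \<le> g \<Longrightarrow>
    (\<integral>\<^sup>+x. ennreal (laguerre_fun I g a x) \<partial>PiM I (\<lambda>_. lborel)) = ennreal (laguerre_integral I g a)"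
  unfolding laguerre_integral_def
  by (intro nn_integral_eq_integral integrable_laguerre_fun) auto

lemma laguerre_integral_pos:
  fixes I :: "'i set"
  assumes "finite I" "0 < a" "0 \<le> g"
  shows "0 < laguerre_integral I g a"
proof -
  obtain f :: "'i \<Rightarrow> nat" where f: "inj_on f I"
    using finite_imp_inj_to_nat_seg[OF assms(1)] by auto
  \<comment> \<open>Pairwise disjoint intervals of length 1, spaced by the injection f, give a box
    of measure 1 whose points have distinct positive coordinates.\<close>
  let ?B = "Pi\<^sub>E I (\<lambda>i. {real (f i) + 1<..<real (f i) + 2})"
  have B: "?B \<in> sets (PiM I (\<lambda>_. lborel))" using assms by (intro sets_PiM_I_finite) auto
  have eB: "emeasure (PiM I (\<lambda>_. lborel)) ?B = 1"
    using assms by (subst lebesgue_product.emeasure_PiM) auto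
  have pos: "0 < laguerre_fun I g a x" if x: "x \<in> ?B" for x
  proof (rule laguerre_fun_pos[OF assms(1)])
    show "0 < x i" if "i \<in> I" for i using PiE_mem[OF x that] by auto
    show "inj_on x I"
    proof (rule inj_onI)
      fix i j assume ij: "i \<in> I" "j \<in> I" "x i = x j"
      then have "\<bar>real (f i) - real (f j)\<bar> < 1" using PiE_mem[OF x ij(1)] PiE_mem[OF x ij(2)] by auto
      then have "f i = f j" by linarith
      then show "i = j" using f ij by (auto simp: inj_on_def)
    qed
  qed
  have "laguerre_integral I g a \<noteq> 0"
  proof
    assume "laguerre_integral I g a = 0"
    then have "AE x in PiM I (\<lambda>_. lborel). laguerre_fun I g a x = 0"
      unfolding laguerre_integral_def using assms
      by (subst (asm) integral_nonneg_eq_0_iff_AE) (auto intro: integrable_laguerre_fun)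
    then have "AE x in PiM I (\<lambda>_. lborel). x \<notin> ?B"
      by eventually_elim (use pos in fastforce)
    then have "emeasure (PiM I (\<lambda>_. lborel)) ?B = 0"
      using B by (subst (asm) AE_iff_measurable[OF B]) (auto dest: sets.sets_into_space)
    then show False using eB by simp
  qed
  moreover have "0 \<le> laguerre_integral I g a" unfolding laguerre_integral_def by simp
  ultimately show ?thesis by simp
qed

lemma laguerre_fun_add:
  assumes "finite I"
  shows "laguerre_fun I g (a + s) x = (\<Prod>i\<in>I. x i) powr s * laguerre_fun I g a x"
proof (cases "\<forall>i\<in>I. 0 < x i")
  case False
  then have "\<exists>i\<in>I. x i \<le> 0" by (auto simp: not_less)
  then show ?thesis using assms laguerre_fun_eq_0[of I x g] by simp
next
  case True
  have "(\<Prod>i\<in>I. laguerre_weight (a + s) (x i)) = (\<Prod>i\<in>I. x i powr s * laguerre_weight a (x i))"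
  proof (rule prod.cong[OF refl])
    fix i assume "i \<in> I"
    have "x i powr (a + s - 1) = x i powr s * x i powr (a - 1)" by (simp flip: powr_add add: algebra_simps)
    then show "laguerre_weight (a + s) (x i) = x i powr s * laguerre_weight a (x i)"
      using True \<open>i \<in> I\<close> by (simp add: laguerre_weight_def)
  qed
  also have "\<dots> = (\<Prod>i\<in>I. x i) powr s * (\<Prod>i\<in>I. laguerre_weight a (x i))"
    using True by (simp add: prod.distrib prod_powr_distrib less_imp_le)
  finally show ?thesis by (simp add: laguerre_fun_def)
qed

lemma laguerre_fun_add_1:
  assumes "finite I"
  shows "laguerre_fun I g (a + 1) x = (\<Prod>i\<in>I. x i) * laguerre_fun I g a x"
proof (cases "\<forall>i\<in>I. 0 < x i")
  case False
  then have "\<exists>i\<in>I. x i \<le> 0" by (auto simp: not_less)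
  then show ?thesis using assms laguerre_fun_eq_0[of I x g] by simp
next
  case True
  then have "0 \<le> (\<Prod>i\<in>I. x i)" by (intro prod_nonneg) (auto simp: less_imp_le)
  then show ?thesis using laguerre_fun_add[OF assms, of g a 1 x] by simp
qed

text \<open>The elements of K are removed one by one, which is why the recursion is stated for every
  K inside I. For K = I the product of the coordinates raises a to a + 1.\<close>

lemma laguerre_moment:
  fixes I :: "'i set"
  assumes I: "finite I" "K \<subseteq> I" and a: "0 < a" and g: "0 < g"
  shows "(\<integral>x. (\<Prod>i\<in>K. x i) * laguerre_fun I g a x \<partial>PiM I (\<lambda>_. lborel)) =
     (\<Prod>m=1..card K. 2 * (a + g * (real (card I) - real m))) * laguerre_integral I g a"
proof -
  have "finite K" using I finite_subset by auto
  then show ?thesis using I(2)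
  proof (induction K)
    case empty
    then show ?case by (simp add: laguerre_integral_def)
  next
    case (insert k K)
    then have "(\<integral>x. (\<Prod>i\<in>insert k K. x i) * laguerre_fun I g a x \<partial>PiM I (\<lambda>_. lborel)) =
      2 * (a + g * (real (card I) - real (card (insert k K)))) *
       (\<integral>x. (\<Prod>i\<in>insert k K - {k}. x i) * laguerre_fun I g a x \<partial>PiM I (\<lambda>_. lborel))"
      using a g by (intro aomoto_recursion I) auto
    also have "insert k K - {k} = K" using insert by auto
    also have "(\<integral>x. (\<Prod>i\<in>K. x i) * laguerre_fun I g a x \<partial>PiM I (\<lambda>_. lborel)) = 
       (\<Prod>m=1..card K. 2 * (a + g * (real (card I) - real m))) * laguerre_integral I g a"
      using insert by auto
    finally show ?case using insert by (simp add: mult_ac)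
  qed
qed

lemma laguerre_integral_add_1:
  assumes I: "finite I" and a: "0 < a" and g: "0 < g"
  shows "laguerre_integral I g (a + 1) = (\<Prod>j<card I. 2 * (a + g * real j)) * laguerre_integral I g a"
proof -
  have "laguerre_integral I g (a + 1) = (\<Prod>m=1..card I. 2 * (a + g * (real (card I) - real m)))
      * laguerre_integral I g a"
    using laguerre_moment[OF I order_refl a g] I by (simp add: laguerre_integral_def laguerre_fun_add_1)
  also have "(\<Prod>m=1..card I. 2 * (a + g * (real (card I) - real m))) = (\<Prod>j<card I. 2 * (a + g * real j))"
    by (rule prod.reindex_bij_witness[where i = "\<lambda>j. card I - j" and j = "\<lambda>m. card I - m"])
       (auto simp: of_nat_diff)
  finally show ?thesis .
qed

section \<open>Log-convexity in the exponent and the Bohr-Mollerup argument\<close>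

lemma powr_le_tangent:
  fixes P c s :: real
  assumes "0 \<le> P" "0 < c" "0 \<le> s" "s \<le> 1"
  shows "P powr s \<le> c powr s * (1 + s * (P / c - 1))"
proof (cases "P = 0")
  case False
  then have P: "0 < P" using assms by simp
  have "exp ((1 - s) *\<^sub>R 0 + s *\<^sub>R ln (P / c)) \<le> (1 - s) * exp 0 + s * exp (ln (P / c))"
    using assms by (intro convex_onD[OF exp_convex]) auto
  then have "(P / c) powr s \<le> 1 + s * (P / c - 1)"
    using P assms by (simp add: powr_def algebra_simps)
  then have "c powr s * (P / c) powr s \<le> c powr s * (1 + s * (P / c - 1))"
    by (intro mult_left_mono) auto
  then show ?thesis using P assms by (simp add: powr_divide)
qed (use assms in auto)

text \<open>Log-convexity of the integral in a. The power s of the product of the coordinates is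
  bounded by a chord in s; choosing c as the quotient of the integrals at a + 1 and a makes the
  linear correction integrate to 0.\<close>

lemma laguerre_integral_add_le:
  assumes I: "finite I" and a: "0 < a" and g: "0 < g" and s: "0 \<le> s" "s \<le> 1"
  shows "laguerre_integral I g (a + s) \<le> (\<Prod>j<card I. 2 * (a + g * real j)) powr s * laguerre_integral I g a"
proof -
  define c where "c = (\<Prod>j<card I. 2 * (a + g * real j))"
  have c: "0 < c" unfolding c_def using a g by (intro prod_pos) (auto intro!: add_pos_nonneg)
  let ?P = "PiM I (\<lambda>_. lborel :: real measure)"
  note int = integrable_laguerre_fun[OF I _ less_imp_le[OF g]]
  have "laguerre_integral I g (a + s) \<le>
      (\<integral>x. c powr s * ((1 - s) * laguerre_fun I g a x + (s / c) * laguerre_fun I g (a + 1) x) \<partial>?P)"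
    unfolding laguerre_integral_def
  proof (rule integral_mono)
    fix x
    show "laguerre_fun I g (a + s) x \<le> c powr s * ((1 - s) * laguerre_fun I g a x + (s / c)
        * laguerre_fun I g (a + 1) x)"
    proof (cases "\<forall>i\<in>I. 0 < x i")
      case False
      then have "\<exists>i\<in>I. x i \<le> 0" by (auto simp: not_less)
      then show ?thesis using I laguerre_fun_eq_0[of I x g] by simp
    next
      case True
      then have "0 \<le> (\<Prod>i\<in>I. x i)" by (intro prod_nonneg) (auto simp: less_imp_le)
      then have "(\<Prod>i\<in>I. x i) powr s \<le> c powr s * (1 + s * ((\<Prod>i\<in>I. x i) / c - 1))"
        using c s by (intro powr_le_tangent) auto
      then have "(\<Prod>i\<in>I. x i) powr s * laguerre_fun I g a x
          \<le> c powr s * (1 + s * ((\<Prod>i\<in>I. x i) / c - 1)) * laguerre_fun I g a x"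
        by (intro mult_right_mono) auto
      also have "\<dots> = c powr s * ((1 - s) * laguerre_fun I g a x + (s / c) * laguerre_fun I g (a + 1) x)"
        unfolding laguerre_fun_add_1[OF I] by (simp add: algebra_simps)
      finally show ?thesis unfolding laguerre_fun_add[OF I] .
    qed
  qed (use a s in \<open>auto intro!: int Bochner_Integration.integrable_add integrable_mult_right\<close>)
  also have "\<dots> = c powr s * ((1 - s) * laguerre_integral I g a + (s / c) * laguerre_integral I g (a + 1))"
    using a int by (simp add: laguerre_integral_def)
  also have "\<dots> = c powr s * laguerre_integral I g a"
    using c unfolding laguerre_integral_add_1[OF I a g] c_def[symmetric] by (simp add: algebra_simps)
  finally show ?thesis by (simp add: c_def)
qed

lemma Gamma_add_le:
  fixes z t :: real
  assumes z: "0 < z" and t: "0 \<le> t" "t \<le> 1"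
  shows "Gamma (z + t) \<le> Gamma z * z powr t"
proof -
  have "(ln \<circ> Gamma) ((1 - t) *\<^sub>R z + t *\<^sub>R (z + 1)) \<le> (1 - t) * (ln \<circ> Gamma) z + t * (ln \<circ> Gamma) (z + 1)"
    using z t by (intro convex_onD[OF log_convex_Gamma_real]) auto
  also have "(1 - t) *\<^sub>R z + t *\<^sub>R (z + 1) = z + t" by (simp add: algebra_simps)
  also have "(ln \<circ> Gamma) (z + 1) = ln z + ln (Gamma z)"
  proof -
    have "Gamma (z + 1) = z * Gamma z" using z by (intro Gamma_plus1) (auto elim!: nonpos_Ints_cases)
    moreover have "Gamma z \<noteq> 0" using Gamma_real_pos[OF z] by linarith
    ultimately show ?thesis using z by (simp add: ln_mult)
  qed
  finally have "ln (Gamma (z + t)) \<le> ln (Gamma z) + t * ln z"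
    by (simp add: algebra_simps)
  also have "\<dots> = ln (Gamma z * z powr t)"
  proof -
    have "Gamma z \<noteq> 0" using Gamma_real_pos[OF z] by linarith
    then show ?thesis using z by (simp add: ln_mult ln_powr)
  qed
  finally show ?thesis
    using z t Gamma_real_pos[of z] Gamma_real_pos[of "z + t"] by simp
qed

text \<open>The dependence on a of the Selberg-Laguerre integral, without the factor that depends
  only on n and g.\<close>

definition laguerre_gamma :: "nat \<Rightarrow> real \<Rightarrow> real \<Rightarrow> real" where
  "laguerre_gamma n g a = (\<Prod>j<n. 2 powr (a + g * real j) * Gamma (a + g * real j))"

lemma laguerre_gamma_pos: "0 < a \<Longrightarrow> 0 \<le> g \<Longrightarrow> 0 < laguerre_gamma n g a"
  unfolding laguerre_gamma_def by (intro prod_pos) (auto intro!: mult_pos_pos Gamma_real_pos add_pos_nonneg)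

lemma laguerre_gamma_add_1:
  assumes "0 < a" "0 \<le> g"
  shows "laguerre_gamma n g (a + 1) = (\<Prod>j<n. 2 * (a + g * real j)) * laguerre_gamma n g a"
  unfolding laguerre_gamma_def prod.distrib[symmetric]
proof (rule prod.cong[OF refl])
  fix j
  have "0 < a + g * real j" using assms by (intro add_pos_nonneg) auto
  then have "Gamma ((a + g * real j) + 1) = (a + g * real j) * Gamma (a + g * real j)"
    by (intro Gamma_plus1) (auto elim!: nonpos_Ints_cases)
  moreover have "a + 1 + g * real j = (a + g * real j) + 1" by simp
  ultimately show "2 powr (a + 1 + g * real j) * Gamma (a + 1 + g * real j) =
      2 * (a + g * real j) * (2 powr (a + g * real j) * Gamma (a + g * real j))"
    by (simp only:) (simp add: powr_add)
qed

text \<open>The numerator is bounded by log-convexity of the integral, the denominator by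
  log-convexity of Gamma. Each j costs a mismatch of at most 1 + 1 / (a + g j), which disappears for
  large a.\<close>

lemma laguerre_ratio_le:
  assumes I: "finite I" and a: "0 < a" and g: "0 < g" and s: "0 \<le> s" "s \<le> 1"
  shows "laguerre_integral I g (a + s) / laguerre_gamma (card I) g (a + s) \<le>
     laguerre_integral I g a / laguerre_gamma (card I) g a * (\<Prod>j<card I. 1 + 1 / (a + g * real j))"
proof -
  let ?n = "card I"
  have b: "0 < a + g * real j" for j using a g by (intro add_pos_nonneg) auto
  have "(\<Prod>j<?n. 2 * (a + g * real j)) powr s * laguerre_gamma ?n g a =
      (\<Prod>j<?n. (2 * (a + g * real j)) powr s * (2 powr (a + g * real j) * Gamma (a + g * real j)))"
  proof -
    have "(\<Prod>j<?n. 2 * (a + g * real j)) powr s = (\<Prod>j<?n. (2 * (a + g * real j)) powr s)"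
      by (rule prod_powr_distrib)
    then show ?thesis unfolding laguerre_gamma_def prod.distrib by (simp only:)
  qed
  also have "\<dots> \<le> (\<Prod>j<?n. (1 + 1 / (a + g * real j)) * (2 powr (a + s + g * real j)
      * Gamma (a + s + g * real j)))"
  proof (intro prod_mono conjI)
    fix j
    let ?b = "a + g * real j"
    \<comment> \<open>An upper bound for the step from b + s to b + 1 serves as a lower bound for
      Gamma at b + s.\<close>
    have "Gamma (?b + s + (1 - s)) \<le> Gamma (?b + s) * (?b + s) powr (1 - s)"
      using b[of j] s by (intro Gamma_add_le) auto
    moreover have "Gamma (?b + s + (1 - s)) = ?b * Gamma ?b"
    proof -
      have "Gamma (?b + 1) = ?b * Gamma ?b" using b[of j]
          by (intro Gamma_plus1) (auto elim!: nonpos_Ints_cases)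
      moreover have "?b + s + (1 - s) = ?b + 1" by simp
      ultimately show ?thesis by (simp only:)
    qed
    ultimately have "?b * Gamma ?b \<le> Gamma (?b + s) * (?b + s) powr (1 - s)" by simp
    then have "?b powr (s - 1) * (?b * Gamma ?b) \<le> ?b powr (s - 1) * (Gamma (?b + s) * (?b + s) powr (1 - s))"
      by (intro mult_left_mono) auto
    also have "?b powr (s - 1) * (?b * Gamma ?b) = ?b powr s * Gamma ?b"
      using b[of j] by (simp add: powr_diff)
    also have "?b powr (s - 1) * (Gamma (?b + s) * (?b + s) powr (1 - s))
        = ((?b + s) / ?b) powr (1 - s) * Gamma (?b + s)"
    proof -
      have "?b powr (s - 1) = 1 / ?b powr (1 - s)" by (simp flip: powr_minus_divide)
      then show ?thesis using b[of j] s by (simp add: powr_divide)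
    qed
    also have "((?b + s) / ?b) powr (1 - s) \<le> ((?b + s) / ?b) powr 1"
      using b[of j] s by (intro powr_mono) auto
    also have "\<dots> \<le> 1 + 1 / ?b"
    proof -
      have "(?b + s) / ?b = 1 + s / ?b" using b[of j] by (simp add: add_divide_distrib)
      moreover have "s / ?b \<le> 1 / ?b" using b[of j] s by (intro divide_right_mono) auto
      moreover have "0 \<le> s / ?b" using b[of j] s by simp
      ultimately show ?thesis by simp
    qed
    finally have "?b powr s * Gamma ?b \<le> (1 + 1 / ?b) * Gamma (?b + s)"
      using Gamma_real_pos[of "?b + s"] b[of j] s by (simp add: mult_right_mono)
    then have "2 powr (?b + s) * (?b powr s * Gamma ?b) \<le> 2 powr (?b + s) * ((1 + 1 / ?b) * Gamma (?b + s))"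
      by (intro mult_left_mono) auto
    moreover have "2 powr (?b + s) * (?b powr s * Gamma ?b) = (2 * ?b) powr s * (2 powr ?b * Gamma ?b)"
      by (simp only: powr_mult powr_add mult_ac)
    moreover have "a + s + g * real j = ?b + s" by simp
    ultimately show "(2 * ?b) powr s * (2 powr ?b * Gamma ?b)
        \<le> (1 + 1 / ?b) * (2 powr (a + s + g * real j) * Gamma (a + s + g * real j))"
      by (simp only: mult_ac)
    show "0 \<le> (2 * ?b) powr s * (2 powr ?b * Gamma ?b)"
      using b[of j] Gamma_real_pos[of ?b] by simp
  qed
  also have "\<dots> = (\<Prod>j<?n. 1 + 1 / (a + g * real j)) * laguerre_gamma ?n g (a + s)"
    by (simp only: laguerre_gamma_def prod.distrib)
  finally have le: "(\<Prod>j<?n. 2 * (a + g * real j)) powr s * laguerre_gamma ?n g a \<le> 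
     (\<Prod>j<?n. 1 + 1 / (a + g * real j)) * laguerre_gamma ?n g (a + s)" .
  let ?C = "(\<Prod>j<?n. 2 * (a + g * real j)) powr s"
  have pos: "0 < laguerre_gamma ?n g a" "0 < laguerre_gamma ?n g (a + s)"
    using a s g by (auto intro!: laguerre_gamma_pos)
  have "laguerre_integral I g (a + s) * laguerre_gamma ?n g a
      \<le> ?C * laguerre_integral I g a * laguerre_gamma ?n g a"
    using laguerre_integral_add_le[OF I a g s] pos by (intro mult_right_mono) auto
  also have "\<dots> = laguerre_integral I g a * (?C * laguerre_gamma ?n g a)" by simp
  also have "\<dots> \<le> laguerre_integral I g a * ((\<Prod>j<?n. 1 + 1 / (a + g * real j)) * laguerre_gamma ?n g (a + s))"
    using le laguerre_integral_pos[OF I a, of g] g by (intro mult_left_mono) auto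
  finally show ?thesis using pos by (simp add: field_simps)
qed

text \<open>As in the Bohr-Mollerup theorem, the quotient of the integral by its conjectured value has
  period \<open>1\<close> in \<open>a\<close>, and this removes the error factor of \<open>laguerre_ratio_le\<close> in the limit of large shifts.\<close>

lemma laguerre_ratio_periodic:
  assumes "finite I" "0 < a" "0 < g"
  shows "laguerre_integral I g (a + real N) / laguerre_gamma (card I) g (a + real N) =
    laguerre_integral I g a / laguerre_gamma (card I) g a"
proof (induction N)
  case (Suc N)
  have pos: "0 < a + real N" using assms by auto
  define C where "C = (\<Prod>j<card I. 2 * (a + real N + g * real j))"
  have "C > 0"
    unfolding C_def using assms pos by (intro prod_pos) (auto intro!: mult_pos_pos add_pos_nonneg)
  moreover have "laguerre_integral I g (a + real N + 1) = C * laguerre_integral I g (a + real N)"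
    unfolding C_def using assms pos by (intro laguerre_integral_add_1) auto
  moreover have "laguerre_gamma (card I) g (a + real N + 1) = C * laguerre_gamma (card I) g (a + real N)"
    unfolding C_def using assms pos by (intro laguerre_gamma_add_1) auto
  ultimately have "laguerre_integral I g (a + real N + 1) / laguerre_gamma (card I) g (a + real N + 1) =
    laguerre_integral I g (a + real N) / laguerre_gamma (card I) g (a + real N)"
    by simp
  then show ?case using Suc by (simp add: add_ac)
qed simp

lemma laguerre_ratio_antimono:
  assumes I: "finite I" and a: "0 < a" and g: "0 < g" and s: "0 \<le> s" "s \<le> 1"
  shows "laguerre_integral I g (a + s) / laguerre_gamma (card I) g (a + s) \<le>
     laguerre_integral I g a / laguerre_gamma (card I) g a"
proof (rule LIMSEQ_le_const)
  let ?r = "\<lambda>a. laguerre_integral I g a / laguerre_gamma (card I) g a"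
  have "(\<lambda>N. ?r a * (\<Prod>j<card I. 1 + 1 / (a + real N + g * real j))) \<longlonglongrightarrow> ?r a * (\<Prod>j<card I. 1)"
  proof (intro tendsto_mult tendsto_const tendsto_prod)
    fix j
    show "(\<lambda>N. 1 + 1 / (a + real N + g * real j)) \<longlonglongrightarrow> 1" by real_asymp
  qed
  then show "(\<lambda>N. ?r a * (\<Prod>j<card I. 1 + 1 / (a + real N + g * real j))) \<longlonglongrightarrow> ?r a" by simp
  have "?r (a + s) \<le> ?r a * (\<Prod>j<card I. 1 + 1 / (a + real N + g * real j))" for N
    using laguerre_ratio_le[OF I _ g s, of "a + real N"] a s g
      laguerre_ratio_periodic[OF I _ g, of "a + s" N] laguerre_ratio_periodic[OF I a g, of N]
    by (simp add: add_ac)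
  then show "\<exists>N. \<forall>n\<ge>N. ?r (a + s) \<le> ?r a * (\<Prod>j<card I. 1 + 1 / (a + real n + g * real j))" by auto
qed

text \<open>A function of period 1 that never increases over steps of length at most 1 is constant:
  the values at a, a + s and a + 1 decrease, and the outer two agree.\<close>

lemma laguerre_ratio_const:
  assumes I: "finite I" and a: "0 < a" "0 < b" and g: "0 < g"
  shows "laguerre_integral I g a / laguerre_gamma (card I) g a =
     laguerre_integral I g b / laguerre_gamma (card I) g b"
proof -
  let ?r = "\<lambda>a. laguerre_integral I g a / laguerre_gamma (card I) g a"
  have *: "?r b = ?r a" if ab: "0 < a" "a \<le> b" for a b
  proof -
    define N where "N = nat \<lfloor>b - a\<rfloor>"
    define s where "s = b - a - real N"
    have s: "0 \<le> s" "s \<le> 1" using ab unfolding s_def N_def by linarith+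
    have b: "b = (a + s) + real N" by (simp add: s_def)
    have rb: "?r b = ?r (a + s)" unfolding b using ab s by (intro laguerre_ratio_periodic I g) auto
    have "?r (a + s) \<le> ?r a" using ab s by (intro laguerre_ratio_antimono I g) auto
    moreover have "?r ((a + s) + (1 - s)) \<le> ?r (a + s)" using ab s by (intro laguerre_ratio_antimono I g) auto
    moreover have "?r (a + real 1) = ?r a" using ab by (intro laguerre_ratio_periodic I g) auto
    ultimately show ?thesis using rb by simp
  qed
  show ?thesis using *[of a b] *[of b a] a by (cases "a \<le> b") auto
qed

subsection \<open>The Selberg-Laguerre integral\<close>

lemma vanishes_on_ties_laguerre_fun: "finite I \<Longrightarrow> vanishes_on_ties I (laguerre_fun I g a)"
  unfolding vanishes_on_ties_def using laguerre_fun_eq_0 by blast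

lemma nn_integral_powr_initial:
  assumes "0 < a" "0 \<le> m"
  shows "(\<integral>\<^sup>+t. ennreal (t powr (a - 1) * of_bool (0 < t \<and> t < m)) \<partial>lborel) = ennreal (m powr a / a)"
proof (rule nn_integral_has_integral_lborel)
  have "((\<lambda>t. if t \<in> {0..m} then t powr (a - 1) else 0) has_integral m powr a / a) UNIV"
    using has_integral_powr_from_0[of "a - 1" m] assms by (subst has_integral_restrict_UNIV) simp
  then show "((\<lambda>t. t powr (a - 1) * of_bool (0 < t \<and> t < m)) has_integral m powr a / a) UNIV"
    by (rule has_integral_spike[of "{0, m}", rotated 2]) auto
qed auto

text \<open>Only the smallest coordinate can carry the mass that t powr (a - 1) concentrates at 0 as
  a tends to 0, so it is isolated here; exchangeability supplies the factor.\<close>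

lemma nn_integral_smallest:
  fixes J :: "'i set"
  assumes J: "finite J" "k \<notin> J" and a: "0 < a" and g: "0 < g"
  shows "ennreal (laguerre_integral (insert k J) g a) = of_nat (Suc (card J)) *
    (\<integral>\<^sup>+x. (\<integral>\<^sup>+t. ennreal (laguerre_weight a t * (\<Prod>j\<in>J. \<bar>t - x j\<bar> powr (2 * g)) * of_bool (\<forall>j\<in>J. t
        < x j)) \<partial>lborel)
       * ennreal (laguerre_fun J g a x) \<partial>PiM J (\<lambda>_. lborel))"
proof -
  let ?I = "insert k J"
  let ?P = "PiM ?I (\<lambda>_. lborel :: real measure)"
  have [measurable]: "(\<lambda>x. ennreal (laguerre_fun ?I g a x) * of_bool (\<forall>j\<in>?I - {k}. x j > x k))
      \<in> borel_measurable ?P"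
  proof -
    have "Measurable.pred ?P (\<lambda>x. \<forall>j\<in>?I - {k}. x j > x k)"
      using J by (intro pred_intros_finite) (auto intro!: borel_measurable_pred_less
          measurable_component_singleton)
    then show ?thesis by measurable
  qed
  have "ennreal (laguerre_integral ?I g a) = (\<integral>\<^sup>+x. ennreal (laguerre_fun ?I g a x) \<partial>?P)"
    using J a g by (simp add: nn_integral_laguerre_fun)
  also have "\<dots> = of_nat (card ?I) * (\<integral>\<^sup>+x. ennreal (laguerre_fun ?I g a x)
      * of_bool (\<forall>j\<in>?I - {k}. x j > x k) \<partial>?P)"
  proof (rule nn_integral_strict_extreme)
    show "exchangeable_on ?I (\<lambda>x. ennreal (laguerre_fun ?I g a x))"
      using exchangeable_on_laguerre_fun[of ?I g a] unfolding exchangeable_on_def by simp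
    show "vanishes_on_ties ?I (\<lambda>x. ennreal (laguerre_fun ?I g a x))"
      using vanishes_on_ties_laguerre_fun[of ?I g a] J unfolding vanishes_on_ties_def by simp
    show "(>) = ((<) :: real \<Rightarrow> _) \<or> (>) = ((>) :: real \<Rightarrow> _)" by simp
  qed (use J in \<open>auto\<close>)
  also have "(\<integral>\<^sup>+x. ennreal (laguerre_fun ?I g a x) * of_bool (\<forall>j\<in>?I - {k}. x j > x k) \<partial>?P)
     = (\<integral>\<^sup>+x. (\<integral>\<^sup>+t. ennreal (laguerre_fun ?I g a (x(k := t)))
         * of_bool (\<forall>j\<in>?I - {k}. (x(k := t)) j > (x(k := t)) k) \<partial>lborel) \<partial>PiM J (\<lambda>_. lborel))"
    using J by (intro lebesgue_product.product_nn_integral_insert) auto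
  also have "\<dots> = (\<integral>\<^sup>+x. (\<integral>\<^sup>+t. ennreal (laguerre_weight a t * (\<Prod>j\<in>J. \<bar>t - x j\<bar> powr (2 * g))
      * of_bool (\<forall>j\<in>J. t < x j))
       * ennreal (laguerre_fun J g a x) \<partial>lborel) \<partial>PiM J (\<lambda>_. lborel))"
  proof (intro nn_integral_cong)
    fix x :: "'i \<Rightarrow> real" and t :: real
    have "(\<Prod>i\<in>J. \<bar>(x(k := t)) k - (x(k := t)) i\<bar> powr (2 * g)) = (\<Prod>i\<in>J. \<bar>t - x i\<bar> powr (2 * g))"
      using J by (intro prod.cong) auto
    moreover have "laguerre_fun J g a (x(k := t)) = laguerre_fun J g a x"
      using J by (intro laguerre_fun_cong) auto
    ultimately have F: "laguerre_fun ?I g a (x(k := t)) =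
        laguerre_weight a t * (\<Prod>i\<in>J. \<bar>t - x i\<bar> powr (2 * g)) * laguerre_fun J g a x"
      using J by (simp add: laguerre_fun_insert)
    have "?I - {k} = J" using J by auto
    moreover have "(\<forall>j\<in>J. (x(k := t)) k < (x(k := t)) j) \<longleftrightarrow> (\<forall>j\<in>J. t < x j)" using J by auto
    ultimately show "ennreal (laguerre_fun ?I g a (x(k := t)))
        * of_bool (\<forall>j\<in>?I - {k}. (x(k := t)) j > (x(k := t)) k)
      = ennreal (laguerre_weight a t * (\<Prod>j\<in>J. \<bar>t - x j\<bar> powr (2 * g)) * of_bool (\<forall>j\<in>J. t < x j))
          * ennreal (laguerre_fun J g a x)"
      unfolding F by (auto simp: ennreal_mult prod_nonneg)
  qed
  also have "\<dots> = (\<integral>\<^sup>+x. (\<integral>\<^sup>+t. ennreal (laguerre_weight a t * (\<Prod>j\<in>J. \<bar>t - x j\<bar> powr (2 * g))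
      * of_bool (\<forall>j\<in>J. t < x j)) \<partial>lborel)
       * ennreal (laguerre_fun J g a x) \<partial>PiM J (\<lambda>_. lborel))"
  proof (intro nn_integral_cong nn_integral_multc)
    fix x :: "'i \<Rightarrow> real"
    have [measurable]: "Measurable.pred borel (\<lambda>t. \<forall>j\<in>J. t < x j)" using J by (intro pred_intros_finite) auto
    show "(\<lambda>t. ennreal (laguerre_weight a t * (\<Prod>j\<in>J. \<bar>t - x j\<bar> powr (2 * g)) * of_bool (\<forall>j\<in>J. t
        < x j))) \<in> borel_measurable lborel"
      by measurable
  qed
  finally show ?thesis using J by simp
qed

text \<open>As \<open>a\<close> tends to \<open>0\<close>, the mass concentrates on the smallest coordinate being close to \<open>0\<close>, which
  reduces the number of variables by one and shifts the exponent by \<open>2 * g\<close>.\<close>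

lemma laguerre_integral_at_0_upper:
  fixes J :: "'i set"
  assumes J: "finite J" "k \<notin> J" "J \<noteq> {}" and a: "0 < a" and g: "0 < g"
  shows "a * laguerre_integral (insert k J) g a \<le> Suc (card J) * laguerre_integral J g (2 * g + a
      + a / card J)"
proof -
  let ?b = "2 * g + a / card J"
  have cJ: "0 < card J" using J by (simp add: card_gt_0_iff)
  have b: "0 < ?b" using a g cJ by (intro add_pos_nonneg) auto
  have "(\<integral>\<^sup>+t. ennreal (laguerre_weight a t * (\<Prod>j\<in>J. \<bar>t - x j\<bar> powr (2 * g)) * of_bool (\<forall>j\<in>J. t
      < x j)) \<partial>lborel)
       * ennreal (laguerre_fun J g a x) \<le> ennreal (1 / a) * ennreal (laguerre_fun J g (a + ?b) x)" for x
  proof (cases "\<forall>j\<in>J. 0 < x j")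
    case False
    then have "laguerre_fun J g a x = 0" using J by (intro laguerre_fun_eq_0) (auto simp: not_less)
    then show ?thesis by simp
  next
    case True
    define m where "m = Min (x ` J)"
    have m: "\<And>j. j \<in> J \<Longrightarrow> m \<le> x j" "0 < m" "\<And>t. (\<forall>j\<in>J. t < x j) \<longleftrightarrow> t < m"
      using J True by (auto simp: m_def)
    \<comment> \<open>The integral over t < m leaves m powr a / a. The minimum m is at most the
      geometric mean of the x j, and a power of their product is just a shift of the exponent, here
      by a / card J.\<close>
    have "m powr card J = (\<Prod>j\<in>J. m)" using m by (simp add: powr_realpow)
    also have "\<dots> \<le> (\<Prod>j\<in>J. x j)" using m by (intro prod_mono) auto
    finally have "(m powr card J) powr (a / card J) \<le> (\<Prod>j\<in>J. x j) powr (a / card J)"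
      using a by (intro powr_mono2) auto
    then have mle: "m powr a \<le> (\<Prod>j\<in>J. x j) powr (a / card J)" using cJ by (simp add: powr_powr)
    have "(\<integral>\<^sup>+t. ennreal (laguerre_weight a t * (\<Prod>j\<in>J. \<bar>t - x j\<bar> powr (2 * g)) * of_bool (\<forall>j\<in>J. t
        < x j)) \<partial>lborel)
      \<le> (\<integral>\<^sup>+t. ennreal ((\<Prod>j\<in>J. x j) powr (2 * g)) * ennreal (t powr (a - 1) * of_bool (0 < t \<and> t
          < m)) \<partial>lborel)"
    proof (intro nn_integral_mono)
      fix t :: real
      show "ennreal (laguerre_weight a t * (\<Prod>j\<in>J. \<bar>t - x j\<bar> powr (2 * g)) * of_bool (\<forall>j\<in>J. t < x j))
        \<le> ennreal ((\<Prod>j\<in>J. x j) powr (2 * g)) * ennreal (t powr (a - 1) * of_bool (0 < t \<and> t < m))"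
      proof (cases "0 < t \<and> t < m")
        case False
        then show ?thesis using m(3) by (auto simp: laguerre_weight_def)
      next
        case t: True
        have "laguerre_weight a t \<le> t powr (a - 1)"
          using t by (simp add: laguerre_weight_def mult_left_le)
        moreover have "(\<Prod>j\<in>J. \<bar>t - x j\<bar> powr (2 * g)) \<le> (\<Prod>j\<in>J. x j) powr (2 * g)"
          unfolding prod_powr_distrib
        proof (intro prod_mono conjI powr_mono2)
          fix j assume "j \<in> J"
          then show "\<bar>t - x j\<bar> \<le> x j" using t m(1)[of j] by auto
        qed (use g in auto)
        ultimately have "laguerre_weight a t * (\<Prod>j\<in>J. \<bar>t - x j\<bar> powr (2 * g))
            \<le> t powr (a - 1) * (\<Prod>j\<in>J. x j) powr (2 * g)"
          by (intro mult_mono prod_nonneg) auto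
        then show ?thesis using t m(3) by (auto simp: ennreal_mult[symmetric]
            mult.commute intro!: ennreal_leI)
      qed
    qed
    also have "\<dots> = ennreal ((\<Prod>j\<in>J. x j) powr (2 * g)) * ennreal (m powr a / a)"
      using m a by (subst nn_integral_cmult) (auto simp: nn_integral_powr_initial)
    also have "\<dots> = ennreal (1 / a) * ennreal ((\<Prod>j\<in>J. x j) powr (2 * g) * m powr a)"
      using a by (simp add: ennreal_mult[symmetric] mult.commute)
    also have "\<dots> \<le> ennreal (1 / a) * ennreal ((\<Prod>j\<in>J. x j) powr (2 * g) * (\<Prod>j\<in>J. x j) powr (a / card J))"
      using mle by (intro mult_left_mono ennreal_leI) auto
    also have "(\<Prod>j\<in>J. x j) powr (2 * g) * (\<Prod>j\<in>J. x j) powr (a / card J) = (\<Prod>j\<in>J. x j) powr ?b"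
      by (simp add: powr_add)
    finally have "(\<integral>\<^sup>+t. ennreal (laguerre_weight a t * (\<Prod>j\<in>J. \<bar>t - x j\<bar> powr (2 * g))
        * of_bool (\<forall>j\<in>J. t < x j)) \<partial>lborel)
       * ennreal (laguerre_fun J g a x) \<le> (ennreal (1 / a) * ennreal ((\<Prod>j\<in>J. x j) powr ?b))
           * ennreal (laguerre_fun J g a x)"
      by (rule mult_right_mono) simp
    then show ?thesis unfolding laguerre_fun_add[OF J(1)] by (simp add: ennreal_mult mult.assoc)
  qed
  then have "ennreal (laguerre_integral (insert k J) g a) \<le> of_nat (Suc (card J)) * 
      (\<integral>\<^sup>+x. ennreal (1 / a) * ennreal (laguerre_fun J g (a + ?b) x) \<partial>PiM J (\<lambda>_. lborel))"
    unfolding nn_integral_smallest[OF J(1,2) a g] by (intro mult_left_mono nn_integral_mono) auto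
  also have "\<dots> = of_nat (Suc (card J)) * (ennreal (1 / a) * ennreal (laguerre_integral J g (a + ?b)))"
    using J a b g by (subst nn_integral_cmult) (auto simp: nn_integral_laguerre_fun add_pos_pos)
  also have "\<dots> = ennreal (Suc (card J) * ((1 / a) * laguerre_integral J g (a + ?b)))"
  proof -
    have "ennreal (1 / a * laguerre_integral J g (a + ?b))
        = ennreal (1 / a) * ennreal (laguerre_integral J g (a + ?b))"
      using a by (intro ennreal_mult') auto
    moreover have "ennreal (real (Suc (card J)) * X) = ennreal (real (Suc (card J))) * ennreal X" for X
      by (intro ennreal_mult') auto
    ultimately show ?thesis by (simp only: ennreal_of_nat_eq_real_of_nat)
  qed
  finally have "laguerre_integral (insert k J) g a
      \<le> Suc (card J) * ((1 / a) * laguerre_integral J g (a + ?b))"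
    using laguerre_integral_pos[of J "a + ?b" g] J a b g by (subst (asm) ennreal_le_iff) auto
  then have "a * laguerre_integral (insert k J) g a
      \<le> a * (Suc (card J) * ((1 / a) * laguerre_integral J g (a + ?b)))"
    using a by (intro mult_left_mono) auto
  then show ?thesis using a by (simp add: add_ac)
qed

text \<open>Fatou's lemma along a = 1 / (N + 1), after restricting to configurations whose smallest
  coordinate is below a and whose other coordinates exceed a. Every point with positive coordinates
  satisfies the second restriction eventually, and the minorants converge there to the integrand
  with exponent 2 * g.\<close>

lemma laguerre_integral_at_0_lower:
  fixes J :: "'i set"
  assumes J: "finite J" "k \<notin> J" "J \<noteq> {}" and g: "0 < g"
    and lim: "(\<lambda>N. (1 / real (Suc N)) * laguerre_integral (insert k J) g (1 / real (Suc N))) \<longlonglongrightarrow> c"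
  shows "Suc (card J) * laguerre_integral J g (2 * g) \<le> c"
proof -
  let ?a = "\<lambda>N. 1 / real (Suc N)"
  \<comment> \<open>For t < a the distances to the x j are at least x j - a and exp (- t / 2) is at
    least exp (- a / 2); the power a powr a is a times the integral of t powr (a - 1) over (0,
    a).\<close>
  let ?B = "\<lambda>N x. (\<Prod>j\<in>J. (x j - ?a N) powr (2 * g)) * (exp (- ?a N / 2) * ?a N powr ?a N)
      * laguerre_fun J g (?a N) x"
  let ?L = "\<lambda>N x. if \<forall>j\<in>J. ?a N < x j then ?B N x else 0"
  have [measurable]: "(\<lambda>x. x i) \<in> borel_measurable (PiM J (\<lambda>_. lborel :: real measure))" if "i \<in> J" for i
    using measurable_component_singleton[of i J "\<lambda>_. lborel"] that by auto
  have meas: "(\<lambda>x. ennreal (?L N x)) \<in> borel_measurable (PiM J (\<lambda>_. lborel))" for N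
  proof -
    have [measurable]: "Measurable.pred (PiM J (\<lambda>_. lborel)) (\<lambda>x. \<forall>j\<in>J. ?a N < x j)"
      using J by (intro pred_intros_finite) (auto intro!: borel_measurable_pred_less
          measurable_component_singleton)
    have [measurable]: "(\<lambda>x. \<Prod>j\<in>J. (x j - ?a N) powr (2 * g)) \<in> borel_measurable (PiM J (\<lambda>_. lborel))"
      by (intro borel_measurable_prod) measurable
    show ?thesis by measurable
  qed
  have ap: "0 < ?a N" for N by simp
  have below: "(\<integral>\<^sup>+x. ennreal (?L N x) \<partial>PiM J (\<lambda>_. lborel)) * of_nat (Suc (card J))
      \<le> ennreal (?a N * laguerre_integral (insert k J) g (?a N))" for N
  proof -
    have a: "0 < ?a N" by simp
    have "ennreal (?L N x) \<le> ennreal (?a N) * ((\<integral>\<^sup>+t. ennreal (laguerre_weight (?a N) t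
        * (\<Prod>j\<in>J. \<bar>t - x j\<bar> powr (2 * g)) * of_bool (\<forall>j\<in>J. t < x j)) \<partial>lborel)
       * ennreal (laguerre_fun J g (?a N) x))" for x
    proof (cases "\<forall>j\<in>J. ?a N < x j")
      case True
      let ?c = "(\<Prod>j\<in>J. (x j - ?a N) powr (2 * g)) * exp (- ?a N / 2)"
      have c0: "0 \<le> ?c" by (intro mult_nonneg_nonneg prod_nonneg) auto
      have "(\<integral>\<^sup>+t. ennreal ?c * ennreal (t powr (?a N - 1) * of_bool (0 < t \<and> t < ?a N)) \<partial>lborel) \<le>
        (\<integral>\<^sup>+t. ennreal (laguerre_weight (?a N) t * (\<Prod>j\<in>J. \<bar>t - x j\<bar> powr (2 * g)) * of_bool (\<forall>j\<in>J. t
            < x j)) \<partial>lborel)"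
      proof (intro nn_integral_mono)
        fix t :: real
        show "ennreal ?c * ennreal (t powr (?a N - 1) * of_bool (0 < t \<and> t < ?a N)) \<le>
          ennreal (laguerre_weight (?a N) t * (\<Prod>j\<in>J. \<bar>t - x j\<bar> powr (2 * g)) * of_bool (\<forall>j\<in>J. t < x j))"
        proof (cases "0 < t \<and> t < ?a N")
          case t: True
          have "(\<Prod>j\<in>J. (x j - ?a N) powr (2 * g)) \<le> (\<Prod>j\<in>J. \<bar>t - x j\<bar> powr (2 * g))"
          proof (intro prod_mono conjI powr_mono2)
            fix j assume "j \<in> J"
            then show "0 \<le> x j - ?a N" "x j - ?a N \<le> \<bar>t - x j\<bar>" using True t by (auto simp: less_imp_le)
          qed (use g in auto)
          moreover have "exp (- ?a N / 2) * t powr (?a N - 1) \<le> laguerre_weight (?a N) t"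
          proof -
            have "- ?a N / 2 \<le> - t / 2" using t by (intro divide_right_mono) auto
            then have "exp (- ?a N / 2) * t powr (?a N - 1) \<le> exp (- t / 2) * t powr (?a N - 1)"
              by (intro mult_right_mono) auto
            then show ?thesis using t by (simp add: laguerre_weight_def mult.commute)
          qed
          ultimately have "(exp (- ?a N / 2) * t powr (?a N - 1)) * (\<Prod>j\<in>J. (x j - ?a N) powr (2 * g))
             \<le> laguerre_weight (?a N) t * (\<Prod>j\<in>J. \<bar>t - x j\<bar> powr (2 * g))"
            by (intro mult_mono prod_nonneg) auto
          moreover have "\<forall>j\<in>J. t < x j" using True t by (meson less_trans)
          ultimately show ?thesis using t c0 by (auto simp: ennreal_mult[symmetric]
              mult_ac intro!: ennreal_leI)
        qed auto
      qed
      moreover have "(\<integral>\<^sup>+t. ennreal ?c * ennreal (t powr (?a N - 1) * of_bool (0 < t \<and> t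
          < ?a N)) \<partial>lborel) = ennreal ?c * ennreal (?a N powr ?a N / ?a N)"
        using nn_integral_powr_initial[OF a, of "?a N"] a by (subst nn_integral_cmult) auto
      ultimately have "ennreal ?c * ennreal (?a N powr ?a N / ?a N) \<le> 
        (\<integral>\<^sup>+t. ennreal (laguerre_weight (?a N) t * (\<Prod>j\<in>J. \<bar>t - x j\<bar> powr (2 * g)) * of_bool (\<forall>j\<in>J. t
            < x j)) \<partial>lborel)" by simp
      then have "ennreal (?a N) * ((ennreal ?c * ennreal (?a N powr ?a N / ?a N))
          * ennreal (laguerre_fun J g (?a N) x)) \<le>
        ennreal (?a N) * ((\<integral>\<^sup>+t. ennreal (laguerre_weight (?a N) t * (\<Prod>j\<in>J. \<bar>t - x j\<bar> powr (2 * g))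
            * of_bool (\<forall>j\<in>J. t < x j)) \<partial>lborel)
           * ennreal (laguerre_fun J g (?a N) x))"
        by (intro mult_left_mono mult_right_mono) auto
      moreover have "ennreal (?a N) * ((ennreal ?c * ennreal (?a N powr ?a N / ?a N))
          * ennreal (laguerre_fun J g (?a N) x)) = ennreal (?L N x)"
      proof -
        let ?D = "?a N powr ?a N / ?a N" and ?E = "laguerre_fun J g (?a N) x"
        have "?L N x = ?a N * ((?c * ?D) * ?E)"
          using True by simp
        then have "ennreal (?L N x) = ennreal (?a N * ((?c * ?D) * ?E))" by (simp only:)
        also have "\<dots> = ennreal (?a N) * ennreal ((?c * ?D) * ?E)"
          using a by (intro ennreal_mult') simp
        also have "ennreal ((?c * ?D) * ?E) = ennreal (?c * ?D) * ennreal ?E"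
          by (rule ennreal_mult') (rule mult_nonneg_nonneg[OF c0], simp)
        also have "ennreal (?c * ?D) = ennreal ?c * ennreal ?D"
          by (rule ennreal_mult'[OF c0])
        finally show ?thesis by (rule sym)
      qed
      ultimately show ?thesis by simp
    qed auto
    then have "(\<integral>\<^sup>+x. ennreal (?L N x) \<partial>PiM J (\<lambda>_. lborel))
        \<le> (\<integral>\<^sup>+x. ennreal (?a N) * ((\<integral>\<^sup>+t. ennreal (laguerre_weight (?a N) t
        * (\<Prod>j\<in>J. \<bar>t - x j\<bar> powr (2 * g)) * of_bool (\<forall>j\<in>J. t < x j)) \<partial>lborel)
       * ennreal (laguerre_fun J g (?a N) x)) \<partial>PiM J (\<lambda>_. lborel))"
      by (intro nn_integral_mono) auto
    also have "\<dots> \<le> ennreal (?a N) * (\<integral>\<^sup>+x. ((\<integral>\<^sup>+t. ennreal (laguerre_weight (?a N) t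
        * (\<Prod>j\<in>J. \<bar>t - x j\<bar> powr (2 * g)) * of_bool (\<forall>j\<in>J. t < x j)) \<partial>lborel)
       * ennreal (laguerre_fun J g (?a N) x)) \<partial>PiM J (\<lambda>_. lborel))"
    proof (rule eq_refl, rule nn_integral_cmult)
      show "(\<lambda>x. (\<integral>\<^sup>+t. ennreal (laguerre_weight (?a N) t * (\<Prod>j\<in>J. \<bar>t - x j\<bar> powr (2 * g))
          * of_bool (\<forall>j\<in>J. t < x j)) \<partial>lborel)
       * ennreal (laguerre_fun J g (?a N) x)) \<in> borel_measurable (PiM J (\<lambda>_. lborel))"
      proof -
        let ?Q = "PiM J (\<lambda>_. lborel :: real measure) \<Otimes>\<^sub>M lborel"
        have [measurable]: "(\<lambda>z. fst z i) \<in> borel_measurable ?Q" if "i \<in> J" for i using that by measurable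
        have "Measurable.pred ?Q (\<lambda>z. \<forall>j\<in>J. snd z < fst z j)"
          using J by (intro pred_intros_finite borel_measurable_pred_less) auto
        then have [measurable]: "Measurable.pred ?Q (\<lambda>(x, t). \<forall>j\<in>J. t < x j)" by (simp add: case_prod_beta')
        have "(\<lambda>z. \<Prod>j\<in>J. \<bar>snd z - fst z j\<bar> powr (2 * g)) \<in> borel_measurable ?Q"
          by (intro borel_measurable_prod) measurable
        then have [measurable]: "(\<lambda>(x, t). \<Prod>j\<in>J. \<bar>t - x j\<bar> powr (2 * g)) \<in> borel_measurable ?Q"
            by (simp add: case_prod_beta')
        have "(\<lambda>(x, t). ennreal (laguerre_weight (?a N) t * (\<Prod>j\<in>J. \<bar>t - x j\<bar> powr (2 * g))
            * of_bool (\<forall>j\<in>J. t < x j))) \<in> borel_measurable ?Q"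
          by measurable
        from lborel.borel_measurable_nn_integral[OF this] show ?thesis
          by (intro borel_measurable_times_ennreal measurable_compose[OF _ measurable_ennreal]
              borel_measurable_laguerre_fun) simp_all
      qed
    qed
    finally have "(\<integral>\<^sup>+x. ennreal (?L N x) \<partial>PiM J (\<lambda>_. lborel)) * of_nat (Suc (card J))
        \<le> ennreal (?a N) * ennreal (laguerre_integral (insert k J) g (?a N))"
      unfolding nn_integral_smallest[OF J(1,2) a g] by (simp add: mult_ac mult_left_mono del: of_nat_Suc)
    then show ?thesis by (simp only: ennreal_mult'[OF less_imp_le[OF a]])
  qed
  have ptw: "ennreal (laguerre_fun J g (2 * g) x) \<le> liminf (\<lambda>N. ennreal (?L N x))" for x
  proof (cases "\<forall>j\<in>J. 0 < x j")
    case False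
    then have "laguerre_fun J g (2 * g) x = 0" using J by (intro laguerre_fun_eq_0) (auto simp: not_less)
    then show ?thesis by simp
  next
    case True
    then have pos: "0 < (\<Prod>j\<in>J. x j)" by (intro prod_pos) auto
    have a0: "?a \<longlonglongrightarrow> 0" by real_asymp
    have lf: "laguerre_fun J g (?a N) x = (\<Prod>j\<in>J. x j) powr (?a N - 2 * g) * laguerre_fun J g (2 * g) x" for N
      using laguerre_fun_add[OF J(1), of g "2 * g" "?a N - 2 * g" x] by simp
    have "(\<lambda>N. (\<Prod>j\<in>J. (x j - ?a N) powr (2 * g)) * (exp (- ?a N / 2) * ?a N powr ?a N)
        * ((\<Prod>j\<in>J. x j) powr (?a N - 2 * g) * laguerre_fun J g (2 * g) x))
       \<longlonglongrightarrow> (\<Prod>j\<in>J. (x j - 0) powr (2 * g)) * (exp (- 0 / 2) * 1) * ((\<Prod>j\<in>J. x j) powr (0 - 2 * g)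
           * laguerre_fun J g (2 * g) x)"
    proof (intro tendsto_mult tendsto_prod tendsto_powr tendsto_const tendsto_diff tendsto_exp
        tendsto_divide tendsto_minus a0)
      show "(\<lambda>N. ?a N powr ?a N) \<longlonglongrightarrow> 1" by real_asymp
    qed (use True pos in auto)
    also have "(\<Prod>j\<in>J. (x j - 0) powr (2 * g)) * (exp (- 0 / 2) * 1) * ((\<Prod>j\<in>J. x j) powr (0 - 2 * g)
        * laguerre_fun J g (2 * g) x) = laguerre_fun J g (2 * g) x"
      using pos True by (simp add: prod_powr_distrib[symmetric] powr_minus)
    finally have "(\<lambda>N. ?B N x) \<longlonglongrightarrow> laguerre_fun J g (2 * g) x" unfolding lf .
    moreover have "eventually (\<lambda>N. ?L N x = ?B N x) sequentially"
    proof -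
      have "eventually (\<lambda>N. \<forall>j\<in>J. ?a N < x j) sequentially"
        using True by (intro eventually_ball_finite J ballI order_tendstoD(2)[OF a0]) auto
      then show ?thesis by eventually_elim simp
    qed
    ultimately have "(\<lambda>N. ?L N x) \<longlonglongrightarrow> laguerre_fun J g (2 * g) x"
      by (simp add: tendsto_cong)
    then have "(\<lambda>N. ennreal (?L N x)) \<longlonglongrightarrow> ennreal (laguerre_fun J g (2 * g) x)" by (rule tendsto_ennrealI)
    then have "liminf (\<lambda>N. ennreal (?L N x)) = ennreal (laguerre_fun J g (2 * g) x)"
      by (intro lim_imp_Liminf) simp
    then show ?thesis by (simp only: order_refl)
  qed
  have pos: "0 < laguerre_integral (insert k J) g (?a N)" for N
    by (rule laguerre_integral_pos) (use J g in simp_all)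
  have c0: "0 \<le> c"
    by (rule LIMSEQ_le_const[OF lim]) (intro exI allI impI mult_nonneg_nonneg less_imp_le[OF ap]
        less_imp_le[OF pos])
  have "ennreal (laguerre_integral J g (2 * g)) * of_nat (Suc (card J))
      = (\<integral>\<^sup>+x. ennreal (laguerre_fun J g (2 * g) x) \<partial>PiM J (\<lambda>_. lborel)) * of_nat (Suc (card J))"
    using J g by (simp add: nn_integral_laguerre_fun)
  also have "\<dots> \<le> (\<integral>\<^sup>+x. liminf (\<lambda>N. ennreal (?L N x)) \<partial>PiM J (\<lambda>_. lborel)) * of_nat (Suc (card J))"
    by (intro mult_right_mono nn_integral_mono ptw) auto
  also have "\<dots> \<le> liminf (\<lambda>N. \<integral>\<^sup>+x. ennreal (?L N x) \<partial>PiM J (\<lambda>_. lborel)) * of_nat (Suc (card J))"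
    by (intro mult_right_mono nn_integral_liminf meas) auto
  also have "\<dots> \<le> ennreal c"
  proof -
    let ?S = "of_nat (Suc (card J)) :: ennreal"
    have S: "?S \<noteq> 0" "?S \<noteq> top" by (simp_all add: ennreal_of_nat_eq_real_of_nat del: of_nat_Suc)
    have "liminf (\<lambda>N. \<integral>\<^sup>+x. ennreal (?L N x) \<partial>PiM J (\<lambda>_. lborel))
        \<le> liminf (\<lambda>N. ennreal (?a N * laguerre_integral (insert k J) g (?a N)) / ?S)"
    proof (intro Liminf_mono always_eventually allI)
      fix N
      have "(\<integral>\<^sup>+x. ennreal (?L N x) \<partial>PiM J (\<lambda>_. lborel)) * ?S / ?S
          \<le> ennreal (?a N * laguerre_integral (insert k J) g (?a N)) / ?S"
        by (intro divide_right_mono_ennreal below)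
      then show "(\<integral>\<^sup>+x. ennreal (?L N x) \<partial>PiM J (\<lambda>_. lborel))
          \<le> ennreal (?a N * laguerre_integral (insert k J) g (?a N)) / ?S"
        using S by (simp add: mult_divide_eq_ennreal del: of_nat_Suc)
    qed
    also have "\<dots> = ennreal c / ?S"
    proof (rule lim_imp_Liminf)
      show "(\<lambda>N. ennreal (?a N * laguerre_integral (insert k J) g (?a N)) / ?S) \<longlonglongrightarrow> ennreal c / ?S"
      proof -
        have *: "ennreal r / ?S = ennreal (r / real (Suc (card J)))" if "0 \<le> r" for r
          using divide_ennreal[OF that, of "real (Suc (card J))"]
              by (simp add: ennreal_of_nat_eq_real_of_nat del: of_nat_Suc)
        have "(\<lambda>N. ennreal (?a N * laguerre_integral (insert k J) g (?a N)
            / real (Suc (card J)))) \<longlonglongrightarrow> ennreal (c / real (Suc (card J)))"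
          by (intro tendsto_ennrealI tendsto_divide lim tendsto_const) simp
        then show ?thesis
          using pos by (subst *[OF c0], subst *) (auto intro!: mult_nonneg_nonneg less_imp_le
              simp del: of_nat_Suc)
      qed
    qed simp
    finally have "liminf (\<lambda>N. \<integral>\<^sup>+x. ennreal (?L N x) \<partial>PiM J (\<lambda>_. lborel)) * ?S \<le> ennreal c / ?S * ?S"
      by (rule mult_right_mono) simp
    also have "\<dots> = ennreal c"
    proof -
      have "?S / ?S = 1" using S by (intro ennreal_divide_self) (simp_all only: less_top not_False_eq_True)
      then show ?thesis by (simp only: ennreal_divide_times mult_1_right)
    qed
    finally show ?thesis .
  qed
  finally show ?thesis using c0 laguerre_integral_pos[of J "2 * g" g] J g
    by (simp add: ennreal_of_nat_eq_real_of_nat ennreal_mult[symmetric] mult.commute del: of_nat_Suc)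
qed


text \<open>For each number of variables the integral is known up to a constant C. Multiplying by a
  and letting a tend to 0 evaluates it in two ways: through C and the regular Gamma factors, and
  through the integral with one variable less at exponent 2 * g. This determines C
  recursively.\<close>

theorem laguerre_selberg_integral:
  fixes I :: "'i set"
  assumes I: "finite I" and a: "0 < a" and g: "0 < g"
  shows "laguerre_integral I g a =
    (\<Prod>j=1..card I. 2 powr (g * (real j - 1)) * Gamma (1 + g * real j) / Gamma (1 + g))
        * laguerre_gamma (card I) g a"
proof -
  let ?c = "\<lambda>n. (\<Prod>j=1..n. 2 powr (g * (real j - 1)) * Gamma (1 + g * real j) / Gamma (1 + g))"
  have Gg: "0 < Gamma z" if "0 < z" for z :: real using Gamma_real_pos[OF that] .
  have "\<forall>a>0. laguerre_integral I g a = ?c (card I) * laguerre_gamma (card I) g a"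
    using I
  proof (induction I rule: finite_induct)
    case empty
    have "laguerre_integral ({} :: 'i set) g a = 1" if a: "0 < a" for a
    proof -
      have "ennreal (laguerre_integral ({} :: 'i set) g a)
          = (\<integral>\<^sup>+x. ennreal (laguerre_fun {} g a x) \<partial>PiM ({} :: 'i set) (\<lambda>_. lborel))"
        by (rule nn_integral_laguerre_fun[OF finite.emptyI a less_imp_le[OF g], symmetric])
      also have "\<dots> = 1"
        by (simp add: laguerre_fun_def vandermonde_power_def space_PiM_empty)
      finally show ?thesis by (metis ennreal_1 ennreal_inj laguerre_integral_pos[OF finite.emptyI a
          less_imp_le[OF g]] less_imp_le zero_le_one)
    qed
    then show ?case by (simp add: laguerre_gamma_def)
  next
    case (insert k J)
    show ?case
    proof (cases "J = {}")
      \<comment> \<open>With a single variable no coordinate remains after the limit and the shift a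
        / card J is meaningless; the integral is a Gamma integral.\<close>
      case True
      have "laguerre_integral {k} g a = 2 powr a * Gamma a" if a: "0 < a" for a
      proof -
        have "ennreal (laguerre_integral {k} g a) = (\<integral>\<^sup>+x. ennreal (laguerre_weight a (x k)) \<partial>PiM
            {k} (\<lambda>_. lborel))"
          using a g by (simp add: nn_integral_laguerre_fun[symmetric] laguerre_fun_def vandermonde_power_def)
        also have "\<dots> = (\<integral>\<^sup>+t. ennreal (laguerre_weight a t) \<partial>lborel)"
          by (intro lebesgue_product.product_nn_integral_singleton) auto
        also have "\<dots> = ennreal (2 powr a * Gamma a)"
          using a by (rule nn_integral_laguerre_weight)
        finally show ?thesis
          using a g laguerre_integral_pos[of "{k}" a g] Gg[OF a] by simp
      qed
      moreover have "Gamma (1 + g) \<noteq> 0" using Gg[of "1 + g"] g by linarith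
      ultimately show ?thesis using True g by (auto simp: laguerre_gamma_def lessThan_Suc)
    next
      case False
      let ?n = "card J"
      have n: "1 \<le> ?n" using False insert.hyps by (simp add: Suc_le_eq card_gt_0_iff)
      define C where "C = laguerre_integral (insert k J) g 1 / laguerre_gamma (Suc ?n) g 1"
      have C: "laguerre_integral (insert k J) g a = C * laguerre_gamma (Suc ?n) g a" if a: "0 < a" for a
        using laguerre_ratio_const[of "insert k J" a 1 g] insert.hyps a g laguerre_gamma_pos[of a g "Suc ?n"]
        unfolding C_def by (simp add: field_simps)
      have IH: "laguerre_integral J g a = ?c ?n * laguerre_gamma ?n g a" if "0 < a" for a
        using insert.IH that by auto
      let ?H = "\<Prod>j=1..?n. 2 powr (g * real j) * Gamma (g * real j)"
      \<comment> \<open>Only the factor j = 0 has a pole at a = 0; it is cured by a * Gamma a =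
        Gamma (a + 1).\<close>
      have split: "laguerre_gamma (Suc ?n) g a = 2 powr a * Gamma a
          * (\<Prod>j=1..?n. 2 powr (a + g * real j) * Gamma (a + g * real j))" for a
        unfolding laguerre_gamma_def
        by (subst prod.lessThan_Suc_shift) (simp add: prod.atLeast1_atMost_eq lessThan_atLeast0)
      define e where "e N = 1 / real (Suc N)" for N
      have e: "0 < e N" for N by (simp add: e_def)
      have e0: "e \<longlonglongrightarrow> 0" unfolding e_def by real_asymp
      have lim: "(\<lambda>N. e N * laguerre_integral (insert k J) g (e N)) \<longlonglongrightarrow> C * ?H"
      proof -
        have eq: "e N * laguerre_integral (insert k J) g (e N) = C * (2 powr e N * Gamma (e N + 1) *
           (\<Prod>j=1..?n. 2 powr (e N + g * real j) * Gamma (e N + g * real j)))" for N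
        proof -
          have "Gamma (e N + 1) = e N * Gamma (e N)" using e[of N]
              by (intro Gamma_plus1) (auto elim!: nonpos_Ints_cases)
          then show ?thesis unfolding C[OF e] split by simp
        qed
        have "(\<lambda>N. C * (2 powr e N * Gamma (e N + 1) * (\<Prod>j=1..?n. 2 powr (e N + g * real j)
            * Gamma (e N + g * real j))))
          \<longlonglongrightarrow> C * (2 powr 0 * Gamma (0 + 1) * (\<Prod>j=1..?n. 2 powr (0 + g * real j) * Gamma (0 + g * real j)))"
        proof (intro tendsto_mult tendsto_const tendsto_prod tendsto_powr tendsto_Gamma tendsto_add e0)
          fix j assume "j \<in> {1..?n}"
          then have "0 < 0 + g * real j" using g by simp
          then show "0 + g * real j \<notin> \<int>\<^sub>\<le>\<^sub>0" by (auto elim!: nonpos_Ints_cases)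
        qed auto
        then show ?thesis unfolding eq by simp
      qed
      have low: "Suc ?n * laguerre_integral J g (2 * g) \<le> C * ?H"
        using lim insert.hyps False g unfolding e_def by (intro laguerre_integral_at_0_lower) auto
      have up: "C * ?H \<le> Suc ?n * laguerre_integral J g (2 * g)"
      proof (rule LIMSEQ_le[OF lim])
        let ?b = "\<lambda>N. 2 * g + e N + e N / ?n"
        have b: "0 < ?b N" for N using g e[of N] by (intro add_pos_nonneg) auto
        have "(\<lambda>N. Suc ?n * (?c ?n * laguerre_gamma ?n g (?b N))) \<longlonglongrightarrow> Suc ?n
            * (?c ?n * laguerre_gamma ?n g (2 * g + 0 + 0 / ?n))"
          unfolding laguerre_gamma_def
        proof (intro tendsto_mult tendsto_const tendsto_prod tendsto_powr tendsto_Gamma tendsto_add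
            e0 tendsto_divide)
          fix j
          have "0 < 2 * g + 0 + 0 / real ?n + g * real j" using g by (simp add: add_pos_nonneg)
          then show "2 * g + 0 + 0 / real ?n + g * real j \<notin> \<int>\<^sub>\<le>\<^sub>0" by (auto elim!: nonpos_Ints_cases)
        qed (use n in auto)
        then show "(\<lambda>N. Suc ?n * laguerre_integral J g (?b N)) \<longlonglongrightarrow> Suc ?n * laguerre_integral J g (2 * g)"
          using IH b g by simp
        show "\<exists>N. \<forall>m\<ge>N. e m * laguerre_integral (insert k J) g (e m) \<le> Suc ?n * laguerre_integral J g (?b m)"
          using laguerre_integral_at_0_upper[OF insert.hyps False e g] by blast
      qed
      have eq: "C * ?H = Suc ?n * (?c ?n * laguerre_gamma ?n g (2 * g))"
        using low up IH[of "2 * g"] g by (simp del: of_nat_Suc)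
      \<comment> \<open>The arguments 2 g + g j with j < n are the multiples 2 g, ..., (n + 1) g.
        The factor at g completes them at the bottom, after which \<open>?H\<close> cancels and only
        the top multiple is left.\<close>
      have "laguerre_gamma ?n g (2 * g) * (2 powr g * Gamma g)
          = ?H * (2 powr (g * Suc ?n) * Gamma (g * Suc ?n))"
      proof -
        let ?f = "\<lambda>j. 2 powr (g * real j) * Gamma (g * real j)"
        have "laguerre_gamma ?n g (2 * g) = (\<Prod>j<?n. ?f (j + 2))"
          unfolding laguerre_gamma_def by (intro prod.cong refl) (simp add: algebra_simps)
        also have "\<dots> * (2 powr g * Gamma g) = (\<Prod>j<Suc ?n. ?f (j + 1))"
          by (subst prod.lessThan_Suc_shift) simp
        also have "\<dots> = (\<Prod>j=1..Suc ?n. ?f j)"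
          by (simp only: One_nat_def prod.atLeast1_atMost_eq add_Suc_right add_0_right)
        finally show ?thesis by simp
      qed
      then have "?H * C * (2 powr g * Gamma g) = ?H
          * (Suc ?n * ?c ?n * (2 powr (g * Suc ?n) * Gamma (g * Suc ?n)))"
        using eq by (simp add: algebra_simps del: of_nat_Suc)
      moreover have "0 < ?H" using g by (intro prod_pos) (auto intro!: mult_pos_pos Gg)
      moreover have "X * Y = Z" if "h * X * Y = h * Z" "0 < h" for h X Y Z :: real
        using that by simp
      ultimately have "C * (2 powr g * Gamma g) = Suc ?n * ?c ?n * (2 powr (g * Suc ?n) * Gamma (g * Suc ?n))"
        by blast
      then have "C = ?c ?n * (Suc ?n * (2 powr (g * Suc ?n) * Gamma (g * Suc ?n)) / (2 powr g * Gamma g))"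
        using Gg[OF g] by (simp add: field_simps del: of_nat_Suc)
      also have "Suc ?n * (2 powr (g * Suc ?n) * Gamma (g * Suc ?n)) / (2 powr g * Gamma g) =
          2 powr (g * (real (Suc ?n) - 1)) * Gamma (1 + g * real (Suc ?n)) / Gamma (1 + g)"
      proof -
        have "Gamma (1 + g) = g * Gamma g" "Gamma (1 + g * Suc ?n) = g * Suc ?n * Gamma (g * Suc ?n)"
        proof -
          have "Gamma (1 + z) = z * Gamma z" if "0 < z" for z :: real
            using Gamma_plus1[of z] that by (force simp: add.commute elim!: nonpos_Ints_cases)
          then show "Gamma (1 + g) = g * Gamma g" "Gamma (1 + g * Suc ?n) = g * Suc ?n * Gamma (g * Suc ?n)"
            using g by (simp_all del: of_nat_Suc)
        qed
        moreover have "2 powr (g * Suc ?n) = 2 powr (g * (real (Suc ?n) - 1)) * 2 powr g"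
          by (simp add: powr_add[symmetric] algebra_simps)
        ultimately show ?thesis using g by (simp del: of_nat_Suc)
      qed
      finally have "C = ?c (Suc ?n)" by (simp add: mult.commute)
      then show ?thesis using C insert.hyps by simp
    qed
  qed
  then show ?thesis using a by blast
qed

subsection \<open>The sampling law and the estimator\<close>

lemma nn_integral_exp_tail:
  assumes "0 < s"
  shows "(\<integral>\<^sup>+t. ennreal (exp (- (s * (t - c))) * of_bool (c < t)) \<partial>lborel) = ennreal (1 / s)"
proof -
  have "(\<integral>\<^sup>+t. ennreal (exp (- (s * (t - c))) * of_bool (c < t)) \<partial>lborel) =
     (\<integral>\<^sup>+t. ennreal (if 0 < t then t powr (1 - 1) * exp (- (s * t)) else 0) \<partial>lborel)"
    by (subst nn_integral_real_affine[where c = 1 and t = c]) (auto intro!: nn_integral_cong)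
  also have "\<dots> = ennreal (Gamma 1 / s powr 1)"
    using assms by (intro nn_integral_powr_exp) auto
  finally show ?thesis using assms by simp
qed

section \<open>The ensemble in terms of the Laguerre weight, and its normalisation\<close>

lemma laguerre_density_eq:
  "laguerre_density n p \<beta> l = laguerre_const n p \<beta> * laguerre_fun {1..n} (\<beta> / 2) (\<beta> * (p - real n + 1) / 2) l"
proof (cases "\<forall>i\<in>{1..n}. 0 < l i")
  case False
  then have "laguerre_fun {1..n} (\<beta> / 2) (\<beta> * (p - real n + 1) / 2) l = 0"
    by (intro laguerre_fun_eq_0) (auto simp: not_less)
  then show ?thesis using False by (auto simp: laguerre_density_def)
next
  case True
  have vand: "(\<Prod>j=1..n. \<Prod>i\<in>{1..<j}. \<bar>l i - l j\<bar> powr \<beta>) = vandermonde_power {1..n} (\<beta> / 2) l" for n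
  proof (induction n)
    case (Suc n)
    have "{1..Suc n} = insert (Suc n) {1..n}" by auto
    then have "vandermonde_power {1..Suc n} (\<beta> / 2) l
        = vandermonde_power {1..n} (\<beta> / 2) l * (\<Prod>i\<in>{1..n}. \<bar>l (Suc n) - l i\<bar> powr (2 * (\<beta> / 2)))"
      by (simp only:) (rule vandermonde_power_insert; simp)
    also have "(\<Prod>i\<in>{1..n}. \<bar>l (Suc n) - l i\<bar> powr (2 * (\<beta> / 2))) = (\<Prod>i\<in>{1..<Suc n}. \<bar>l i - l (Suc n)\<bar> powr \<beta>)"
      by (intro prod.cong) (auto simp: abs_minus_commute)
    finally show ?case using Suc by simp
  qed (simp add: vandermonde_power_def)
  have "(\<Prod>i\<in>{1..n}. laguerre_weight (\<beta> * (p - real n + 1) / 2) (l i)) =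
      (\<Prod>i=1..n. l i powr (\<beta> * (p - real n + 1) / 2 - 1) * exp (- l i / 2))"
    using True by (intro prod.cong refl) (simp only: laguerre_weight_def if_True)
  also have "\<dots> = (\<Prod>i=1..n. l i powr (\<beta> * (p - real n + 1) / 2 - 1)) * exp (- (1 / 2) * (\<Sum>i=1..n. l i))"
    by (simp add: prod.distrib exp_sum[symmetric] sum_distrib_left sum_negf sum_divide_distrib)
  finally show ?thesis
    unfolding laguerre_density_def laguerre_fun_def vand if_P[OF True] by (simp only: mult_ac)
qed

lemma laguerre_const_pos:
  assumes "0 < \<beta>" "real n \<le> p"
  shows "0 < laguerre_const n p \<beta>"
  unfolding laguerre_const_def
proof (rule mult_pos_pos)
  show "0 < (\<Prod>j = 1..n. Gamma (1 + \<beta> / 2) / (Gamma (1 + \<beta> / 2 * real j)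
      * Gamma (\<beta> / 2 * (p - real n + real j))))"
  proof (rule prod_pos)
    fix j assume "j \<in> {1..n}"
    then have "0 < p - real n + real j" using assms by auto
    then have "0 < \<beta> / 2 * (p - real n + real j)" "0 < 1 + \<beta> / 2 * real j" "0 < 1 + \<beta> / 2"
      using assms by (auto simp: add_pos_nonneg)
    then show "0 < Gamma (1 + \<beta> / 2) / (Gamma (1 + \<beta> / 2 * real j) * Gamma (\<beta> / 2 * (p - real n + real j)))"
      by (intro divide_pos_pos mult_pos_pos[of "Gamma _"] Gamma_real_pos)
  qed
qed simp

text \<open>With a = \<beta> (p - n + 1) / 2 and g = \<beta> / 2, the exponents of 2 add up to n a +
  g n (n - 1) = \<beta> n p / 2, and the Gamma factors cancel one by one.\<close>

lemma laguerre_const_mult_integral: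
  assumes \<beta>: "0 < \<beta>" and p: "real n \<le> p"
  shows "laguerre_const n p \<beta> * laguerre_integral {1..n} (\<beta> / 2) (\<beta> * (p - real n + 1) / 2) = 1"
proof -
  let ?g = "\<beta> / 2" and ?a = "\<beta> * (p - real n + 1) / 2"
  have a: "0 < ?a" using \<beta> p by auto
  have G0: "Gamma z \<noteq> 0" if "0 < z" for z :: real using Gamma_real_pos[OF that] by linarith
  have gam: "laguerre_gamma n ?g ?a = (\<Prod>j=1..n. 2 powr (?a + ?g * (real j - 1))
      * Gamma (\<beta> / 2 * (p - real n + real j)))"
    unfolding laguerre_gamma_def One_nat_def prod.atLeast1_atMost_eq
  proof (intro prod.cong refl arg_cong2[where f = "(*)"])
    fix j
    show "2 powr (?a + ?g * real j) = 2 powr (?a + ?g * (real (Suc j) - 1))" by simp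
    show "Gamma (?a + ?g * real j) = Gamma (\<beta> / 2 * (p - real n + real (Suc j)))"
      by (rule arg_cong[where f = Gamma]) (simp add: field_simps)
  qed
  have two: "(\<Prod>j=1..k. 2 powr (a + 2 * g * (real j - 1)))
      = (2::real) powr (real k * a + g * real k * (real k - 1))" for k :: nat and a g :: real
  proof (induction k)
    case (Suc k)
    then show ?case by (simp add: powr_add[symmetric] algebra_simps)
  qed simp
  have "laguerre_integral {1..n} ?g ?a = (\<Prod>j=1..n. 2 powr (?g * (real j - 1))
      * Gamma (1 + ?g * real j) / Gamma (1 + ?g)) * laguerre_gamma n ?g ?a"
    using laguerre_selberg_integral[of "{1..n}" ?a ?g] a \<beta> by simp
  also have "\<dots> = (\<Prod>j=1..n. 2 powr (?a + 2 * ?g * (real j - 1)) * (Gamma (1 + ?g * real j)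
      * Gamma (\<beta> / 2 * (p - real n + real j)) / Gamma (1 + ?g)))"
    unfolding gam prod.distrib[symmetric]
  proof (intro prod.cong refl)
    fix j
    have "(2::real) powr (?a + 2 * ?g * (real j - 1))
        = 2 powr (?g * (real j - 1)) * 2 powr (?a + ?g * (real j - 1))"
      by (simp add: powr_add[symmetric] algebra_simps)
    then show "2 powr (?g * (real j - 1)) * Gamma (1 + ?g * real j) / Gamma (1 + ?g)
        * (2 powr (?a + ?g * (real j - 1)) * Gamma (\<beta> / 2 * (p - real n + real j)))
      = 2 powr (?a + 2 * ?g * (real j - 1)) * (Gamma (1 + ?g * real j)
          * Gamma (\<beta> / 2 * (p - real n + real j)) / Gamma (1 + ?g))"
      by (simp only:) simp
  qed
  also have "\<dots> = (\<Prod>j=1..n. 2 powr (?a + 2 * ?g * (real j - 1))) * (\<Prod>j=1..n. Gamma (1 + ?g * real j)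
      * Gamma (\<beta> / 2 * (p - real n + real j)) / Gamma (1 + ?g))"
    by (rule prod.distrib)
  also have "(\<Prod>j=1..n. 2 powr (?a + 2 * ?g * (real j - 1))) = (2::real) powr (\<beta> * real n * p / 2)"
    unfolding two by (rule arg_cong2[where f = "(powr)"]) (auto simp: field_simps)
  finally have int: "laguerre_integral {1..n} ?g ?a = 2 powr (\<beta> * real n * p / 2) *
     (\<Prod>j=1..n. Gamma (1 + ?g * real j) * Gamma (\<beta> / 2 * (p - real n + real j)) / Gamma (1 + ?g))" .
  have "laguerre_const n p \<beta> * laguerre_integral {1..n} ?g ?a
      = (2 powr (- (\<beta> * real n * p / 2)) * 2 powr (\<beta> * real n * p / 2)) *
     ((\<Prod>j=1..n. Gamma (1 + \<beta> / 2) / (Gamma (1 + \<beta> / 2 * real j) * Gamma (\<beta> / 2 * (p - real n + real j)))) *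
      (\<Prod>j=1..n. Gamma (1 + ?g * real j) * Gamma (\<beta> / 2 * (p - real n + real j)) / Gamma (1 + ?g)))"
    unfolding int laguerre_const_def by (simp only: mult_ac)
  also have "(2::real) powr (- (\<beta> * real n * p / 2)) * 2 powr (\<beta> * real n * p / 2) = 1"
    by (simp flip: powr_add)
  also have "((\<Prod>j=1..n. Gamma (1 + \<beta> / 2) / (Gamma (1 + \<beta> / 2 * real j)
      * Gamma (\<beta> / 2 * (p - real n + real j)))) *
      (\<Prod>j=1..n. Gamma (1 + ?g * real j) * Gamma (\<beta> / 2 * (p - real n + real j)) / Gamma (1 + ?g)))
          = (\<Prod>j=1..n. 1)"
    unfolding prod.distrib[symmetric]
  proof (intro prod.cong refl)
    fix j assume "j \<in> {1..n}"
    then have "Gamma (\<beta> / 2 * (p - real n + real j)) \<noteq> 0" "Gamma (1 + \<beta> / 2 * real j) \<noteq> 0"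
        "Gamma (1 + \<beta> / 2) \<noteq> 0"
      using p \<beta> by (auto intro!: G0 mult_pos_pos add_pos_nonneg)
    then show "Gamma (1 + \<beta> / 2) / (Gamma (1 + \<beta> / 2 * real j) * Gamma (\<beta> / 2 * (p - real n + real j))) *
      (Gamma (1 + ?g * real j) * Gamma (\<beta> / 2 * (p - real n + real j)) / Gamma (1 + ?g)) = 1" by simp
  qed
  finally show ?thesis by simp
qed

lemma decreasing_iff_adjacent:
  fixes l :: "nat \<Rightarrow> real"
  shows "(\<forall>i\<in>{1..<n}. l (i + 1) < l i) \<longleftrightarrow> (\<forall>i\<in>{1..n}. \<forall>j\<in>{1..n}. i < j \<longrightarrow> l j < l i)"
proof
  assume *: "\<forall>i\<in>{1..<n}. l (i + 1) < l i"
  have "l (i + Suc k) < l i" if "1 \<le> i" "i + Suc k \<le> n" for i k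
    using that
  proof (induction k)
    case 0
    then show ?case using * by auto
  next
    case (Suc k)
    then have "l (i + Suc k + 1) < l (i + Suc k)" using * by auto
    then show ?case using Suc by auto
  qed
  then show "\<forall>i\<in>{1..n}. \<forall>j\<in>{1..n}. i < j \<longrightarrow> l j < l i"
    by (metis atLeastAtMost_iff less_iff_Suc_add add_Suc_right)
qed auto

lemma ordered_laguerre_density_eq:
  "ordered_laguerre_density n p \<beta> l = fact n * laguerre_const n p \<beta> *
    laguerre_fun {1..n} (\<beta> / 2) (\<beta> * (p - real n + 1) / 2) l * of_bool (\<forall>i\<in>{1..n}. \<forall>j\<in>{1..n}. i < j
        \<longrightarrow> l j < l i)"
  unfolding ordered_laguerre_density_def decreasing_iff_adjacent laguerre_density_eq by simp

lemma ordered_laguerre_density_nonneg: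
  "0 < \<beta> \<Longrightarrow> real n \<le> p \<Longrightarrow> 0 \<le> ordered_laguerre_density n p \<beta> l"
  unfolding ordered_laguerre_density_eq using laguerre_const_pos[of \<beta> n p] by simp

lemma borel_measurable_ordered_laguerre_density [measurable]:
  "ordered_laguerre_density n p \<beta> \<in> borel_measurable (PiM {1..n} (\<lambda>_. lborel))"
proof -
  have [measurable]: "Measurable.pred (PiM {1..n} (\<lambda>_. lborel))
      (\<lambda>x :: nat \<Rightarrow> real. \<forall>i\<in>{1..n}. \<forall>j\<in>{1..n}. i < j \<longrightarrow> x j < x i)"
    by (intro pred_intros_finite pred_intros_imp') (auto intro!: borel_measurable_pred_less
        measurable_component_singleton)
  have [measurable]: "laguerre_fun {1..n} (\<beta> / 2) (\<beta> * (p - real n + 1) / 2)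
      \<in> borel_measurable (PiM {1..n} (\<lambda>_. lborel))"
    by (intro borel_measurable_laguerre_fun) simp
  have "(\<lambda>l. fact n * laguerre_const n p \<beta> *
    laguerre_fun {1..n} (\<beta> / 2) (\<beta> * (p - real n + 1) / 2) l * of_bool (\<forall>i\<in>{1..n}. \<forall>j\<in>{1..n}. i < j
        \<longrightarrow> l j < l i))
     \<in> borel_measurable (PiM {1..n} (\<lambda>_. lborel))" by measurable
  then show ?thesis by (simp only: ordered_laguerre_density_eq[abs_def])
qed

lemma nn_integral_ordered_laguerre_density:
  assumes \<beta>: "0 < \<beta>" and p: "real n \<le> p"
  shows "(\<integral>\<^sup>+l. ennreal (ordered_laguerre_density n p \<beta> l) \<partial>PiM {1..n} (\<lambda>_. lborel)) = 1"
proof -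
  let ?g = "\<beta> / 2" and ?a = "\<beta> * (p - real n + 1) / 2"
  let ?P = "PiM {1..n} (\<lambda>_. lborel :: real measure)"
  let ?O = "\<lambda>l :: nat \<Rightarrow> real. \<forall>i\<in>{1..n}. \<forall>j\<in>{1..n}. i < j \<longrightarrow> l j < l i"
  have a: "0 < ?a" using \<beta> p by auto
  have [measurable]: "Measurable.pred ?P ?O"
    by (intro pred_intros_finite pred_intros_imp') (auto intro!: borel_measurable_pred_less
        measurable_component_singleton)
  have [measurable]: "laguerre_fun {1..n} ?g ?a \<in> borel_measurable ?P"
    by (intro borel_measurable_laguerre_fun) simp
  have c: "0 < laguerre_const n p \<beta>" by (rule laguerre_const_pos[OF \<beta> p])
  have "(\<integral>\<^sup>+l. ennreal (ordered_laguerre_density n p \<beta> l) \<partial>?P) =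
     (\<integral>\<^sup>+l. ennreal (fact n * laguerre_const n p \<beta>) * (ennreal (laguerre_fun {1..n} ?g ?a l)
         * of_bool (?O l)) \<partial>?P)"
    unfolding ordered_laguerre_density_eq using c by (intro nn_integral_cong) (auto simp: ennreal_mult)
  also have "\<dots> = ennreal (fact n * laguerre_const n p \<beta>)
      * (\<integral>\<^sup>+l. ennreal (laguerre_fun {1..n} ?g ?a l) * of_bool (?O l) \<partial>?P)"
    by (rule nn_integral_cmult) measurable
  also have "\<dots> = ennreal (laguerre_const n p \<beta>) * (fact (card {1..n})
      * (\<integral>\<^sup>+l. ennreal (laguerre_fun {1..n} ?g ?a l) * of_bool (?O l) \<partial>?P))"
  proof -
    have "ennreal (fact n) = fact n" by (metis ennreal_of_nat_eq_real_of_nat of_nat_fact)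
    then show ?thesis using c by (simp add: ennreal_mult mult_ac)
  qed
  also have "fact (card {1..n}) * (\<integral>\<^sup>+l. ennreal (laguerre_fun {1..n} ?g ?a l) * of_bool (?O l) \<partial>?P)
      = (\<integral>\<^sup>+l. ennreal (laguerre_fun {1..n} ?g ?a l) \<partial>?P)"
  proof (rule nn_integral_decreasing[symmetric])
    show "exchangeable_on {1..n} (\<lambda>l. ennreal (laguerre_fun {1..n} ?g ?a l))"
      using exchangeable_on_laguerre_fun[of "{1..n}" ?g ?a] unfolding exchangeable_on_def by simp
    show "vanishes_on_ties {1..n} (\<lambda>l. ennreal (laguerre_fun {1..n} ?g ?a l))"
      using vanishes_on_ties_laguerre_fun[of "{1..n}" ?g ?a] unfolding vanishes_on_ties_def by simp
  qed auto
  also have "\<dots> = ennreal (laguerre_integral {1..n} ?g ?a)"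
    using a \<beta> by (intro nn_integral_laguerre_fun) auto
  also have "ennreal (laguerre_const n p \<beta>) * \<dots> = 1"
    using laguerre_const_mult_integral[OF \<beta> p] c by (simp flip: ennreal_mult')
  finally show ?thesis .
qed

text \<open>Prepends the top eigenvalue t to the lower eigenvalues l, which are again numbered from
  1; the restriction keeps the result a point of the product space.\<close>

definition cons_fun :: "nat \<Rightarrow> real \<Rightarrow> (nat \<Rightarrow> real) \<Rightarrow> nat \<Rightarrow> real" where
  "cons_fun m t l = (\<lambda>i\<in>{1..Suc m}. if i = 1 then t else l (i - 1))"

lemma nn_integral_cons_fun:
  assumes [measurable]: "F \<in> borel_measurable (PiM {1..Suc m} (\<lambda>_. lborel))"
  shows "(\<integral>\<^sup>+l. F l \<partial>PiM {1..Suc m} (\<lambda>_. lborel)) =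
    (\<integral>\<^sup>+l. (\<integral>\<^sup>+t. F (cons_fun m t l) \<partial>lborel) \<partial>PiM {1..m} (\<lambda>_. lborel))"
proof -
  have eq: "{1..Suc m} = insert 1 {2..Suc m}" by auto
  have F [measurable]: "F \<in> borel_measurable (PiM (insert 1 {2..Suc m}) (\<lambda>_. lborel))"
    using assms unfolding eq .
  have "(\<integral>\<^sup>+l. F l \<partial>PiM {1..Suc m} (\<lambda>_. lborel)) = (\<integral>\<^sup>+l. (\<integral>\<^sup>+t. F (l(1 := t)) \<partial>lborel) \<partial>PiM {2..Suc
      m} (\<lambda>_. lborel))"
    unfolding eq by (rule lebesgue_product.product_nn_integral_insert[OF _ _ F]) auto
  also have "\<dots> = (\<integral>\<^sup>+l. (\<integral>\<^sup>+t. F ((\<lambda>i\<in>{2..Suc m}. l (i - 1))(1 := t)) \<partial>lborel) \<partial>PiM {1..m} (\<lambda>_. lborel))"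
  proof (rule nn_integral_PiM_lborel_reindex[symmetric])
    show "bij_betw (\<lambda>i. i - 1) {2..Suc m} {1..m}"
      by (rule bij_betw_byWitness[where f' = Suc]) auto
    show "(\<lambda>l. \<integral>\<^sup>+t. F (l(1 := t)) \<partial>lborel) \<in> borel_measurable (PiM {2..Suc m} (\<lambda>_. lborel))"
      by measurable
  qed simp
  also have "\<dots> = (\<integral>\<^sup>+l. (\<integral>\<^sup>+t. F (cons_fun m t l) \<partial>lborel) \<partial>PiM {1..m} (\<lambda>_. lborel))"
  proof -
    have "(\<lambda>i\<in>{2..Suc m}. l (i - 1))(1 := t) = cons_fun m t l" for l t
      by (auto simp: cons_fun_def fun_eq_iff restrict_def)
    then show ?thesis by (simp only:)
  qed
  finally show ?thesis .
qed


lemma laguerre_fun_cons_fun: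
  "laguerre_fun {1..Suc m} g a (cons_fun m t l) =
    laguerre_weight a t * (\<Prod>i=1..m. \<bar>t - l i\<bar> powr (2 * g)) * laguerre_fun {1..m} g a l"
proof -
  let ?c = "cons_fun m t l"
  have eq: "{1..Suc m} = insert 1 {2..Suc m}" by auto
  have bij: "bij_betw Suc {1..m} {2..Suc m}"
    by (rule bij_betw_byWitness[where f' = "\<lambda>i. i - 1"]) auto
  have c: "?c 1 = t" "\<And>i. i \<in> {1..m} \<Longrightarrow> ?c (Suc i) = l i" by (auto simp: cons_fun_def)
  have "laguerre_fun {1..Suc m} g a ?c = laguerre_weight a (?c 1) * (\<Prod>i\<in>{2..Suc m}. \<bar>?c 1
      - ?c i\<bar> powr (2 * g)) * laguerre_fun {2..Suc m} g a ?c"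
    unfolding eq by (rule laguerre_fun_insert) auto
  also have "(\<Prod>i\<in>{2..Suc m}. \<bar>?c 1 - ?c i\<bar> powr (2 * g)) = (\<Prod>i\<in>{1..m}. \<bar>?c 1 - ?c (Suc i)\<bar> powr (2 * g))"
    by (rule prod.reindex_bij_betw[OF bij, symmetric])
  also have "\<dots> = (\<Prod>i=1..m. \<bar>t - l i\<bar> powr (2 * g))"
    unfolding c(1) by (intro prod.cong refl) (simp add: c(2))
  also have "laguerre_fun {2..Suc m} g a ?c = laguerre_fun {1..m} g a (\<lambda>i. ?c (Suc i))"
    by (rule laguerre_fun_reindex[OF bij, symmetric])
  also have "\<dots> = laguerre_fun {1..m} g a l"
    by (rule laguerre_fun_cong) (rule c(2))
  finally show ?thesis unfolding c(1) .
qed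

text \<open>Here m counts the eigenvalues below the top one, and there is at least one, since the
  sampling density refers to the second largest. The level x is a parameter, so the tail estimates
  can also be instantiated at other levels above \<beta>.\<close>

locale laguerre_sampling =
  fixes \<beta> x p :: real and n m :: nat
  assumes \<beta>: "0 < \<beta>" and x: "\<beta> < x" and n: "n = Suc m" and m: "1 \<le> m" and p: "real n \<le> p"
begin

text \<open>Written as 1 / 2 - \<beta> / (2 * x), this is the limit of 1 / 2 - \<alpha> / (p * x),
  the decay rate of t powr \<alpha> * exp (- t / 2) at t = p * x.\<close>

definition \<rho> :: real where "\<rho> = (x - \<beta>) / (2 * x)"
definition \<alpha> :: real where "\<alpha> = \<beta> * (p - real n + 1) / 2 - 1"
definition K :: real where "K = real n * (laguerre_const n p \<beta> / laguerre_const m (p - 1) \<beta>)"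
definition w :: "(nat \<Rightarrow> real) \<Rightarrow> real" where "w = ordered_laguerre_density m (p - 1) \<beta>"

abbreviation "Pm \<equiv> PiM {1..m} (\<lambda>_. lborel :: real measure)"
abbreviation "Pn \<equiv> PiM {1..n} (\<lambda>_. lborel :: real measure)"
abbreviation "P \<equiv> ordered_laguerre_law n p \<beta>"
abbreviation "Q \<equiv> sampling_law n p \<beta> x"
abbreviation "L \<equiv> is_estimator n p \<beta> x"
abbreviation "\<theta> \<equiv> tail_prob n p \<beta> x"
abbreviation "q \<equiv> \<lambda>l. ordered_laguerre_density (n - 1) (p - 1) \<beta> (\<lambda>i. l (i + 1))
    * top_density p \<beta> x (l 2) (l 1)"

lemma \<rho>_bounds: "0 < \<rho>" "\<rho> = 1 / 2 - \<beta> / (2 * x)" "\<rho> < 1 / 2"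
  using \<beta> x by (auto simp: \<rho>_def field_simps)

lemma p_pos: "1 < p" "0 < p * x" "real m \<le> p - 1"
  using n m p \<beta> x by auto

lemma K_pos: "0 < K"
  unfolding K_def using n p by (auto intro!: mult_pos_pos divide_pos_pos laguerre_const_pos \<beta>)

lemma w_nonneg: "0 \<le> w l"
  unfolding w_def using p_pos by (intro ordered_laguerre_density_nonneg \<beta>)

lemma w_eq: "w l = fact m * laguerre_const m (p - 1) \<beta> * laguerre_fun {1..m} (\<beta> / 2) (\<alpha> + 1) l *
    of_bool (\<forall>i\<in>{1..m}. \<forall>j\<in>{1..m}. i < j \<longrightarrow> l j < l i)"
  unfolding w_def ordered_laguerre_density_eq \<alpha>_def using n by simp

lemma w_cong: "(\<And>i. i \<in> {1..m} \<Longrightarrow> l i = l' i) \<Longrightarrow> w l = w l'"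
  using laguerre_fun_cong[of "{1..m}" l l'] unfolding w_eq by (auto intro!: arg_cong[where f = of_bool])

lemma w_neq_0D:
  assumes "w l \<noteq> 0" "i \<in> {1..m}"
  shows "0 < l i" "l i \<le> l 1"
proof -
  show "0 < l i" using assms laguerre_fun_eq_0[of "{1..m}" l "\<beta> / 2" "\<alpha> + 1"] unfolding w_eq by force
  show "l i \<le> l 1"
  proof (cases "i = 1")
    case False
    then show ?thesis using assms unfolding w_eq by (auto simp: less_imp_le)
  qed simp
qed

lemma measurable_w [measurable]: "w \<in> borel_measurable Pm"
  unfolding w_def by measurable

lemma nn_integral_w: "(\<integral>\<^sup>+l. ennreal (w l) \<partial>Pm) = 1"
  unfolding w_def using p_pos by (intro nn_integral_ordered_laguerre_density \<beta>)

lemma top_density_eq: "top_density p \<beta> x s t = \<rho> * exp (- (\<rho> * (t - max (p * x) s)))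
    * of_bool (max (p * x) s < t)"
  unfolding top_density_def \<rho>_def by simp

lemma component_measurable: "i \<in> {1..k} \<Longrightarrow> (\<lambda>l. l i)
    \<in> borel_measurable (PiM {1..k} (\<lambda>_. lborel :: real measure))"
  using measurable_component_singleton[of i "{1..k}" "\<lambda>_. lborel"] by simp

lemma measurable_q [measurable]: "q \<in> borel_measurable Pn"
proof -
  have "(\<lambda>l. \<lambda>i\<in>{1..m}. l (Suc i)) \<in> measurable Pn Pm"
    by (intro measurable_PiM_lborel_reindex) (auto simp: n)
  then have "(\<lambda>l. w (\<lambda>i\<in>{1..m}. l (Suc i))) \<in> borel_measurable Pn"
    by (rule measurable_compose) measurable
  also have "(\<lambda>l. w (\<lambda>i\<in>{1..m}. l (Suc i))) = (\<lambda>l. ordered_laguerre_density (n - 1) (p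
      - 1) \<beta> (\<lambda>i. l (i + 1)))"
    unfolding n by (auto simp flip: w_def intro!: w_cong)
  finally have [measurable]: "(\<lambda>l. ordered_laguerre_density (n - 1) (p - 1) \<beta> (\<lambda>i. l (i + 1)))
      \<in> borel_measurable Pn" .
  have [measurable]: "(\<lambda>l. l 1) \<in> borel_measurable Pn" "(\<lambda>l. l 2) \<in> borel_measurable Pn"
    by (intro component_measurable; use n m in simp)+
  show ?thesis unfolding top_density_eq by measurable
qed

lemma measurable_L [measurable]: "L \<in> borel_measurable Pn"
proof -
  have [measurable]: "(\<lambda>l. l i) \<in> borel_measurable Pn" if "i \<in> {1..n}" for i
    using that by (rule component_measurable)
  have [measurable]: "(\<lambda>l. l 1) \<in> borel_measurable Pn" "(\<lambda>l. l 2) \<in> borel_measurable Pn"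
    by (intro component_measurable; use n m in simp)+
  have [measurable]: "(\<lambda>l. \<Prod>i=2..n. (l 1 - l i) powr \<beta>) \<in> borel_measurable Pn"
  proof (rule borel_measurable_prod)
    fix i assume "i \<in> {2..n}"
    then have [measurable]: "(\<lambda>l. l i) \<in> borel_measurable Pn" by (intro component_measurable) auto
    show "(\<lambda>l. (l 1 - l i) powr \<beta>) \<in> borel_measurable Pn" by measurable
  qed
  show ?thesis unfolding is_estimator_def by measurable
qed

lemma q_nonneg: "0 \<le> q l"
  using ordered_laguerre_density_nonneg[OF \<beta>, of m "p - 1"] p_pos n \<rho>_bounds
  by (simp add: top_density_eq)

lemma q_cons_fun: "q (cons_fun m t l) = w l * top_density p \<beta> x (l 1) t"
proof -
  have "w (\<lambda>i. cons_fun m t l (i + 1)) = w l" by (rule w_cong) (auto simp: cons_fun_def)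
  moreover have "cons_fun m t l 1 = t" "cons_fun m t l 2 = l 1" using m by (auto simp: cons_fun_def)
  ultimately show ?thesis using n by (simp add: w_def)
qed

lemma L_cons_fun: "L (cons_fun m t l) =
  K * (\<Prod>i=1..m. (t - l i) powr \<beta>) * t powr \<alpha> * exp (- (1 / 2) * t)
      / (\<rho> * exp (- (\<rho> * (t - max (p * x) (l 1)))))"
proof -
  let ?c = "cons_fun m t l"
  have c: "?c 1 = t" "?c 2 = l 1" using m by (auto simp: cons_fun_def)
  have "(\<Prod>i=2..n. (?c 1 - ?c i) powr \<beta>) = (\<Prod>i=1..m. (t - l i) powr \<beta>)"
    unfolding c n by (rule prod.reindex_bij_witness[where i = Suc and j
        = "\<lambda>i. i - 1"]) (auto simp: cons_fun_def)
  then show ?thesis unfolding is_estimator_def c K_def \<alpha>_def \<rho>_def using n by simp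
qed

lemma L_nonneg: "0 \<le> L l"
proof -
  have "L l = (K * (\<Prod>i=2..n. (l 1 - l i) powr \<beta>) * l 1 powr \<alpha> * exp (- (1 / 2) * l 1)) /
     (\<rho> * exp (- \<rho> * (l 1 - max (p * x) (l 2))))"
    unfolding is_estimator_def K_def \<rho>_def \<alpha>_def using n by simp
  also have "0 \<le> \<dots>"
    using K_pos \<rho>_bounds(1) by (intro divide_nonneg_nonneg mult_nonneg_nonneg prod_nonneg)
        (auto simp: less_imp_le)
  finally show ?thesis .
qed

text \<open>The pairs (n, p) and (n - 1, p - 1) have the same p - n, hence the same exponent
  \<alpha> in the weight. So the density of the lower eigenvalues splits off unchanged, and the
  constants combine to \<open>K\<close>.\<close>

lemma ordered_density_cons_fun:
  "ordered_laguerre_density n p \<beta> (cons_fun m t l) =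
    K * w l * (\<Prod>i=1..m. \<bar>t - l i\<bar> powr \<beta>) * laguerre_weight (\<alpha> + 1) t * of_bool (l 1 < t)"
proof -
  let ?c = "cons_fun m t l"
  have ord: "(\<forall>i\<in>{1..n}. \<forall>j\<in>{1..n}. i < j \<longrightarrow> ?c j < ?c i) \<longleftrightarrow> l 1 < t \<and> (\<forall>i\<in>{1..m}. \<forall>j\<in>{1..m}. i < j
      \<longrightarrow> l j < l i)"
    (is "?O \<longleftrightarrow> _ \<and> ?o")
  proof -
    have "?O \<longleftrightarrow> (\<forall>i\<in>{1..<n}. ?c (i + 1) < ?c i)" by (simp only: decreasing_iff_adjacent)
    also have "\<dots> \<longleftrightarrow> l 1 < t \<and> (\<forall>i\<in>{1..<m}. l (i + 1) < l i)"
    proof (intro iffI conjI ballI)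
      assume *: "\<forall>i\<in>{1..<n}. ?c (i + 1) < ?c i"
      show "l 1 < t" using *[rule_format, of 1] n m by (simp add: cons_fun_def)
      fix i assume i: "i \<in> {1..<m}"
      then show "l (i + 1) < l i" using *[rule_format, of "Suc i"] n by (simp add: cons_fun_def)
    next
      fix i assume *: "l 1 < t \<and> (\<forall>i\<in>{1..<m}. l (i + 1) < l i)" and i: "i \<in> {1..<n}"
      show "?c (i + 1) < ?c i"
      proof (cases "i = 1")
        case False
        then obtain k where "i = Suc k" "k \<in> {1..<m}" using i n by (cases i) auto
        then show ?thesis using * by (simp add: cons_fun_def)
      qed (use * m in \<open>simp add: cons_fun_def\<close>)
    qed
    also have "(\<forall>i\<in>{1..<m}. l (i + 1) < l i) \<longleftrightarrow> ?o" by (rule decreasing_iff_adjacent)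
    finally show ?thesis .
  qed
  have g: "ordered_laguerre_density n p \<beta> ?c = fact n * laguerre_const n p \<beta> *
      (laguerre_weight (\<alpha> + 1) t * (\<Prod>i=1..m. \<bar>t - l i\<bar> powr \<beta>) * laguerre_fun {1..m} (\<beta> / 2) (\<alpha>
          + 1) l) * of_bool (l 1 < t \<and> ?o)"
  proof -
    have "\<beta> * (p - real n + 1) / 2 = \<alpha> + 1" by (simp add: \<alpha>_def)
    moreover have "laguerre_fun {1..n} (\<beta> / 2) (\<alpha> + 1) ?c =
        laguerre_weight (\<alpha> + 1) t * (\<Prod>i=1..m. \<bar>t - l i\<bar> powr \<beta>) * laguerre_fun {1..m} (\<beta> / 2) (\<alpha> + 1) l"
      using laguerre_fun_cons_fun[of m "\<beta> / 2" "\<alpha> + 1" t l] unfolding n by simp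
    ultimately show ?thesis unfolding ordered_laguerre_density_eq ord by (simp only:)
  qed
  have "laguerre_const m (p - 1) \<beta> \<noteq> 0" using laguerre_const_pos[OF \<beta>, of m "p - 1"] p_pos by simp
  then show ?thesis unfolding g w_eq K_def by (cases ?o; cases "l 1 < t") (simp_all add: n)
qed

text \<open>The estimator is the likelihood ratio of P, restricted to the rare event, against Q.
  Where q is positive, t exceeds every l i, so the absolute values of the Vandermonde factor drop
  out; everywhere else both sides vanish.\<close>

lemma L_q_cons_fun: "L (cons_fun m t l) * q (cons_fun m t l)
    = ordered_laguerre_density n p \<beta> (cons_fun m t l) * of_bool (p * x < t)"
proof (cases "max (p * x) (l 1) < t \<and> w l \<noteq> 0")
  case False
  then consider "t \<le> p * x" | "t \<le> l 1" | "w l = 0" by force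
  then show ?thesis
  proof cases
    case 1
    then show ?thesis unfolding q_cons_fun unfolding top_density_eq by auto
  next
    case 2
    then show ?thesis unfolding q_cons_fun unfolding top_density_eq ordered_density_cons_fun by auto
  next
    case 3
    then show ?thesis unfolding q_cons_fun ordered_density_cons_fun by auto
  qed
next
  case True
  then have t: "0 < t" "l 1 < t" "p * x < t" "max (p * x) (l 1) < t" using p_pos by auto
  have pr: "(\<Prod>i=1..m. (t - l i) powr \<beta>) = (\<Prod>i=1..m. \<bar>t - l i\<bar> powr \<beta>)"
  proof (intro prod.cong refl)
    fix i assume i: "i \<in> {1..m}"
    then have "l i \<le> l 1" using w_neq_0D(2)[of l i] True by auto
    then show "(t - l i) powr \<beta> = \<bar>t - l i\<bar> powr \<beta>" using t by simp
  qed
  have lw: "laguerre_weight (\<alpha> + 1) t = t powr \<alpha> * exp (- (1 / 2) * t)" using t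
      by (simp add: laguerre_weight_def)
  have td: "top_density p \<beta> x (l 1) t = \<rho> * exp (- (\<rho> * (t - max (p * x) (l 1))))"
      unfolding top_density_eq using t by simp
  have "L (cons_fun m t l) * q (cons_fun m t l) = K * (\<Prod>i=1..m. \<bar>t - l i\<bar> powr \<beta>)
      * laguerre_weight (\<alpha> + 1) t * w l"
    unfolding L_cons_fun q_cons_fun td pr lw using \<rho>_bounds(1) by simp
  then show ?thesis unfolding ordered_density_cons_fun using t by simp
qed


lemma space_Pn_cons_fun:
  assumes "l \<in> space Pn"
  shows "cons_fun m (l 1) (\<lambda>i\<in>{1..m}. l (i + 1)) = l"
  using assms unfolding cons_fun_def n by (auto simp: fun_eq_iff space_PiM PiE_iff extensional_def
      restrict_def)

lemma L_q: "l \<in> space Pn \<Longrightarrow> L l * q l = ordered_laguerre_density n p \<beta> l * of_bool (p * x < l 1)"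
  using L_q_cons_fun[of "l 1" "\<lambda>i\<in>{1..m}. l (i + 1)"] by (simp only: space_Pn_cons_fun)

lemma nn_integral_Pn:
  assumes "F \<in> borel_measurable Pn"
  shows "(\<integral>\<^sup>+l. F l \<partial>Pn) = (\<integral>\<^sup>+l. (\<integral>\<^sup>+t. F (cons_fun m t l) \<partial>lborel) \<partial>Pm)"
  using nn_integral_cons_fun[of F m] assms unfolding n .

lemma nn_integral_Q:
  assumes [measurable]: "F \<in> borel_measurable Pn"
  shows "(\<integral>\<^sup>+l. F l \<partial>Q) = (\<integral>\<^sup>+l. (\<integral>\<^sup>+t. ennreal (w l * top_density p \<beta> x (l 1) t)
      * F (cons_fun m t l) \<partial>lborel) \<partial>Pm)"
proof -
  have "(\<integral>\<^sup>+l. F l \<partial>Q) = (\<integral>\<^sup>+l. ennreal (q l) * F l \<partial>Pn)"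
    unfolding sampling_law_def by (rule nn_integral_density) measurable
  also have "\<dots> = (\<integral>\<^sup>+l. (\<integral>\<^sup>+t. ennreal (q (cons_fun m t l)) * F (cons_fun m t l) \<partial>lborel) \<partial>Pm)"
    by (rule nn_integral_Pn) measurable
  finally show ?thesis unfolding q_cons_fun .
qed

lemma nn_integral_top_density: "(\<integral>\<^sup>+t. ennreal (top_density p \<beta> x s t) \<partial>lborel) = 1"
proof -
  have "(\<integral>\<^sup>+t. ennreal (top_density p \<beta> x s t) \<partial>lborel) =
      (\<integral>\<^sup>+t. ennreal \<rho> * ennreal (exp (- (\<rho> * (t - max (p * x) s))) * of_bool (max (p * x) s < t)) \<partial>lborel)"
    using \<rho>_bounds(1) unfolding top_density_eq by (intro nn_integral_cong) (auto simp: ennreal_mult)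
  also have "\<dots> = ennreal \<rho> * ennreal (1 / \<rho>)"
    using \<rho>_bounds(1) by (subst nn_integral_cmult) (auto simp: nn_integral_exp_tail simp del:
        max_less_iff_conj)
  also have "\<dots> = 1" using \<rho>_bounds(1) by (simp flip: ennreal_mult)
  finally show ?thesis .
qed

lemma prob_space_Q: "prob_space Q"
proof (rule prob_spaceI)
  have "emeasure Q (space Q) = (\<integral>\<^sup>+l. 1 \<partial>Q)" by simp
  also have "\<dots> = (\<integral>\<^sup>+l. ennreal (w l) * (\<integral>\<^sup>+t. ennreal (top_density p \<beta> x (l 1) t) \<partial>lborel) \<partial>Pm)"
    unfolding nn_integral_Q[OF borel_measurable_const]
  proof (rule nn_integral_cong)
    fix l :: "nat \<Rightarrow> real"
    have [measurable]: "top_density p \<beta> x (l 1) \<in> borel_measurable lborel" unfolding top_density_eq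
        by measurable
    have "(\<integral>\<^sup>+t. ennreal (w l * top_density p \<beta> x (l 1) t) * 1 \<partial>lborel)
        = (\<integral>\<^sup>+t. ennreal (w l) * ennreal (top_density p \<beta> x (l 1) t) \<partial>lborel)"
      using w_nonneg \<rho>_bounds(1) unfolding top_density_eq by (simp add: ennreal_mult)
    also have "\<dots> = ennreal (w l) * (\<integral>\<^sup>+t. ennreal (top_density p \<beta> x (l 1) t) \<partial>lborel)"
      by (rule nn_integral_cmult) measurable
    finally show "(\<integral>\<^sup>+t. ennreal (w l * top_density p \<beta> x (l 1) t) * 1 \<partial>lborel) = \<dots>" .
  qed
  also have "\<dots> = 1" unfolding nn_integral_top_density by (simp only: mult_1_right nn_integral_w)
  finally show "emeasure Q (space Q) = 1" .
qed

lemma sets_PQ [simp, measurable_cong]: "sets P = sets Pn" "sets Q = sets Pn" "space P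
    = space Pn" "space Q = space Pn"
  by (auto simp: ordered_laguerre_law_def sampling_law_def)

lemma prob_space_P: "prob_space P"
proof (rule prob_spaceI)
  have "emeasure P (space P) = (\<integral>\<^sup>+l. 1 \<partial>P)" by simp
  also have "\<dots> = (\<integral>\<^sup>+l. ennreal (ordered_laguerre_density n p \<beta> l) * 1 \<partial>Pn)"
    unfolding ordered_laguerre_law_def by (rule nn_integral_density) measurable
  also have "\<dots> = 1" using nn_integral_ordered_laguerre_density[OF \<beta> p] by (simp only: mult_1_right)
  finally show "emeasure P (space P) = 1" .
qed

lemma measurable_comp1 [measurable]: "(\<lambda>l. l 1) \<in> borel_measurable Pn"
  using n by (intro component_measurable) simp

section \<open>Change of measure, unbiasedness and total variation\<close>

lemma nn_integral_L_indicator: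
  assumes A [measurable]: "A \<in> sets Pn"
  shows "(\<integral>\<^sup>+l. ennreal (L l) * indicator A l \<partial>Q) = emeasure P {l\<in>space Pn. l \<in> A \<and> p * x < l 1}"
proof -
  have "(\<integral>\<^sup>+l. ennreal (L l) * indicator A l \<partial>Q) = (\<integral>\<^sup>+l. ennreal (q l)
      * (ennreal (L l) * indicator A l) \<partial>Pn)"
    unfolding sampling_law_def by (rule nn_integral_density) measurable
  also have "\<dots> = (\<integral>\<^sup>+l. ennreal (ordered_laguerre_density n p \<beta> l) * indicator {l\<in>space Pn. l
      \<in> A \<and> p * x < l 1} l \<partial>Pn)"
  proof (rule nn_integral_cong)
    fix l assume l: "l \<in> space Pn"
    have "ennreal (q l) * (ennreal (L l) * indicator A l) = ennreal (L l * q l) * indicator A l"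
      using L_nonneg[of l] q_nonneg[of l] by (simp add: ennreal_mult mult_ac)
    then show "ennreal (q l) * (ennreal (L l) * indicator A l)
        = ennreal (ordered_laguerre_density n p \<beta> l) * indicator {l\<in>space Pn. l \<in> A \<and> p * x < l 1} l"
      unfolding L_q[OF l] using l by (auto simp: indicator_def)
  qed
  also have "\<dots> = emeasure P {l\<in>space Pn. l \<in> A \<and> p * x < l 1}"
    unfolding ordered_laguerre_law_def by (rule emeasure_density[symmetric]) measurable
  finally show ?thesis .
qed

lemma \<theta>_eq: "\<theta> = measure P {l\<in>space Pn. p * x < l 1}"
  unfolding tail_prob_def by simp

lemma nn_integral_L: "(\<integral>\<^sup>+l. ennreal (L l) \<partial>Q) = ennreal \<theta>"
proof -
  interpret P: prob_space P by (rule prob_space_P)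
  have "(\<integral>\<^sup>+l. ennreal (L l) \<partial>Q) = (\<integral>\<^sup>+l. ennreal (L l) * indicator (space Pn) l \<partial>Q)"
    by (intro nn_integral_cong) simp
  also have "\<dots> = emeasure P {l\<in>space Pn. l \<in> space Pn \<and> p * x < l 1}"
    by (rule nn_integral_L_indicator) simp
  also have "{l\<in>space Pn. l \<in> space Pn \<and> p * x < l 1} = {l\<in>space Pn. p * x < l 1}" by auto
  finally show ?thesis unfolding \<theta>_eq P.emeasure_eq_measure .
qed

lemma unbiased: "unbiased_estimator Q L \<theta>"
  unfolding unbiased_estimator_def
  using nn_integral_L L_nonneg \<theta>_eq
  by (auto intro!: integrableI_nn_integral_finite[of _ _ \<theta>] integral_eq_nn_integral[THEN trans]
      simp: measure_nonneg)

text \<open>The relative error of the estimator dominates the distance between the sampling law and the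
  conditional law, because their densities differ by the factor \<open>L / \<theta>\<close>.\<close>

lemma total_variation_le:
  assumes A: "A \<in> sets Pn" and \<theta>: "0 < \<theta>" and int: "integrable Q (\<lambda>l. (L l)\<^sup>2)"
  shows "\<bar>measure Q A - cond_prob P (\<lambda>l. l \<in> A) (\<lambda>l. l 1 > p * x)\<bar> \<le> sqrt ((\<integral>l. (L l)\<^sup>2 \<partial>Q) / \<theta>\<^sup>2 - 1)"
proof -
  interpret Q: prob_space Q by (rule prob_space_Q)
  interpret P: prob_space P by (rule prob_space_P)
  have AQ [measurable]: "A \<in> sets Q" using A unfolding sets_PQ .
  have iL: "integrable Q L" "(\<integral>l. L l \<partial>Q) = \<theta>" using unbiased by (auto simp: unbiased_estimator_def)
  have iLA: "integrable Q (\<lambda>l. L l * indicator A l)"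
    by (rule integrable_real_mult_indicator[OF AQ iL(1)])
  have "ennreal (\<integral>l. L l * indicator A l \<partial>Q) = (\<integral>\<^sup>+l. ennreal (L l * indicator A l) \<partial>Q)"
    using L_nonneg by (intro nn_integral_eq_integral[symmetric] iLA) auto
  also have "\<dots> = (\<integral>\<^sup>+l. ennreal (L l) * indicator A l \<partial>Q)"
    by (intro nn_integral_cong) (auto simp: indicator_def)
  also have "\<dots> = ennreal (measure P {l\<in>space Pn. l \<in> A \<and> p * x < l 1})"
    using nn_integral_L_indicator[OF A] by (simp add: P.emeasure_eq_measure)
  finally have LA: "(\<integral>l. L l * indicator A l \<partial>Q) = measure P {l\<in>space Pn. l \<in> A \<and> p * x < l 1}"
    using L_nonneg by (subst (asm) ennreal_inj) (auto intro!: integral_nonneg_AE)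
  have cp: "cond_prob P (\<lambda>l. l \<in> A) (\<lambda>l. l 1 > p * x) = (\<integral>l. L l * indicator A l \<partial>Q) / \<theta>"
    unfolding cond_prob_def LA \<theta>_eq by simp
  let ?d = "\<lambda>l. 1 - L l / \<theta>"
  have id: "integrable Q ?d" using iL by auto
  have id2: "integrable Q (\<lambda>l. (?d l)\<^sup>2)"
    using iL int by (simp add: power2_diff power_divide)
  have "measure Q A - cond_prob P (\<lambda>l. l \<in> A) (\<lambda>l. l 1 > p * x)
      = (\<integral>l. indicator A l - L l * indicator A l / \<theta> \<partial>Q)"
  proof -
    have iA: "integrable Q (indicator A :: _ \<Rightarrow> real)"
      using AQ Q.emeasure_finite[of A] by (intro integrable_real_indicator) (simp_all only: less_top
          infinity_ennreal_def)
    have mA: "(\<integral>l. indicator A l \<partial>Q) = measure Q A"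
      unfolding Bochner_Integration.integral_indicator Int_absorb2[OF sets.sets_into_space[OF AQ]] ..
    show ?thesis
      unfolding cp mA[symmetric] using iA iLA by (subst Bochner_Integration.integral_diff) simp_all
  qed
  also have "\<dots> = (\<integral>l. ?d l * indicator A l \<partial>Q)"
    by (intro Bochner_Integration.integral_cong) (auto simp: indicator_def)
  finally have "\<bar>measure Q A - cond_prob P (\<lambda>l. l \<in> A) (\<lambda>l. l 1 > p * x)\<bar> \<le> (\<integral>l. \<bar>?d l * indicator A l\<bar> \<partial>Q)"
    by (simp only: integral_abs_bound)
  also have "\<dots> \<le> (\<integral>l. \<bar>?d l\<bar> \<partial>Q)"
  proof (rule integral_mono)
    show "integrable Q (\<lambda>l. \<bar>?d l * indicator A l\<bar>)"
      by (intro integrable_abs integrable_real_mult_indicator[OF AQ id])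
  qed (use id in \<open>auto simp: indicator_def\<close>)
  also have "\<dots> \<le> sqrt (\<integral>l. (?d l)\<^sup>2 \<partial>Q)"
  proof (rule real_le_rsqrt)
    \<comment> \<open>The Cauchy-Schwarz inequality on a probability space, as nonnegativity of a
      variance.\<close>
    have "0 \<le> Q.variance (\<lambda>l. \<bar>?d l\<bar>)" by simp
    also have "Q.variance (\<lambda>l. \<bar>?d l\<bar>) = (\<integral>l. \<bar>?d l\<bar>\<^sup>2 \<partial>Q) - (\<integral>l. \<bar>?d l\<bar> \<partial>Q)\<^sup>2"
      using id id2 by (intro Q.variance_eq) auto
    finally show "(\<integral>l. \<bar>?d l\<bar> \<partial>Q)\<^sup>2 \<le> (\<integral>l. (?d l)\<^sup>2 \<partial>Q)" by simp
  qed
  also have "(\<integral>l. (?d l)\<^sup>2 \<partial>Q) = (\<integral>l. 1 - 2 * L l / \<theta> + (L l)\<^sup>2 / \<theta>\<^sup>2 \<partial>Q)"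
    by (rule Bochner_Integration.integral_cong[OF refl]) (simp add: power2_diff power_divide algebra_simps)
  also have "\<dots> = (\<integral>l. (L l)\<^sup>2 \<partial>Q) / \<theta>\<^sup>2 - 1"
    using iL int \<theta> Q.prob_space by simp
  finally show ?thesis .
qed

lemma second_moment_ge:
  assumes int: "integrable Q (\<lambda>l. (L l)\<^sup>2)"
  shows "\<theta>\<^sup>2 \<le> (\<integral>l. (L l)\<^sup>2 \<partial>Q)"
proof -
  interpret Q: prob_space Q by (rule prob_space_Q)
  have iL: "integrable Q L" "(\<integral>l. L l \<partial>Q) = \<theta>" using unbiased by (auto simp: unbiased_estimator_def)
  have "0 \<le> Q.variance L" by simp
  also have "Q.variance L = (\<integral>l. (L l)\<^sup>2 \<partial>Q) - \<theta>\<^sup>2"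
    using Q.variance_eq[OF iL(1) int] iL(2) by simp
  finally show ?thesis by simp
qed

end

subsection \<open>Laplace-type bounds on the bulk event\<close>

text \<open>Concavity of ln with the slope 1 / r at the left end point; the next bound, from below,
  takes the slope at the right end point r + s.\<close>

lemma powr_le_exp_mult:
  fixes r s k :: real
  assumes "0 < r" "0 \<le> s" "0 \<le> k"
  shows "(r + s) powr k \<le> r powr k * exp (k * s / r)"
proof -
  have "r + s = r * (1 + s / r)" using assms by (simp add: field_simps)
  also have "\<dots> \<le> r * exp (s / r)" using assms by (intro mult_left_mono) auto
  finally have "(r + s) powr k \<le> (r * exp (s / r)) powr k" using assms by (intro powr_mono2) auto
  also have "\<dots> = r powr k * exp (k * s / r)"
    using assms by (simp add: powr_mult) (simp add: powr_def)
  finally show ?thesis .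
qed

lemma powr_ge_exp_mult:
  fixes r s k :: real
  assumes "0 < r" "0 \<le> s" "0 \<le> k"
  shows "r powr k * exp (k * s / (r + s)) \<le> (r + s) powr k"
proof -
  have "r = (r + s) * (1 - s / (r + s))" using assms by (simp add: field_simps)
  also have "\<dots> \<le> (r + s) * exp (- (s / (r + s)))"
  proof (intro mult_left_mono)
    show "1 - s / (r + s) \<le> exp (- (s / (r + s)))" using exp_ge_add_one_self[of "- (s / (r + s))"] by simp
  qed (use assms in auto)
  finally have "r powr k \<le> ((r + s) * exp (- (s / (r + s)))) powr k" using assms by (intro powr_mono2) auto
  also have "\<dots> = (r + s) powr k * exp (- (k * s / (r + s)))"
    using assms by (simp add: powr_mult) (simp add: powr_def)
  finally have "r powr k * exp (k * s / (r + s)) \<le> (r + s) powr k * exp (- (k * s / (r + s)))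
      * exp (k * s / (r + s))"
    by (intro mult_right_mono) auto
  then show ?thesis by (simp add: mult.assoc flip: exp_add)
qed

lemma nn_integral_exp_interval:
  assumes s: "0 < s" and M: "0 \<le> M"
  shows "(\<integral>\<^sup>+t. ennreal (exp (- (s * (t - c))) * of_bool (c < t \<and> t \<le> c + M)) \<partial>lborel)
      = ennreal ((1 - exp (- (s * M))) / s)"
proof -
  have "ennreal (1 / s) = (\<integral>\<^sup>+t. ennreal (exp (- (s * (t - c))) * of_bool (c < t)) \<partial>lborel)"
    by (rule nn_integral_exp_tail[OF s, symmetric])
  also have "\<dots> = (\<integral>\<^sup>+t. ennreal (exp (- (s * (t - c))) * of_bool (c < t \<and> t \<le> c + M)) +
      ennreal (exp (- (s * M))) * ennreal (exp (- (s * (t - (c + M)))) * of_bool (c + M < t)) \<partial>lborel)"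
  proof (intro nn_integral_cong)
    fix t
    have "exp (- (s * M)) * exp (- (s * (t - (c + M)))) = exp (- (s * (t - c)))"
      by (simp add: algebra_simps flip: exp_add)
    then show "ennreal (exp (- (s * (t - c))) * of_bool (c < t))
        = ennreal (exp (- (s * (t - c))) * of_bool (c < t \<and> t \<le> c + M)) +
      ennreal (exp (- (s * M))) * ennreal (exp (- (s * (t - (c + M)))) * of_bool (c + M < t))"
      using M by (auto simp: ennreal_mult[symmetric])
  qed
  also have "\<dots> = (\<integral>\<^sup>+t. ennreal (exp (- (s * (t - c))) * of_bool (c < t \<and> t \<le> c + M)) \<partial>lborel)
      + ennreal (exp (- (s * M)) * (1 / s))"
  proof -
    have "(\<integral>\<^sup>+t. ennreal (exp (- (s * M))) * ennreal (exp (- (s * (t - (c + M)))) * of_bool (c + M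
        < t)) \<partial>lborel) = ennreal (exp (- (s * M))) * ennreal (1 / s)"
      by (subst nn_integral_cmult) (simp_all only: nn_integral_exp_tail[OF s], measurable)
    then have T: "(\<integral>\<^sup>+t. ennreal (exp (- (s * M))) * ennreal (exp (- (s * (t - (c + M))))
        * of_bool (c + M < t)) \<partial>lborel) = ennreal (exp (- (s * M)) * (1 / s))"
      using s by (simp only: ennreal_mult'[OF exp_ge_zero])
    show ?thesis
      unfolding T[symmetric] by (rule nn_integral_add) auto
  qed
  finally have "(\<integral>\<^sup>+t. ennreal (exp (- (s * (t - c))) * of_bool (c < t \<and> t \<le> c + M)) \<partial>lborel)
      + ennreal (exp (- (s * M)) / s) = ennreal (1 / s)"
    by simp
  moreover have "A = B - ennreal D" if "A + ennreal D = B" for A B D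
    using that by (metis ennreal_add_diff_cancel_right ennreal_neq_top)
  ultimately have "(\<integral>\<^sup>+t. ennreal (exp (- (s * (t - c))) * of_bool (c < t \<and> t \<le> c + M)) \<partial>lborel)
      = ennreal (1 / s) - ennreal (exp (- (s * M)) / s)"
    by blast
  also have "\<dots> = ennreal ((1 - exp (- (s * M))) / s)"
    using s by (simp add: ennreal_minus diff_divide_distrib)
  finally show ?thesis .
qed

context laguerre_sampling
begin

text \<open>The level p * x' delimits the bulk: x' > \<beta> makes its complement exponentially
  unlikely, and x' < x keeps all lower eigenvalues at distance at least p * (x - x') from p *
  x.\<close>

definition x' :: real where "x' = (x + \<beta>) / 2"
definition c0 :: real where "c0 = (p * x) powr \<alpha> * exp (- (p * x) / 2)"
definition X :: "(nat \<Rightarrow> real) \<Rightarrow> real" where "X l = (\<Prod>i=1..m. (p * x - l i) powr \<beta>)"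
text \<open>On the bulk, \<epsilon> / 2 bounds the logarithmic derivative of the product of the (t -
  l i) powr \<beta> for t > p * x; the factor 2 accounts for the square in the second
  moment.\<close>

definition \<epsilon> :: real where "\<epsilon> = 2 * \<beta> * real m / (p * (x - x'))"
definition bulk :: "(nat \<Rightarrow> real) \<Rightarrow> real" where "bulk l = of_bool (l 1 < p * x')"
text \<open>The numerator of the estimator without its constant \<open>K\<close>; at t = p * x it
  would be X l * c0.\<close>

definition top_factor :: "(nat \<Rightarrow> real) \<Rightarrow> real \<Rightarrow> real" where
  "top_factor l t = (\<Prod>i=1..m. (t - l i) powr \<beta>) * t powr \<alpha> * exp (- (1 / 2) * t)"

lemma x'_bounds: "\<beta> < x'" "x' < x" "0 < x'" "0 < x - x'" "0 < x"
  using \<beta> x by (auto simp: x'_def)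

lemma c0_pos: "0 < c0"
  unfolding c0_def by (intro mult_pos_pos) (use p_pos in auto)

lemma X_nonneg: "0 \<le> X l"
  unfolding X_def by (intro prod_nonneg) auto

lemma top_factor_nonneg: "0 \<le> top_factor l t"
  unfolding top_factor_def by (intro mult_nonneg_nonneg prod_nonneg) auto

lemma \<alpha>_le: "\<alpha> \<le> \<beta> * p / 2"
proof -
  have "\<beta> * (p - real n + 1) \<le> \<beta> * p" using \<beta> n by (intro mult_left_mono) auto
  then show ?thesis unfolding \<alpha>_def by simp
qed

lemma \<alpha>_div_le: "\<alpha> / (p * x) \<le> 1 / 2 - \<rho>"
proof -
  have "\<alpha> / (p * x) \<le> (\<beta> * p / 2) / (p * x)" using \<alpha>_le p_pos by (intro divide_right_mono) auto
  also have "\<dots> = 1 / 2 - \<rho>" using p_pos unfolding \<rho>_bounds(2) by simp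
  finally show ?thesis .
qed

text \<open>The logarithm of the factor is bounded by slopes at p * x: the gap of the bulk gives
  \<epsilon> / 2 for the product, the power \<alpha> gives at most 1 / 2 - \<rho>, and the
  exponential subtracts 1 / 2.\<close>

lemma top_factor_le_bulk:
  assumes \<alpha>: "0 \<le> \<alpha>" and t: "p * x < t" and l: "\<And>i. i \<in> {1..m} \<Longrightarrow> l i \<le> p * x'"
  shows "top_factor l t \<le> X l * c0 * exp ((\<epsilon> / 2 - \<rho>) * (t - p * x))"
proof -
  define y where "y = t - p * x"
  have y: "0 < y" "t = p * x + y" using t by (auto simp: y_def)
  have gap: "0 < p * (x - x')" using p_pos x'_bounds by auto
  have "(\<Prod>i=1..m. (t - l i) powr \<beta>) \<le> (\<Prod>i=1..m. (p * x - l i) powr \<beta> * exp (\<beta> * y / (p * (x - x'))))"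
  proof (intro prod_mono conjI)
    fix i assume "i \<in> {1..m}"
    then have li: "p * (x - x') \<le> p * x - l i" using l[of i] by (simp add: algebra_simps)
    have "(t - l i) powr \<beta> = ((p * x - l i) + y) powr \<beta>" using y by (simp add: algebra_simps)
    also have "\<dots> \<le> (p * x - l i) powr \<beta> * exp (\<beta> * y / (p * x - l i))"
      using y \<beta> gap li by (intro powr_le_exp_mult) auto
    also have "\<dots> \<le> (p * x - l i) powr \<beta> * exp (\<beta> * y / (p * (x - x')))"
    proof -
      have "\<beta> * y / (p * x - l i) \<le> \<beta> * y / (p * (x - x'))"
      proof (rule divide_left_mono[OF li])
        show "0 < (p * x - l i) * (p * (x - x'))" using gap li by (intro mult_pos_pos[OF _ gap]) linarith
      qed (use y \<beta> in auto)
      then show ?thesis by (intro mult_left_mono) auto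
    qed
    finally show "(t - l i) powr \<beta> \<le> (p * x - l i) powr \<beta> * exp (\<beta> * y / (p * (x - x')))" .
  qed auto
  also have "\<dots> = X l * exp (\<epsilon> / 2 * y)"
  proof -
    have "\<epsilon> / 2 * y = real m * (\<beta> * y / (p * (x - x')))" unfolding \<epsilon>_def by simp
    then show ?thesis unfolding prod.distrib X_def
        by (simp only: exp_of_nat_mult prod_constant card_atLeastAtMost diff_Suc_1)
  qed
  finally have 1: "(\<Prod>i=1..m. (t - l i) powr \<beta>) \<le> X l * exp (\<epsilon> / 2 * y)" .
  have "t powr \<alpha> \<le> (p * x) powr \<alpha> * exp (\<alpha> * y / (p * x))"
    unfolding y(2) using y p_pos \<alpha> by (intro powr_le_exp_mult) auto
  also have "\<dots> \<le> (p * x) powr \<alpha> * exp ((1 / 2 - \<rho>) * y)"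
  proof -
    have "\<alpha> / (p * x) * y \<le> (1 / 2 - \<rho>) * y" using \<alpha>_div_le y by (intro mult_right_mono) auto
    then show ?thesis by (intro mult_left_mono) auto
  qed
  finally have 2: "t powr \<alpha> \<le> (p * x) powr \<alpha> * exp ((1 / 2 - \<rho>) * y)" .
  have "top_factor l t \<le> (X l * exp (\<epsilon> / 2 * y)) * ((p * x) powr \<alpha> * exp ((1 / 2 - \<rho>) * y))
      * exp (- (1 / 2) * t)"
    unfolding top_factor_def using 1 2 X_nonneg by (intro mult_mono mult_nonneg_nonneg prod_nonneg) auto
  also have "\<dots> = X l * c0 * exp ((\<epsilon> / 2 - \<rho>) * y)"
  proof -
    have "exp (\<epsilon> / 2 * y) * exp ((1 / 2 - \<rho>) * y) * exp (- (1 / 2) * t)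
        = exp (- (p * x) / 2) * exp ((\<epsilon> / 2 - \<rho>) * y)"
      unfolding y(2) by (simp add: algebra_simps flip: exp_add)
    then show ?thesis unfolding c0_def by (simp only: mult_ac)
  qed
  finally show ?thesis unfolding y_def .
qed

text \<open>Off the bulk there is no gap, so each t - l i is replaced by t. This turns X l into (p *
  x) powr (\<beta> * m), but the rate stays the same, since \<beta> m / (p x) is at most \<epsilon>
  / 2.\<close>

lemma top_factor_le:
  assumes \<alpha>: "0 \<le> \<alpha>" and t: "p * x < t" and l: "\<And>i. i \<in> {1..m} \<Longrightarrow> 0 \<le> l i \<and> l i \<le> t"
  shows "top_factor l t \<le> (p * x) powr (\<beta> * real m) * c0 * exp ((\<epsilon> / 2 - \<rho>) * (t - p * x))"
proof -
  define y where "y = t - p * x"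
  have y: "0 < y" "t = p * x + y" using t by (auto simp: y_def)
  have t0: "0 < t" using p_pos t by linarith
  have px: "0 < p * (x - x')" "p * (x - x') \<le> p * x" using p_pos x'_bounds by auto
  have "(\<Prod>i=1..m. (t - l i) powr \<beta>) \<le> (\<Prod>i=1..m. t powr \<beta>)"
    using l \<beta> by (intro prod_mono conjI powr_mono2) auto
  also have "\<dots> = t powr (\<beta> * real m)" using prod_powr_const[OF t0, of "{1..m}" \<beta>] by simp
  finally have "(\<Prod>i=1..m. (t - l i) powr \<beta>) * t powr \<alpha> \<le> t powr (\<beta> * real m) * t powr \<alpha>"
    by (intro mult_right_mono) auto
  also have "\<dots> = t powr (\<beta> * real m + \<alpha>)" by (simp add: powr_add)
  also have "\<dots> \<le> (p * x) powr (\<beta> * real m + \<alpha>) * exp ((\<beta> * real m + \<alpha>) * y / (p * x))"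
    unfolding y(2) using y p_pos \<alpha> \<beta> by (intro powr_le_exp_mult) auto
  also have "\<dots> \<le> (p * x) powr (\<beta> * real m + \<alpha>) * exp ((\<epsilon> / 2 + (1 / 2 - \<rho>)) * y)"
  proof -
    have "\<beta> * real m / (p * x) \<le> \<beta> * real m / (p * (x - x'))"
      using px \<beta> by (intro divide_left_mono mult_nonneg_nonneg mult_pos_pos[of "p * x"]) auto
    then have "(\<beta> * real m + \<alpha>) / (p * x) \<le> \<epsilon> / 2 + (1 / 2 - \<rho>)"
      using \<alpha>_div_le unfolding \<epsilon>_def add_divide_distrib by simp
    then have "(\<beta> * real m + \<alpha>) / (p * x) * y \<le> (\<epsilon> / 2 + (1 / 2 - \<rho>)) * y"
      using y by (intro mult_right_mono) auto
    then show ?thesis by (intro mult_left_mono) auto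
  qed
  finally have "top_factor l t \<le> (p * x) powr (\<beta> * real m + \<alpha>) * exp ((\<epsilon> / 2 + (1 / 2 - \<rho>)) * y)
      * exp (- (1 / 2) * t)"
    unfolding top_factor_def by (intro mult_right_mono) auto
  also have "\<dots> = (p * x) powr (\<beta> * real m) * c0 * exp ((\<epsilon> / 2 - \<rho>) * y)"
  proof -
    have "exp ((\<epsilon> / 2 + (1 / 2 - \<rho>)) * y) * exp (- (1 / 2) * t) = exp (- (p * x) / 2) * exp ((\<epsilon> / 2 - \<rho>) * y)"
      unfolding y(2) by (simp add: algebra_simps flip: exp_add)
    then show ?thesis unfolding c0_def powr_add by (simp only: mult_ac)
  qed
  finally show ?thesis unfolding y_def .
qed

text \<open>The squared factor decays at rate 2 \<rho> - \<epsilon>, and dividing by the sampling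
  density loses \<rho>, which leaves \<rho> - \<epsilon> > 0. The bound B is X l on the bulk and (p
  * x) powr (\<beta> * m) elsewhere.\<close>

lemma second_moment_inner:
  assumes B: "\<And>t. max (p * x) (l 1) < t \<Longrightarrow> top_factor l t \<le> B * c0 * exp ((\<epsilon> / 2 - \<rho>) * (t - p * x))"
    and \<epsilon>: "\<epsilon> < \<rho>" and B0: "0 \<le> B"
  shows "(\<integral>\<^sup>+t. ennreal (w l * top_density p \<beta> x (l 1) t) * ennreal ((L (cons_fun m t l))\<^sup>2) \<partial>lborel)
    \<le> ennreal (K\<^sup>2 * c0\<^sup>2 / (\<rho> * (\<rho> - \<epsilon>)) * (B\<^sup>2 * w l))"
proof -
  let ?mx = "max (p * x) (l 1)"
  have "(\<integral>\<^sup>+t. ennreal (w l * top_density p \<beta> x (l 1) t) * ennreal ((L (cons_fun m t l))\<^sup>2) \<partial>lborel) \<le>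
    (\<integral>\<^sup>+t. ennreal (w l * K\<^sup>2 * B\<^sup>2 * c0\<^sup>2 / \<rho>) * ennreal (exp (- ((\<rho> - \<epsilon>) * (t - p * x)))
        * of_bool (p * x < t)) \<partial>lborel)"
  proof (intro nn_integral_mono)
    fix t
    show "ennreal (w l * top_density p \<beta> x (l 1) t) * ennreal ((L (cons_fun m t l))\<^sup>2) \<le>
      ennreal (w l * K\<^sup>2 * B\<^sup>2 * c0\<^sup>2 / \<rho>) * ennreal (exp (- ((\<rho> - \<epsilon>) * (t - p * x))) * of_bool (p * x < t))"
    proof (cases "?mx < t")
      case False
      then show ?thesis unfolding top_density_eq by simp
    next
      case True
      have r: "\<rho> \<noteq> 0" using \<rho>_bounds(1) by simp
      let ?N = "top_factor l t" and ?E = "exp (- (\<rho> * (t - ?mx)))"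
      have "w l * top_density p \<beta> x (l 1) t * (L (cons_fun m t l))\<^sup>2 = w l * K\<^sup>2 / \<rho> * (?N\<^sup>2 / ?E)"
        unfolding top_density_eq L_cons_fun top_factor_def using True r by (simp add: power2_eq_square)
      also have "\<dots> \<le> w l * K\<^sup>2 / \<rho> * ((B * c0 * exp ((\<epsilon> / 2 - \<rho>) * (t - p * x)))\<^sup>2 * exp (\<rho> * (t - p * x)))"
      proof (intro mult_left_mono)
        have "?N\<^sup>2 \<le> (B * c0 * exp ((\<epsilon> / 2 - \<rho>) * (t - p * x)))\<^sup>2"
          using B[OF True] top_factor_nonneg by (intro power_mono)
        \<comment> \<open>If l 1 exceeds p * x, the sampling density starts only at l 1; measuring
          from p * x instead can only enlarge this factor.\<close>
        moreover have "1 / ?E \<le> exp (\<rho> * (t - p * x))"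
        proof -
          have "1 / ?E = exp (\<rho> * (t - ?mx))" by (simp add: exp_minus inverse_eq_divide)
          also have "\<dots> \<le> exp (\<rho> * (t - p * x))" using \<rho>_bounds by simp
          finally show ?thesis .
        qed
        ultimately have "?N\<^sup>2 * (1 / ?E) \<le> (B * c0 * exp ((\<epsilon> / 2 - \<rho>) * (t - p * x)))\<^sup>2
            * exp (\<rho> * (t - p * x))"
          by (intro mult_mono) auto
        then show "?N\<^sup>2 / ?E \<le> \<dots>" by simp
      qed (use w_nonneg \<rho>_bounds in auto)
      also have "(B * c0 * exp ((\<epsilon> / 2 - \<rho>) * (t - p * x)))\<^sup>2 * exp (\<rho> * (t - p * x))
          = B\<^sup>2 * c0\<^sup>2 * exp (- ((\<rho> - \<epsilon>) * (t - p * x)))"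
      proof -
        have "(exp ((\<epsilon> / 2 - \<rho>) * (t - p * x)))\<^sup>2 * exp (\<rho> * (t - p * x)) = exp (- ((\<rho> - \<epsilon>) * (t - p * x)))"
          by (simp add: power2_eq_square algebra_simps flip: exp_add)
        then show ?thesis by (simp add: power_mult_distrib)
      qed
      finally have "w l * top_density p \<beta> x (l 1) t * (L (cons_fun m t l))\<^sup>2 \<le>
         (w l * K\<^sup>2 * B\<^sup>2 * c0\<^sup>2 / \<rho>) * (exp (- ((\<rho> - \<epsilon>) * (t - p * x))) * of_bool (p * x < t))"
        using True by (simp add: mult_ac)
      then have "ennreal (w l * top_density p \<beta> x (l 1) t * (L (cons_fun m t l))\<^sup>2) \<le>
         ennreal ((w l * K\<^sup>2 * B\<^sup>2 * c0\<^sup>2 / \<rho>) * (exp (- ((\<rho> - \<epsilon>) * (t - p * x))) * of_bool (p * x < t)))"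
        by (rule ennreal_leI)
      then show ?thesis
        using w_nonneg[of l] \<rho>_bounds(1) by (subst (asm) (1 2) ennreal_mult) (auto simp: top_density_eq)
    qed
  qed
  also have "\<dots> = ennreal (w l * K\<^sup>2 * B\<^sup>2 * c0\<^sup>2 / \<rho>) * ennreal (1 / (\<rho> - \<epsilon>))"
    using \<epsilon> by (subst nn_integral_cmult) (auto simp: nn_integral_exp_tail)
  also have "\<dots> = ennreal (K\<^sup>2 * c0\<^sup>2 / (\<rho> * (\<rho> - \<epsilon>)) * (B\<^sup>2 * w l))"
    using w_nonneg[of l] \<rho>_bounds(1) \<epsilon> by (subst ennreal_mult[symmetric]) (auto simp: mult_ac)
  finally show ?thesis .
qed

lemma top_factor_ge:
  assumes \<alpha>: "0 \<le> \<alpha>" and t: "p * x < t" "t \<le> p * x + M" and l: "\<And>i. i \<in> {1..m} \<Longrightarrow> l i \<le> p * x'"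
  shows "X l * c0 * exp (- ((1 / 2 - \<alpha> / (p * x + M)) * (t - p * x))) \<le> top_factor l t"
proof -
  define y where "y = t - p * x"
  have y: "0 < y" "t = p * x + y" "y \<le> M" using t by (auto simp: y_def)
  have "p * x' \<le> p * x" using p_pos x'_bounds by auto
  then have 1: "X l \<le> (\<Prod>i=1..m. (t - l i) powr \<beta>)"
    unfolding X_def using l \<beta> t by (intro prod_mono conjI powr_mono2) (auto intro: order_trans)
  have "(p * x) powr \<alpha> * exp (\<alpha> / (p * x + M) * y) \<le> (p * x) powr \<alpha> * exp (\<alpha> * y / (p * x + y))"
  proof -
    have "\<alpha> * y / (p * x + M) \<le> \<alpha> * y / (p * x + y)"
      using y p_pos \<alpha> by (intro divide_left_mono mult_nonneg_nonneg mult_pos_pos) auto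
    then show ?thesis by (intro mult_left_mono) auto
  qed
  also have "\<dots> \<le> t powr \<alpha>"
    unfolding y(2) using y p_pos \<alpha> by (intro powr_ge_exp_mult) auto
  finally have 2: "(p * x) powr \<alpha> * exp (\<alpha> / (p * x + M) * y) \<le> t powr \<alpha>" .
  have eq: "exp (\<alpha> / (p * x + M) * y) * exp (- (1 / 2) * t)
      = exp (- (p * x) / 2) * exp (- ((1 / 2 - \<alpha> / (p * x + M)) * y))"
    unfolding y(2) by (simp add: algebra_simps flip: exp_add)
  have "X l * c0 * exp (- ((1 / 2 - \<alpha> / (p * x + M)) * y))
      = X l * ((p * x) powr \<alpha> * exp (\<alpha> / (p * x + M) * y)) * exp (- (1 / 2) * t)"
    unfolding c0_def by (simp only: mult.assoc eq)
  also have "\<dots> \<le> top_factor l t"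
    unfolding top_factor_def using 1 2 X_nonneg by (intro mult_mono mult_nonneg_nonneg prod_nonneg) auto
  finally show ?thesis unfolding y_def .
qed

text \<open>On the bulk the sampling density starts at p * x. In the window of length M the
  logarithmic slope of t powr \<alpha> is at least \<alpha> / (p * x + M), and the remaining product
  is at least its value X l at p * x, so a truncated exponential integral bounds the mean from
  below.\<close>

lemma first_moment_inner:
  assumes \<alpha>: "0 \<le> \<alpha>" and M: "0 < M" and \<sigma>: "0 < 1 / 2 - \<alpha> / (p * x + M)" (is "0 < ?\<sigma>")
    and l: "\<And>i. i \<in> {1..m} \<Longrightarrow> l i \<le> p * x'"
  shows "ennreal (K * c0 * ((1 - exp (- (?\<sigma> * M))) / ?\<sigma>) * (X l * w l)) \<le>
    (\<integral>\<^sup>+t. ennreal (w l * top_density p \<beta> x (l 1) t) * ennreal (L (cons_fun m t l)) \<partial>lborel)"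
proof -
  have l1: "l 1 \<le> p * x'" using l[of 1] m by simp
  have "p * x' \<le> p * x" using p_pos x'_bounds by auto
  then have mx: "max (p * x) (l 1) = p * x" using l1 by simp
  have J0: "0 \<le> (1 - exp (- (?\<sigma> * M))) / ?\<sigma>" using \<sigma> M by auto
  have "ennreal (K * c0 * ((1 - exp (- (?\<sigma> * M))) / ?\<sigma>) * (X l * w l)) = 
     ennreal (K * c0 * (X l * w l)) * ennreal ((1 - exp (- (?\<sigma> * M))) / ?\<sigma>)"
    using J0 K_pos c0_pos X_nonneg[of l] w_nonneg[of l]
        by (subst ennreal_mult[symmetric]) (auto simp: mult_ac)
  also have "\<dots> = (\<integral>\<^sup>+t. ennreal (K * c0 * (X l * w l)) * ennreal (exp (- (?\<sigma> * (t - p * x)))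
      * of_bool (p * x < t \<and> t \<le> p * x + M)) \<partial>lborel)"
    using nn_integral_exp_interval[OF \<sigma>, of M "p * x"] M by (subst nn_integral_cmult) auto
  also have "\<dots> \<le> (\<integral>\<^sup>+t. ennreal (w l * top_density p \<beta> x (l 1) t) * ennreal (L (cons_fun m t l)) \<partial>lborel)"
  proof (intro nn_integral_mono)
    fix t
    show "ennreal (K * c0 * (X l * w l)) * ennreal (exp (- (?\<sigma> * (t - p * x))) * of_bool (p * x
        < t \<and> t \<le> p * x + M))
      \<le> ennreal (w l * top_density p \<beta> x (l 1) t) * ennreal (L (cons_fun m t l))"
    proof (cases "p * x < t \<and> t \<le> p * x + M")
      case True
      have "w l * top_density p \<beta> x (l 1) t * L (cons_fun m t l) = w l * K * top_factor l t"
        unfolding top_density_eq L_cons_fun top_factor_def mx using True \<rho>_bounds(1) by simp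
      moreover have "w l * K * (X l * c0 * exp (- (?\<sigma> * (t - p * x)))) \<le> w l * K * top_factor l t"
        using True w_nonneg K_pos l \<alpha> by (intro mult_left_mono top_factor_ge) auto
      ultimately have "K * c0 * (X l * w l) * exp (- (?\<sigma> * (t - p * x)))
          \<le> w l * top_density p \<beta> x (l 1) t * L (cons_fun m t l)"
        by (simp only: mult_ac)
      then have "ennreal (K * c0 * (X l * w l) * exp (- (?\<sigma> * (t - p * x))))
          \<le> ennreal (w l * top_density p \<beta> x (l 1) t * L (cons_fun m t l))"
        by (rule ennreal_leI)
      moreover have "0 \<le> w l * top_density p \<beta> x (l 1) t" using w_nonneg[of l] \<rho>_bounds(1)
          by (auto simp: top_density_eq)
      moreover have "0 \<le> K * c0 * (X l * w l)" using K_pos c0_pos X_nonneg[of l] w_nonneg[of l] by auto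
      ultimately show ?thesis using True by (simp add: ennreal_mult')
    qed auto
  qed
  finally show ?thesis .
qed

section \<open>Strong log-concavity on the bulk\<close>

lemma measurable_bulk [measurable]: "bulk \<in> borel_measurable Pm"
proof -
  have [measurable]: "(\<lambda>l. l 1) \<in> borel_measurable Pm" using m by (intro component_measurable) simp
  show ?thesis unfolding bulk_def by measurable
qed

lemma measurable_X [measurable]: "X \<in> borel_measurable Pm"
  unfolding X_def
proof (rule borel_measurable_prod)
  fix i assume "i \<in> {1..m}"
  then have [measurable]: "(\<lambda>l. l i) \<in> borel_measurable Pm" by (rule component_measurable)
  show "(\<lambda>l. (p * x - l i) powr \<beta>) \<in> borel_measurable Pm" by measurable
qed

text \<open>Let \<mu> be the midpoint and d half the difference of u and v. Moving u to \<mu> in the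
  first power costs exp (2 \<beta> a) with a linear in |d|, whereas u v = \<mu>^2 - d^2 gains exp (-
  \<alpha> b) with b quadratic in d. Completing the square leaves the constant, which is of order 1
  / \<alpha>.\<close>

lemma midpoint_powr_le:
  assumes \<alpha>: "0 < \<alpha>" and u: "0 < u" "u \<le> p * x'" and v: "0 < v" "v \<le> p * x'"
  shows "(p * x - u) powr (2 * \<beta>) * (u * v) powr \<alpha> \<le>
    exp (\<beta>\<^sup>2 * x'\<^sup>2 / ((x - x')\<^sup>2 * \<alpha>)) * ((p * x - (u + v) / 2) powr (2 * \<beta>) * ((u + v) / 2) powr (2 * \<alpha>))"
proof -
  define \<mu> where "\<mu> = (u + v) / 2"
  define d where "d = (u - v) / 2"
  have uv: "u = \<mu> + d" "v = \<mu> - d" by (auto simp: \<mu>_def d_def field_simps)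
  have \<mu>: "0 < \<mu>" "\<mu> \<le> p * x'" using u v by (auto simp: \<mu>_def)
  have gap: "0 < p * (x - x')" using p_pos x'_bounds by auto
  have g\<mu>: "p * (x - x') \<le> p * x - \<mu>" using \<mu> by (simp add: algebra_simps)
  define a where "a = \<bar>d\<bar> / (p * (x - x'))"
  have "p * x - u \<le> (p * x - \<mu>) * exp a"
  proof -
    have "\<bar>d\<bar> / (p * x - \<mu>) \<le> a"
      unfolding a_def using gap g\<mu> by (intro divide_left_mono) (auto intro!: mult_pos_pos)
    then have "1 + \<bar>d\<bar> / (p * x - \<mu>) \<le> exp a"
      using exp_ge_add_one_self[of a] by linarith
    then have "(p * x - \<mu>) * (1 + \<bar>d\<bar> / (p * x - \<mu>)) \<le> (p * x - \<mu>) * exp a"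
      using gap g\<mu> by (intro mult_left_mono) auto
    moreover have "(p * x - \<mu>) * (1 + \<bar>d\<bar> / (p * x - \<mu>)) = p * x - \<mu> + \<bar>d\<bar>"
      using gap g\<mu> by (simp add: distrib_left)
    ultimately show ?thesis unfolding uv by linarith
  qed
  then have 1: "(p * x - u) powr (2 * \<beta>) \<le> ((p * x - \<mu>) * exp a) powr (2 * \<beta>)"
  proof (intro powr_mono2)
    have "p * x' \<le> p * x" using p_pos x'_bounds by (intro mult_left_mono) auto
    then show "0 \<le> p * x - u" using u by linarith
  qed (use \<beta> in auto)
  have "((p * x - \<mu>) * exp a) powr (2 * \<beta>) = (p * x - \<mu>) powr (2 * \<beta>) * exp (2 * \<beta> * a)"
    by (simp add: powr_mult) (simp add: powr_def)
  with 1 have 1: "(p * x - u) powr (2 * \<beta>) \<le> (p * x - \<mu>) powr (2 * \<beta>) * exp (2 * \<beta> * a)" by simp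
  define b where "b = d\<^sup>2 / \<mu>\<^sup>2"
  have "u * v \<le> \<mu>\<^sup>2 * exp (- b)"
  proof -
    have "u * v = \<mu>\<^sup>2 * (1 + - b)"
      unfolding uv b_def using \<mu> by (simp add: power2_eq_square field_simps)
    also have "\<dots> \<le> \<mu>\<^sup>2 * exp (- b)" by (intro mult_left_mono exp_ge_add_one_self) auto
    finally show ?thesis .
  qed
  then have 2: "(u * v) powr \<alpha> \<le> (\<mu>\<^sup>2 * exp (- b)) powr \<alpha>"
    using u v \<alpha> by (intro powr_mono2) auto
  have "(\<mu>\<^sup>2 * exp (- b)) powr \<alpha> = \<mu> powr (2 * \<alpha>) * exp (- (\<alpha> * b))"
    using \<mu> by (simp add: powr_mult powr_powr flip: powr_numeral) (simp add: powr_def)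
  with 2 have 2: "(u * v) powr \<alpha> \<le> \<mu> powr (2 * \<alpha>) * exp (- (\<alpha> * b))" by simp
  have "d\<^sup>2 / (p * x')\<^sup>2 \<le> b"
    unfolding b_def using \<mu> p_pos x'_bounds by (intro divide_left_mono power_mono) auto
  then have ab: "2 * \<beta> * a - \<alpha> * b \<le> 2 * \<beta> * a - \<alpha> * (d\<^sup>2 / (p * x')\<^sup>2)"
    using \<alpha> by (intro diff_left_mono mult_left_mono) auto
  define z where "z = \<bar>d\<bar> / (p * x')"
  have "2 * \<beta> * a - \<alpha> * (d\<^sup>2 / (p * x')\<^sup>2) = 2 * (\<beta> * x' / (x - x')) * z - \<alpha> * z\<^sup>2"
    unfolding a_def z_def using p_pos x'_bounds by (simp add: power_divide mult_ac)
  also have "\<dots> \<le> (\<beta> * x' / (x - x'))\<^sup>2 / \<alpha>"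
  proof -
    have "0 \<le> (\<beta> * x' / (x - x') - \<alpha> * z)\<^sup>2 / \<alpha>" using \<alpha> by simp
    also have "\<dots> = (\<beta> * x' / (x - x'))\<^sup>2 / \<alpha> - (2 * (\<beta> * x' / (x - x')) * z - \<alpha> * z\<^sup>2)"
      using \<alpha> by (simp add: power2_diff diff_divide_distrib add_divide_distrib) (simp add: power2_eq_square)
    finally show ?thesis by simp
  qed
  also have "\<dots> = \<beta>\<^sup>2 * x'\<^sup>2 / ((x - x')\<^sup>2 * \<alpha>)" by (simp add: power_divide power_mult_distrib)
  finally have E: "exp (2 * \<beta> * a) * exp (- (\<alpha> * b)) \<le> exp (\<beta>\<^sup>2 * x'\<^sup>2 / ((x - x')\<^sup>2 * \<alpha>))"
    using ab by (simp flip: exp_add)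
  have "(p * x - u) powr (2 * \<beta>) * (u * v) powr \<alpha> \<le> ((p * x - \<mu>) powr (2 * \<beta>) * exp (2 * \<beta> * a))
      * (\<mu> powr (2 * \<alpha>) * exp (- (\<alpha> * b)))"
    using 1 2 by (intro mult_mono) auto
  also have "\<dots> = (exp (2 * \<beta> * a) * exp (- (\<alpha> * b))) * ((p * x - \<mu>) powr (2 * \<beta>) * \<mu> powr (2 * \<alpha>))"
    by (simp only: mult_ac)
  also have "\<dots> \<le> exp (\<beta>\<^sup>2 * x'\<^sup>2 / ((x - x')\<^sup>2 * \<alpha>)) * ((p * x - \<mu>) powr (2 * \<beta>) * \<mu> powr (2 * \<alpha>))"
    by (intro mult_right_mono E) auto
  finally show ?thesis unfolding \<mu>_def .
qed

text \<open>As u and v are ordered alike, u i - u j and v i - v j have the same sign, so the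
  inequality between geometric and arithmetic mean handles each Vandermonde factor. The exponentials
  agree exactly, and each coordinate pays the cost of \<open>midpoint_powr_le\<close> once.\<close>

lemma midpoint_laguerre_fun_le:
  assumes \<alpha>: "0 < \<alpha>"
    and u: "\<And>i. i \<in> {1..m} \<Longrightarrow> 0 < u i \<and> u i \<le> p * x'" "\<And>i j. i \<in> {1..m} \<Longrightarrow> j \<in> {1..m} \<Longrightarrow> i < j \<Longrightarrow> u j < u i"
    and v: "\<And>i. i \<in> {1..m} \<Longrightarrow> 0 < v i \<and> v i \<le> p * x'" "\<And>i j. i \<in> {1..m} \<Longrightarrow> j \<in> {1..m} \<Longrightarrow> i < j \<Longrightarrow> v j < v i"
    and \<mu>: "\<And>i. i \<in> {1..m} \<Longrightarrow> \<mu> i = (u i + v i) / 2"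
  shows "(X u)\<^sup>2 * laguerre_fun {1..m} (\<beta> / 2) (\<alpha> + 1) u * laguerre_fun {1..m} (\<beta> / 2) (\<alpha> + 1) v \<le>
    exp (real m * (\<beta>\<^sup>2 * x'\<^sup>2 / ((x - x')\<^sup>2 * \<alpha>))) * (X \<mu> * laguerre_fun {1..m} (\<beta> / 2) (\<alpha> + 1) \<mu>)\<^sup>2"
proof -
  let ?V = "vandermonde_power {1..m} (\<beta> / 2)"
  define C where "C = \<beta>\<^sup>2 * x'\<^sup>2 / ((x - x')\<^sup>2 * \<alpha>)"
  have \<mu>0: "0 < \<mu> i" if "i \<in> {1..m}" for i using u(1)[OF that] v(1)[OF that] \<mu>[OF that] by auto
  have vand: "?V u * ?V v \<le> (?V \<mu>)\<^sup>2"
  proof -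
    have "?V u * ?V v = (\<Prod>i\<in>{1..m}. \<Prod>j\<in>{1..m} - {i}. \<bar>u i - u j\<bar> powr (\<beta> / 2) * \<bar>v i - v j\<bar> powr (\<beta> / 2))"
      unfolding vandermonde_power_def prod.distrib ..
    also have "\<dots> \<le> (\<Prod>i\<in>{1..m}. \<Prod>j\<in>{1..m} - {i}. \<bar>\<mu> i - \<mu> j\<bar> powr (\<beta> / 2) * \<bar>\<mu> i - \<mu> j\<bar> powr (\<beta> / 2))"
    proof (intro prod_mono conjI prod_nonneg)
      fix i j assume i: "i \<in> {1..m}" and j: "j \<in> {1..m} - {i}"
      have same: "0 \<le> (u i - u j) * (v i - v j)"
      proof (cases "i < j")
        case True
        then have "0 < u i - u j" "0 < v i - v j" using u(2)[of i j] v(2)[of i j] i j by auto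
        then show ?thesis by simp
      next
        case False
        then have "u i - u j < 0" "v i - v j < 0" using u(2)[of j i] v(2)[of j i] i j by auto
        then show ?thesis by (simp add: mult_nonpos_nonpos)
      qed
      have "\<bar>u i - u j\<bar> * \<bar>v i - v j\<bar> = (u i - u j) * (v i - v j)" using same by (simp flip: abs_mult)
      also have "\<dots> \<le> (((u i - u j) + (v i - v j)) / 2)\<^sup>2"
        using sum_squares_bound[of "u i - u j" "v i - v j"] by (simp add: power2_eq_square field_simps)
      also have "((u i - u j) + (v i - v j)) / 2 = \<mu> i - \<mu> j" using \<mu>[of i] \<mu>[of j] i j
          by (simp add: field_simps)
      also have "(\<mu> i - \<mu> j)\<^sup>2 = \<bar>\<mu> i - \<mu> j\<bar> * \<bar>\<mu> i - \<mu> j\<bar>" by (simp add: power2_eq_square flip: abs_mult)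
      finally have "(\<bar>u i - u j\<bar> * \<bar>v i - v j\<bar>) powr (\<beta> / 2) \<le> (\<bar>\<mu> i - \<mu> j\<bar> * \<bar>\<mu> i - \<mu> j\<bar>) powr (\<beta> / 2)"
        using \<beta> by (intro powr_mono2) auto
      then show "\<bar>u i - u j\<bar> powr (\<beta> / 2) * \<bar>v i - v j\<bar> powr (\<beta> / 2)
          \<le> \<bar>\<mu> i - \<mu> j\<bar> powr (\<beta> / 2) * \<bar>\<mu> i - \<mu> j\<bar> powr (\<beta> / 2)"
        by (simp only: powr_mult)
    qed auto
    also have "\<dots> = (?V \<mu>)\<^sup>2" unfolding vandermonde_power_def prod.distrib by (simp add: power2_eq_square)
    finally show ?thesis .
  qed
  let ?W = "laguerre_weight (\<alpha> + 1)"
  have "(X u)\<^sup>2 * ((\<Prod>i=1..m. ?W (u i)) * (\<Prod>i=1..m. ?W (v i))) =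
     (\<Prod>i=1..m. (p * x - u i) powr (2 * \<beta>) * (u i * v i) powr \<alpha> * exp (- (u i + v i) / 2))"
    unfolding X_def power2_eq_square prod.distrib[symmetric]
  proof (intro prod.cong refl)
    fix i assume i: "i \<in> {1..m}"
    have "(p * x - u i) powr (2 * \<beta>) = (p * x - u i) powr \<beta> * (p * x - u i) powr \<beta>" by (simp flip: powr_add)
    moreover have "exp (- (u i + v i) / 2) = exp (- u i / 2) * exp (- v i / 2)"
        by (simp add: field_simps flip: exp_add)
    ultimately show "(p * x - u i) powr \<beta> * (p * x - u i) powr \<beta> * (?W (u i) * ?W (v i))
        = (p * x - u i) powr (2 * \<beta>) * (u i * v i) powr \<alpha> * exp (- (u i + v i) / 2)"
      using u(1)[OF i] v(1)[OF i] by (simp add: laguerre_weight_def powr_mult)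
  qed
  also have "\<dots> \<le> (\<Prod>i=1..m. exp C * ((p * x - \<mu> i) powr (2 * \<beta>) * (\<mu> i) powr (2 * \<alpha>))
      * exp (- (u i + v i) / 2))"
  proof (intro prod_mono conjI mult_right_mono)
    fix i assume i: "i \<in> {1..m}"
    show "(p * x - u i) powr (2 * \<beta>) * (u i * v i) powr \<alpha>
        \<le> exp C * ((p * x - \<mu> i) powr (2 * \<beta>) * (\<mu> i) powr (2 * \<alpha>))"
      unfolding \<mu>[OF i] using u(1)[OF i] v(1)[OF i] by (intro midpoint_powr_le[folded C_def] \<alpha>) auto
  qed auto
  also have "\<dots> = (\<Prod>i=1..m. exp C) * ((X \<mu>)\<^sup>2 * (\<Prod>i=1..m. ?W (\<mu> i))\<^sup>2)"
    unfolding X_def power2_eq_square prod.distrib[symmetric]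
  proof (intro prod.cong refl)
    fix i assume i: "i \<in> {1..m}"
    have "(p * x - \<mu> i) powr (2 * \<beta>) = (p * x - \<mu> i) powr \<beta> * (p * x - \<mu> i) powr \<beta>" by (simp flip: powr_add)
    moreover have "exp (- (u i + v i) / 2) = exp (- \<mu> i / 2) * exp (- \<mu> i / 2)" using \<mu>[OF i]
        by (simp add: field_simps flip: exp_add)
    moreover have "\<mu> i powr (2 * \<alpha>) = \<mu> i powr \<alpha> * \<mu> i powr \<alpha>" by (simp flip: powr_add)
    moreover have "?W (\<mu> i) = \<mu> i powr \<alpha> * exp (- \<mu> i / 2)" using \<mu>0[OF i] by (simp add: laguerre_weight_def)
    ultimately show "exp C * ((p * x - \<mu> i) powr (2 * \<beta>) * \<mu> i powr (2 * \<alpha>)) * exp (- (u i + v i) / 2) =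
      exp C * ((p * x - \<mu> i) powr \<beta> * (p * x - \<mu> i) powr \<beta> * (?W (\<mu> i) * ?W (\<mu> i)))"
      by (simp only: mult_ac)
  qed
  also have "(\<Prod>i=1..m. exp C) = exp (real m * C)" by (simp add: exp_of_nat_mult)
  finally have wt: "(X u)\<^sup>2 * ((\<Prod>i=1..m. ?W (u i)) * (\<Prod>i=1..m. ?W (v i)))
      \<le> exp (real m * C) * ((X \<mu>)\<^sup>2 * (\<Prod>i=1..m. ?W (\<mu> i))\<^sup>2)" .
  have "(X u)\<^sup>2 * laguerre_fun {1..m} (\<beta> / 2) (\<alpha> + 1) u * laguerre_fun {1..m} (\<beta> / 2) (\<alpha> + 1) v =
     ((X u)\<^sup>2 * ((\<Prod>i=1..m. ?W (u i)) * (\<Prod>i=1..m. ?W (v i)))) * (?V u * ?V v)"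
    unfolding laguerre_fun_def by (simp only: mult_ac)
  also have "\<dots> \<le> (exp (real m * C) * ((X \<mu>)\<^sup>2 * (\<Prod>i=1..m. ?W (\<mu> i))\<^sup>2)) * (?V \<mu>)\<^sup>2"
    by (intro mult_mono wt vand mult_nonneg_nonneg) auto
  also have "\<dots> = exp (real m * C) * (X \<mu> * laguerre_fun {1..m} (\<beta> / 2) (\<alpha> + 1) \<mu>)\<^sup>2"
    unfolding laguerre_fun_def power_mult_distrib by (simp only: mult_ac)
  finally show ?thesis unfolding C_def .
qed

text \<open>Reverse Jensen inequality for \<open>X\<close>: since the bulk density is strongly log-concave, the price is only
  \<open>exp O(m / p)\<close>.\<close>

lemma bulk_prekopa_leindler:
  assumes \<alpha>: "0 < \<alpha>"
  shows "(\<integral>\<^sup>+l. ennreal (bulk l * (X l)\<^sup>2 * w l) \<partial>Pm) * (\<integral>\<^sup>+l. ennreal (bulk l * w l) \<partial>Pm) \<le>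
    ennreal (exp (real m * (\<beta>\<^sup>2 * x'\<^sup>2 / ((x - x')\<^sup>2 * \<alpha>)))) * (\<integral>\<^sup>+l. ennreal (bulk l * X l * w l) \<partial>Pm)\<^sup>2"
proof -
  let ?C = "exp (real m * (\<beta>\<^sup>2 * x'\<^sup>2 / ((x - x')\<^sup>2 * \<alpha>)))"
  have bulk0: "0 \<le> bulk l" for l by (simp add: bulk_def)
  have "(\<integral>\<^sup>+l. ennreal (bulk l * (X l)\<^sup>2 * w l) \<partial>Pm) * (\<integral>\<^sup>+l. ennreal (bulk l * w l) \<partial>Pm) \<le>
    (\<integral>\<^sup>+l. ennreal (sqrt ?C) * ennreal (bulk l * X l * w l) \<partial>Pm)\<^sup>2"
  proof (rule prekopa_leindler)
    fix u v :: "nat \<Rightarrow> real"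
    let ?\<mu> = "\<lambda>i\<in>{1..m}. (u i + v i) / 2"
    show "ennreal (bulk u * (X u)\<^sup>2 * w u) * ennreal (bulk v * w v)
        \<le> (ennreal (sqrt ?C) * ennreal (bulk ?\<mu> * X ?\<mu> * w ?\<mu>))\<^sup>2"
    proof (cases "bulk u * w u \<noteq> 0 \<and> bulk v * w v \<noteq> 0")
      case False
      then have "bulk u * (X u)\<^sup>2 * w u = 0 \<or> bulk v * w v = 0" by auto
      then show ?thesis by auto
    next
      case True
      let ?k = "fact m * laguerre_const m (p - 1) \<beta>"
      let ?l = "laguerre_fun {1..m} (\<beta> / 2) (\<alpha> + 1)"
      have u: "u 1 < p * x'" "w u \<noteq> 0" and v: "v 1 < p * x'" "w v \<noteq> 0" using True by (auto simp: bulk_def)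
      have ou: "u j < u i" and ov: "v j < v i" if "i \<in> {1..m}" "j \<in> {1..m}" "i < j" for i j
        using u(2) v(2) that unfolding w_eq by auto
      \<comment> \<open>The decreasing configurations below p * x' form a convex set, so the
        midpoint stays in the support and the indicators cost nothing.\<close>
      have \<mu>1: "?\<mu> 1 < p * x'" using u v m by simp
      have o\<mu>: "\<forall>i\<in>{1..m}. \<forall>j\<in>{1..m}. i < j \<longrightarrow> ?\<mu> j < ?\<mu> i" using ou ov
          by (auto intro!: divide_strict_right_mono add_strict_mono)
      have wu: "w u = ?k * ?l u" and wv: "w v = ?k * ?l v" using u(2) v(2) unfolding w_eq by auto
      have w\<mu>: "w ?\<mu> = ?k * ?l ?\<mu>" unfolding w_eq using o\<mu> by simp
      have b: "bulk u = 1" "bulk v = 1" "bulk ?\<mu> = 1" using u v \<mu>1 by (auto simp: bulk_def)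
      have "(X u)\<^sup>2 * ?l u * ?l v \<le> ?C * (X ?\<mu> * ?l ?\<mu>)\<^sup>2"
      proof (rule midpoint_laguerre_fun_le[OF \<alpha>])
        fix i assume i: "i \<in> {1..m}"
        show "0 < u i \<and> u i \<le> p * x'" using w_neq_0D[OF u(2) i] u(1) by auto
        show "0 < v i \<and> v i \<le> p * x'" using w_neq_0D[OF v(2) i] v(1) by auto
        show "?\<mu> i = (u i + v i) / 2" using i by simp
      qed (use ou ov in auto)
      then have "?k\<^sup>2 * ((X u)\<^sup>2 * ?l u * ?l v) \<le> ?k\<^sup>2 * (?C * (X ?\<mu> * ?l ?\<mu>)\<^sup>2)"
        by (rule mult_left_mono) simp
      moreover have "bulk u * (X u)\<^sup>2 * w u * (bulk v * w v) = ?k\<^sup>2 * ((X u)\<^sup>2 * ?l u * ?l v)"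
        unfolding b wu wv by (simp add: power2_eq_square mult_ac)
      moreover have "(sqrt ?C * (bulk ?\<mu> * X ?\<mu> * w ?\<mu>))\<^sup>2 = ?k\<^sup>2 * (?C * (X ?\<mu> * ?l ?\<mu>)\<^sup>2)"
        unfolding b w\<mu> power_mult_distrib by (simp add: mult_ac)
      ultimately have "bulk u * (X u)\<^sup>2 * w u * (bulk v * w v) \<le> (sqrt ?C * (bulk ?\<mu> * X ?\<mu> * w ?\<mu>))\<^sup>2"
        by (simp only:)
      then have "ennreal (bulk u * (X u)\<^sup>2 * w u * (bulk v * w v))
          \<le> ennreal ((sqrt ?C * (bulk ?\<mu> * X ?\<mu> * w ?\<mu>))\<^sup>2)"
        by (rule ennreal_leI)
      moreover have "0 \<le> bulk u * (X u)\<^sup>2 * w u" "0 \<le> bulk v * w v" "0 \<le> bulk ?\<mu> * X ?\<mu> * w ?\<mu>"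
        using bulk0 w_nonneg X_nonneg by (auto intro!: mult_nonneg_nonneg)
      ultimately show ?thesis by (simp only: ennreal_mult ennreal_power[symmetric]
          real_sqrt_ge_zero exp_ge_zero mult_nonneg_nonneg)
    qed
  qed measurable
  also have "(\<integral>\<^sup>+l. ennreal (sqrt ?C) * ennreal (bulk l * X l * w l) \<partial>Pm)
      = ennreal (sqrt ?C) * (\<integral>\<^sup>+l. ennreal (bulk l * X l * w l) \<partial>Pm)"
    by (rule nn_integral_cmult) measurable
  also have "\<dots>\<^sup>2 = ennreal ?C * (\<integral>\<^sup>+l. ennreal (bulk l * X l * w l) \<partial>Pm)\<^sup>2"
    by (simp add: power_mult_distrib ennreal_power)
  finally show ?thesis .
qed

end

section \<open>Explicit bounds for the Gamma function\<close>

lemma Gamma_add_powr_le: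
  fixes u v :: real
  assumes u: "0 < u" and v: "0 \<le> v"
  shows "Gamma (u + v) \<le> Gamma u * (u + v) powr v"
proof -
  define k where "k = nat \<lfloor>v\<rfloor>"
  define t where "t = v - real k"
  have t: "0 \<le> t" "t \<le> 1" using v unfolding t_def k_def by linarith+
  \<comment> \<open>The fractional part t of the shift is handled by log-convexity, each unit step
    by the functional equation.\<close>
  have "Gamma (u + t + real j) \<le> Gamma u * (u + t + real j) powr (t + real j)" for j
  proof (induction j)
    case 0
    have "Gamma (u + t) \<le> Gamma u * u powr t" by (rule Gamma_add_le[OF u t])
    also have "\<dots> \<le> Gamma u * (u + t) powr t"
      using u t Gamma_real_pos[OF u] by (intro mult_left_mono powr_mono2) auto
    finally show ?case by simp
  next
    case (Suc j)
    let ?y = "u + t + real j"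
    have y: "0 < ?y" using u t by auto
    have "Gamma (u + t + real (Suc j)) = Gamma (?y + 1)" by (simp add: add_ac)
    also have "\<dots> = ?y * Gamma ?y" using y by (intro Gamma_plus1) (auto elim!: nonpos_Ints_cases)
    also have "\<dots> \<le> (?y + 1) * (Gamma u * (?y + 1) powr (t + real j))"
    proof (intro mult_mono)
      have "Gamma u * ?y powr (t + real j) \<le> Gamma u * (?y + 1) powr (t + real j)"
        using y t Gamma_real_pos[OF u] by (intro mult_left_mono powr_mono2) auto
      then show "Gamma ?y \<le> Gamma u * (?y + 1) powr (t + real j)" using Suc by simp
    qed (use y Gamma_real_pos[OF y] in auto)
    also have "\<dots> = Gamma u * (?y + 1) powr (t + real j + 1)"
      using y by (simp add: powr_add)
    finally show ?case by (simp add: add_ac)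
  qed
  from this[of k] show ?thesis by (simp add: t_def)
qed

text \<open>The weak form of Stirling's bound: in the Gamma integral only t > z is kept, where t
  powr z is at least z powr z.\<close>

lemma Gamma_1_plus_ge:
  fixes z :: real
  assumes z: "0 < z"
  shows "(z / exp 1) powr z \<le> Gamma (1 + z)"
proof -
  have "ennreal (z powr z * exp (- z)) = (\<integral>\<^sup>+t. ennreal (z powr z * exp (- z))
      * ennreal (exp (- (1 * (t - z))) * of_bool (z < t)) \<partial>lborel)"
    by (subst nn_integral_cmult) (auto simp: nn_integral_exp_tail[of 1, simplified])
  also have "\<dots> \<le> (\<integral>\<^sup>+t. ennreal (if 0 < t then t powr ((1 + z) - 1) * exp (- (1 * t)) else 0) \<partial>lborel)"
  proof (intro nn_integral_mono)
    fix t
    show "ennreal (z powr z * exp (- z)) * ennreal (exp (- (1 * (t - z))) * of_bool (z < t))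
        \<le> ennreal (if 0 < t then t powr ((1 + z) - 1) * exp (- (1 * t)) else 0)"
    proof (cases "z < t")
      case True
      have "z powr z * exp (- z) * exp (- (1 * (t - z))) = z powr z * exp (- t)"
          by (simp add: mult.assoc flip: exp_add)
      also have "\<dots> \<le> t powr z * exp (- t)" using True z by (intro mult_right_mono powr_mono2) auto
      finally show ?thesis using True z by (simp add: ennreal_mult[symmetric] ennreal_leI)
    qed auto
  qed
  also have "\<dots> = ennreal (Gamma (1 + z) / 1 powr (1 + z))"
    using z by (intro nn_integral_powr_exp) auto
  finally have "z powr z * exp (- z) \<le> Gamma (1 + z)"
    using z Gamma_real_pos[of "1 + z"] by simp
  moreover have "(z / exp 1) powr z = z powr z * exp (- z)"
  proof -
    have "exp 1 powr z = exp z" by (simp add: powr_def)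
    then show ?thesis unfolding powr_divide by (simp add: exp_minus divide_inverse)
  qed
  ultimately show ?thesis by simp
qed

section \<open>The relative second moment in terms of the bulk probability\<close>

context laguerre_sampling
begin

text \<open>The probability, under the law of the lower eigenvalues, that the largest of them stays
  below p * x'.\<close>

definition \<delta> :: real where "\<delta> = enn2real (\<integral>\<^sup>+l. ennreal (bulk l * w l) \<partial>Pm)"

lemma bulk_cases: "bulk l = 0 \<or> bulk l = 1" "0 \<le> bulk l"
  by (auto simp: bulk_def)

lemma bulk_mass: "(\<integral>\<^sup>+l. ennreal (bulk l * w l) \<partial>Pm) = ennreal \<delta>" "0 \<le> \<delta>" "\<delta> \<le> 1"
  "(\<integral>\<^sup>+l. ennreal ((1 - bulk l) * w l) \<partial>Pm) = ennreal (1 - \<delta>)"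
proof -
  have le: "(\<integral>\<^sup>+l. ennreal (bulk l * w l) \<partial>Pm) \<le> 1"
    unfolding nn_integral_w[symmetric] using bulk_cases w_nonneg
    by (intro nn_integral_mono ennreal_leI) (metis mult_zero_left mult_1 order_refl)
  then have fin: "(\<integral>\<^sup>+l. ennreal (bulk l * w l) \<partial>Pm) < top" by (rule order.strict_trans1) simp
  show eq: "(\<integral>\<^sup>+l. ennreal (bulk l * w l) \<partial>Pm) = ennreal \<delta>" unfolding \<delta>_def using fin by simp
  show d0: "0 \<le> \<delta>" unfolding \<delta>_def by simp
  show d1: "\<delta> \<le> 1" using le unfolding eq by simp
  have "1 = (\<integral>\<^sup>+l. ennreal (bulk l * w l) + ennreal ((1 - bulk l) * w l) \<partial>Pm)"
    unfolding nn_integral_w[symmetric]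
  proof (rule nn_integral_cong)
    fix l
    show "ennreal (w l) = ennreal (bulk l * w l) + ennreal ((1 - bulk l) * w l)"
      using bulk_cases(1)[of l] by auto
  qed
  also have "\<dots> = ennreal \<delta> + (\<integral>\<^sup>+l. ennreal ((1 - bulk l) * w l) \<partial>Pm)"
    unfolding eq[symmetric] by (rule nn_integral_add) measurable
  finally have "1 = ennreal \<delta> + (\<integral>\<^sup>+l. ennreal ((1 - bulk l) * w l) \<partial>Pm)" .
  then have "(\<integral>\<^sup>+l. ennreal ((1 - bulk l) * w l) \<partial>Pm) = 1 - ennreal \<delta>"
    by (metis ennreal_add_diff_cancel_left ennreal_neq_top)
  also have "\<dots> = ennreal (1 - \<delta>)" using d0 by (simp add: ennreal_minus flip: ennreal_1)
  finally show "(\<integral>\<^sup>+l. ennreal ((1 - bulk l) * w l) \<partial>Pm) = ennreal (1 - \<delta>)" .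
qed

lemma bulkD:
  assumes "bulk l * w l \<noteq> 0" "i \<in> {1..m}"
  shows "0 < l i" "l i \<le> p * x'"
  using w_neq_0D[of l i] assms by (auto simp: bulk_def)

text \<open>The two bounds differ by a factor exp O(m). This is too coarse for the bulk itself, but
  it gives finite moments of X and a comparison with the contribution of the complement.\<close>

lemma X_bounds:
  assumes "bulk l * w l \<noteq> 0"
  shows "(p * (x - x')) powr (\<beta> * real m) \<le> X l" "X l \<le> (p * x) powr (\<beta> * real m)"
proof -
  have gap: "0 < p * (x - x')" using p_pos x'_bounds by auto
  have "(p * (x - x')) powr (\<beta> * real m) = (\<Prod>i=1..m. (p * (x - x')) powr \<beta>)"
    using prod_powr_const[OF gap, of "{1..m}" \<beta>] by simp
  also have "\<dots> \<le> X l"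
    unfolding X_def
  proof (intro prod_mono conjI powr_mono2)
    fix i assume i: "i \<in> {1..m}"
    show "p * (x - x') \<le> p * x - l i" using bulkD(2)[OF assms i] by (simp add: algebra_simps)
  qed (use gap \<beta> in auto)
  finally show "(p * (x - x')) powr (\<beta> * real m) \<le> X l" .
  have "X l \<le> (\<Prod>i=1..m. (p * x) powr \<beta>)"
    unfolding X_def
  proof (intro prod_mono conjI powr_mono2)
    fix i assume i: "i \<in> {1..m}"
    have "p * x' \<le> p * x" using p_pos x'_bounds by (intro mult_left_mono) auto
    then show "0 \<le> p * x - l i" "p * x - l i \<le> p * x" using bulkD[OF assms i] by auto
  qed (use \<beta> in auto)
  also have "\<dots> = (p * x) powr (\<beta> * real m)"
    using prod_powr_const[OF p_pos(2), of "{1..m}" \<beta>] by simp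
  finally show "X l \<le> (p * x) powr (\<beta> * real m)" .
qed

text \<open>\<open>M\<close> is the length of the window above \<open>p * x\<close> in which the top eigenvalue is kept for the lower
  bound of \<open>\<theta>\<close>; it is chosen as \<open>sqrt p\<close> in the end.\<close>

lemma second_moment_upper:
  fixes M :: real
  defines "\<sigma> \<equiv> 1 / 2 - \<alpha> / (p * x + M)"
  defines "J \<equiv> (1 - exp (- (\<sigma> * M))) / \<sigma>"
  defines "C \<equiv> exp (real m * (\<beta>\<^sup>2 * x'\<^sup>2 / ((x - x')\<^sup>2 * \<alpha>)))"
  assumes \<alpha>: "0 < \<alpha>" and M: "0 < M" and \<sigma>: "0 < \<sigma>" and \<epsilon>: "\<epsilon> < \<rho>" and \<delta>: "0 < \<delta>"
  shows "0 < \<theta>" "integrable Q (\<lambda>l. (L l)\<^sup>2)"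
    "(\<integral>l. (L l)\<^sup>2 \<partial>Q) \<le> \<theta>\<^sup>2 * ((C / \<delta> + (x / (x - x')) powr (2 * \<beta> * real m) * (1 - \<delta>) / \<delta>\<^sup>2)
        / (\<rho> * (\<rho> - \<epsilon>) * J\<^sup>2))"
proof -
  let ?\<kappa> = "K\<^sup>2 * c0\<^sup>2 / (\<rho> * (\<rho> - \<epsilon>))"
  let ?R = "(p * x) powr (\<beta> * real m)" and ?S = "(p * (x - x')) powr (\<beta> * real m)"
  have J: "0 < J" unfolding J_def using \<sigma> M by auto
  have \<kappa>0: "0 \<le> ?\<kappa>" using \<rho>_bounds(1) \<epsilon> by auto
  define a1 where "a1 = enn2real (\<integral>\<^sup>+l. ennreal (bulk l * X l * w l) \<partial>Pm)"
  define a2 where "a2 = enn2real (\<integral>\<^sup>+l. ennreal (bulk l * (X l)\<^sup>2 * w l) \<partial>Pm)"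
  have bound: "(\<integral>\<^sup>+l. ennreal (bulk l * F l * w l) \<partial>Pm) < top"
    if "\<And>l. bulk l * w l \<noteq> 0 \<Longrightarrow> F l \<le> c" "0 \<le> c" for F :: "(nat \<Rightarrow> real) \<Rightarrow> real" and c
  proof -
    have "(\<integral>\<^sup>+l. ennreal (bulk l * F l * w l) \<partial>Pm) \<le> (\<integral>\<^sup>+l. ennreal c * ennreal (w l) \<partial>Pm)"
    proof (rule nn_integral_mono)
      fix l
      have "bulk l * F l * w l \<le> c * w l"
      proof (cases "bulk l * w l = 0")
        case True
        then have *: "bulk l * F l * w l = 0" by auto
        show ?thesis unfolding * using that(2) w_nonneg by (intro mult_nonneg_nonneg)
      next
        case False
        then have "bulk l = 1" using bulk_cases by force
        then show ?thesis using that(1)[OF False] w_nonneg by (simp add: mult_right_mono)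
      qed
      then show "ennreal (bulk l * F l * w l) \<le> ennreal c * ennreal (w l)"
        using that(2) w_nonneg by (simp add: ennreal_mult[symmetric] ennreal_leI)
    qed
    also have "\<dots> = ennreal c * 1" unfolding nn_integral_w[symmetric] by (rule nn_integral_cmult) measurable
    also have "\<dots> < top" by simp
    finally show ?thesis .
  qed
  have a1: "(\<integral>\<^sup>+l. ennreal (bulk l * X l * w l) \<partial>Pm) = ennreal a1" "0 \<le> a1"
    using bound[of X ?R] X_bounds(2) unfolding a1_def by auto
  have a2: "(\<integral>\<^sup>+l. ennreal (bulk l * (X l)\<^sup>2 * w l) \<partial>Pm) = ennreal a2" "0 \<le> a2"
    using bound[of "\<lambda>l. (X l)\<^sup>2" "?R\<^sup>2"] power_mono[OF X_bounds(2) X_nonneg, of _ 2] unfolding a2_def by auto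
  have pl: "a2 * \<delta> \<le> C * a1\<^sup>2"
  proof -
    have "ennreal (a2 * \<delta>) \<le> ennreal (C * a1\<^sup>2)"
      using bulk_prekopa_leindler[OF \<alpha>] a1 a2 bulk_mass unfolding C_def
      by (simp add: ennreal_mult ennreal_power)
    then show ?thesis using a1 unfolding C_def by (simp add: ennreal_le_iff)
  qed
  have low: "?S * \<delta> \<le> a1"
  proof -
    have "ennreal (?S * \<delta>) = ennreal ?S * (\<integral>\<^sup>+l. ennreal (bulk l * w l) \<partial>Pm)"
      using bulk_mass by (simp add: ennreal_mult)
    also have "\<dots> = (\<integral>\<^sup>+l. ennreal ?S * ennreal (bulk l * w l) \<partial>Pm)"
      by (rule nn_integral_cmult[symmetric]) measurable
    also have "\<dots> \<le> (\<integral>\<^sup>+l. ennreal (bulk l * X l * w l) \<partial>Pm)"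
    proof (rule nn_integral_mono)
      fix l
      have "?S * (bulk l * w l) \<le> bulk l * X l * w l"
      proof (cases "bulk l * w l = 0")
        case True
        then show ?thesis by auto
      next
        case False
        then have "?S * (bulk l * w l) \<le> X l * (bulk l * w l)"
          using X_bounds(1) bulk_cases w_nonneg by (intro mult_right_mono) auto
        then show ?thesis by (simp add: mult_ac)
      qed
      then show "ennreal ?S * ennreal (bulk l * w l) \<le> ennreal (bulk l * X l * w l)"
        using bulk_cases(2)[of l] w_nonneg[of l] by (simp add: ennreal_mult[symmetric] ennreal_leI)
    qed
    finally show ?thesis using a1 by simp
  qed
  have th: "K * c0 * J * a1 \<le> \<theta>"
  proof -
    have "ennreal (K * c0 * J * a1) = ennreal (K * c0 * J) * (\<integral>\<^sup>+l. ennreal (bulk l * X l * w l) \<partial>Pm)"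
      using a1 K_pos c0_pos J by (simp add: ennreal_mult)
    also have "\<dots> = (\<integral>\<^sup>+l. ennreal (K * c0 * J) * ennreal (bulk l * X l * w l) \<partial>Pm)"
      by (rule nn_integral_cmult[symmetric]) measurable
    also have "\<dots> \<le> (\<integral>\<^sup>+l. (\<integral>\<^sup>+t. ennreal (w l * top_density p \<beta> x (l 1) t)
        * ennreal (L (cons_fun m t l)) \<partial>lborel) \<partial>Pm)"
    proof (rule nn_integral_mono)
      fix l
      show "ennreal (K * c0 * J) * ennreal (bulk l * X l * w l)
          \<le> (\<integral>\<^sup>+t. ennreal (w l * top_density p \<beta> x (l 1) t) * ennreal (L (cons_fun m t l)) \<partial>lborel)"
      proof (cases "bulk l * w l = 0")
        case True
        then have *: "bulk l * X l * w l = 0" by auto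
        show ?thesis unfolding * by simp
      next
        case False
        then have b: "bulk l = 1" using bulk_cases by force
        have "ennreal (K * c0 * J) * ennreal (bulk l * X l * w l) = ennreal (K * c0 * J * (X l * w l))"
          using K_pos c0_pos J X_nonneg[of l] w_nonneg[of l] b by (simp add: ennreal_mult)
        also have "\<dots> \<le> (\<integral>\<^sup>+t. ennreal (w l * top_density p \<beta> x (l 1) t)
            * ennreal (L (cons_fun m t l)) \<partial>lborel)"
          unfolding J_def \<sigma>_def using \<alpha> M \<sigma> bulkD(2)[OF False]
              by (intro first_moment_inner) (auto simp: \<sigma>_def)
        finally show ?thesis .
      qed
    qed
    also have "\<dots> = ennreal \<theta>"
      unfolding nn_integral_L[symmetric] by (rule nn_integral_Q[symmetric]) measurable
    finally show ?thesis using \<theta>_eq measure_nonneg by simp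
  qed
  have S0: "0 < ?S" "0 < ?R" using p_pos x'_bounds by auto
  have a1pos: "0 < a1" using low S0 \<delta> by (smt (verit) mult_pos_pos)
  have k0: "0 < K * c0 * J" using K_pos c0_pos J by auto
  show \<theta>pos: "0 < \<theta>" using th mult_pos_pos[OF k0 a1pos] by linarith
  have "(\<integral>\<^sup>+l. ennreal ((L l)\<^sup>2) \<partial>Q) = (\<integral>\<^sup>+l. (\<integral>\<^sup>+t. ennreal (w l * top_density p \<beta> x (l 1) t)
      * ennreal ((L (cons_fun m t l))\<^sup>2) \<partial>lborel) \<partial>Pm)"
    by (rule nn_integral_Q) measurable
  \<comment> \<open>\<open>second_moment_inner\<close> is used with B = X l on the bulk and with the
    worst case \<open>?R\<close> on its complement, whose probability is 1 - \<delta>.\<close>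
  also have "\<dots> \<le> (\<integral>\<^sup>+l. ennreal ?\<kappa> * ennreal (bulk l * (X l)\<^sup>2 * w l) + ennreal (?\<kappa> * ?R\<^sup>2)
      * ennreal ((1 - bulk l) * w l) \<partial>Pm)"
  proof (rule nn_integral_mono)
    fix l
    let ?I = "\<integral>\<^sup>+t. ennreal (w l * top_density p \<beta> x (l 1) t) * ennreal ((L (cons_fun m t l))\<^sup>2) \<partial>lborel"
    show "?I \<le> ennreal ?\<kappa> * ennreal (bulk l * (X l)\<^sup>2 * w l) + ennreal (?\<kappa> * ?R\<^sup>2)
        * ennreal ((1 - bulk l) * w l)"
    proof (cases "w l = 0")
      case True
      then show ?thesis by simp
    next
      case w: False
      show ?thesis
      proof (cases "bulk l = 1")
        case True
        have "?I \<le> ennreal (?\<kappa> * ((X l)\<^sup>2 * w l))"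
        proof (rule second_moment_inner[OF _ \<epsilon> X_nonneg])
          fix t assume "max (p * x) (l 1) < t"
          then show "top_factor l t \<le> X l * c0 * exp ((\<epsilon> / 2 - \<rho>) * (t - p * x))"
            using \<alpha> bulkD(2)[of l] w True by (intro top_factor_le_bulk) auto
        qed
        also have "\<dots> = ennreal ?\<kappa> * ennreal (bulk l * (X l)\<^sup>2 * w l)"
          using True by (simp only: mult_1 ennreal_mult'[OF \<kappa>0])
        finally show ?thesis using True by simp
      next
        case False
        then have b: "bulk l = 0" using bulk_cases by auto
        have "?I \<le> ennreal (?\<kappa> * (?R\<^sup>2 * w l))"
        proof (rule second_moment_inner[OF _ \<epsilon>])
          fix t assume t: "max (p * x) (l 1) < t"
          show "top_factor l t \<le> ?R * c0 * exp ((\<epsilon> / 2 - \<rho>) * (t - p * x))"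
          proof (rule top_factor_le)
            fix i assume "i \<in> {1..m}"
            then show "0 \<le> l i \<and> l i \<le> t" using w_neq_0D[OF w] t by force
          qed (use \<alpha> t in auto)
        qed simp
        also have "\<dots> = ennreal (?\<kappa> * ?R\<^sup>2) * ennreal ((1 - bulk l) * w l)"
          using b \<kappa>0 by (subst ennreal_mult'[symmetric]) (auto simp: mult.assoc simp del:
              times_divide_eq_left)
        finally show ?thesis using b by simp
      qed
    qed
  qed
  also have "\<dots> = ennreal ?\<kappa> * ennreal a2 + ennreal (?\<kappa> * ?R\<^sup>2) * ennreal (1 - \<delta>)"
    unfolding a2(1)[symmetric] bulk_mass(4)[symmetric]
    by (subst nn_integral_add, measurable, subst nn_integral_cmult, measurable,
        subst nn_integral_cmult, measurable)
  also have "\<dots> = ennreal (?\<kappa> * a2 + ?\<kappa> * ?R\<^sup>2 * (1 - \<delta>))"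
    using \<kappa>0 a2 bulk_mass by (subst ennreal_plus) (auto simp: ennreal_mult' simp del: times_divide_eq_left)
  finally have M2: "(\<integral>\<^sup>+l. ennreal ((L l)\<^sup>2) \<partial>Q) \<le> ennreal (?\<kappa> * a2 + ?\<kappa> * ?R\<^sup>2 * (1 - \<delta>))" .
  show int: "integrable Q (\<lambda>l. (L l)\<^sup>2)"
  proof (rule integrableI_bounded)
    show "(\<lambda>l. (L l)\<^sup>2) \<in> borel_measurable Q" by measurable
    have "(\<integral>\<^sup>+l. ennreal (norm ((L l)\<^sup>2)) \<partial>Q) = (\<integral>\<^sup>+l. ennreal ((L l)\<^sup>2) \<partial>Q)" by simp
    also note M2
    also have "ennreal (?\<kappa> * a2 + ?\<kappa> * ?R\<^sup>2 * (1 - \<delta>)) < \<infinity>" by simp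
    finally show "(\<integral>\<^sup>+l. ennreal (norm ((L l)\<^sup>2)) \<partial>Q) < \<infinity>" .
  qed
  have "ennreal (\<integral>l. (L l)\<^sup>2 \<partial>Q) \<le> ennreal (?\<kappa> * a2 + ?\<kappa> * ?R\<^sup>2 * (1 - \<delta>))"
    using M2 nn_integral_eq_integral[OF int] by simp
  moreover have rhs0: "0 \<le> ?\<kappa> * a2 + ?\<kappa> * ?R\<^sup>2 * (1 - \<delta>)"
    using \<kappa>0 a2 bulk_mass by (intro add_nonneg_nonneg mult_nonneg_nonneg) auto
  ultimately have "(\<integral>l. (L l)\<^sup>2 \<partial>Q) \<le> ?\<kappa> * a2 + ?\<kappa> * ?R\<^sup>2 * (1 - \<delta>)"
    by (simp only: ennreal_le_iff)
  also have "\<dots> \<le> \<theta>\<^sup>2 * ((C / \<delta> + (x / (x - x')) powr (2 * \<beta> * real m) * (1 - \<delta>) / \<delta>\<^sup>2) / (\<rho> * (\<rho> - \<epsilon>) * J\<^sup>2))"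
  proof -
    let ?D = "\<rho> * (\<rho> - \<epsilon>) * J\<^sup>2"
    have D: "0 < ?D" using \<rho>_bounds(1) \<epsilon> J by auto
    have \<kappa>: "?\<kappa> = (K * c0 * J)\<^sup>2 / ?D" using J by (simp add: power_mult_distrib)
    have t1: "(K * c0 * J * a1)\<^sup>2 \<le> \<theta>\<^sup>2" using th k0 a1pos by (intro power_mono) auto
    have "?\<kappa> * a2 \<le> \<theta>\<^sup>2 * (C / \<delta> / ?D)"
    proof -
      have "a2 \<le> C * a1\<^sup>2 / \<delta>" using pl \<delta> by (simp add: field_simps)
      then have "?\<kappa> * a2 \<le> ?\<kappa> * (C * a1\<^sup>2 / \<delta>)" using \<kappa>0 by (rule mult_left_mono)
      also have "\<dots> = (K * c0 * J * a1)\<^sup>2 * (C / \<delta> / ?D)" unfolding \<kappa> by (simp add: power_mult_distrib mult_ac)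
      also have "\<dots> \<le> \<theta>\<^sup>2 * (C / \<delta> / ?D)" using t1 \<delta> D unfolding C_def by (intro mult_right_mono) auto
      finally show ?thesis .
    qed
    \<comment> \<open>On the complement, \<open>?R\<close> is compared with \<open>?S\<close> times
      \<delta>, a lower bound for the mean of X over the bulk. The quotient of \<open>?R\<close> and
      \<open>?S\<close> is exponential in m, to be beaten by 1 - \<delta>.\<close>
    moreover have "?\<kappa> * ?R\<^sup>2 * (1 - \<delta>) \<le> \<theta>\<^sup>2 * ((x / (x - x')) powr (2 * \<beta> * real m) * (1 - \<delta>) / \<delta>\<^sup>2 / ?D)"
    proof -
      have r: "?R\<^sup>2 = (x / (x - x')) powr (2 * \<beta> * real m) * ?S\<^sup>2"
      proof -
        have "p * x = (x / (x - x')) * (p * (x - x'))" using x'_bounds by simp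
        then have "?R = (x / (x - x')) powr (\<beta> * real m) * ?S" by (metis powr_mult)
        moreover have "((x / (x - x')) powr (\<beta> * real m))\<^sup>2 = (x / (x - x')) powr (2 * \<beta> * real m)"
          by (simp add: power2_eq_square powr_add[symmetric] mult.assoc)
        ultimately show ?thesis by (simp add: power_mult_distrib)
      qed
      have "(?S * \<delta>)\<^sup>2 \<le> a1\<^sup>2" using low \<delta> S0 by (intro power_mono) auto
      then have "(K * c0 * J)\<^sup>2 * (?S * \<delta>)\<^sup>2 \<le> (K * c0 * J)\<^sup>2 * a1\<^sup>2" by (rule mult_left_mono) simp
      also have "\<dots> \<le> \<theta>\<^sup>2" using t1 by (simp add: power_mult_distrib)
      finally have t2: "(K * c0 * J)\<^sup>2 * (?S * \<delta>)\<^sup>2 \<le> \<theta>\<^sup>2" .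
      have "?\<kappa> * ?R\<^sup>2 * (1 - \<delta>) = (K * c0 * J)\<^sup>2 * (?S * \<delta>)\<^sup>2
          * ((x / (x - x')) powr (2 * \<beta> * real m) * (1 - \<delta>) / \<delta>\<^sup>2 / ?D)"
        unfolding \<kappa> r using \<delta> by (simp add: power_mult_distrib mult_ac)
      also have "\<dots> \<le> \<theta>\<^sup>2 * ((x / (x - x')) powr (2 * \<beta> * real m) * (1 - \<delta>) / \<delta>\<^sup>2 / ?D)"
        using t2 D bulk_mass by (intro mult_right_mono) auto
      finally show ?thesis .
    qed
    ultimately show ?thesis by (simp add: add_divide_distrib distrib_left)
  qed
  finally show "(\<integral>l. (L l)\<^sup>2 \<partial>Q) \<le> \<theta>\<^sup>2 * ((C / \<delta> + (x / (x - x')) powr (2 * \<beta> * real m) * (1 - \<delta>)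
      / \<delta>\<^sup>2) / (\<rho> * (\<rho> - \<epsilon>) * J\<^sup>2))" .
qed

end

subsection \<open>Tail of the largest eigenvalue\<close>

lemma measurable_powr_exp:
  "(\<lambda>t::real. ennreal (if 0 < t then t powr a * exp (- (c * t)) else 0)) \<in> borel_measurable lborel"
  by measurable

context laguerre_sampling
begin

text \<open>The Gamma factors depend on p - n and j only, so those with j <= m are common to both
  constants and just the factor j = n survives.\<close>

lemma K_eq: "K = real n * (2 powr (- (\<beta> * (real n + p - 1) / 2)) *
    (Gamma (1 + \<beta> / 2) / (Gamma (1 + \<beta> / 2 * real n) * Gamma (\<beta> / 2 * p))))"
proof -
  let ?f = "\<lambda>j. Gamma (1 + \<beta> / 2) / (Gamma (1 + \<beta> / 2 * real j) * Gamma (\<beta> / 2 * (p - real n + real j)))"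
  have cn: "laguerre_const n p \<beta> = 2 powr (- (\<beta> * real n * p / 2)) * ((\<Prod>j=1..m. ?f j) * ?f n)"
    unfolding laguerre_const_def by (subst (2) n) (simp add: n)
  have "p - 1 - real m + real j = p - real n + real j" for j using n by simp
  then have cm: "laguerre_const m (p - 1) \<beta> = 2 powr (- (\<beta> * real m * (p - 1) / 2)) * (\<Prod>j=1..m. ?f j)"
    unfolding laguerre_const_def by (simp only:)
  have ne: "(\<Prod>j=1..m. ?f j) \<noteq> 0"
  proof
    assume "(\<Prod>j=1..m. ?f j) = 0"
    then have "laguerre_const m (p - 1) \<beta> = 0" unfolding cm by (simp only: mult_zero_right)
    then show False using laguerre_const_pos[OF \<beta>, of m "p - 1"] p_pos by simp
  qed
  have two: "(2::real) powr (- (\<beta> * real n * p / 2)) / 2 powr (- (\<beta> * real m * (p - 1) / 2))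
      = 2 powr (- (\<beta> * (real n + p - 1) / 2))"
    unfolding powr_diff[symmetric] using n by (intro arg_cong[where f
        = "\<lambda>z. 2 powr z"]) (simp add: field_simps)
  have "laguerre_const n p \<beta> / laguerre_const m (p - 1) \<beta> =
     (2 powr (- (\<beta> * real n * p / 2)) / 2 powr (- (\<beta> * real m * (p - 1) / 2))) * ?f n"
    unfolding cn cm using ne by simp
  then show ?thesis unfolding K_def two by simp
qed

text \<open>Chernoff's inequality: below the top eigenvalue t all distances t - l i are at most t,
  so t is dominated by a Gamma weight of shape \<alpha> + \<beta> m + 1 and rate 1 / 2, out of which
  exp (- s T) is taken.\<close>

lemma tail_le:
  assumes s: "0 < s" "s < 1 / 2"
  shows "measure P {l \<in> space Pn. T < l 1} \<le>
    K * exp (- (s * T)) * (Gamma (\<alpha> + \<beta> * real m + 1) / (1 / 2 - s) powr (\<alpha> + \<beta> * real m + 1))"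
proof -
  interpret P: prob_space P by (rule prob_space_P)
  let ?k = "\<alpha> + \<beta> * real m + 1"
  have "0 < \<beta> * (p - real n + 1)" using \<beta> p by (intro mult_pos_pos) auto
  then have \<alpha>1: "0 < \<alpha> + 1" unfolding \<alpha>_def by simp
  moreover have "0 \<le> \<beta> * real m" using \<beta> by simp
  ultimately have k: "0 < ?k" by linarith
  let ?h = "\<lambda>t. if 0 < t then t powr (?k - 1) * exp (- ((1 / 2 - s) * t)) else 0"
  have [measurable]: "{l \<in> space Pn. T < l 1} \<in> sets Pn" by measurable
  have "emeasure P {l \<in> space Pn. T < l 1} = (\<integral>\<^sup>+l. ennreal (ordered_laguerre_density n p \<beta> l)
      * indicator {l \<in> space Pn. T < l 1} l \<partial>Pn)"
    unfolding ordered_laguerre_law_def by (rule emeasure_density) measurable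
  also have "\<dots> = (\<integral>\<^sup>+l. (\<integral>\<^sup>+t. ennreal (ordered_laguerre_density n p \<beta> (cons_fun m t l))
      * indicator {l \<in> space Pn. T < l 1} (cons_fun m t l) \<partial>lborel) \<partial>Pm)"
    by (rule nn_integral_Pn) measurable
  also have "\<dots> \<le> (\<integral>\<^sup>+l. (\<integral>\<^sup>+t. ennreal (w l * (K * exp (- (s * T)))) * ennreal (?h t) \<partial>lborel) \<partial>Pm)"
  proof (intro nn_integral_mono)
    fix l t
    have c1: "cons_fun m t l 1 = t" by (simp add: cons_fun_def)
    have h0: "0 \<le> ?h t" by simp
    show "ennreal (ordered_laguerre_density n p \<beta> (cons_fun m t l)) * indicator {l \<in> space Pn. T
        < l 1} (cons_fun m t l) \<le>
      ennreal (w l * (K * exp (- (s * T)))) * ennreal (?h t)"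
    proof (cases "w l \<noteq> 0 \<and> l 1 < t \<and> T < t")
      case False
      then have "ordered_laguerre_density n p \<beta> (cons_fun m t l) = 0 \<or> \<not> T < cons_fun m t l 1"
        unfolding ordered_density_cons_fun c1 by auto
      then show ?thesis by (auto simp: indicator_def)
    next
      case True
      have t0: "0 < t" using w_neq_0D(1)[of l 1] True m by force
      have "(\<Prod>i=1..m. \<bar>t - l i\<bar> powr \<beta>) \<le> (\<Prod>i=1..m. t powr \<beta>)"
      proof (intro prod_mono conjI powr_mono2)
        fix i assume "i \<in> {1..m}"
        then show "\<bar>t - l i\<bar> \<le> t" using w_neq_0D[of l i] True by auto
      qed (use \<beta> in auto)
      also have "\<dots> = t powr (\<beta> * real m)" using prod_powr_const[OF t0, of "{1..m}" \<beta>] by simp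
      finally have 1: "(\<Prod>i=1..m. \<bar>t - l i\<bar> powr \<beta>) \<le> t powr (\<beta> * real m)" .
      have "- (t / 2) = - (s * t) + - ((1 / 2 - s) * t)" by (simp add: algebra_simps)
      also have "\<dots> \<le> - (s * T) + - ((1 / 2 - s) * t)" using True s by simp
      finally have 2: "exp (- t / 2) \<le> exp (- (s * T)) * exp (- ((1 / 2 - s) * t))" by (simp flip: exp_add)
      have "ordered_laguerre_density n p \<beta> (cons_fun m t l)
          = K * w l * ((\<Prod>i=1..m. \<bar>t - l i\<bar> powr \<beta>) * (t powr \<alpha> * exp (- t / 2)))"
        unfolding ordered_density_cons_fun using True t0 by (simp add: laguerre_weight_def)
      also have "\<dots> \<le> K * w l * (t powr (\<beta> * real m)
          * (t powr \<alpha> * (exp (- (s * T)) * exp (- ((1 / 2 - s) * t)))))"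
        using 1 2 K_pos w_nonneg by (intro mult_left_mono mult_mono mult_nonneg_nonneg prod_nonneg) auto
      also have "\<dots> = (w l * (K * exp (- (s * T)))) * ?h t"
        using t0 by (simp add: powr_add mult_ac)
      finally have "ennreal (ordered_laguerre_density n p \<beta> (cons_fun m t l))
          \<le> ennreal ((w l * (K * exp (- (s * T)))) * ?h t)"
        by (rule ennreal_leI)
      also have "\<dots> = ennreal (w l * (K * exp (- (s * T)))) * ennreal (?h t)"
        using w_nonneg K_pos by (intro ennreal_mult') auto
      finally show ?thesis by (auto simp: indicator_def)
    qed
  qed
  also have "\<dots> = (\<integral>\<^sup>+l. ennreal (w l) * ennreal (K * exp (- (s * T)) * (Gamma ?k / (1 / 2 - s) powr ?k)) \<partial>Pm)"
  proof (rule nn_integral_cong)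
    fix l
    have "(\<integral>\<^sup>+t. ennreal (w l * (K * exp (- (s * T)))) * ennreal (?h t) \<partial>lborel)
        = ennreal (w l * (K * exp (- (s * T)))) * (\<integral>\<^sup>+t. ennreal (?h t) \<partial>lborel)"
      by (rule nn_integral_cmult) (rule measurable_powr_exp)
    also have "(\<integral>\<^sup>+t. ennreal (?h t) \<partial>lborel) = ennreal (Gamma ?k / (1 / 2 - s) powr ?k)"
      using k s by (intro nn_integral_powr_exp) auto
    also have "ennreal (w l * (K * exp (- (s * T)))) * \<dots>
        = ennreal (w l * ((K * exp (- (s * T))) * (Gamma ?k / (1 / 2 - s) powr ?k)))"
      unfolding mult.assoc[symmetric] using w_nonneg K_pos by (intro ennreal_mult'[symmetric]) auto
    also have "\<dots> = ennreal (w l) * ennreal (K * exp (- (s * T)) * (Gamma ?k / (1 / 2 - s) powr ?k))"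
      using w_nonneg by (intro ennreal_mult') auto
    finally show "(\<integral>\<^sup>+t. ennreal (w l * (K * exp (- (s * T)))) * ennreal (?h t) \<partial>lborel) = \<dots>" .
  qed
  also have "\<dots> = (\<integral>\<^sup>+l. ennreal (w l) \<partial>Pm) * ennreal (K * exp (- (s * T)) * (Gamma ?k / (1 / 2 - s) powr ?k))"
    by (rule nn_integral_multc) measurable
  also have "\<dots> = ennreal (K * exp (- (s * T)) * (Gamma ?k / (1 / 2 - s) powr ?k))"
    unfolding nn_integral_w by simp
  finally show ?thesis
    using K_pos Gamma_real_pos[OF k] by (simp add: P.emeasure_eq_measure)
qed

text \<open>With u = \<beta> p / 2, v = \<beta> m / 2 and z = \<beta> n / 2, the Gamma quotient of
  the Chernoff bound is at most (u + z) powr z / (z / e) powr z = (e (1 + p / n)) powr z, so that p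
  enters the exponent linearly except for a term n ln (1 + p / n).\<close>

lemma tail_exponential_bound:
  assumes y: "\<beta> < y" and p1: "2 \<le> \<beta> * p"
  defines "s \<equiv> (y - \<beta>) / (2 * (y + \<beta>))"
  shows "measure P {l \<in> space Pn. p * y < l 1} \<le> real n * Gamma (1 + \<beta> / 2) *
    exp (- (s * y * p) - \<beta> / 2 * (p + real n) * ln (1 - 2 * s) + \<beta> * real n / 2 * (1 + ln (1 + p / real n)))"
proof -
  have s: "0 < s" "s < 1 / 2" unfolding s_def using y \<beta> by (auto simp: field_simps)
  let ?u = "\<beta> * p / 2" and ?v = "\<beta> * real m / 2" and ?z = "\<beta> * real n / 2"
  have pos: "0 < ?u" "0 \<le> ?v" "0 < ?z" "?v \<le> ?z" "1 \<le> ?u" using \<beta> p_pos n p1 by (auto simp: mult_left_mono)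
  have k: "\<alpha> + \<beta> * real m + 1 = ?u + ?v" unfolding \<alpha>_def using n by (simp add: field_simps)
  have G: "0 < Gamma ?u" "0 < Gamma (1 + ?z)" "0 < Gamma (1 + \<beta> / 2)"
    using pos \<beta> by (auto intro!: Gamma_real_pos)
  have "s * (p * y) = s * y * p" by simp
  then have "measure P {l \<in> space Pn. p * y < l 1}
      \<le> K * exp (- (s * y * p)) * (Gamma (?u + ?v) / (1 / 2 - s) powr (?u + ?v))"
    using tail_le[OF s, of "p * y"] unfolding k by (simp only:)
  also have "\<dots> = real n * Gamma (1 + \<beta> / 2) * exp (- (s * y * p)) * (2 powr (- (?u + ?v))
      / (1 / 2 - s) powr (?u + ?v)) *
      (Gamma (?u + ?v) / (Gamma (1 + ?z) * Gamma ?u))"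
  proof -
    have "\<beta> * (real n + p - 1) / 2 = ?u + ?v" using n by (simp add: field_simps)
    moreover have "\<beta> / 2 * real n = ?z" "\<beta> / 2 * p = ?u" by simp_all
    moreover have "N * (T * (G / (A * B))) * E * (H / D) = N * G * E * (T / D) * (H / (A * B))"
        for N T G A B E H D :: real
      by (simp add: mult_ac)
    ultimately show ?thesis unfolding K_eq by (simp only:)
  qed
  also have "2 powr (- (?u + ?v)) / (1 / 2 - s) powr (?u + ?v) = exp (- ((?u + ?v) * ln (1 - 2 * s)))"
  proof -
    have "2 powr (- (?u + ?v)) / (1 / 2 - s) powr (?u + ?v)
        = 1 / (2 powr (?u + ?v) * (1 / 2 - s) powr (?u + ?v))"
      by (simp only: powr_minus_divide divide_divide_eq_left)
    also have "2 powr (?u + ?v) * (1 / 2 - s) powr (?u + ?v) = (1 - 2 * s) powr (?u + ?v)"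
      by (simp add: powr_mult[symmetric] algebra_simps)
    finally show ?thesis using s by (simp add: powr_def exp_minus inverse_eq_divide)
  qed
  also have "real n * Gamma (1 + \<beta> / 2) * exp (- (s * y * p)) * exp (- ((?u + ?v) * ln (1 - 2 * s)))
      * (Gamma (?u + ?v) / (Gamma (1 + ?z) * Gamma ?u)) \<le>
     real n * Gamma (1 + \<beta> / 2) * exp (- (s * y * p)) * exp (- ((?u + ?z) * ln (1 - 2 * s)))
         * exp (?z * (1 + ln (1 + p / real n)))"
  proof (intro mult_mono)
    have "ln (1 - 2 * s) \<le> 0" using s by simp
    then have "(?u + ?z) * ln (1 - 2 * s) \<le> (?u + ?v) * ln (1 - 2 * s)"
      using pos by (intro mult_right_mono_neg) auto
    then show "exp (- ((?u + ?v) * ln (1 - 2 * s))) \<le> exp (- ((?u + ?z) * ln (1 - 2 * s)))" by simp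
    have "Gamma (?u + ?v) \<le> Gamma ?u * (?u + ?v) powr ?v" using pos by (intro Gamma_add_powr_le) auto
    also have "\<dots> \<le> Gamma ?u * (?u + ?z) powr ?z"
    proof (intro mult_left_mono)
      have "(?u + ?v) powr ?v \<le> (?u + ?z) powr ?v" using pos by (intro powr_mono2) auto
      \<comment> \<open>Raising the exponent from v to z needs a base of at least 1, which follows
        from u >= 1, that is 2 <= \<beta> p.\<close>
      also have "\<dots> \<le> (?u + ?z) powr ?z" using pos by (intro powr_mono) auto
      finally show "(?u + ?v) powr ?v \<le> (?u + ?z) powr ?z" .
    qed (use G in auto)
    finally have "Gamma (?u + ?v) / (Gamma (1 + ?z) * Gamma ?u)
        \<le> Gamma ?u * (?u + ?z) powr ?z / (Gamma (1 + ?z) * Gamma ?u)"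
      using G by (intro divide_right_mono) auto
    also have "\<dots> = (?u + ?z) powr ?z / Gamma (1 + ?z)" using G by simp
    also have "\<dots> \<le> (?u + ?z) powr ?z / (?z / exp 1) powr ?z"
    proof (rule divide_left_mono)
      have "0 < ?z / exp 1" using pos(3) by (intro divide_pos_pos) auto
      then have "?z / exp 1 \<noteq> 0" by linarith
      then have "0 < (?z / exp 1) powr ?z" by (simp only: powr_gt_zero not_False_eq_True)
      then show "0 < Gamma (1 + ?z) * (?z / exp 1) powr ?z" by (intro mult_pos_pos G)
    qed (use Gamma_1_plus_ge[OF pos(3)] in auto)
    also have "\<dots> = ((?u + ?z) / (?z / exp 1)) powr ?z"
      using pos by (intro powr_divide[symmetric])
    also have "(?u + ?z) / (?z / exp 1) = exp 1 * (1 + p / real n)"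
    proof -
      have "0 < N \<Longrightarrow> (\<beta> * p / 2 + \<beta> * N / 2) / (\<beta> * N / 2 / exp 1) = exp 1 * (1 + p / N)" for N
        using \<beta> by (simp add: field_simps)
      then show ?thesis using n by simp
    qed
    also have "\<dots> powr ?z = exp (?z * (1 + ln (1 + p / real n)))"
    proof -
      have q: "0 < 1 + p / real n" using p_pos n by (intro add_pos_nonneg) auto
      then have "ln (exp 1 * (1 + p / real n)) = 1 + ln (1 + p / real n)" by (simp add: ln_mult)
      then show ?thesis using q by (simp add: powr_def)
    qed
    finally show "Gamma (?u + ?v) / (Gamma (1 + ?z) * Gamma ?u) \<le> exp (?z * (1 + ln (1 + p / real n)))" .
  qed (use G pos Gamma_real_pos[of "?u + ?v"] in auto)
  also have "\<dots> = real n * Gamma (1 + \<beta> / 2) *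
    exp (- (s * y * p) - \<beta> / 2 * (p + real n) * ln (1 - 2 * s) + \<beta> * real n / 2 * (1 + ln (1 + p / real n)))"
    by (simp add: exp_add[symmetric] mult.assoc algebra_simps)
  finally show ?thesis .
qed

end

text \<open>The rate is largest at s = (y - \<beta>) / (2 y), but there the estimate ln r <= r - 1
  would only yield a rate of at least 0. The smaller value with y + \<beta> in the denominator
  leaves a positive margin.\<close>

lemma chernoff_rate_pos:
  fixes \<beta> y :: real
  assumes "0 < \<beta>" "\<beta> < y"
  shows "0 < (y - \<beta>) / (2 * (y + \<beta>)) * y + \<beta> / 2 * ln (1 - 2 * ((y - \<beta>) / (2 * (y + \<beta>))))"
proof -
  let ?r = "(y + \<beta>) / (2 * \<beta>)"
  have r: "0 < ?r" using assms by auto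
  have "1 - 2 * ((y - \<beta>) / (2 * (y + \<beta>))) = inverse ?r" using assms by (simp add: field_simps)
  then have "ln (1 - 2 * ((y - \<beta>) / (2 * (y + \<beta>)))) = - ln ?r" using r by (simp only: ln_inverse)
  moreover have "ln ?r \<le> ?r - 1" using r by (intro ln_le_minus_one)
  moreover have "\<beta> / 2 * (?r - 1) < (y - \<beta>) / (2 * (y + \<beta>)) * y"
  proof -
    have "\<beta> / 2 * (?r - 1) = (y - \<beta>) * (1 / 4)" using assms by (simp add: field_simps)
    also have "\<dots> < (y - \<beta>) * (y / (2 * (y + \<beta>)))" using assms
        by (intro mult_strict_left_mono) (auto simp: field_simps)
    finally show ?thesis by simp
  qed
  moreover have "\<beta> / 2 * ln ?r \<le> \<beta> / 2 * (?r - 1)" using assms calculation(2) by (intro mult_left_mono) auto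
  ultimately show ?thesis by simp
qed

text \<open>The constants depend on \<beta> and y alone, so the bound can be used for the ensemble
  itself at level x and for the lower eigenvalues at level x'. The prefactor n is absorbed into exp
  n, and the exponent becomes n times a function of p / n, in which the linear term dominates the
  logarithm.\<close>

lemma tail_bound:
  fixes \<beta> y :: real
  assumes \<beta>: "0 < \<beta>" and y: "\<beta> < y"
  obtains \<kappa> c where "0 < \<kappa>"
    "\<And>n p. 2 \<le> n \<Longrightarrow> real n \<le> p \<Longrightarrow> 2 \<le> \<beta> * p \<Longrightarrow>
      measure (ordered_laguerre_law n p \<beta>) {l \<in> space (PiM {1..n} (\<lambda>_. lborel)). p * y < l 1} \<le>
      Gamma (1 + \<beta> / 2) * exp (real n * (c - \<kappa> * (p / real n) + \<beta> / 2 * ln (1 + p / real n)))"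
proof
  let ?s = "(y - \<beta>) / (2 * (y + \<beta>))"
  let ?\<kappa> = "?s * y + \<beta> / 2 * ln (1 - 2 * ?s)"
  let ?c = "1 - \<beta> / 2 * ln (1 - 2 * ?s) + \<beta> / 2"
  show "0 < ?\<kappa>" using chernoff_rate_pos[OF \<beta> y] .
  fix n :: nat and p :: real assume n: "2 \<le> n" and p: "real n \<le> p" and p1: "2 \<le> \<beta> * p"
  interpret laguerre_sampling \<beta> y p n "n - 1"
    by unfold_locales (use \<beta> y n p in auto)
  have "measure P {l \<in> space Pn. p * y < l 1} \<le> real n * Gamma (1 + \<beta> / 2) *
    exp (- (?s * y * p) - \<beta> / 2 * (p + real n) * ln (1 - 2 * ?s) + \<beta> * real n / 2
        * (1 + ln (1 + p / real n)))"
    by (rule tail_exponential_bound[OF y p1])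
  also have "\<dots> \<le> exp (real n) * Gamma (1 + \<beta> / 2) *
    exp (- (?s * y * p) - \<beta> / 2 * (p + real n) * ln (1 - 2 * ?s) + \<beta> * real n / 2
        * (1 + ln (1 + p / real n)))"
  proof (intro mult_right_mono)
    show "real n \<le> exp (real n)" using exp_ge_add_one_self[of "real n"] by linarith
  qed (use Gamma_real_pos[of "1 + \<beta> / 2"] \<beta> in auto)
  also have "\<dots> = Gamma (1 + \<beta> / 2) * exp (real n * (?c - ?\<kappa> * (p / real n) + \<beta> / 2 * ln (1 + p / real n)))"
  proof -
    let ?l = "ln (1 - 2 * ?s)" and ?m = "ln (1 + p / real n)"
    have "real n * (1 - \<beta> / 2 * a + \<beta> / 2 - (b * y + \<beta> / 2 * a) * (p / real n) + \<beta> / 2 * d) =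
       real n + (- (b * y * p) - \<beta> / 2 * (p + real n) * a + \<beta> * real n / 2 * (1 + d))" for a b d
      using n by (simp add: field_simps)
    from this[of ?l ?s ?m] show ?thesis by (simp only: exp_add mult_ac)
  qed
  finally show "measure P {l \<in> space Pn. p * y < l 1} \<le> \<dots>" .
qed

subsection \<open>Asymptotics\<close>

text \<open>The bracket tends to minus infinity; once it is negative, the factor N k >= 1 can only
  lower the exponent. The constant c is arbitrary, which leaves room for additional factors exp
  O(n).\<close>

lemma exponential_decay:
  fixes q :: "nat \<Rightarrow> real" and N :: "nat \<Rightarrow> real"
  assumes q: "filterlim q at_top sequentially" and N: "eventually (\<lambda>k. 1 \<le> N k) sequentially" and \<kappa>: "0 < \<kappa>"
  shows "(\<lambda>k. exp (N k * (c - \<kappa> * q k + b * ln (1 + q k)))) \<longlonglongrightarrow> 0"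
proof (rule tendsto_sandwich[of "\<lambda>_. 0" "\<lambda>k. exp (N k * (c - \<kappa> * q k + b * ln (1 + q k)))"
    sequentially "\<lambda>k. exp (c - \<kappa> * q k + b * ln (1 + q k))"])
  have "filterlim (\<lambda>q. c - \<kappa> * q + b * ln (1 + q)) at_bot at_top" using \<kappa> by real_asymp
  from filterlim_compose[OF this q]
  have bot: "filterlim (\<lambda>k. c - \<kappa> * q k + b * ln (1 + q k)) at_bot sequentially" .
  then show "(\<lambda>k. exp (c - \<kappa> * q k + b * ln (1 + q k))) \<longlonglongrightarrow> 0"
    by (rule filterlim_compose[OF exp_at_bot])
  have "eventually (\<lambda>k. c - \<kappa> * q k + b * ln (1 + q k) \<le> 0) sequentially"
    using bot by (simp add: filterlim_at_bot)
  with N show "eventually (\<lambda>k. exp (N k * (c - \<kappa> * q k + b * ln (1 + q k)))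
      \<le> exp (c - \<kappa> * q k + b * ln (1 + q k))) sequentially"
  proof eventually_elim
    case (elim k)
    then have "(N k - 1) * (c - \<kappa> * q k + b * ln (1 + q k)) \<le> 0" by (intro mult_nonneg_nonpos) auto
    then show ?case by (simp add: algebra_simps)
  qed
qed auto

text \<open>The lower eigenvalues form an ensemble with parameter p - 1, for which the tail bound
  speaks of the level (p - 1) * x', slightly below the level p * x' of the bulk.\<close>

lemma (in laguerre_sampling) one_minus_\<delta>_le:
  "1 - \<delta> \<le> measure (ordered_laguerre_law m (p - 1) \<beta>) {l \<in> space Pm. (p - 1) * x' < l 1}"
proof -
  have [measurable]: "(\<lambda>l. l 1) \<in> borel_measurable Pm" using m by (intro component_measurable) simp
  let ?A = "{l \<in> space Pm. (p - 1) * x' < l 1}"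
  have prob: "prob_space (ordered_laguerre_law m (p - 1) \<beta>)"
  proof (rule prob_spaceI)
    have "emeasure (ordered_laguerre_law m (p - 1) \<beta>) (space (ordered_laguerre_law m (p - 1) \<beta>))
        = (\<integral>\<^sup>+l. 1 \<partial>ordered_laguerre_law m (p - 1) \<beta>)" by simp
    also have "\<dots> = (\<integral>\<^sup>+l. ennreal (w l) * 1 \<partial>Pm)"
      unfolding ordered_laguerre_law_def w_def by (rule nn_integral_density) measurable
    also have "\<dots> = 1" by (simp only: mult_1_right nn_integral_w)
    finally show "emeasure (ordered_laguerre_law m (p - 1) \<beta>) (space (ordered_laguerre_law m (p
        - 1) \<beta>)) = 1" .
  qed
  interpret prob_space "ordered_laguerre_law m (p - 1) \<beta>" by (rule prob)
  have "ennreal (1 - \<delta>) = (\<integral>\<^sup>+l. ennreal ((1 - bulk l) * w l) \<partial>Pm)" by (rule bulk_mass(4)[symmetric])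
  also have "\<dots> \<le> (\<integral>\<^sup>+l. ennreal (w l) * indicator ?A l \<partial>Pm)"
  proof (rule nn_integral_mono)
    fix l assume l: "l \<in> space Pm"
    show "ennreal ((1 - bulk l) * w l) \<le> ennreal (w l) * indicator ?A l"
    proof (cases "l 1 < p * x'")
      case False
      then have "(p - 1) * x' < l 1" using x'_bounds by (simp add: left_diff_distrib)
      then show ?thesis using False l by (simp add: bulk_def)
    qed (simp add: bulk_def)
  qed
  also have "\<dots> = emeasure (ordered_laguerre_law m (p - 1) \<beta>) ?A"
    unfolding ordered_laguerre_law_def w_def by (rule emeasure_density[symmetric]) measurable
  finally show ?thesis by (simp add: emeasure_eq_measure)
qed

text \<open>Since n <= p, passing to (p - 1) / (n - 1) can only increase the ratio.\<close>

lemma filterlim_shifted_ratio: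
  fixes p :: "nat \<Rightarrow> real"
  assumes "\<And>n. 1 \<le> n \<Longrightarrow> real n \<le> p n" "filterlim (\<lambda>n. p n / real n) at_top sequentially"
  shows "filterlim (\<lambda>n. (p n - 1) / real (n - 1)) at_top sequentially"
proof (rule filterlim_at_top_mono[OF assms(2)])
  show "eventually (\<lambda>n. p n / real n \<le> (p n - 1) / real (n - 1)) sequentially"
    using eventually_ge_at_top[of 2]
  proof eventually_elim
    case (elim n)
    have "real n \<le> p n" using assms(1)[of n] elim by simp
    then show ?case using elim by (simp add: of_nat_diff field_simps)
  qed
qed

text \<open>A sandwich: nonnegative variance bounds the quotient below by 1, and
  \<open>second_moment_upper\<close> bounds it above by an explicit B n. As n / p tends to 0, the
  Prekopa-Leindler cost C n tends to 1 and \<epsilon> n to 0, and the exponentially small 1 -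
  \<delta> n beats the factor exp O(n) of the complement.\<close>

proposition relative_error_tendsto_1:
  fixes \<beta> x :: real and p :: "nat \<Rightarrow> real"
  assumes \<beta>: "0 < \<beta>" and x: "\<beta> < x" and p: "\<And>n. 1 \<le> n \<Longrightarrow> real n \<le> p n"
    and lim: "filterlim (\<lambda>n. p n / real n) at_top sequentially"
  defines "Q \<equiv> \<lambda>n. sampling_law n (p n) \<beta> x" and "L \<equiv> \<lambda>n. is_estimator n (p n) \<beta> x"
    and "\<theta> \<equiv> \<lambda>n. tail_prob n (p n) \<beta> x"
  shows "eventually (\<lambda>n. 0 < \<theta> n \<and> integrable (Q n) (\<lambda>l. (L n l)\<^sup>2)) sequentially"
    and "(\<lambda>n. (\<integral>l. (L n l)\<^sup>2 \<partial>Q n) / (\<theta> n)\<^sup>2) \<longlonglongrightarrow> 1"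
    and "\<theta> \<longlonglongrightarrow> 0"
proof -
  have S: "laguerre_sampling \<beta> x (p n) n (n - 1)" if "2 \<le> n" for n
    by unfold_locales (use \<beta> x p[of n] that in auto)
  define x' where "x' = (x + \<beta>) / 2"
  have x': "\<beta> < x'" "x' < x" using x by (auto simp: x'_def)
  define \<rho> where "\<rho> = (x - \<beta>) / (2 * x)"
  have \<rho>: "0 < \<rho>" "\<rho> = 1 / 2 - \<beta> / (2 * x)" using \<beta> x by (auto simp: \<rho>_def field_simps)
  define r where "r n = real n / p n" for n
  have r0: "r \<longlonglongrightarrow> 0"
  proof -
    have "(\<lambda>n. inverse (p n / real n)) \<longlonglongrightarrow> 0" by (rule tendsto_inverse_0_at_top[OF lim])
    then show ?thesis unfolding r_def by (simp add: inverse_eq_divide)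
  qed
  have p_top: "filterlim p at_top sequentially"
    by (rule filterlim_at_top_mono[OF filterlim_real_sequentially
        eventually_mono[OF eventually_ge_at_top[of 1]]]) (rule p)
  have inv_p: "(\<lambda>n. 1 / p n) \<longlonglongrightarrow> 0"
    using tendsto_inverse_0_at_top[OF p_top] by (simp add: inverse_eq_divide)
  have inv_sqrt: "(\<lambda>n. 1 / sqrt (p n)) \<longlonglongrightarrow> 0"
    using tendsto_real_sqrt[OF inv_p] by (simp add: real_sqrt_divide)
  define \<alpha> where "\<alpha> n = \<beta> * (p n - real n + 1) / 2 - 1" for n
  define \<epsilon> where "\<epsilon> n = 2 * \<beta> * real (n - 1) / (p n * (x - x'))" for n
  \<comment> \<open>M must tend to infinity, for the truncated exponential integral to become full,
    but more slowly than p, for the rate \<sigma> to tend to \<rho>; the square root does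
    both.\<close>
  define M where "M n = sqrt (p n)" for n
  define \<sigma> where "\<sigma> n = 1 / 2 - \<alpha> n / (p n * x + M n)" for n
  define J where "J n = (1 - exp (- (\<sigma> n * M n))) / \<sigma> n" for n
  define C where "C n = exp (real (n - 1) * (\<beta>\<^sup>2 * x'\<^sup>2 / ((x - x')\<^sup>2 * \<alpha> n)))" for n
  define \<delta> where "\<delta> n = laguerre_sampling.\<delta> \<beta> x (p n) (n - 1)" for n
  have p_pos: "eventually (\<lambda>n. 0 < p n) sequentially"
    using p_top by (simp add: filterlim_at_top_dense)
  have \<alpha>_lim: "(\<lambda>n. \<alpha> n / p n) \<longlonglongrightarrow> \<beta> / 2"
  proof -
    have "(\<lambda>n. \<beta> / 2 * (1 - r n + 1 / p n) - 1 / p n) \<longlonglongrightarrow> \<beta> / 2 * (1 - 0 + 0) - 0"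
      by (intro tendsto_intros r0 inv_p)
    moreover have "eventually (\<lambda>n. \<beta> / 2 * (1 - r n + 1 / p n) - 1 / p n = \<alpha> n / p n) sequentially"
      using p_pos by eventually_elim (simp add: r_def \<alpha>_def field_simps)
    ultimately show ?thesis by (simp add: tendsto_cong)
  qed
  have nm: "(\<lambda>n. real (n - 1) / p n) \<longlonglongrightarrow> 0"
  proof -
    have "(\<lambda>n. r n - 1 / p n) \<longlonglongrightarrow> 0 - 0" by (intro tendsto_intros r0 inv_p)
    moreover have "eventually (\<lambda>n. r n - 1 / p n = real (n - 1) / p n) sequentially"
      using eventually_ge_at_top[of 1] by eventually_elim (simp add: r_def of_nat_diff diff_divide_distrib)
    ultimately show ?thesis by (simp add: tendsto_cong)
  qed
  have \<epsilon>_lim: "\<epsilon> \<longlonglongrightarrow> 0"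
  proof -
    have "(\<lambda>n. 2 * \<beta> / (x - x') * (real (n - 1) / p n)) \<longlonglongrightarrow> 2 * \<beta> / (x - x') * 0"
      by (intro tendsto_intros nm)
    then show ?thesis unfolding \<epsilon>_def by (simp add: mult.commute)
  qed
  have \<sigma>_lim: "\<sigma> \<longlonglongrightarrow> \<rho>"
  proof -
    have "(\<lambda>n. 1 / 2 - (\<alpha> n / p n) / (x + 1 / sqrt (p n))) \<longlonglongrightarrow> 1 / 2 - (\<beta> / 2) / (x + 0)"
      using \<beta> x by (intro tendsto_intros \<alpha>_lim inv_sqrt) auto
    moreover have "eventually (\<lambda>n. 1 / 2 - (\<alpha> n / p n) / (x + 1 / sqrt (p n)) = \<sigma> n) sequentially"
      using p_pos
    proof eventually_elim
      case (elim n)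
      have "p n * x + sqrt (p n) = p n * (x + 1 / sqrt (p n))"
        using elim by (simp add: distrib_left real_div_sqrt)
      then show ?case using elim by (simp add: \<sigma>_def M_def)
    qed
    ultimately show ?thesis unfolding \<rho>(2) by (simp add: tendsto_cong)
  qed
  have M_top: "filterlim M at_top sequentially"
    unfolding M_def by (rule filterlim_compose[OF sqrt_at_top p_top])
  have J_lim: "J \<longlonglongrightarrow> 1 / \<rho>"
  proof -
    have "filterlim (\<lambda>n. \<sigma> n * M n) at_top sequentially"
      by (rule filterlim_tendsto_pos_mult_at_top[OF \<sigma>_lim \<rho>(1) M_top])
    then have "(\<lambda>n. exp (- (\<sigma> n * M n))) \<longlonglongrightarrow> 0"
      by (intro filterlim_compose[OF exp_at_bot]) (simp add: filterlim_uminus_at_bot)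
    then have "J \<longlonglongrightarrow> (1 - 0) / \<rho>"
      unfolding J_def using \<rho>(1) by (intro tendsto_intros \<sigma>_lim) auto
    then show ?thesis by simp
  qed
  have C_lim: "C \<longlonglongrightarrow> 1"
  proof -
    have "(\<lambda>n. exp ((real (n - 1) / p n) * (\<beta>\<^sup>2 * x'\<^sup>2 / ((x - x')\<^sup>2 * (\<alpha> n / p n))))) \<longlonglongrightarrow> exp (0
        * (\<beta>\<^sup>2 * x'\<^sup>2 / ((x - x')\<^sup>2 * (\<beta> / 2))))"
      using \<beta> x' by (intro tendsto_intros nm \<alpha>_lim) auto
    moreover have "eventually (\<lambda>n. exp ((real (n - 1) / p n)
        * (\<beta>\<^sup>2 * x'\<^sup>2 / ((x - x')\<^sup>2 * (\<alpha> n / p n)))) = C n) sequentially"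
      using p_pos by eventually_elim (simp add: C_def)
    ultimately show ?thesis by (simp add: tendsto_cong)
  qed
  have q_lim: "filterlim (\<lambda>n. (p n - 1) / real (n - 1)) at_top sequentially"
    by (rule filterlim_shifted_ratio[OF p lim])
  \<comment> \<open>The tail bound will be applied to the lower ensemble with parameters n - 1 and p
    n - 1, hence the added 1 here and the requirement 3 <= n.\<close>
  have pb: "eventually (\<lambda>n. 2 / \<beta> + 1 \<le> p n) sequentially"
    using p_top by (simp add: filterlim_at_top)
  note ev = eventually_ge_at_top[of "3::nat"] pb
  let ?E = "\<lambda>n. (x / (x - x')) powr (2 * \<beta> * real (n - 1))"
  have tail: "(\<lambda>n. ?E n * (1 - \<delta> n)) \<longlonglongrightarrow> 0" and \<delta>_lim: "\<delta> \<longlonglongrightarrow> 1"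
  proof -
    obtain \<kappa> c where \<kappa>: "0 < \<kappa>" and b: "\<And>n p. 2 \<le> n \<Longrightarrow> real n \<le> p \<Longrightarrow> 2 \<le> \<beta> * p \<Longrightarrow>
      measure (ordered_laguerre_law n p \<beta>) {l \<in> space (PiM {1..n} (\<lambda>_. lborel)). p * x' < l 1} \<le>
      Gamma (1 + \<beta> / 2) * exp (real n * (c - \<kappa> * (p / real n) + \<beta> / 2 * ln (1 + p / real n)))"
      by (rule tail_bound[OF \<beta> x'(1)]) blast
    let ?e = "2 * \<beta> * ln (x / (x - x'))"
    let ?b = "\<lambda>c n. exp (real (n - 1) * (c - \<kappa> * ((p n - 1) / real (n - 1)) + \<beta> / 2
        * ln (1 + (p n - 1) / real (n - 1))))"
    have dec: "(\<lambda>n. Gamma (1 + \<beta> / 2) * ?b c n) \<longlonglongrightarrow> 0" for c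
    proof -
      have "?b c \<longlonglongrightarrow> 0"
        by (rule exponential_decay[OF q_lim _ \<kappa>]) (auto intro!:
            eventually_mono[OF eventually_ge_at_top[of 2]])
      then show ?thesis by (rule tendsto_mult_right_zero)
    qed
    have "eventually (\<lambda>n. 0 \<le> 1 - \<delta> n \<and> 1 - \<delta> n \<le> Gamma (1 + \<beta> / 2) * ?b c n) sequentially"
      using ev
    proof eventually_elim
      case (elim n)
      interpret ls: laguerre_sampling \<beta> x "p n" n "n - 1" by (rule S) (use elim in simp)
      have x'eq: "ls.x' = x'" unfolding x'_def ls.x'_def ..
      have "2 \<le> \<beta> * (p n - 1)" using elim \<beta> by (simp add: field_simps)
      moreover have "2 \<le> n - 1" "real (n - 1) \<le> p n - 1" using elim p[of n] by auto
      ultimately have "1 - \<delta> n \<le> Gamma (1 + \<beta> / 2) * ?b c n"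
        using ls.one_minus_\<delta>_le b[of "n - 1" "p n - 1"] unfolding x'eq \<delta>_def by linarith
      then show ?case using ls.bulk_mass(3) unfolding \<delta>_def by simp
    qed
    note bound = this
    have d0: "(\<lambda>n. 1 - \<delta> n) \<longlonglongrightarrow> 0"
      by (rule tendsto_sandwich[OF _ _ tendsto_const dec[of c]]; rule eventually_mono[OF bound]) auto
    from tendsto_diff[OF tendsto_const[of 1] d0] show "\<delta> \<longlonglongrightarrow> 1" by simp
    \<comment> \<open>The factor \<open>?E n\<close> equals exp ((n - 1) * ?e), so it merely changes
      the constant c of the tail bound into c + ?e, and the decay holds for every constant.\<close>
    have eb: "?E n * (Gamma (1 + \<beta> / 2) * ?b c n) = Gamma (1 + \<beta> / 2) * ?b (c + ?e) n" for n
    proof -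
      have "?E n = exp (real (n - 1) * ?e)" using x' \<beta> x by (simp add: powr_def mult_ac)
      then have "?E n * ?b c n = ?b (c + ?e) n" by (simp only: exp_add[symmetric]) (simp add: algebra_simps)
      then show ?thesis by (simp add: mult.left_commute)
    qed
    show "(\<lambda>n. ?E n * (1 - \<delta> n)) \<longlonglongrightarrow> 0"
    proof (rule tendsto_sandwich[OF _ _ tendsto_const dec[of "c + ?e"]])
      show "eventually (\<lambda>n. 0 \<le> ?E n * (1 - \<delta> n)) sequentially"
        by (rule eventually_mono[OF bound]) auto
      show "eventually (\<lambda>n. ?E n * (1 - \<delta> n) \<le> Gamma (1 + \<beta> / 2) * ?b (c + ?e) n) sequentially"
        unfolding eb[symmetric] by (rule eventually_mono[OF bound]) (intro mult_left_mono; simp)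
    qed
  qed
  define B where "B n = (C n / \<delta> n + ?E n * (1 - \<delta> n) / (\<delta> n)\<^sup>2) / (\<rho> * (\<rho> - \<epsilon> n) * (J n)\<^sup>2)" for n
  \<comment> \<open>The limit is 1 because the second moment contributes 1 / \<rho>^2 and the
    squared mean contributes the square of lim J = 1 / \<rho>: the sampling rate matches the decay
    rate of the top factor.\<close>
  have "B \<longlonglongrightarrow> (1 / 1 + 0 / 1\<^sup>2) / (\<rho> * (\<rho> - 0) * (1 / \<rho>)\<^sup>2)"
    unfolding B_def using \<rho>(1) by (intro tendsto_intros C_lim \<delta>_lim tail \<epsilon>_lim J_lim) auto
  also have "(1 / 1 + 0 / 1\<^sup>2) / (\<rho> * (\<rho> - 0) * (1 / \<rho>)\<^sup>2) = 1"
    using \<rho>(1) by (simp add: power2_eq_square)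
  finally have B_lim: "B \<longlonglongrightarrow> 1" .
  have "eventually (\<lambda>n. 0 < \<alpha> n / p n) sequentially" using \<alpha>_lim \<beta> by (auto intro: order_tendstoD)
  moreover have "eventually (\<lambda>n. 0 < \<sigma> n) sequentially" using \<sigma>_lim \<rho>(1) by (auto intro: order_tendstoD)
  moreover have "eventually (\<lambda>n. \<epsilon> n < \<rho>) sequentially" using \<epsilon>_lim \<rho>(1) by (auto intro: order_tendstoD)
  moreover have "eventually (\<lambda>n. 0 < \<delta> n) sequentially" using \<delta>_lim by (auto intro: order_tendstoD)
  ultimately have main: "eventually (\<lambda>n. 0 < \<theta> n \<and> integrable (Q n) (\<lambda>l. (L n l)\<^sup>2) \<and>
      (\<theta> n)\<^sup>2 \<le> (\<integral>l. (L n l)\<^sup>2 \<partial>Q n) \<and> (\<integral>l. (L n l)\<^sup>2 \<partial>Q n) \<le> (\<theta> n)\<^sup>2 * B n) sequentially"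
    using ev p_pos
  proof eventually_elim
    case (elim n)
    interpret ls: laguerre_sampling \<beta> x "p n" n "n - 1" by (rule S) (use elim in simp)
    have eqs: "ls.x' = x'" "ls.\<rho> = \<rho>" "ls.\<alpha> = \<alpha> n" "ls.\<epsilon> = \<epsilon> n" "ls.\<delta> = \<delta> n"
      unfolding ls.x'_def ls.\<rho>_def ls.\<alpha>_def ls.\<epsilon>_def \<delta>_def x'_def \<rho>_def \<alpha>_def \<epsilon>_def by simp_all
    have "0 < \<alpha> n" using elim by (simp add: zero_less_divide_iff)
    moreover have "0 < M n" using elim by (simp add: M_def)
    ultimately have "0 < \<theta> n" "integrable (Q n) (\<lambda>l. (L n l)\<^sup>2)" "(\<integral>l. (L n l)\<^sup>2 \<partial>Q n) \<le> (\<theta> n)\<^sup>2 * B n"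
      using ls.second_moment_upper[of "M n", unfolded eqs] elim
      unfolding \<theta>_def Q_def L_def B_def \<sigma>_def J_def C_def by auto
    moreover have "(\<theta> n)\<^sup>2 \<le> (\<integral>l. (L n l)\<^sup>2 \<partial>Q n)"
      using ls.second_moment_ge calculation(2) unfolding \<theta>_def Q_def L_def by simp
    ultimately show ?case by simp
  qed
  from main show "eventually (\<lambda>n. 0 < \<theta> n \<and> integrable (Q n) (\<lambda>l. (L n l)\<^sup>2)) sequentially"
    by eventually_elim simp
  show "(\<lambda>n. (\<integral>l. (L n l)\<^sup>2 \<partial>Q n) / (\<theta> n)\<^sup>2) \<longlonglongrightarrow> 1"
  proof (rule tendsto_sandwich[OF _ _ tendsto_const B_lim])
    show "eventually (\<lambda>n. 1 \<le> (\<integral>l. (L n l)\<^sup>2 \<partial>Q n) / (\<theta> n)\<^sup>2) sequentially"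
      using main by eventually_elim (simp add: field_simps)
    show "eventually (\<lambda>n. (\<integral>l. (L n l)\<^sup>2 \<partial>Q n) / (\<theta> n)\<^sup>2 \<le> B n) sequentially"
      using main by eventually_elim (simp add: field_simps)
  qed
  show "\<theta> \<longlonglongrightarrow> 0"
  proof -
    obtain \<kappa> c where \<kappa>: "0 < \<kappa>" and b: "\<And>n p. 2 \<le> n \<Longrightarrow> real n \<le> p \<Longrightarrow> 2 \<le> \<beta> * p \<Longrightarrow>
      measure (ordered_laguerre_law n p \<beta>) {l \<in> space (PiM {1..n} (\<lambda>_. lborel)). p * x < l 1} \<le>
      Gamma (1 + \<beta> / 2) * exp (real n * (c - \<kappa> * (p / real n) + \<beta> / 2 * ln (1 + p / real n)))"
      by (rule tail_bound[OF \<beta> x]) blast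
    have "(\<lambda>n. exp (real n * (c - \<kappa> * (p n / real n) + \<beta> / 2 * ln (1 + p n / real n)))) \<longlonglongrightarrow> 0"
      by (rule exponential_decay[OF lim _ \<kappa>]) (auto intro!: eventually_mono[OF eventually_ge_at_top[of 2]])
    then have lim0: "(\<lambda>n. Gamma (1 + \<beta> / 2) * exp (real n * (c - \<kappa> * (p n / real n) + \<beta> / 2
        * ln (1 + p n / real n)))) \<longlonglongrightarrow> 0"
      by (rule tendsto_mult_right_zero)
    have upper: "eventually (\<lambda>n. \<theta> n \<le> Gamma (1 + \<beta> / 2)
        * exp (real n * (c - \<kappa> * (p n / real n) + \<beta> / 2 * ln (1 + p n / real n)))) sequentially"
      using ev
    proof eventually_elim
      case (elim n)
      interpret ls: laguerre_sampling \<beta> x "p n" n "n - 1" by (rule S) (use elim in simp)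
      have "2 \<le> \<beta> * p n" using elim \<beta> by (simp add: field_simps)
      then show ?case using b[of n "p n"] elim p[of n] unfolding \<theta>_def ls.\<theta>_eq by simp
    qed
    have "eventually (\<lambda>n. 0 \<le> \<theta> n) sequentially" using main by eventually_elim simp
    then show ?thesis by (rule tendsto_sandwich[OF _ upper tendsto_const lim0])
  qed
qed

theorem theorem2:
  fixes \<beta> x :: real and p :: "nat \<Rightarrow> real"
  assumes "0 < \<beta>" and "\<beta> < x"
    and "\<And>n. 1 \<le> n \<Longrightarrow> real n \<le> p n"
  shows
    "(filterlim (\<lambda>n. p n / real n powr (5 / 3)) at_top sequentially \<longrightarrow>
        (\<lambda>n. SUP A\<in>orthant_borel n.
           \<bar>measure (sampling_law n (p n) \<beta> x) A -
            cond_prob (ordered_laguerre_law n (p n) \<beta>) (\<lambda>l. l \<in> A) (\<lambda>l. l 1 > p n * x)\<bar>)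
          \<longlonglongrightarrow> 0 \<and>
        (\<lambda>n. (\<integral>l. (is_estimator n (p n) \<beta> x l)\<^sup>2 \<partial>sampling_law n (p n) \<beta> x) /
             (tail_prob n (p n) \<beta> x)\<^sup>2) \<longlonglongrightarrow> 1) \<and>
     ((\<lambda>n. real n powr (5 / 3) / p n) \<in> O(\<lambda>_. 1) \<longrightarrow>
        (\<lambda>n. \<integral>l. (is_estimator n (p n) \<beta> x l)\<^sup>2 \<partial>sampling_law n (p n) \<beta> x)
          \<in> O(\<lambda>n. (tail_prob n (p n) \<beta> x)\<^sup>2) \<and>
        strongly_efficient (\<lambda>n. sampling_law n (p n) \<beta> x)
          (\<lambda>n. is_estimator n (p n) \<beta> x) (\<lambda>n. tail_prob n (p n) \<beta> x)) \<and>
     (filterlim (\<lambda>n. p n / real n) at_top sequentially \<longrightarrow>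
        (\<lambda>n. ln (\<integral>l. (is_estimator n (p n) \<beta> x l)\<^sup>2 \<partial>sampling_law n (p n) \<beta> x) /
             (2 * ln (tail_prob n (p n) \<beta> x))) \<longlonglongrightarrow> 1 \<and>
        asymptotically_efficient (\<lambda>n. sampling_law n (p n) \<beta> x)
          (\<lambda>n. is_estimator n (p n) \<beta> x) (\<lambda>n. tail_prob n (p n) \<beta> x))"
proof -
  let ?Q = "\<lambda>n. sampling_law n (p n) \<beta> x" and ?L = "\<lambda>n. is_estimator n (p n) \<beta> x"
  let ?\<theta> = "\<lambda>n. tail_prob n (p n) \<beta> x"
  let ?M2 = "\<lambda>n. \<integral>l. (?L n l)\<^sup>2 \<partial>?Q n"
  let ?R = "\<lambda>n. ?M2 n / (?\<theta> n)\<^sup>2"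
  have S: "laguerre_sampling \<beta> x (p n) n (n - 1)" if "2 \<le> n" for n
    by unfold_locales (use assms(1,2) assms(3)[of n] that in auto)
  have key: "eventually (\<lambda>n. 0 < ?\<theta> n \<and> integrable (?Q n) (\<lambda>l. (?L n l)\<^sup>2)) sequentially" "?R \<longlonglongrightarrow> 1" "?\<theta> \<longlonglongrightarrow> 0"
    if lim: "filterlim (\<lambda>n. p n / real n) at_top sequentially"
    using relative_error_tendsto_1[of \<beta> x p] assms lim by blast+
  have unb: "eventually (\<lambda>n. unbiased_estimator (?Q n) (?L n) (?\<theta> n)) sequentially"
    using eventually_ge_at_top[of 2] by eventually_elim (rule laguerre_sampling.unbiased[OF S])
  have weak1: "filterlim (\<lambda>n. p n / real n) at_top sequentially"
    if "filterlim (\<lambda>n. p n / real n powr (5 / 3)) at_top sequentially"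
  proof (rule filterlim_at_top_mono[OF that])
    show "eventually (\<lambda>n. p n / real n powr (5 / 3) \<le> p n / real n) sequentially"
      using eventually_ge_at_top[of 1]
    proof eventually_elim
      case (elim n)
      have "real n powr 1 \<le> real n powr (5 / 3)" using elim by (intro powr_mono) auto
      then show ?case using elim assms(3)[of n] by (intro divide_left_mono) auto
    qed
  qed
  have weak2: "filterlim (\<lambda>n. p n / real n) at_top sequentially"
    if O: "(\<lambda>n. real n powr (5 / 3) / p n) \<in> O(\<lambda>_. 1)"
  proof -
    obtain c where c: "0 < c" "eventually (\<lambda>n. norm (real n powr (5 / 3) / p n)
        \<le> c * norm (1::real)) sequentially"
      using landau_o.bigE[OF O] by blast
    \<comment> \<open>From n powr (5 / 3) <= c p, dividing by c n gives p / n >= n powr (2 / 3) /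
      c.\<close>
    have "filterlim (\<lambda>n. real n powr (2 / 3) / c) at_top sequentially" using c(1) by real_asymp
    moreover have "eventually (\<lambda>n. real n powr (2 / 3) / c \<le> p n / real n) sequentially"
      using c(2) eventually_ge_at_top[of 1]
    proof eventually_elim
      case (elim n)
      have pn: "0 < p n" "0 < real n" using elim assms(3)[of n] by auto
      then have "real n powr (5 / 3) \<le> c * p n" using elim by (simp add: field_simps)
      moreover have "real n powr (5 / 3) = real n powr (2 / 3) * real n"
        using pn powr_add[of "real n" "2 / 3" 1] by simp
      ultimately show ?case using pn c(1) by (simp add: field_simps)
    qed
    ultimately show ?thesis by (rule filterlim_at_top_mono)
  qed
  have part1: "(\<lambda>n. SUP A\<in>orthant_borel n. \<bar>measure (?Q n) A
      - cond_prob (ordered_laguerre_law n (p n) \<beta>) (\<lambda>l. l \<in> A) (\<lambda>l. l 1 > p n * x)\<bar>) \<longlonglongrightarrow> 0"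
    if lim: "filterlim (\<lambda>n. p n / real n) at_top sequentially"
  proof (rule tendsto_sandwich[OF _ _ tendsto_const[of 0]])
    let ?d = "\<lambda>n A. \<bar>measure (?Q n) A - cond_prob (ordered_laguerre_law n (p n) \<beta>) (\<lambda>l. l
        \<in> A) (\<lambda>l. l 1 > p n * x)\<bar>"
    \<comment> \<open>A real supremum is controlled only over a nonempty bounded family; the empty
      event provides a member, whose value is nonnegative.\<close>
    have ob: "{} \<in> orthant_borel n" for n unfolding orthant_borel_def by simp
    have sub: "A \<in> sets (PiM {1..n} (\<lambda>_. lborel))" if "A \<in> orthant_borel n" for A n
    proof -
      have "Pi\<^sub>E {1..n} (\<lambda>_. {0::real..}) \<in> sets (PiM {1..n} (\<lambda>_. borel))" by (intro sets_PiM_I_finite) auto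
      then have "A \<in> sets (PiM {1..n} (\<lambda>_. borel))"
        using that unfolding orthant_borel_def by (subst (asm) sets_restrict_space) auto
      then show ?thesis by (simp cong: sets_PiM_cong)
    qed
    have le: "eventually (\<lambda>n. \<forall>A\<in>orthant_borel n. ?d n A \<le> sqrt (?R n - 1)) sequentially"
      using key(1)[OF lim] eventually_ge_at_top[of 2]
    proof eventually_elim
      case (elim n)
      interpret laguerre_sampling \<beta> x "p n" n "n - 1" by (rule S) (use elim in simp)
      show ?case using total_variation_le[OF sub] elim by auto
    qed
    then show "eventually (\<lambda>n. (SUP A\<in>orthant_borel n. ?d n A) \<le> sqrt (?R n - 1)) sequentially"
      by eventually_elim (intro cSUP_least; use ob in auto)
    show "eventually (\<lambda>n. 0 \<le> (SUP A\<in>orthant_borel n. ?d n A)) sequentially"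
      using le
    proof eventually_elim
      case (elim n)
      have "0 \<le> ?d n {}" by simp
      also have "\<dots> \<le> (SUP A\<in>orthant_borel n. ?d n A)"
        using elim by (intro cSUP_upper ob bdd_aboveI2[of _ _ "sqrt (?R n - 1)"]) auto
      finally show ?case .
    qed
    have "(\<lambda>n. sqrt (?R n - 1)) \<longlonglongrightarrow> sqrt (1 - 1)" by (intro tendsto_intros key(2)[OF lim])
    then show "(\<lambda>n. sqrt (?R n - 1)) \<longlonglongrightarrow> 0" by simp
  qed
  have R2: "eventually (\<lambda>n. ?R n < 2) sequentially" if "filterlim (\<lambda>n. p n / real n) at_top sequentially"
    using key(2)[OF that] by (rule order_tendstoD) simp
  have part2: "?M2 \<in> O(\<lambda>n. (?\<theta> n)\<^sup>2)" if lim: "filterlim (\<lambda>n. p n / real n) at_top sequentially"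
  proof (rule landau_o.bigI[of 2])
    show "eventually (\<lambda>n. norm (?M2 n) \<le> 2 * norm ((?\<theta> n)\<^sup>2)) sequentially"
      using R2[OF lim] key(1)[OF lim] by eventually_elim (simp add: field_simps)
  qed simp
  have part2': "strongly_efficient ?Q ?L ?\<theta>" if lim: "filterlim (\<lambda>n. p n / real n) at_top sequentially"
    unfolding strongly_efficient_def
  proof (intro conjI unb)
    have "limsup (\<lambda>n. (\<integral>\<^sup>+ l. ennreal ((?L n l)\<^sup>2) \<partial>?Q n) / ennreal ((?\<theta> n)\<^sup>2)) \<le> 2"
    proof (rule Limsup_bounded)
      show "eventually (\<lambda>n. (\<integral>\<^sup>+ l. ennreal ((?L n l)\<^sup>2) \<partial>?Q n) / ennreal ((?\<theta> n)\<^sup>2) \<le> 2) sequentially"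
        using R2[OF lim] key(1)[OF lim]
      proof eventually_elim
        case (elim n)
        have "(\<integral>\<^sup>+ l. ennreal ((?L n l)\<^sup>2) \<partial>?Q n) = ennreal (?M2 n)"
          using elim by (intro nn_integral_eq_integral) auto
        moreover have "ennreal (?M2 n) / ennreal ((?\<theta> n)\<^sup>2) = ennreal (?R n)"
          using elim by (intro divide_ennreal) auto
        moreover have "ennreal (?R n) \<le> ennreal 2" using elim by (intro ennreal_leI) auto
        ultimately show ?case by simp
      qed
    qed
    also have "(2::ennreal) < \<infinity>" by simp
    finally show "limsup (\<lambda>n. (\<integral>\<^sup>+ l. ennreal ((?L n l)\<^sup>2) \<partial>?Q n) / ennreal ((?\<theta> n)\<^sup>2)) < \<infinity>" .
  qed
  have part3: "(\<lambda>n. ln (?M2 n) / (2 * ln (?\<theta> n))) \<longlonglongrightarrow> 1"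
      if lim: "filterlim (\<lambda>n. p n / real n) at_top sequentially"
  proof -
    have pos: "eventually (\<lambda>n. 0 < ?\<theta> n) sequentially" using key(1)[OF lim] by eventually_elim simp
    have "filterlim (\<lambda>n. ?\<theta> n) (at_right 0) sequentially"
      using key(3)[OF lim] pos by (simp add: filterlim_at eventually_mono)
    \<comment> \<open>The logarithm of the second moment is 2 ln \<theta> plus the logarithm of the
      relative second moment. The latter tends to 0, so dividing by 2 ln \<theta>, which tends to
      minus infinity, leaves 1.\<close>
    then have lnbot: "filterlim (\<lambda>n. ln (?\<theta> n)) at_bot sequentially"
      by (rule filterlim_compose[OF ln_at_0])
    have "(\<lambda>n. ln (?R n)) \<longlonglongrightarrow> ln 1" by (intro tendsto_ln key(2)[OF lim]) simp
    then have "(\<lambda>n. ln (?R n) / (2 * ln (?\<theta> n))) \<longlonglongrightarrow> 0"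
      by (intro tendsto_divide_0[where c = 0] filterlim_at_bot_imp_at_infinity
          filterlim_tendsto_pos_mult_at_bot[OF tendsto_const _ lnbot]) auto
    then have "(\<lambda>n. 1 + ln (?R n) / (2 * ln (?\<theta> n))) \<longlonglongrightarrow> 1 + 0" by (intro tendsto_intros)
    moreover have "eventually (\<lambda>n. 1 + ln (?R n) / (2 * ln (?\<theta> n))
        = ln (?M2 n) / (2 * ln (?\<theta> n))) sequentially"
    proof -
      have R0: "eventually (\<lambda>n. 0 < ?R n) sequentially" using key(2)[OF lim] by (rule order_tendstoD) simp
      have "eventually (\<lambda>n. ln (?\<theta> n) < 0) sequentially" using lnbot by (simp add: filterlim_at_bot_dense)
      then show ?thesis using pos R0
      proof eventually_elim
        case (elim n)
        have "?M2 n = ?R n * (?\<theta> n)\<^sup>2" using elim by simp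
        then have "ln (?M2 n) = ln (?R n * (?\<theta> n)\<^sup>2)" by (simp only:)
        also have "\<dots> = ln (?R n) + ln ((?\<theta> n)\<^sup>2)" using elim by (subst ln_mult) auto
        also have "ln ((?\<theta> n)\<^sup>2) = 2 * ln (?\<theta> n)" using elim by (simp add: ln_realpow)
        finally show ?case using elim by (simp add: add_divide_distrib)
      qed
    qed
    ultimately show ?thesis by (simp add: tendsto_cong)
  qed
  have part3': "asymptotically_efficient ?Q ?L ?\<theta>" if lim: "filterlim (\<lambda>n. p n / real n) at_top sequentially"
    unfolding asymptotically_efficient_def using unb part3[OF lim] by simp
  show ?thesis
    using part1 key(2) part2 part2' part3 part3' weak1 weak2 by blast
qed

end
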